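(* For every positive integer $t$, there is an algorithm that, given an $n$-vertex graph $G$ that does not contain $tC_3 \uplus C_4$ as an induced minor, computes a maximum independent set of $G$ in time $n^{O(t^2 \log n)+t^{O(1)}}$.
   Context: An independent set is a set of pairwise non-adjacent vertices. A graph $H$ is an induced minor of $G$ if $H$ can be obtained from $G$ by a sequence of vertex deletions and edge contractions. $C_\ell$ is the cycle on $\ell$ vertices; $tC_3$ is the disjoint union of $t$ triangles, and $tC_3 \uplus C_4$ is the disjoint union of $t$ triangles and one cycle on 4 vertices. The constants hidden in $O(\cdot)$ do not depend on $t$ or $n$. *)

theory Defs
  imports Complex_Main
begin

section \<open>Finite simple graphs\<close>

record 'a graph =
  verts :: "'a set"
  edges :: "'a set set"

definition simple_graph :: "'a graph \<Rightarrow> bool" where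
  "simple_graph G \<longleftrightarrow> finite (verts G) \<and> (\<forall>e\<in>edges G. e \<subseteq> verts G \<and> card e = 2)"

definition isomorphic :: "'a graph \<Rightarrow> 'b graph \<Rightarrow> bool" where
  "isomorphic G H \<longleftrightarrow>
     (\<exists>f. bij_betw f (verts G) (verts H) \<and> (\<lambda>e. f ` e) ` edges G = edges H)"

definition independent_set :: "'a graph \<Rightarrow> 'a set \<Rightarrow> bool" where
  "independent_set G S \<longleftrightarrow> S \<subseteq> verts G \<and> (\<forall>u\<in>S. \<forall>v\<in>S. {u, v} \<notin> edges G)"

definition maximum_independent_set :: "'a graph \<Rightarrow> 'a set \<Rightarrow> bool" where
  "maximum_independent_set G S \<longleftrightarrow>
     independent_set G S \<and> (\<forall>T. independent_set G T \<longrightarrow> card T \<le> card S)"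

subsection \<open>Induced minors\<close>

definition delete_vertex :: "'a \<Rightarrow> 'a graph \<Rightarrow> 'a graph" where
  "delete_vertex v G = \<lparr>verts = verts G - {v}, edges = {e \<in> edges G. v \<notin> e}\<rparr>"

text \<open>The vertex resulting from the contraction of \<open>{u, v}\<close> reuses the name \<open>u\<close>.\<close>

definition contract_edge :: "'a \<Rightarrow> 'a \<Rightarrow> 'a graph \<Rightarrow> 'a graph" where
  "contract_edge u v G =
     \<lparr>verts = verts G - {v},
      edges = (\<lambda>e. (\<lambda>x. if x = v then u else x) ` e) ` (edges G - {{u, v}})\<rparr>"

inductive minor_step :: "'a graph \<Rightarrow> 'a graph \<Rightarrow> bool" where
  delete: "v \<in> verts G \<Longrightarrow> minor_step G (delete_vertex v G)"
| contract: "{u, v} \<in> edges G \<Longrightarrow> minor_step G (contract_edge u v G)"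

definition induced_minor :: "'b graph \<Rightarrow> 'a graph \<Rightarrow> bool" where
  "induced_minor H G \<longleftrightarrow> (\<exists>G'. minor_step\<^sup>*\<^sup>* G G' \<and> isomorphic G' H)"

subsection \<open>The excluded graph\<close>

text \<open>Only meaningful for \<open>l \<ge> 3\<close>.\<close>

definition cycle_graph :: "nat \<Rightarrow> nat graph" where
  "cycle_graph l = \<lparr>verts = {..<l}, edges = {{i, (i + 1) mod l} | i. i < l}\<rparr>"

definition copies :: "nat \<Rightarrow> 'a graph \<Rightarrow> (nat \<times> 'a) graph" where
  "copies t G =
     \<lparr>verts = {..<t} \<times> verts G, edges = {Pair i ` e | i e. i < t \<and> e \<in> edges G}\<rparr>"

definition disjoint_union :: "'a graph \<Rightarrow> 'b graph \<Rightarrow> ('a + 'b) graph" where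
  "disjoint_union G H =
     \<lparr>verts = verts G <+> verts H,
      edges = (\<lambda>e. Inl ` e) ` edges G \<union> (\<lambda>e. Inr ` e) ` edges H\<rparr>"

definition tC3_C4 :: "nat \<Rightarrow> (nat \<times> nat + nat) graph" where
  "tC3_C4 t = disjoint_union (copies t (cycle_graph 3)) (cycle_graph 4)"


section \<open>Algorithms and running time\<close>

text \<open>
  An algorithm is a program for a unit-cost random access machine, written as a while program.
  A machine state consists of registers and arrays, all holding natural numbers; a program
  mentions only finitely many of them, and array indices may be computed. Every operation costs
  one time unit. The only arithmetic operations are addition and truncated subtraction, so that
  after \<open>T\<close> steps the numbers have a bit length that is linear in \<open>T\<close> and in that of the initial
  data. This keeps the model polynomially equivalent to Turing machines; with a unit-cost
  multiplication it would not be.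
\<close>

datatype expr =
    Const nat
  | Reg nat
  | Elem nat expr
  | Add expr expr
  | Sub expr expr

datatype prog =
    Skip
  | Assign nat expr
  | Store nat expr expr
  | Seq prog prog
  | Cond expr prog prog
  | While expr prog

record machine_state =
  regs :: "nat \<Rightarrow> nat"
  arrs :: "nat \<Rightarrow> nat \<Rightarrow> nat"

fun expr_val :: "expr \<Rightarrow> machine_state \<Rightarrow> nat" where
  "expr_val (Const k) s = k"
| "expr_val (Reg x) s = regs s x"
| "expr_val (Elem a e) s = arrs s a (expr_val e s)"
| "expr_val (Add e1 e2) s = expr_val e1 s + expr_val e2 s"
| "expr_val (Sub e1 e2) s = expr_val e1 s - expr_val e2 s"

fun expr_time :: "expr \<Rightarrow> nat" where
  "expr_time (Const k) = 1"
| "expr_time (Reg x) = 1"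
| "expr_time (Elem a e) = 1 + expr_time e"
| "expr_time (Add e1 e2) = 1 + expr_time e1 + expr_time e2"
| "expr_time (Sub e1 e2) = 1 + expr_time e1 + expr_time e2"

definition set_reg :: "nat \<Rightarrow> nat \<Rightarrow> machine_state \<Rightarrow> machine_state" where
  "set_reg x k s = s\<lparr>regs := (regs s)(x := k)\<rparr>"

definition set_elem :: "nat \<Rightarrow> nat \<Rightarrow> nat \<Rightarrow> machine_state \<Rightarrow> machine_state" where
  "set_elem a i k s = s\<lparr>arrs := (arrs s)(a := (arrs s a)(i := k))\<rparr>"

text \<open>\<open>exec p s k s'\<close>: started in \<open>s\<close>, the program \<open>p\<close> halts in \<open>s'\<close> after \<open>k\<close> time units.
  A test succeeds if the value of its expression is nonzero.\<close>

inductive exec :: "prog \<Rightarrow> machine_state \<Rightarrow> nat \<Rightarrow> machine_state \<Rightarrow> bool" where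
  Skip: "exec Skip s 1 s"
| Assign: "exec (Assign x e) s (1 + expr_time e) (set_reg x (expr_val e s) s)"
| Store: "exec (Store a i e) s (1 + expr_time i + expr_time e)
            (set_elem a (expr_val i s) (expr_val e s) s)"
| Seq: "\<lbrakk>exec p s k s'; exec q s' l s''\<rbrakk> \<Longrightarrow> exec (Seq p q) s (k + l) s''"
| CondTrue: "\<lbrakk>expr_val b s \<noteq> 0; exec p s k s'\<rbrakk> \<Longrightarrow>
            exec (Cond b p q) s (1 + expr_time b + k) s'"
| CondFalse: "\<lbrakk>expr_val b s = 0; exec q s k s'\<rbrakk> \<Longrightarrow>
            exec (Cond b p q) s (1 + expr_time b + k) s'"
| WhileFalse: "expr_val b s = 0 \<Longrightarrow> exec (While b p) s (1 + expr_time b) s"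
| WhileTrue: "\<lbrakk>expr_val b s \<noteq> 0; exec p s k s'; exec (While b p) s' l s''\<rbrakk> \<Longrightarrow>
            exec (While b p) s (1 + expr_time b + k + l) s''"

inductive_cases SkipE: "exec Skip s k s'"
inductive_cases AssignE: "exec (Assign x e) s k s'"
inductive_cases StoreE: "exec (Store a i e) s k s'"
inductive_cases SeqE: "exec (Seq p q) s k s'"
inductive_cases CondE: "exec (Cond b p q) s k s'"
inductive_cases WhileE: "exec (While b p) s k s'"

text \<open>By the following lemma, ``some execution halts within the time bound with a correct output'' says the same
  as ``the execution does''.\<close>

lemma exec_deterministic:
  assumes "exec p s k s'" and "exec p s l s''"
  shows "k = l \<and> s' = s''"
  using assms
proof (induction arbitrary: l s'' rule: exec.induct)
  case (Seq p s k s' q l' s2)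
  from Seq.prems show ?case
    by (rule SeqE) (auto dest: Seq.IH)
next
  case (CondTrue b s p k s' q)
  from CondTrue.prems show ?case
    by (rule CondE) (auto simp: CondTrue.hyps(1) dest: CondTrue.IH)
next
  case (CondFalse b s q k s' p)
  from CondFalse.prems show ?case
    by (rule CondE) (auto simp: CondFalse.hyps(1) dest: CondFalse.IH)
next
  case (WhileFalse b s p)
  from WhileFalse.prems show ?case
    by (rule WhileE) (auto simp: WhileFalse.hyps(1))
next
  case (WhileTrue b s p k s' l' s2)
  from WhileTrue.prems show ?case
    by (rule WhileE) (auto simp: WhileTrue.hyps(1) dest: WhileTrue.IH)
qed (auto elim: SkipE AssignE StoreE)

text \<open>
  A graph on the vertex set \<open>{..<n}\<close> is given to the machine by \<open>n\<close> in register \<open>0\<close> and its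
  adjacency matrix, row by row, in array \<open>0\<close>: the entry for \<open>(u, v)\<close> has index \<open>u * n + v\<close>.
  Everything else is initially \<open>0\<close>. The output is the set of vertices at which array \<open>1\<close> is
  nonzero.
\<close>

definition input_state :: "nat graph \<Rightarrow> machine_state" where
  "input_state G =
     (let n = card (verts G) in
      \<lparr>regs = (\<lambda>x. if x = 0 then n else 0),
       arrs = (\<lambda>a i. if a = 0 \<and> i < n * n \<and> {i div n, i mod n} \<in> edges G then 1 else 0)\<rparr>)"

definition output_set :: "nat graph \<Rightarrow> machine_state \<Rightarrow> nat set" where
  "output_set G s = {v \<in> verts G. arrs s 1 v \<noteq> 0}"

end

theory Submission imports Defs "HOL-Real_Asymp.Real_Asymp" begin

text \<open>
  Induced minors allow to contract a long cycle to a triangle. So the excluded configuration consists of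
  \<open>t\<close> pairwise anticomplete vertex sets, each inducing a connected graph with a cycle, and of a hole
  anticomplete to them.

  A vertex with a complete neighbourhood can be put into the independent set, and at a vertex of degree
  two with nonadjacent neighbours the two incident edges can be contracted. If neither kind is left, all
  degrees are at least three. If \<open>G - N[v]\<close> has no hole for some \<open>v\<close>, then branching on \<open>v\<close>
  creates only one additional leaf, because graphs without holes are eliminated by their simplicial
  vertices. Otherwise, unless \<open>G\<close> is small, some \<open>N[v]\<close> carries a fraction of order \<open>1 / t\<close> of the
  sum of all degrees, so that taking such vertices happens at most \<open>O(t * ln n)\<close> times on a branch.
  Indeed, if all closed neighbourhoods were light, then deleting few of them would always leave
  a subgraph of average degree above \<open>2.8\<close> and hence a short cycle. So one finds \<open>4 * t\<close> anticomplete
  short cycles away from a shortest hole \<open>f\<close> and a shortest hole \<open>g\<close> of \<open>G - N[f 0]\<close>. Every hole is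
  attached to almost all of these cycles, but a hole composed of parts of \<open>f\<close> and \<open>g\<close> misses too many.

  The machine traverses the search tree by depth-first search, recomputing every leaf from the
  root, and determines an independent set by deleting vertices as long as the independence
  number does not drop.
\<close>

section \<open>Cyclic sets and holes\<close>

text \<open>The Moore bound turns average degree \<open>2.8\<close> only into cycles of logarithmic
  length, whereas a budget of \<open>O(t)\<close> deleted neighbourhoods requires cycles of constant
  size. Therefore logarithmic cycles are collected greedily outside the vertices of high degree.
  Either \<open>t + 1\<close> anticomplete ones are found, or the high degrees and the
  neighbourhoods of the collected cycles form a small set \<open>H\<close> outside of which there
  are hardly more edges than vertices. The surplus of edges then sits in a few layers around
  \<open>H\<close>; contracting these onto \<open>H\<close> gives a multigraph with
  \<open>n powr 0.05\<close> edges per vertex, where \<open>21\<close> steps of the Moore bound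
  suffice. This is the origin of \<open>560\<close>. The collections in \<open>exists_heavy\<close>
  stay within \<open>1120 * t\<close> vertices, and \<open>44800 = 40 * 1120\<close> makes their
  neighbourhoods carry at most one fortieth of the volume, so that minimum degree \<open>3\<close>
  leaves average degree \<open>2.8\<close>. Volume means a sum of closed degrees. It bounds the
  edges lost with a neighbourhood, and neither deletions nor contractions at vertices of degree two
  increase it along a branch.\<close>

lemma add_mod_inj:
  fixes i j k l :: nat
  assumes "(i + k) mod l = (j + k) mod l" "i < l" "j < l"
  shows "i = j"
proof -
  have "i = j" if "i \<le> j" "(i + k) mod l = (j + k) mod l" "j < l" for i j :: nat
  proof -
    have "l dvd (j + k) - (i + k)" using mod_eq_dvd_iff_nat[of "i + k" "j + k" l] that by simp
    then have "l dvd j - i" by simp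
    with that show ?thesis by (auto dest: dvd_imp_le)
  qed
  from this[of i j] this[of j i] assms show ?thesis by linarith
qed

text \<open>One relation together with varying vertex sets replaces graph records here, so that an
  induced subgraph is just a subset.\<close>

locale adjacency =
  fixes adj :: "'a \<Rightarrow> 'a \<Rightarrow> bool"
  assumes adj_sym: "adj x y \<Longrightarrow> adj y x" and adj_irrefl: "\<not> adj x x"
begin

lemma adj_commute: "adj x y \<longleftrightarrow> adj y x"
  using adj_sym by blast

lemma adj_neq: "adj x y \<Longrightarrow> x \<noteq> y"
  using adj_irrefl by blast

definition apairs :: "'a set \<Rightarrow> ('a \<times> 'a) set" where
  "apairs A = {(x, y). x \<in> A \<and> y \<in> A \<and> adj x y}"

text \<open>Edges are counted as ordered pairs, that is, twice.\<close>

definition ec :: "'a set \<Rightarrow> nat" where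
  "ec A = card (apairs A)"

text \<open>As \<open>ec\<close> counts ordered pairs, this asks for at least as many edges as
  vertices. Such a set contains a cycle, and unlike being a cycle the condition can be established
  by counting alone.\<close>

definition cyc :: "'a set \<Rightarrow> bool" where
  "cyc Q \<longleftrightarrow> finite Q \<and> Q \<noteq> {} \<and> 2 * card Q \<le> ec Q"

text \<open>The closed neighbourhood in the whole type; restricting it to a vertex set is left to
  explicit intersections.\<close>

definition cnb :: "'a set \<Rightarrow> 'a set" where
  "cnb X = {u. \<exists>x\<in>X. u = x \<or> adj x u}"

definition anticomplete :: "'a set \<Rightarrow> 'a set \<Rightarrow> bool" where
  "anticomplete A B \<longleftrightarrow> A \<inter> cnb B = {}"

text \<open>Connectedness by cuts rather than paths makes unions easy (\<open>conn_Un\<close>);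
  paths are recovered in \<open>walk_exists\<close>.\<close>

definition conn :: "'a set \<Rightarrow> bool" where
  "conn A \<longleftrightarrow> A \<noteq> {} \<and> (\<forall>S\<subseteq>A. S \<noteq> {} \<longrightarrow> S \<noteq> A \<longrightarrow> (\<exists>x\<in>S. \<exists>y\<in>A - S. adj x y))"

definition hole :: "(nat \<Rightarrow> 'a) \<Rightarrow> nat \<Rightarrow> bool" where
  "hole f l \<longleftrightarrow> 4 \<le> l \<and> inj_on f {..<l} \<and>
     (\<forall>i<l. \<forall>j<l. adj (f i) (f j) \<longleftrightarrow> j = (i + 1) mod l \<or> i = (j + 1) mod l)"

definition hole_in :: "'a set \<Rightarrow> bool" where
  "hole_in A \<longleftrightarrow> (\<exists>f l. hole f l \<and> f ` {..<l} \<subseteq> A)"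

lemma finite_apairs: "finite A \<Longrightarrow> finite (apairs A)"
  unfolding apairs_def by (rule finite_subset[of _ "A \<times> A"]) auto

lemma apairs_mono: "A \<subseteq> B \<Longrightarrow> apairs A \<subseteq> apairs B"
  unfolding apairs_def by auto

lemma ec_mono: "finite B \<Longrightarrow> A \<subseteq> B \<Longrightarrow> ec A \<le> ec B"
  unfolding ec_def by (intro card_mono finite_apairs apairs_mono)

lemma ec_sum:
  assumes "finite A" shows "ec A = (\<Sum>x\<in>A. card {y\<in>A. adj x y})"
proof -
  have "apairs A = (SIGMA x:A. {y\<in>A. adj x y})" by (auto simp: apairs_def)
  then show ?thesis using assms by (simp add: ec_def)
qed

lemma ec_le_square: "finite A \<Longrightarrow> ec A \<le> card A * card A"
  unfolding ec_def apairs_def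
  by (rule order_trans[OF card_mono[of "A \<times> A"]]) (auto simp: card_cartesian_product)

lemma cnb_mono: "A \<subseteq> B \<Longrightarrow> cnb A \<subseteq> cnb B"
  unfolding cnb_def by auto

lemma cnb_Un: "cnb (A \<union> B) = cnb A \<union> cnb B"
  unfolding cnb_def by auto

lemma cnb_insert: "cnb (insert a A) = cnb {a} \<union> cnb A"
  unfolding cnb_def by auto

lemma subset_cnb: "A \<subseteq> cnb A"
  unfolding cnb_def by auto

lemma cnb_empty [simp]: "cnb {} = {}"
  unfolding cnb_def by auto

lemma mem_cnb_iff: "x \<in> cnb A \<longleftrightarrow> (\<exists>a\<in>A. a \<in> cnb {x})"
  unfolding cnb_def using adj_sym by auto

lemma anticomplete_sym: "anticomplete A B \<longleftrightarrow> anticomplete B A"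
  unfolding anticomplete_def cnb_def using adj_sym by auto

lemma anticomplete_mono: "anticomplete A B \<Longrightarrow> A' \<subseteq> A \<Longrightarrow> B' \<subseteq> B \<Longrightarrow> anticomplete A' B'"
  unfolding anticomplete_def using cnb_mono by blast

subsection \<open>Connected sets\<close>

lemma conn_singleton: "conn {x}"
  unfolding conn_def by auto

text \<open>A part without outgoing edges contains or misses each of \<open>A\<close> and
  \<open>B\<close> entirely, and the contact between them rules out the mixed cases.\<close>

lemma conn_Un:
  assumes A: "conn A" and B: "conn B" and t: "A \<inter> cnb B \<noteq> {}"
  shows "conn (A \<union> B)"
  unfolding conn_def
proof (intro conjI allI impI)
  show "A \<union> B \<noteq> {}" using A by (auto simp: conn_def)
  fix S assume S: "S \<subseteq> A \<union> B" "S \<noteq> {}" "S \<noteq> A \<union> B"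
  show "\<exists>x\<in>S. \<exists>y\<in>A \<union> B - S. adj x y"
  proof (rule ccontr)
    assume no: "\<not> ?thesis"
    have a: "A \<inter> S = {} \<or> A \<subseteq> S"
    proof (rule ccontr)
      assume "\<not> ?thesis"
      then have "A \<inter> S \<subseteq> A" "A \<inter> S \<noteq> {}" "A \<inter> S \<noteq> A" by auto
      with A obtain x y where "x \<in> A \<inter> S" "y \<in> A - A \<inter> S" "adj x y"
        unfolding conn_def by meson
      with no show False by auto
    qed
    have b: "B \<inter> S = {} \<or> B \<subseteq> S"
    proof (rule ccontr)
      assume "\<not> ?thesis"
      then have "B \<inter> S \<subseteq> B" "B \<inter> S \<noteq> {}" "B \<inter> S \<noteq> B" by auto
      with B obtain x y where "x \<in> B \<inter> S" "y \<in> B - B \<inter> S" "adj x y"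
        unfolding conn_def by meson
      with no show False by auto
    qed
    from t obtain p q where pq: "p \<in> A" "q \<in> B" "p = q \<or> adj q p"
      by (auto simp: cnb_def)
    from a b S no pq adj_sym show False by blast
  qed
qed

lemma conn_path:
  assumes "\<And>i. a \<le> i \<Longrightarrow> i < b \<Longrightarrow> adj (f i) (f (Suc i))" and "a \<le> b"
  shows "conn (f ` {a..b})"
  using assms(2,1)
proof (induction b rule: dec_induct)
  case base then show ?case by (simp add: conn_singleton)
next
  case (step b)
  have "conn (f ` {a..b} \<union> {f (Suc b)})"
  proof (rule conn_Un)
    show "conn (f ` {a..b})" using step by simp
    show "f ` {a..b} \<inter> cnb {f (Suc b)} \<noteq> {}"
    proof -
      have "f b \<in> f ` {a..b}" "f b \<in> cnb {f (Suc b)}"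
        using step.prems[of b] step.hyps adj_sym by (auto simp: cnb_def)
      then show ?thesis by blast
    qed
  qed (rule conn_singleton)
  moreover have "f ` {a..b} \<union> {f (Suc b)} = f ` {a..Suc b}"
    using step.hyps by (auto simp: atLeastAtMostSuc_conv)
  ultimately show ?case by simp
qed

subsection \<open>Holes through a vertex\<close>

definition walk :: "(nat \<Rightarrow> 'a) \<Rightarrow> nat \<Rightarrow> 'a set \<Rightarrow> bool" where
  "walk p k R \<longleftrightarrow> (\<forall>i\<le>k. p i \<in> R) \<and> (\<forall>i<k. adj (p i) (p (Suc i)))"

text \<open>Otherwise the vertices reachable from \<open>a\<close> would form a cut that no edge
  crosses.\<close>

lemma walk_exists:
  assumes R: "conn R" and "a \<in> R" "b \<in> R"
  shows "\<exists>p k. walk p k R \<and> p 0 = a \<and> p k = b"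
proof (rule ccontr)
  assume no: "\<not> ?thesis"
  define S where "S = {x \<in> R. \<exists>p k. walk p k R \<and> p 0 = a \<and> p k = x}"
  have "a \<in> S" unfolding S_def walk_def using assms by (auto intro!: exI[of _ "\<lambda>_. a"] exI[of _ 0])
  moreover have "b \<notin> S" using no by (auto simp: S_def)
  moreover have "S \<subseteq> R" by (auto simp: S_def)
  ultimately obtain x y where xy: "x \<in> S" "y \<in> R - S" "adj x y"
    using R assms(3) unfolding conn_def by (metis empty_iff)
  from xy obtain p k where p: "walk p k R" "p 0 = a" "p k = x" by (auto simp: S_def)
  have "walk (p(Suc k := y)) (Suc k) R"
    using p xy unfolding walk_def by (auto simp: le_Suc_eq less_Suc_eq)
  with xy p have "y \<in> S" unfolding S_def by (force intro: exI[of _ "p(Suc k := y)"] exI[of _ "Suc k"])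
  with xy show False by auto
qed

text \<open>Minimality makes the walk an induced path: a repeated vertex or a chord would permit a
  shortcut.\<close>

lemma shortest_walk:
  assumes "walk p k R" "p 0 = a" "p k = b"
    and min: "\<And>q k'. walk q k' R \<Longrightarrow> q 0 = a \<Longrightarrow> q k' = b \<Longrightarrow> k \<le> k'"
    and ij: "i \<le> k" "j \<le> k" "i < j"
  shows "p i \<noteq> p j" and "adj (p i) (p j) \<Longrightarrow> j = Suc i"
proof -
  show "p i \<noteq> p j"
  proof
    assume e: "p i = p j"
    define q where "q x = (if x \<le> i then p x else p (x + (j - i)))" for x
    have w: "walk q (k - (j - i)) R"
      unfolding walk_def
    proof (intro conjI allI impI)
      fix x assume "x \<le> k - (j - i)"
      then show "q x \<in> R" using assms(1) ij by (auto simp: q_def walk_def)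
    next
      fix x assume x: "x < k - (j - i)"
      consider "x < i" | "x = i" | "x > i" by linarith
      then show "adj (q x) (q (Suc x))"
      proof cases
        case 2
        have "q x = p j" "q (Suc x) = p (Suc j)" using 2 e ij by (auto simp: q_def)
        then show ?thesis using assms(1) x ij 2 by (auto simp: walk_def)
      qed (use assms(1) x ij in \<open>auto simp: q_def walk_def\<close>)
    qed
    have "k - (j - i) + (j - i) = k" using ij by simp
    moreover have "k - (j - i) = i" if "k - (j - i) \<le> i" using that ij by simp
    moreover have "k = j" if "k - (j - i) \<le> i" using that ij by simp
    ultimately have "q (k - (j - i)) = b" using assms(3) e by (auto simp: q_def)
    moreover have "q 0 = a" using assms(2) by (simp add: q_def)
    ultimately have "k \<le> k - (j - i)" using min w by blast
    then show False using ij by auto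
  qed
  show "j = Suc i" if adj: "adj (p i) (p j)"
  proof (rule ccontr)
    assume ne: "j \<noteq> Suc i"
    \<comment> \<open>The number of inner vertices that the chord bypasses.\<close>
    define d where "d = j - i - 1"
    have d: "d > 0" "j = i + 1 + d" using ne ij by (auto simp: d_def)
    define q where "q x = (if x \<le> i then p x else p (x + d))" for x
    have w: "walk q (k - d) R"
      unfolding walk_def
    proof (intro conjI allI impI)
      fix x assume "x \<le> k - d"
      then show "q x \<in> R" using assms(1) ij d by (auto simp: q_def walk_def)
    next
      fix x assume x: "x < k - d"
      consider "x < i" | "x = i" | "x > i" by linarith
      then show "adj (q x) (q (Suc x))"
      proof cases
        case 2
        have "q x = p i" "q (Suc x) = p j" using 2 d ij by (auto simp: q_def)
        then show ?thesis using adj by simp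
      qed (use assms(1) x ij d in \<open>auto simp: q_def walk_def\<close>)
    qed
    have "q (k - d) = b" using assms(3) ij d by (auto simp: q_def)
    moreover have "q 0 = a" using assms(2) by (simp add: q_def)
    ultimately have "k \<le> k - d" using min w by blast
    then show False using ij d by auto
  qed
qed

text \<open>The tool by which new holes are built. A shortest walk from \<open>a\<close> to
  \<open>b\<close> inside \<open>R\<close> is an induced path of which \<open>z\<close> sees only
  the ends; as these are distinct and nonadjacent, closing it through \<open>z\<close> gives at
  least four vertices.\<close>

lemma hole_through:
  assumes R: "conn R" and ab: "a \<in> R" "b \<in> R" "a \<noteq> b" "\<not> adj a b"
    and z: "R \<inter> cnb {z} = {a, b}" "z \<notin> R"
  shows "\<exists>f l. hole f l \<and> f ` {..<l} \<subseteq> insert z R"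
proof -
  define Q where "Q k \<longleftrightarrow> (\<exists>p. walk p k R \<and> p 0 = a \<and> p k = b)" for k
  have ex: "\<exists>k. Q k" using walk_exists[OF R ab(1,2)] by (auto simp: Q_def)
  define k where "k = (LEAST k. Q k)"
  have "Q k" unfolding k_def using ex by (rule LeastI_ex)
  then obtain p where p: "walk p k R" "p 0 = a" "p k = b" by (auto simp: Q_def)
  have min: "k \<le> k'" if "walk q k' R" "q 0 = a" "q k' = b" for q k'
    unfolding k_def by (rule Least_le) (use that in \<open>auto simp: Q_def\<close>)
  have sh: "p i \<noteq> p j" "adj (p i) (p j) \<Longrightarrow> j = Suc i" if "i \<le> k" "j \<le> k" "i < j" for i j
    using shortest_walk[OF p _ that] min by auto
  have k2: "2 \<le> k"
  proof -
    have "k \<noteq> 0" using p ab by (cases k) auto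
    moreover have "k \<noteq> 1" using p ab by (auto simp: walk_def)
    ultimately show ?thesis by linarith
  qed
  have inR: "p i \<in> R" if "i \<le> k" for i using p(1) that by (auto simp: walk_def)
  have zadj: "adj z (p i) \<longleftrightarrow> i = 0 \<or> i = k" if i: "i \<le> k" for i
  proof -
    have "p i \<in> cnb {z} \<longleftrightarrow> p i \<in> {a, b}" using z(1) inR[OF i] by blast
    moreover have "p i \<noteq> z" using z(2) inR[OF i] by blast
    moreover have "p i = a \<longleftrightarrow> i = 0"
      using sh(1)[of 0 i] p(2) i by (cases "i = 0") fastforce+
    moreover have "p i = b \<longleftrightarrow> i = k"
      using sh(1)[of i k] p(3) i by (cases "i = k") fastforce+
    ultimately show ?thesis by (auto simp: cnb_def)
  qed
  \<comment> \<open>\<open>z\<close> gets index \<open>0\<close>, followed by the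
    \<open>k + 1\<close> vertices of the walk, which explains the length
    \<open>k + 2\<close>.\<close>
  define f where "f i = (case i of 0 \<Rightarrow> z | Suc j \<Rightarrow> p j)" for i
  have padj: "adj (p i) (p j) \<longleftrightarrow> j = Suc i \<or> i = Suc j" if "i \<le> k" "j \<le> k" for i j
    using sh(2)[of i j] sh(2)[of j i] p(1) that adj_commute[of "p i" "p j"] adj_irrefl
    unfolding walk_def by (cases i j rule: linorder_cases) (auto simp: Suc_le_eq)
  have "hole f (k + 2)"
    unfolding hole_def
  proof (intro conjI allI impI)
    show "4 \<le> k + 2" using k2 by simp
    show "inj_on f {..<k + 2}"
    proof (rule linorder_inj_onI)
      fix i j assume ij: "i < j" "i \<in> {..<k+2}" "j \<in> {..<k+2}"
      then obtain j' where j: "j = Suc j'" "j' \<le> k" by (cases j) auto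
      show "f i \<noteq> f j"
      proof (cases i)
        case 0 then show ?thesis using inR[of j'] z(2) j by (auto simp: f_def)
      next
        case (Suc i') then show ?thesis using sh(1)[of i' j'] ij j by (auto simp: f_def)
      qed
    qed auto
    fix i j assume ij: "i < k + 2" "j < k + 2"
    have m: "(x + 1) mod (k + 2) = (if x = k + 1 then 0 else x + 1)" if "x < k + 2" for x
      using that by (auto simp: mod_Suc)
    show "adj (f i) (f j) \<longleftrightarrow> j = (i + 1) mod (k + 2) \<or> i = (j + 1) mod (k + 2)"
      unfolding m[OF ij(1)] m[OF ij(2)]
      using ij zadj padj adj_irrefl adj_commute k2
      by (cases i; cases j) (auto simp: f_def)
  qed
  moreover have "f ` {..<k + 2} \<subseteq> insert z R"
    using inR by (auto simp: f_def split: nat.splits)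
  ultimately show ?thesis by blast
qed

lemma hole_in_mono: "hole_in A \<Longrightarrow> A \<subseteq> B \<Longrightarrow> hole_in B"
  unfolding hole_in_def by blast

lemma hole_card: "hole f l \<Longrightarrow> card (f ` {..<l}) = l"
  unfolding hole_def by (simp add: card_image)

lemma hole_Suc: "hole f l \<Longrightarrow> Suc i < l \<Longrightarrow> adj (f i) (f (Suc i))"
  unfolding hole_def by (metis Suc_eq_plus1 Suc_lessD mod_less)

text \<open>Lets any chosen vertex of a hole have index \<open>0\<close>, so that arcs can be
  treated as intervals of indices.\<close>

lemma hole_rotate:
  assumes "hole f l" shows "hole (\<lambda>x. f ((x + k) mod l)) l"
proof -
  have l: "l \<ge> 4" and inj: "inj_on f {..<l}" using assms by (auto simp: hole_def)
  note i0 = add_mod_inj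
  have "adj (f ((i + k) mod l)) (f ((j + k) mod l)) \<longleftrightarrow> j = (i + 1) mod l \<or> i = (j + 1) mod l"
    if ij: "i < l" "j < l" for i j
  proof -
    have e: "((x + k) mod l + 1) mod l = ((x + 1) mod l + k) mod l" for x
      by (metis add.assoc add.commute mod_add_left_eq)
    have "adj (f ((i + k) mod l)) (f ((j + k) mod l)) \<longleftrightarrow>
        (j + k) mod l = ((i + 1) mod l + k) mod l \<or> (i + k) mod l = ((j + 1) mod l + k) mod l"
      using assms l unfolding hole_def by (simp only: e[symmetric]) auto
    also have "\<dots> \<longleftrightarrow> j = (i + 1) mod l \<or> i = (j + 1) mod l"
      using i0[of j k l "(i+1) mod l"] i0[of i k l "(j+1) mod l"] ij l by auto
    finally show ?thesis .
  qed
  moreover have "inj_on (\<lambda>x. f ((x + k) mod l)) {..<l}"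
  proof (rule inj_onI)
    fix x y assume xy: "x \<in> {..<l}" "y \<in> {..<l}" "f ((x + k) mod l) = f ((y + k) mod l)"
    then have "(x + k) mod l = (y + k) mod l" using inj_onD[OF inj xy(3)] l by auto
    with xy show "x = y" by (auto dest: i0)
  qed
  ultimately show ?thesis using l unfolding hole_def by blast
qed

lemma image_rotate:
  assumes "l > 0" shows "(\<lambda>x. f ((x + k) mod l)) ` {..<l} = f ` {..<l::nat}"
proof -
  have "(\<lambda>x. (x + k) mod l) ` {..<l} = {..<l}"
  proof (rule endo_inj_surj)
    show "inj_on (\<lambda>x. (x + k) mod l) {..<l}"
      by (intro inj_onI) (auto dest: add_mod_inj)
  qed (use assms in auto)
  then show ?thesis by (metis image_image)
qed

subsection \<open>Simplicial vertices\<close>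

definition simplicial :: "'a set \<Rightarrow> 'a \<Rightarrow> bool" where
  "simplicial V v \<longleftrightarrow> v \<in> V \<and> (\<forall>x\<in>V \<inter> cnb {v}. \<forall>y\<in>V \<inter> cnb {v}. x = y \<or> adj x y)"

text \<open>Dirac's theorem on chordal graphs. The second conjunct carries the induction: let
  \<open>K\<close> be a component of what lies outside the closed neighbourhood of \<open>v\<close>.
  Its boundary \<open>N\<close> is a clique, and a vertex of \<open>K\<close> that is simplicial in
  \<open>K \<union> N\<close> is simplicial in \<open>V\<close>.\<close>

lemma dirac:
  assumes "finite V" "\<not> hole_in V"
  shows "(V \<noteq> {} \<longrightarrow> (\<exists>s. simplicial V s)) \<and>
    (\<forall>v\<in>V. \<not> V \<subseteq> cnb {v} \<longrightarrow> (\<exists>s. simplicial V s \<and> s \<notin> cnb {v}))"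
  using assms
proof (induction "card V" arbitrary: V rule: less_induct)
  case less
  have far: "\<exists>s. simplicial V s \<and> s \<notin> cnb {v}" if v: "v \<in> V" "\<not> V \<subseteq> cnb {v}" for v
  proof -
    \<comment> \<open>A maximal member of \<open>F\<close> is a connected component of
      \<open>V - cnb {v}\<close>.\<close>
    define F where "F = {K. K \<subseteq> V - cnb {v} \<and> conn K}"
    from v obtain w where "w \<in> V - cnb {v}" by auto
    then have wF: "{w} \<in> F" by (auto simp: F_def conn_singleton)
    have "finite F" using less.prems by (auto simp: F_def intro: finite_subset[of _ "Pow V"])
    with wF obtain K where K: "K \<in> F" "\<And>K'. K' \<in> F \<Longrightarrow> K \<subseteq> K' \<Longrightarrow> K' = K"
      using finite_has_maximal2[of F "{w}"] by (metis)
    have Kc: "conn K" "K \<subseteq> V - cnb {v}" using K by (auto simp: F_def)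
    then have Kne: "K \<noteq> {}" by (auto simp: conn_def)
    define N where "N = (V \<inter> cnb K) - K"
    have NV: "N \<subseteq> cnb {v}"
    proof
      fix x assume x: "x \<in> N"
      show "x \<in> cnb {v}"
      proof (rule ccontr)
        assume "x \<notin> cnb {v}"
        have "conn ({x} \<union> K)" by (rule conn_Un) (use x Kc in \<open>auto simp: N_def conn_singleton\<close>)
        then have "{x} \<union> K \<in> F" using x Kc \<open>x \<notin> cnb {v}\<close> by (auto simp: F_def N_def)
        with K(2)[of "{x} \<union> K"] x show False by (auto simp: N_def)
      qed
    qed
    have vN: "v \<notin> N \<union> K"
    proof -
      have "v \<notin> K" using Kc by (auto simp: cnb_def)
      moreover have "v \<notin> cnb K"
        using Kc(2) mem_cnb_iff[of v K] by blast
      ultimately show ?thesis by (auto simp: N_def)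
    qed
    \<comment> \<open>Nonadjacent boundary vertices are linked through \<open>K\<close>, where
      \<open>v\<close> has no neighbour, so they would lie on a hole through
      \<open>v\<close>.\<close>
    have clique: "x = y \<or> adj x y" if xy: "x \<in> N" "y \<in> N" for x y
    proof (rule ccontr)
      assume n: "\<not> ?thesis"
      have 1: "conn ({x} \<union> K)" by (rule conn_Un) (use xy Kc in \<open>auto simp: N_def conn_singleton\<close>)
      have 2: "conn ({y} \<union> ({x} \<union> K))"
        by (rule conn_Un[OF conn_singleton 1]) (use xy in \<open>auto simp: N_def cnb_Un cnb_insert[of x K]\<close>)
      have 3: "({y} \<union> ({x} \<union> K)) \<inter> cnb {v} = {x, y}" using Kc NV xy by auto
      from hole_through[OF 2 _ _ _ _ 3] n xy vN obtain f l where
        "hole f l" "f ` {..<l} \<subseteq> insert v ({y} \<union> ({x} \<union> K))" by auto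
      moreover have "insert v ({y} \<union> ({x} \<union> K)) \<subseteq> V" using xy Kc v by (auto simp: N_def)
      ultimately show False using less.prems(2) unfolding hole_in_def by blast
    qed
    have up: "simplicial V s" if s: "simplicial (K \<union> N) s" "s \<in> K" for s
    proof -
      have "V \<inter> cnb {s} \<subseteq> (K \<union> N) \<inter> cnb {s}" using s(2) by (auto simp: N_def cnb_def)
      with s Kc show ?thesis unfolding simplicial_def by blast
    qed
    have sub: "K \<union> N \<subseteq> V" using Kc by (auto simp: N_def)
    have "card (K \<union> N) < card V" "card K < card V"
      using sub vN v less.prems(1) by (auto intro!: psubset_card_mono)
    moreover have "finite (K \<union> N)" "finite K" "\<not> hole_in (K \<union> N)" "\<not> hole_in K"
      using sub less.prems hole_in_mono by (auto intro: finite_subset)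
    ultimately have IH1: "K \<noteq> {} \<longrightarrow> (\<exists>s. simplicial K s)"
      and IH2: "\<And>w. w\<in>K \<union> N \<Longrightarrow> \<not> K \<union> N \<subseteq> cnb {w} \<Longrightarrow> (\<exists>s. simplicial (K \<union> N) s \<and> s \<notin> cnb {w})"
      using less.hyps[of "K \<union> N"] less.hyps[of K] by auto
    \<comment> \<open>If some \<open>w\<close> in \<open>N\<close> does not see all of
      \<open>K \<union> N\<close>, the induction hypothesis gives a simplicial vertex not seen by
      \<open>w\<close>, hence outside the clique \<open>N\<close>. Otherwise \<open>N\<close> is
      complete to \<open>K \<union> N\<close>, and a simplicial vertex of \<open>K\<close> remains
      simplicial.\<close>
    have "\<exists>s. simplicial (K \<union> N) s \<and> s \<in> K"
    proof (cases "\<exists>w\<in>N. \<not> K \<union> N \<subseteq> cnb {w}")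
      case True
      then obtain w where w: "w \<in> N" "\<not> K \<union> N \<subseteq> cnb {w}" by auto
      with IH2[of w] obtain s where s: "simplicial (K \<union> N) s" "s \<notin> cnb {w}" by auto
      have "s \<notin> N" using clique[OF w(1), of s] s(2) by (auto simp: cnb_def)
      with s show ?thesis by (auto simp: simplicial_def)
    next
      case False
      then have univ: "\<And>w x. w \<in> N \<Longrightarrow> x \<in> K \<union> N \<Longrightarrow> x = w \<or> adj w x" by (auto simp: cnb_def)
      from IH1 Kne obtain s where s: "simplicial K s" by auto
      have "x = y \<or> adj x y" if "x \<in> (K \<union> N) \<inter> cnb {s}" "y \<in> (K \<union> N) \<inter> cnb {s}" for x y
        using that univ[of x y] univ[of y x] s adj_sym unfolding simplicial_def by blast
      then have "simplicial (K \<union> N) s" using s unfolding simplicial_def by auto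
      with s show ?thesis by (auto simp: simplicial_def)
    qed
    then obtain s where "simplicial (K \<union> N) s" "s \<in> K" by auto
    then show ?thesis using up[of s] Kc by auto
  qed
  have "\<exists>s. simplicial V s" if "V \<noteq> {}"
  proof (cases "\<exists>v\<in>V. \<not> V \<subseteq> cnb {v}")
    case True then show ?thesis using far by blast
  next
    case False
    from that obtain v where "v \<in> V" by auto
    with False have "simplicial V v" unfolding simplicial_def cnb_def by auto
    then show ?thesis ..
  qed
  with far show ?case by blast
qed

lemma simplicial_exists:
  "finite V \<Longrightarrow> V \<noteq> {} \<Longrightarrow> \<not> hole_in V \<Longrightarrow> \<exists>s. simplicial V s"
  using dirac by blast

end

section \<open>Short cycles in graphs with many edges\<close>

context adjacency
begin

text \<open>Distances are measured inside \<open>A\<close>, so that a bounded radius of a cell also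
  expresses its connectedness.\<close>

primrec ball :: "'a set \<Rightarrow> 'a \<Rightarrow> nat \<Rightarrow> 'a set" where
  "ball A x 0 = {x}"
| "ball A x (Suc i) = ball A x i \<union> {y \<in> A. \<exists>z\<in>ball A x i. adj z y}"

lemma ball_mono_set: "A \<subseteq> B \<Longrightarrow> ball A x i \<subseteq> ball B x i"
  by (induction i) auto

lemma ball_mono: "i \<le> k \<Longrightarrow> ball A x i \<subseteq> ball A x k"
  by (induction k rule: dec_induct) auto

lemma ball_subset: "x \<in> A \<Longrightarrow> ball A x i \<subseteq> A"
  by (induction i) auto

lemma ball_trans: "y \<in> ball A x i \<Longrightarrow> z \<in> ball A y k \<Longrightarrow> z \<in> ball A x (i + k)"
  by (induction k arbitrary: z) auto

lemma ball_sym: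
  assumes "x \<in> A" shows "y \<in> ball A x i \<Longrightarrow> x \<in> ball A y i"
proof (induction i arbitrary: y)
  case (Suc i)
  show ?case
  proof (cases "y \<in> ball A x i")
    case True then show ?thesis using Suc.IH ball_mono[of i "Suc i"] by auto
  next
    case False
    then obtain z where z: "y \<in> A" "z \<in> ball A x i" "adj z y" using Suc.prems by auto
    have "z \<in> A" using ball_subset[OF assms] z by auto
    then have "z \<in> ball A y 1" using z adj_sym by auto
    from ball_trans[OF this Suc.IH[OF z(2)]] show ?thesis by simp
  qed
qed auto

text \<open>A breadth-first search tree has \<open>card A - 1\<close> edges; an additional edge closes a cycle with two of
  its branches.\<close>

lemma bfs_tree:
  assumes fin: "finite A" and x: "x \<in> A" and rad: "A \<subseteq> ball A x \<rho>"
  shows "2 * card A \<le> ec A + 2"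
    and "2 * card A \<le> ec A \<Longrightarrow> \<exists>Q\<subseteq>A. cyc Q \<and> card Q \<le> 2 * \<rho> + 2"
proof -
  define dst where "dst y = (LEAST i. y \<in> ball A x i)" for y
  have dst_ball: "y \<in> ball A x (dst y)" and dst_le: "dst y \<le> \<rho>" if "y \<in> A" for y
    unfolding dst_def using that rad by (auto intro: LeastI Least_le)
  have "\<exists>z\<in>A. adj y z \<and> dst z < dst y" if y: "y \<in> A - {x}" for y
  proof -
    have "dst y \<noteq> 0" using dst_ball[of y] y by (auto intro: ccontr)
    then obtain d where d: "dst y = Suc d" by (cases "dst y") auto
    have "y \<notin> ball A x d" using not_less_Least[of d "\<lambda>i. y \<in> ball A x i"] d by (auto simp: dst_def)
    with dst_ball[of y] d y obtain z where z: "z \<in> ball A x d" "adj z y" by auto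
    then have "dst z \<le> d" unfolding dst_def by (auto intro: Least_le)
    moreover have "z \<in> A" using z(1) ball_subset[OF x] by blast
    ultimately show ?thesis using d adj_sym[OF z(2)] by auto
  qed
  then have "\<exists>par. \<forall>y\<in>A - {x}. par y \<in> A \<and> adj y (par y) \<and> dst (par y) < dst y"
    by (intro bchoice) blast
  then obtain par where par: "\<And>y. y \<in> A - {x} \<Longrightarrow> par y \<in> A \<and> adj y (par y) \<and> dst (par y) < dst y"
    by blast
  \<comment> \<open>The tree edges inside \<open>Q\<close> in both orientations, to match the double
    counting in \<open>ec\<close>.\<close>
  define TP where "TP = (\<lambda>Q. (\<lambda>y. (y, par y)) ` (Q - {x}) \<union> (\<lambda>y. (par y, y)) ` (Q - {x}))"
  have TP_card: "card (TP Q) = 2 * (card Q - 1)" if Q: "Q \<subseteq> A" "x \<in> Q" for Q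
  proof -
    have "card (TP Q) = card ((\<lambda>y. (y, par y)) ` (Q - {x})) + card ((\<lambda>y. (par y, y)) ` (Q - {x}))"
      unfolding TP_def
    proof (rule card_Un_disjoint)
      show "(\<lambda>y. (y, par y)) ` (Q - {x}) \<inter> (\<lambda>y. (par y, y)) ` (Q - {x}) = {}"
      proof (rule equals0I)
        fix p assume "p \<in> (\<lambda>y. (y, par y)) ` (Q - {x}) \<inter> (\<lambda>y. (par y, y)) ` (Q - {x})"
        then obtain y z where yz: "y \<in> Q - {x}" "z \<in> Q - {x}" "p = (y, par y)" "p = (par z, z)" by blast
        then have "dst (par y) < dst y" "dst (par z) < dst z" using par Q by blast+
        moreover have "par z = y" "par y = z" using yz(3,4) by (metis prod.inject)+
        ultimately show False by (metis less_asym)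
      qed
    qed (simp_all add: finite_subset[OF Q(1) fin])
    also have "\<dots> = card (Q - {x}) + card (Q - {x})"
      by (intro arg_cong2[of _ _ _ _ plus] card_image inj_onI) auto
    finally show ?thesis using Q fin finite_subset by (simp add: card_Diff_singleton)
  qed
  have TP_sub: "TP Q \<subseteq> apairs Q" if "Q \<subseteq> A" "\<And>y. y \<in> Q - {x} \<Longrightarrow> par y \<in> Q" for Q
    using that par adj_sym unfolding TP_def apairs_def by blast
  have TPA: "TP A \<subseteq> apairs A" "card (TP A) = 2 * (card A - 1)" using TP_sub[of A] TP_card[of A] par x by auto
  have cA: "card A \<ge> 1" using card_gt_0_iff[of A] fin x by auto
  have "2 * (card A - 1) \<le> ec A" unfolding ec_def using card_mono[OF finite_apairs[OF fin] TPA(1)] TPA(2) by simp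
  then show "2 * card A \<le> ec A + 2" by simp
  \<comment> \<open>The path from \<open>y\<close> to the root as a vertex set. It is closed under
    parents and thus contains all its tree edges.\<close>
  have anc: "y \<in> A \<Longrightarrow> \<exists>Q\<subseteq>A. y \<in> Q \<and> x \<in> Q \<and> (\<forall>z\<in>Q - {x}. par z \<in> Q) \<and> card Q \<le> dst y + 1" for y
  proof (induction "dst y" arbitrary: y rule: less_induct)
    case less
    show ?case
    proof (cases "y = x")
      case True then show ?thesis using x by (intro exI[of _ "{x}"]) auto
    next
      case False
      then have p: "par y \<in> A" "dst (par y) < dst y" using par less.prems by auto
      from less.hyps[OF p(2,1)] obtain Q where Q: "Q\<subseteq>A" "par y \<in> Q" "x \<in> Q"
        "\<forall>z\<in>Q - {x}. par z \<in> Q" "card Q \<le> dst (par y) + 1" by auto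
      have "card (insert y Q) \<le> dst y + 1"
        using card_insert_le_m1[of "dst y + 1" Q y] Q(5) p(2) by simp
      then show ?thesis using Q less.prems by (intro exI[of _ "insert y Q"]) auto
    qed
  qed
  assume "2 * card A \<le> ec A"
  then have "card (TP A) < card (apairs A)" using TPA cA by (simp add: ec_def)
  then obtain a b where ab: "(a, b) \<in> apairs A" "(a, b) \<notin> TP A"
  proof -
    have "\<not> apairs A \<subseteq> TP A"
      using card_mono[OF finite_subset[OF TPA(1) finite_apairs[OF fin]], of "apairs A"] \<open>card (TP A) < card (apairs A)\<close>
      by linarith
    then show ?thesis using that by auto
  qed
  have "adj b a" "a \<noteq> b" using ab(1) adj_sym adj_irrefl unfolding apairs_def by blast+
  then have ba: "(b, a) \<in> apairs A" "(b, a) \<notin> TP A" "a \<noteq> b" using ab by (auto simp: apairs_def TP_def)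
  have aA: "a \<in> A" "b \<in> A" using ab by (auto simp: apairs_def)
  from anc[OF aA(1)] obtain Qa where Qa: "Qa\<subseteq>A" "a \<in> Qa" "x \<in> Qa" "\<forall>z\<in>Qa - {x}. par z \<in> Qa" "card Qa \<le> dst a + 1"
    by auto
  from anc[OF aA(2)] obtain Qb where Qb: "Qb\<subseteq>A" "b \<in> Qb" "x \<in> Qb" "\<forall>z\<in>Qb - {x}. par z \<in> Qb" "card Qb \<le> dst b + 1"
    by auto
  \<comment> \<open>Two root paths have at most \<open>2 * (\<rho> + 1)\<close> vertices. Their tree
    edges fall one edge short of what \<open>cyc\<close> demands, and the extra edge
    \<open>a b\<close> supplies it.\<close>
  define Q where "Q = Qa \<union> Qb"
  have Q: "Q \<subseteq> A" "a \<in> Q" "b \<in> Q" "x \<in> Q" "\<And>z. z \<in> Q - {x} \<Longrightarrow> par z \<in> Q" using Qa Qb by (auto simp: Q_def)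
  have finQ: "finite Q" using Q fin finite_subset by auto
  have "card (insert (a, b) (insert (b, a) (TP Q))) \<le> ec Q"
    unfolding ec_def by (rule card_mono[OF finite_apairs[OF finQ]])
      (use TP_sub[OF Q(1,5)] ab ba Q in \<open>auto simp: apairs_def\<close>)
  moreover have "TP Q \<subseteq> TP A" using Q by (auto simp: TP_def)
  moreover
  have "card (insert (a, b) (insert (b, a) (TP Q))) = card (TP Q) + 2"
  proof -
    have f: "finite (TP Q)" using finQ by (simp add: TP_def)
    have "(b, a) \<notin> TP Q" "(a, b) \<notin> insert (b, a) (TP Q)"
      using \<open>TP Q \<subseteq> TP A\<close> ab ba by auto
    then show ?thesis using f by simp
  qed
  moreover have "card Q \<ge> 1" using card_gt_0_iff[of Q] finQ Q(2) by auto
  ultimately have "2 * card Q \<le> ec Q" using TP_card[OF Q(1,4)] by simp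
  moreover have "card Q \<le> 2 * \<rho> + 2"
    using card_Un_le[of Qa Qb] Qa(5) Qb(5) dst_le[OF aA(1)] dst_le[OF aA(2)] by (simp add: Q_def)
  ultimately show "\<exists>Q\<subseteq>A. cyc Q \<and> card Q \<le> 2 * \<rho> + 2"
    using Q finQ by (intro exI[of _ Q]) (auto simp: cyc_def)
qed

text \<open>The Moore bound for the multigraph on \<open>H\<close> that arises by contracting every fibre of \<open>\<phi>\<close>.\<close>

lemma short_cyc_contracted:
  fixes \<Delta> :: real
  assumes fin: "finite A" and H: "H \<subseteq> A" "H \<noteq> {}"
    and \<phi>: "\<And>y. y \<in> A \<Longrightarrow> \<phi> y \<in> H" "\<And>h. h \<in> H \<Longrightarrow> \<phi> h = h"
    and rad: "\<And>y. y \<in> A \<Longrightarrow> y \<in> ball {z\<in>A. \<phi> z = \<phi> y} (\<phi> y) j"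
    and exc: "\<Delta> * card H \<le> ec A / 2 - card A + card H"
    and \<Delta>: "0 \<le> \<Delta>" "card H < \<Delta> ^ r"
  shows "\<exists>Q\<subseteq>A. cyc Q \<and> card Q \<le> 2 * (j + r * (2 * j + 1)) + 2"
proof (rule ccontr)
  assume no: "\<not> ?thesis"
  have finH: "finite H" using fin H finite_subset by auto
  define cell where "cell S = {y\<in>A. \<phi> y \<in> S}" for S
  have fincell: "finite (cell S)" for S using fin by (simp add: cell_def)
  have cell_Un: "cell (S \<union> T) = cell S \<union> cell T" for S T by (auto simp: cell_def)
  have cell_disj: "cell S \<inter> cell T = {}" if "S \<inter> T = {}" for S T using that by (auto simp: cell_def)
  have cell_mono: "S \<subseteq> T \<Longrightarrow> cell S \<subseteq> cell T" for S T by (auto simp: cell_def)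
  \<comment> \<open>Contracting a connected cell uses up a spanning tree, one edge fewer than its
    vertices. So \<open>ex S\<close> counts the edges of the multigraph on \<open>S\<close>, loops
    included.\<close>
  define ex where "ex S = ec (cell S) / 2 - card (cell S) + real (card S)" for S
  define good where "good S \<longleftrightarrow> S \<subseteq> H \<and> S \<noteq> {} \<and> \<Delta> * card S \<le> ex S" for S
  have "cell H = A" using \<phi> by (auto simp: cell_def)
  then have "good H" using H exc by (auto simp: good_def ex_def)
  \<comment> \<open>In a smallest good set every \<open>S\<close> is incident with at least
    \<open>\<Delta> * card S\<close> multigraph edges; this replaces a minimum degree
    condition.\<close>
  then obtain S0 where S0: "good S0" and min: "\<And>S. good S \<Longrightarrow> card S0 \<le> card S"
    using ex_has_least_nat[of good H card] by auto
  have S0H: "S0 \<subseteq> H" "S0 \<noteq> {}" "finite S0" using S0 finH finite_subset by (auto simp: good_def)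
  then obtain x where x: "x \<in> S0" by auto
  \<comment> \<open>Balls around \<open>x\<close> in the multigraph restricted to
    \<open>S0\<close>.\<close>
  define S where "S = rec_nat {x} (\<lambda>_ T. {s\<in>S0. s \<in> T \<or> (\<exists>u\<in>cell T. \<exists>v\<in>cell {s}. adj u v)})"
  have S_0: "S 0 = {x}" and S_Suc: "S (Suc i) = {s\<in>S0. s \<in> S i \<or> (\<exists>u\<in>cell (S i). \<exists>v\<in>cell {s}. adj u v)}" for i
    by (auto simp: S_def)
  have Ssub: "S i \<subseteq> S0" for i by (induction i) (use x in \<open>auto simp: S_0 S_Suc\<close>)
  have SSuc: "S i \<subseteq> S (Suc i)" for i using Ssub by (auto simp: S_Suc)
  have xS: "x \<in> S i" for i by (induction i) (use x in \<open>auto simp: S_0 S_Suc\<close>)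
  have xc: "s \<in> cell T" if "s \<in> T" "T \<subseteq> H" for s T using that H \<phi> by (auto simp: cell_def)
  have celleq: "cell {s} = {z\<in>A. \<phi> z = s}" for s by (auto simp: cell_def)
  \<comment> \<open>One step of the multigraph costs at most \<open>2 * j + 1\<close> steps in the
    graph: one across the edge, \<open>j\<close> to the centre of the new cell and \<open>j\<close>
    away from it.\<close>
  have radius: "cell (S i) \<subseteq> ball (cell (S i)) x (j + i * (2 * j + 1))" for i
  proof (induction i)
    case 0 show ?case using rad by (fastforce simp: S_0 celleq cell_def)
  next
    case (Suc i)
    let ?B = "cell (S (Suc i))"
    have xB: "x \<in> ?B" using xc xS Ssub S0H by (metis subset_trans)
    show ?case
    proof
      fix y assume y: "y \<in> ?B"
      have old: "u \<in> ball ?B x (j + i * (2 * j + 1))" if "u \<in> cell (S i)" for u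
        using Suc.IH ball_mono_set[OF cell_mono[OF SSuc]] that by blast
      show "y \<in> ball ?B x (j + Suc i * (2 * j + 1))"
      proof (cases "\<phi> y \<in> S i")
        case True
        then have "y \<in> cell (S i)" using y by (auto simp: cell_def)
        from old[OF this] ball_mono[of "j + i * (2 * j + 1)" "j + Suc i * (2 * j + 1)"] show ?thesis by auto
      next
        case False
        define s where "s = \<phi> y"
        have "s \<in> S (Suc i)" using y by (auto simp: cell_def s_def)
        with False obtain u v where uv: "u \<in> cell (S i)" "v \<in> cell {s}" "adj u v"
          unfolding S_Suc s_def by auto
        have sub: "cell {s} \<subseteq> ?B" using cell_mono[of "{s}" "S (Suc i)"] \<open>s \<in> S (Suc i)\<close> by auto
        have "v \<in> ball ?B u 1" using uv sub by auto
        from ball_trans[OF old[OF uv(1)] this] have v: "v \<in> ball ?B x (j + i * (2 * j + 1) + 1)" .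
        have "v \<in> ball (cell {s}) s j" "y \<in> ball (cell {s}) s j"
          using rad[of v] rad[of y] uv(2) y by (auto simp: celleq s_def cell_def)
        then have 1: "v \<in> ball ?B s j" "y \<in> ball ?B s j" using ball_mono_set[OF sub] by auto
        have "s \<in> H" using \<open>s \<in> S (Suc i)\<close> Ssub S0H by auto
        then have "s \<in> ?B" using sub xc[of s "{s}"] by auto
        from ball_trans[OF ball_trans[OF v ball_sym[OF this 1(1)]] 1(2)]
        show ?thesis by (simp add: algebra_simps)
      qed
    qed
  qed
  \<comment> \<open>Otherwise \<open>bfs_tree\<close> finds a cycle in this ball that is short
    enough to contradict \<open>no\<close>.\<close>
  have nocyc: "ec (cell (S i)) < 2 * card (cell (S i))" if "i \<le> r" for i
  proof (rule ccontr)
    assume "\<not> ?thesis"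
    then obtain Q where Q: "Q \<subseteq> cell (S i)" "cyc Q" "card Q \<le> 2 * (j + i * (2 * j + 1)) + 2"
      using bfs_tree(2)[OF fincell _ radius] xc[OF xS] Ssub S0H by (metis subset_trans linorder_not_less)
    have "i * (2 * j + 1) \<le> r * (2 * j + 1)" using that by (rule mult_le_mono1)
    then have "2 * (j + i * (2 * j + 1)) + 2 \<le> 2 * (j + r * (2 * j + 1)) + 2" by simp
    then have "card Q \<le> 2 * (j + r * (2 * j + 1)) + 2" using Q(3) order_trans by blast
    moreover have "Q \<subseteq> A" using Q by (auto simp: cell_def)
    ultimately show False using no Q by blast
  qed
  have tree: "2 * card (cell T) \<le> ec (cell T) + 2 * card T" if "T \<subseteq> H" for T
  proof -
    have "finite T" using that finH finite_subset by auto
    then show ?thesis using that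
    proof (induction T)
      case empty then show ?case by (simp add: cell_def)
    next
      case (insert s T)
      have "cell {s} \<subseteq> ball (cell {s}) s j" using rad by (fastforce simp: celleq)
      then have 1: "2 * card (cell {s}) \<le> ec (cell {s}) + 2"
        using bfs_tree(1)[OF fincell[of "{s}"]] xc[of s "{s}"] insert by auto
      have d: "cell {s} \<inter> cell T = {}" using insert by (intro cell_disj) auto
      have e: "cell (insert s T) = cell {s} \<union> cell T" using cell_Un[of "{s}" T] by simp
      have "card (apairs (cell {s}) \<union> apairs (cell T)) = ec (cell {s}) + ec (cell T)"
        unfolding ec_def using d by (intro card_Un_disjoint finite_apairs fincell) (auto simp: apairs_def)
      moreover have "card (apairs (cell {s}) \<union> apairs (cell T)) \<le> ec (cell (insert s T))"
        unfolding ec_def e using fincell by (intro card_mono finite_apairs) (auto simp: apairs_def)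
      ultimately show ?case using insert 1 e card_Un_disjoint[OF fincell fincell d] by auto
    qed
  qed
  \<comment> \<open>By minimality of \<open>S0\<close> the deletion of \<open>S i\<close> costs at
    least \<open>\<Delta> * card (S i)\<close> multigraph edges. All of them lie in the next ball,
    which has fewer edges than vertices, some of them used up by the spanning trees of the cells in
    \<open>N\<close>. So the next ball must be that large.\<close>
  have grow: "\<Delta> * card (S i) \<le> card (S (Suc i))" if "i < r" for i
  proof -
    define D where "D = S0 - S i"
    define N where "N = S (Suc i) - S i"
    have "ex D \<le> \<Delta> * card D"
    proof (cases "D = {}")
      case True then show ?thesis by (simp add: ex_def cell_def ec_def apairs_def)
    next
      case False
      have "card D < card S0" using xS[of i] x S0H unfolding D_def by (intro psubset_card_mono) auto
      then have "\<not> good D" using min by (meson linorder_not_less)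
      then show ?thesis using False S0H by (auto simp: good_def D_def)
    qed
    moreover have "\<Delta> * card S0 \<le> ex S0" using S0 by (simp add: good_def)
    moreover have cD: "card S0 = card D + card (S i)"
      using Ssub[of i] S0H finite_subset[OF Ssub] unfolding D_def by (simp add: card_Diff_subset card_mono)
    moreover have "cell S0 = cell D \<union> cell (S i)" using cell_Un[of D "S i"] Ssub[of i] by (simp add: D_def Un_absorb2)
    then have "card (cell S0) = card (cell D) + card (cell (S i))"
      using card_Un_disjoint[OF fincell fincell cell_disj, of D "S i"] by (auto simp: D_def)
    ultimately have 1: "\<Delta> * card (S i) \<le> ec (cell S0) / 2 - ec (cell D) / 2 - card (cell (S i)) + card (S i)"
      by (simp add: ex_def algebra_simps)
    have sub: "apairs (cell S0) - apairs (cell D) \<subseteq> apairs (cell (S (Suc i)))"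
    proof (rule subrelI)
      fix u v assume uv: "(u, v) \<in> apairs (cell S0) - apairs (cell D)"
      then have adj: "adj u v" "adj v u" "u \<in> A" "v \<in> A" "\<phi> u \<in> S0" "\<phi> v \<in> S0"
        using adj_sym by (auto simp: apairs_def cell_def)
      have "\<phi> u \<in> S i \<or> \<phi> v \<in> S i" using uv adj by (auto simp: apairs_def cell_def D_def)
      then have "\<phi> u \<in> S (Suc i) \<and> \<phi> v \<in> S (Suc i)"
      proof
        assume "\<phi> u \<in> S i"
        then have "u \<in> cell (S i)" "v \<in> cell {\<phi> v}" using adj by (auto simp: cell_def)
        then show ?thesis using adj \<open>\<phi> u \<in> S i\<close> unfolding S_Suc by blast
      next
        assume "\<phi> v \<in> S i"
        then have "v \<in> cell (S i)" "u \<in> cell {\<phi> u}" using adj by (auto simp: cell_def)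
        then show ?thesis using adj \<open>\<phi> v \<in> S i\<close> unfolding S_Suc by blast
      qed
      then show "(u, v) \<in> apairs (cell (S (Suc i)))" using adj by (auto simp: apairs_def cell_def)
    qed
    have ND: "N \<subseteq> D" using Ssub by (auto simp: N_def D_def)
    have "card ((apairs (cell S0) - apairs (cell D)) \<union> apairs (cell N)) \<le> ec (cell (S (Suc i)))"
      unfolding ec_def using sub apairs_mono[OF cell_mono, of N "S (Suc i)"]
      by (intro card_mono finite_apairs fincell) (auto simp: N_def)
    moreover have "card ((apairs (cell S0) - apairs (cell D)) \<union> apairs (cell N))
        = card (apairs (cell S0) - apairs (cell D)) + ec (cell N)"
      unfolding ec_def using apairs_mono[OF cell_mono[OF ND]]
      by (intro card_Un_disjoint finite_apairs fincell finite_Diff) auto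
    moreover have "card (apairs (cell S0) - apairs (cell D)) = ec (cell S0) - ec (cell D)"
      unfolding ec_def by (intro card_Diff_subset finite_apairs fincell apairs_mono cell_mono) (auto simp: D_def)
    moreover have "ec (cell D) \<le> ec (cell S0)"
      by (intro ec_mono fincell cell_mono) (auto simp: D_def)
    moreover have "2 * card (cell N) \<le> ec (cell N) + 2 * card N"
      using Ssub S0H by (intro tree) (auto simp: N_def)
    moreover have "ec (cell (S (Suc i))) < 2 * card (cell (S (Suc i)))" using nocyc that by simp
    moreover have "S (Suc i) = N \<union> S i" using SSuc by (auto simp: N_def)
    then have "card (S (Suc i)) = card N + card (S i)" "cell (S (Suc i)) = cell N \<union> cell (S i)"
      using card_Un_disjoint[of N "S i"] finite_subset[OF Ssub[of i] S0H(3)]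
        finite_subset[OF Ssub[of "Suc i"] S0H(3)] cell_Un[of N "S i"]
      by (auto simp: N_def)
    moreover have "card (cell N \<union> cell (S i)) = card (cell N) + card (cell (S i))"
      using cell_disj[of N "S i"] by (intro card_Un_disjoint fincell) (auto simp: N_def)
    then have "card (cell (S (Suc i))) = card (cell N) + card (cell (S i))"
      using \<open>cell (S (Suc i)) = cell N \<union> cell (S i)\<close> by simp
    ultimately have "real (ec (cell S0)) - ec (cell D) + 2 * card (cell N) - 2 * card N < 2 * card (cell N) + 2 * card (cell (S i))"
      "card (S (Suc i)) = card N + card (S i)"
      by linarith+
    with 1 show ?thesis by simp
  qed
  have "\<Delta> ^ i \<le> card (S i)" if "i \<le> r" for i using that
  proof (induction i)
    case (Suc i)
    have "\<Delta> * \<Delta> ^ i \<le> \<Delta> * card (S i)" using Suc \<Delta> by (intro mult_left_mono) auto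
    with grow[of i] Suc.prems show ?case by simp
  qed (simp add: S_0)
  from this[of r] have "\<Delta> ^ r \<le> card (S r)" by simp
  also have "\<dots> \<le> card H" using card_mono[OF finH, of "S r"] Ssub[of r] S0H by auto
  finally show False using \<Delta> by simp
qed

text \<open>Singleton cells, that is \<open>j = 0\<close>: the ordinary Moore bound.\<close>

corollary short_cyc:
  fixes \<Delta> :: real
  assumes "finite A" "A \<noteq> {}" "\<Delta> * card A \<le> ec A / 2" "0 \<le> \<Delta>" "card A < \<Delta> ^ r"
  shows "\<exists>Q\<subseteq>A. cyc Q \<and> card Q \<le> 2 * r + 2"
  using short_cyc_contracted[of A A "\<lambda>x. x" 0 \<Delta> r] assms by simp

primrec nbh :: "'a set \<Rightarrow> 'a set \<Rightarrow> nat \<Rightarrow> 'a set" where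
  "nbh V H 0 = H"
| "nbh V H (Suc i) = nbh V H i \<union> {y \<in> V. \<exists>z\<in>nbh V H i. adj z y}"

lemma nbh_mono: "i \<le> k \<Longrightarrow> nbh V H i \<subseteq> nbh V H k"
  by (induction k rule: dec_induct) auto

lemma nbh_subset: "H \<subseteq> V \<Longrightarrow> nbh V H i \<subseteq> V"
  by (induction i) auto

text \<open>The cells grow layer by layer: a vertex of a new layer joins the cell of a neighbour in
  the previous one, so its distance to the centre within the cell is at most the number of layers.
  These are the fibres for \<open>short_cyc_contracted\<close>.\<close>

lemma nbh_cells:
  "\<exists>\<phi>. (\<forall>y\<in>nbh V H i. \<phi> y \<in> H) \<and> (\<forall>h\<in>H. \<phi> h = h) \<and>
     (\<forall>y\<in>nbh V H i. y \<in> ball {z\<in>nbh V H i. \<phi> z = \<phi> y} (\<phi> y) i)"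
proof (induction i)
  case 0 show ?case by (intro exI[of _ "\<lambda>x. x"]) auto
next
  case (Suc i)
  then obtain \<phi> where \<phi>: "\<And>y. y \<in> nbh V H i \<Longrightarrow> \<phi> y \<in> H" "\<And>h. h \<in> H \<Longrightarrow> \<phi> h = h"
    "\<And>y. y \<in> nbh V H i \<Longrightarrow> y \<in> ball {z\<in>nbh V H i. \<phi> z = \<phi> y} (\<phi> y) i" by auto
  have "\<exists>p. \<forall>y \<in> nbh V H (Suc i) - nbh V H i. p y \<in> nbh V H i \<and> adj (p y) y"
    by (rule bchoice) auto
  then obtain p where p: "\<And>y. y \<in> nbh V H (Suc i) - nbh V H i \<Longrightarrow> p y \<in> nbh V H i \<and> adj (p y) y" by auto
  define \<psi> where "\<psi> y = (if y \<in> nbh V H i then \<phi> y else \<phi> (p y))" for y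
  have HN: "H \<subseteq> nbh V H i" using nbh_mono[of 0 i] by simp
  have sub: "{z\<in>nbh V H i. \<phi> z = s} \<subseteq> {z\<in>nbh V H (Suc i). \<psi> z = s}" for s by (auto simp: \<psi>_def)
  have old: "y \<in> ball {z\<in>nbh V H (Suc i). \<psi> z = \<psi> y} (\<psi> y) i" if "y \<in> nbh V H i" for y
  proof -
    have "\<psi> y = \<phi> y" using that by (simp add: \<psi>_def)
    then show ?thesis using subsetD[OF ball_mono_set[OF sub] \<phi>(3)[OF that]] by (simp only:)
  qed
  have "y \<in> ball {z\<in>nbh V H (Suc i). \<psi> z = \<psi> y} (\<psi> y) (Suc i)" if y: "y \<in> nbh V H (Suc i)" for y
  proof (cases "y \<in> nbh V H i")
    case True then show ?thesis using old by auto
  next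
    case False
    then have py: "p y \<in> nbh V H i" "adj (p y) y" using p y by auto
    have e: "\<psi> y = \<psi> (p y)" using False py by (auto simp: \<psi>_def)
    show ?thesis using old[OF py(1)] py(2) y e[symmetric] by auto
  qed
  moreover have "\<psi> y \<in> H" if "y \<in> nbh V H (Suc i)" for y
    using that \<phi>(1) p by (cases "y \<in> nbh V H i") (auto simp: \<psi>_def)
  moreover have "\<psi> h = h" if "h \<in> H" for h using that \<phi>(2) HN by (auto simp: \<psi>_def)
  ultimately show ?case by (intro exI[of _ \<psi>] conjI ballI)
qed

text \<open>There are \<open>1.4\<close> edges per vertex but at most \<open>1.01\<close> outside
  \<open>H\<close>, so the surplus lies around \<open>H\<close>. One of six consecutive layers is
  thin; cutting there keeps a surplus above \<open>0.2 * card V\<close>, which after contraction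
  onto the few vertices of \<open>H\<close> means \<open>\<Delta>\<close> edges per vertex.\<close>

lemma short_cyc_sparse_rest:
  fixes \<Delta> :: real
  assumes fin: "finite V" and V: "V \<noteq> {}" "H \<subseteq> V"
    and sparse: "\<And>A. A \<subseteq> V - H \<Longrightarrow> ec A \<le> 2.02 * card A"
    and dense: "2.8 * card V \<le> ec V"
    and \<Delta>: "0 \<le> \<Delta>" "\<Delta> * card H \<le> 0.2 * card V" "card H < \<Delta> ^ 21"
  shows "\<exists>Q\<subseteq>V. cyc Q \<and> card Q \<le> 560"
proof -
  define n where "n = card V"
  have n: "n > 0" using fin V by (auto simp: n_def card_gt_0_iff)
  define Z where "Z i = V - nbh V H i" for i
  have "\<exists>i<6. real (card (Z i)) - card (Z (Suc i)) \<le> n / 6"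
  proof (rule ccontr)
    assume "\<not> ?thesis"
    then have *: "real (card (Z i)) - card (Z (Suc i)) > n / 6" if "i < 6" for i using that by force
    have "card (Z 0) \<le> n" unfolding n_def Z_def by (rule card_mono[OF fin]) auto
    with *[of 0] *[of 1] *[of 2] *[of 3] *[of 4] *[of 5] show False by (simp add: eval_nat_numeral)
  qed
  then obtain i where i: "i < 6" "real (card (Z i)) - card (Z (Suc i)) \<le> n / 6" by auto
  define B where "B = nbh V H (Suc i)"
  have BV: "B \<subseteq> V" unfolding B_def by (rule nbh_subset[OF V(2)])
  have ZH: "Z i \<subseteq> V - H" using nbh_mono[of 0 i] by (auto simp: Z_def)
  have "apairs V \<subseteq> apairs B \<union> apairs (Z i)"
  proof (rule subrelI)
    fix u v assume uv: "(u, v) \<in> apairs V"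
    show "(u, v) \<in> apairs B \<union> apairs (Z i)"
      using uv adj_sym[of u v] by (auto simp: apairs_def B_def Z_def)
  qed
  then have "ec V \<le> card (apairs B \<union> apairs (Z i))"
    unfolding ec_def using fin BV finite_subset by (intro card_mono finite_UnI finite_apairs) (auto simp: Z_def)
  also have "\<dots> \<le> ec B + ec (Z i)" unfolding ec_def by (rule card_Un_le)
  finally have 1: "real (ec V) \<le> ec B + ec (Z i)" by linarith
  have 2: "card B = n - card (Z (Suc i))" "card (Z (Suc i)) \<le> n"
    using BV fin by (auto simp: n_def B_def Z_def card_Diff_subset finite_subset card_mono)
  have 3: "real (ec (Z i)) \<le> 2.02 * card (Z i)" using sparse[OF ZH] .
  have 4: "card (Z i) \<le> n" unfolding n_def Z_def by (rule card_mono[OF fin]) auto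
  \<comment> \<open>Per vertex of \<open>V\<close>, with \<open>z \<le> 1\<close> the fraction in
    \<open>Z i\<close>: at least \<open>1.4 - 1.01 * z\<close> edges remain and at most
    \<open>1 - z + 1 / 6\<close> vertices, so the surplus is at least
    \<open>0.4 - 1 / 6 - 0.01\<close>.\<close>
  have key: "0.2 * n + card B < ec B / 2"
    using 1 2 3 4 i(2) dense n by (simp add: n_def[symmetric] of_nat_diff)
  obtain \<phi> where \<phi>: "\<And>y. y \<in> B \<Longrightarrow> \<phi> y \<in> H" "\<And>h. h \<in> H \<Longrightarrow> \<phi> h = h"
    "\<And>y. y \<in> B \<Longrightarrow> y \<in> ball {z\<in>B. \<phi> z = \<phi> y} (\<phi> y) (Suc i)"
    using nbh_cells[of V H "Suc i"] unfolding B_def[symmetric] by blast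
  have "H \<noteq> {}"
  proof
    assume "H = {}"
    then have "B = {}" using \<phi> by auto
    then show False using key n by (simp add: ec_def apairs_def)
  qed
  have "\<exists>Q\<subseteq>B. cyc Q \<and> card Q \<le> 2 * (Suc i + 21 * (2 * Suc i + 1)) + 2"
  proof (rule short_cyc_contracted[of B H \<phi> "Suc i" \<Delta> 21])
    show "H \<subseteq> B" using nbh_mono[of 0 "Suc i" V H] by (simp add: B_def)
    show "\<Delta> * card H \<le> ec B / 2 - card B + card H" using key \<Delta>(2) by (simp add: n_def)
    show "finite B" using fin BV finite_subset by auto
  qed (use \<phi> \<Delta> \<open>H \<noteq> {}\<close> in auto)
  \<comment> \<open>Equality holds for \<open>i = 5\<close>; this is where \<open>560\<close> comes
    from.\<close>
  moreover have "2 * (Suc i + 21 * (2 * Suc i + 1)) + 2 \<le> 560" using i by simp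
  ultimately show ?thesis using BV by (meson order_trans)
qed

end

text \<open>The final estimate in \<open>dense_cases\<close>: \<open>2 * n powr 0.8\<close> bounds
  the number of vertices of high degree, and the product bounds the neighbourhood of at most
  \<open>n powr 0.1\<close> logarithmic cycles with degrees at most \<open>n powr 0.3\<close>. The
  factor \<open>n powr 0.05\<close> is the density for the Moore bound. All total exponents are
  below \<open>1\<close>.\<close>

definition dense_threshold :: "nat \<Rightarrow> bool" where
  "dense_threshold n \<longleftrightarrow> 1 < n \<and>
     n powr 0.05 * (2 * n powr 0.8 + n powr 0.1 * (2 * (ln n / ln 1.01 + 2) + 2) * (n powr 0.3 + 1)) \<le> 0.2 * n"

lemma ex_dense_threshold: "\<exists>N. \<forall>n\<ge>N. dense_threshold n"
proof -
  have "eventually (\<lambda>x::real. x powr 0.05 * (2 * x powr 0.8 +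
      x powr 0.1 * (2 * (ln x / ln 1.01 + 2) + 2) * (x powr 0.3 + 1)) \<le> 0.2 * x) at_top"
    by real_asymp
  then obtain B :: real where B: "\<And>x. x \<ge> B \<Longrightarrow> x powr 0.05 * (2 * x powr 0.8 +
      x powr 0.1 * (2 * (ln x / ln 1.01 + 2) + 2) * (x powr 0.3 + 1)) \<le> 0.2 * x"
    unfolding eventually_at_top_linorder by blast
  have "dense_threshold n" if "n \<ge> nat \<lceil>B\<rceil> + 2" for n
  proof -
    have "real n \<ge> B" using that by linarith
    with B[of "real n"] that show ?thesis by (simp add: dense_threshold_def)
  qed
  then show ?thesis by blast
qed

text \<open>An unspecified absolute constant. It depends on neither \<open>t\<close> nor
  \<open>n\<close> and ends up in the hidden constants.\<close>

definition dense_bound :: nat where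
  "dense_bound = (SOME N. \<forall>n\<ge>N. dense_threshold n)"

lemma dense_bound: "dense_bound \<le> n \<Longrightarrow> dense_threshold n"
  using someI_ex[OF ex_dense_threshold] unfolding dense_bound_def by blast

section \<open>Cycles of constant length from average degree 2.8\<close>

context adjacency
begin

definition deg :: "'a set \<Rightarrow> 'a \<Rightarrow> nat" where
  "deg V v = card {y \<in> V. adj v y}"

lemma card_cnb_le:
  fixes D :: real
  assumes "finite V" "finite X" "\<And>x. x \<in> X \<Longrightarrow> real (deg V x) \<le> D"
  shows "real (card (V \<inter> cnb X)) \<le> card X * (D + 1)"
  using assms(2,3)
proof (induction X)
  case (insert x X)
  have "V \<inter> cnb {x} \<subseteq> insert x {y \<in> V. adj x y}" by (auto simp: cnb_def)
  then have "card (V \<inter> cnb {x}) \<le> card (insert x {y \<in> V. adj x y})"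
    using assms(1) by (intro card_mono) auto
  also have "\<dots> \<le> deg V x + 1" using assms(1) by (auto simp: deg_def card_insert_if)
  finally have "real (card (V \<inter> cnb {x})) \<le> D + 1" using insert.prems[of x] by simp
  moreover have "V \<inter> cnb (insert x X) = (V \<inter> cnb {x}) \<union> (V \<inter> cnb X)" using cnb_insert[of x X] by auto
  then have "card (V \<inter> cnb (insert x X)) \<le> card (V \<inter> cnb {x}) + card (V \<inter> cnb X)"
    by (metis card_Un_le)
  ultimately show ?case using insert by (simp add: algebra_simps)
qed simp

text \<open>Few vertices have degree above \<open>n powr 0.3\<close>. Among the others a cycle of logarithmic length has a small
  neighbourhood, so that such cycles can be collected greedily; when this stops early, the remainder is sparse.\<close>

lemma dense_cases:
  assumes fin: "finite V" and n: "dense_bound \<le> card V" "t ^ 10 \<le> card V" and dense: "2.8 * card V \<le> ec V"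
  shows "(\<exists>Q\<subseteq>V. cyc Q \<and> card Q \<le> 560) \<or>
    (\<exists>Q. (\<forall>i\<le>t. Q i \<subseteq> V \<and> cyc (Q i)) \<and> (\<forall>i\<le>t. \<forall>j\<le>t. i \<noteq> j \<longrightarrow> anticomplete (Q i) (Q j)))"
proof (rule disjCI)
  assume no2: "\<not> (\<exists>Q. (\<forall>i\<le>t. Q i \<subseteq> V \<and> cyc (Q i)) \<and> (\<forall>i\<le>t. \<forall>j\<le>t. i \<noteq> j \<longrightarrow> anticomplete (Q i) (Q j)))"
  show "\<exists>Q\<subseteq>V. cyc Q \<and> card Q \<le> 560"
  proof (rule ccontr)
    assume no: "\<not> ?thesis"
    define n where "n = real (card V)"
    have th: "n > 1" "n powr 0.05 * (2 * n powr 0.8 + n powr 0.1 * (2 * (ln n / ln 1.01 + 2) + 2) * (n powr 0.3 + 1)) \<le> 0.2 * n"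
      using dense_bound[OF n(1)] by (auto simp: dense_threshold_def n_def)
    have Vne: "V \<noteq> {}" using th by (auto simp: n_def)
    have pw: "(n powr a) ^ k = n powr (a * k)" for a k
      using th by (subst powr_realpow[symmetric]) (auto simp: powr_powr)
    \<comment> \<open>Otherwise there are \<open>n powr 0.1\<close> edges per vertex, and
      \<open>11\<close> steps of the Moore bound lead to a cyclic set of at most \<open>24\<close>
      vertices.\<close>
    have ecV: "real (ec V) < 2 * n powr 1.1"
    proof (rule ccontr)
      assume "\<not> ?thesis"
      moreover have "n powr 0.1 * n = n powr 1.1" using th powr_add[of n "0.1" 1] by simp
      ultimately have "n powr 0.1 * card V \<le> ec V / 2" by (simp add: n_def)
      moreover have "card V < (n powr 0.1) ^ 11"
        unfolding pw n_def[symmetric] using th powr_less_mono[of 1 "0.1 * real 11" n] by simp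
      ultimately obtain Q where "Q \<subseteq> V" "cyc Q" "card Q \<le> 2 * 11 + 2"
        using short_cyc[OF fin Vne, of "n powr 0.1" 11] by auto
      then show False using no by force
    qed
    define D where "D = n powr 0.3"
    have D0: "D > 0" using th by (simp add: D_def)
    define H0 where "H0 = {v\<in>V. D < deg V v}"
    have "card H0 * D \<le> (\<Sum>v\<in>H0. real (deg V v))"
      using sum_mono[of H0 "\<lambda>_. D" "\<lambda>v. real (deg V v)"] by (auto simp: H0_def)
    also have "\<dots> \<le> (\<Sum>v\<in>V. real (deg V v))" using fin by (intro sum_mono2) (auto simp: H0_def)
    also have "\<dots> = ec V" using ec_sum[OF fin] by (simp add: deg_def)
    finally have "card H0 * D \<le> 2 * n powr 1.1" using ecV by simp
    also have "\<dots> = 2 * n powr 0.8 * D" using th powr_add[of n "0.8" "0.3"] by (simp add: D_def)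
    finally have H0: "card H0 \<le> 2 * n powr 0.8" using D0 by simp
    \<comment> \<open>Chosen so that \<open>1.01 ^ r\<close> exceeds \<open>n\<close>: any subset
      with more than \<open>1.01\<close> edges per vertex then contains a cyclic set of at most
      \<open>2 * r + 2\<close> vertices.\<close>
    define r where "r = nat \<lceil>ln n / ln 1.01\<rceil> + 1"
    have lnp: "ln n / ln 1.01 \<ge> 0" using th by simp
    have r: "r > ln n / ln 1.01" "r \<le> ln n / ln 1.01 + 2" using lnp by (auto simp: r_def) linarith+
    have "ln n < real r * ln 1.01" using r(1) by (simp add: pos_divide_less_eq)
    then have "ln n < ln ((1.01::real) ^ r)" by (simp only: ln_realpow)
    moreover have "0 < n" "0 < (1.01::real) ^ r" using th by auto
    ultimately have r101: "n < 1.01 ^ r" by (simp only: ln_less_cancel_iff)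
    define P where "P i \<longleftrightarrow> (\<exists>Q. (\<forall>k<i. Q k \<subseteq> V - H0 \<and> cyc (Q k) \<and> card (Q k) \<le> 2 * r + 2) \<and>
        (\<forall>k<i. \<forall>j<i. k \<noteq> j \<longrightarrow> anticomplete (Q k) (Q j)))" for i :: nat
    have "P 0" by (simp add: P_def)
    moreover have "\<not> P (Suc t)"
    proof
      assume "P (Suc t)"
      then obtain Q where "\<forall>k\<le>t. Q k \<subseteq> V - H0 \<and> cyc (Q k)"
        "\<forall>k\<le>t. \<forall>j\<le>t. k \<noteq> j \<longrightarrow> anticomplete (Q k) (Q j)"
        unfolding P_def less_Suc_eq_le by blast
      then show False using no2 by blast
    qed
    \<comment> \<open>The greedy collection gets stuck with at most \<open>t\<close> members, as
      \<open>t + 1\<close> of them would realise the second alternative.\<close>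
    ultimately obtain i where i: "i \<le> t" "P i" "\<not> P (Suc i)"
    proof -
      define m where "m = (LEAST m. \<not> P m)"
      have "\<not> P m" unfolding m_def using \<open>\<not> P (Suc t)\<close> by (rule LeastI)
      moreover have "m \<le> Suc t" unfolding m_def using \<open>\<not> P (Suc t)\<close> by (rule Least_le)
      moreover have "P k" if "k < m" for k using not_less_Least[of k "\<lambda>m. \<not> P m"] that unfolding m_def by blast
      moreover have "m \<noteq> 0" using \<open>P 0\<close> \<open>\<not> P m\<close> by metis
      ultimately show ?thesis using that[of "m - 1"] by (cases m) auto
    qed
    from i(2) obtain Q where "\<forall>k<i. Q k \<subseteq> V - H0 \<and> cyc (Q k) \<and> card (Q k) \<le> 2 * r + 2"
      "\<forall>k<i. \<forall>j<i. k \<noteq> j \<longrightarrow> anticomplete (Q k) (Q j)"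
      unfolding P_def by (elim exE conjE)
    then have Q: "\<And>k. k < i \<Longrightarrow> Q k \<subseteq> V - H0" "\<And>k. k < i \<Longrightarrow> cyc (Q k)"
      "\<And>k. k < i \<Longrightarrow> card (Q k) \<le> 2 * r + 2" "\<And>k j. k < i \<Longrightarrow> j < i \<Longrightarrow> k \<noteq> j \<Longrightarrow> anticomplete (Q k) (Q j)"
      by blast+
    define X where "X = (\<Union>k<i. Q k)"
    have X: "finite X" "X \<subseteq> V - H0" using Q by (auto simp: X_def cyc_def)
    have "card X \<le> (\<Sum>k<i. card (Q k))" unfolding X_def by (rule card_UN_le) simp
    also have "\<dots> \<le> (\<Sum>k<i. 2 * r + 2)" using Q(3) by (intro sum_mono) auto
    also have "\<dots> \<le> t * (2 * r + 2)" using mult_le_mono1[OF i(1), of "2 * r + 2"] by simp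
    finally have cX: "card X \<le> t * (2 * r + 2)" .
    define Z where "Z = V - H0 - cnb X"
    define H where "H = V - Z"
    have HV: "H \<subseteq> V" "V - H = Z" by (auto simp: H_def Z_def)
    \<comment> \<open>A denser \<open>A\<close> would contribute one more logarithmic cycle, against
      the choice of \<open>i\<close>.\<close>
    have sparse: "ec A \<le> 2.02 * card A" if A: "A \<subseteq> Z" for A
    proof (rule ccontr)
      assume n0: "\<not> ?thesis"
      have AV: "A \<subseteq> V" "finite A" using A fin finite_subset[of A V] by (auto simp: Z_def)
      have "card A \<le> card V" using AV fin card_mono by blast
      then have "card A < (1.01::real) ^ r" using r101 by (simp add: n_def)
      moreover have "A \<noteq> {}" using n0 by (auto simp: ec_def apairs_def)
      ultimately obtain B where B: "B \<subseteq> A" "cyc B" "card B \<le> 2 * r + 2"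
        using short_cyc[OF AV(2), of "1.01" r] n0 by auto
      have BX: "anticomplete B X" using B A by (auto simp: anticomplete_def Z_def)
      have 1: "anticomplete B (Q k)" "anticomplete (Q k) B" if "k < i" for k
        using anticomplete_mono[OF BX, of B "Q k"] that anticomplete_sym[of B "Q k"] by (auto simp: X_def)
      have "P (Suc i)" unfolding P_def
        using Q 1 B A by (intro exI[of _ "Q(i := B)"]) (auto simp: less_Suc_eq Z_def)
      with i(3) show False by simp
    qed
    have tn: "real t \<le> n powr 0.1"
    proof -
      have "real t ^ 10 \<le> n" using n(2) unfolding n_def by (metis of_nat_le_iff of_nat_power)
      also have "n = (n powr 0.1) ^ 10" unfolding pw using th by simp
      finally show ?thesis using power_mono_iff[of "real t" "n powr 0.1" 10] by simp
    qed
    have "card (V \<inter> cnb X) \<le> card X * (D + 1)"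
      by (rule card_cnb_le[OF fin X(1)]) (use X(2) in \<open>auto simp: H0_def not_less\<close>)
    also have "\<dots> \<le> (n powr 0.1 * (2 * (ln n / ln 1.01 + 2) + 2)) * (D + 1)"
    proof (rule mult_right_mono)
      have "real (card X) \<le> real t * (2 * real r + 2)" using of_nat_mono[OF cX, where ?'a = real] by (simp add: distrib_left add.commute)
      also have "\<dots> \<le> n powr 0.1 * (2 * (ln n / ln 1.01 + 2) + 2)"
        using tn r(2) by (intro mult_mono) auto
      finally show "real (card X) \<le> n powr 0.1 * (2 * (ln n / ln 1.01 + 2) + 2)" .
    qed (use D0 in simp)
    finally have cn: "card (V \<inter> cnb X) \<le> (n powr 0.1 * (2 * (ln n / ln 1.01 + 2) + 2)) * (D + 1)" .
    have "H = H0 \<union> (V \<inter> cnb X)" by (auto simp: H_def Z_def H0_def)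
    then have "card H \<le> card H0 + card (V \<inter> cnb X)" by (simp add: card_Un_le)
    then have cH: "card H \<le> 2 * n powr 0.8 + n powr 0.1 * (2 * (ln n / ln 1.01 + 2) + 2) * (n powr 0.3 + 1)"
      using H0 cn by (simp add: D_def)
    have "\<exists>Q\<subseteq>V. cyc Q \<and> card Q \<le> 560"
    proof (rule short_cyc_sparse_rest[OF fin Vne HV(1) _ dense, of "n powr 0.05"])
      show "ec A \<le> 2.02 * card A" if "A \<subseteq> V - H" for A using sparse that HV by simp
      have "n powr 0.05 * card H \<le> n powr 0.05 *
          (2 * n powr 0.8 + n powr 0.1 * (2 * (ln n / ln 1.01 + 2) + 2) * (n powr 0.3 + 1))"
        using cH by (intro mult_left_mono) auto
      from order_trans[OF this th(2)] show "n powr 0.05 * card H \<le> 0.2 * card V" by (simp only: n_def)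
      have "real (card H) \<le> n" using card_mono[OF fin HV(1)] by (simp add: n_def)
      also have "n < n powr (0.05 * real 21)" using th powr_less_mono[of 1 "0.05 * real 21" n] by simp
      finally show "card H < (n powr 0.05) ^ 21" unfolding pw .
    qed simp
    with no show False by blast
  qed
qed

section \<open>Shortest holes\<close>

definition shortest_hole :: "'a set \<Rightarrow> (nat \<Rightarrow> 'a) \<Rightarrow> nat \<Rightarrow> bool" where
  "shortest_hole W f l \<longleftrightarrow> hole f l \<and> f ` {..<l} \<subseteq> W \<and>
     (\<forall>g k. hole g k \<longrightarrow> g ` {..<k} \<subseteq> W \<longrightarrow> l \<le> k)"

lemma ex_shortest_hole: "hole_in W \<Longrightarrow> \<exists>f l. shortest_hole W f l"
proof -
  assume "hole_in W"
  then have "\<exists>l f. hole f l \<and> f ` {..<l} \<subseteq> W" by (auto simp: hole_in_def)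
  from LeastI_ex[OF this] Least_le[of "\<lambda>l. \<exists>f. hole f l \<and> f ` {..<l} \<subseteq> W"]
  show ?thesis unfolding shortest_hole_def by blast
qed

lemma shortest_hole_rotate:
  assumes "shortest_hole W f l" shows "shortest_hole W (\<lambda>x. f ((x + k) mod l)) l"
proof -
  have "l > 0" using assms by (auto simp: shortest_hole_def hole_def)
  then show ?thesis using assms hole_rotate image_rotate by (auto simp: shortest_hole_def)
qed

text \<open>\<open>K\<close> can replace the part of the hole outside the arc from \<open>i\<close>
  to \<open>j\<close>. This yields a hole through \<open>f m\<close> in that arc together with
  \<open>K\<close>, and it cannot be shorter than \<open>f\<close>.\<close>

lemma attach_inside:
  assumes f: "shortest_hole W f l" and K: "conn K" "K \<subseteq> W" "finite K"
    and ij: "i < m" "m < j" "j < l" and touch: "f i \<in> cnb K" "f j \<in> cnb K" "f m \<notin> cnb K"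
  shows "l \<le> j - i + 1 + card K"
proof -
  have h: "hole f l" "f ` {..<l} \<subseteq> W" using f by (auto simp: shortest_hole_def)
  have adj: "adj (f x) (f y) \<longleftrightarrow> y = (x + 1) mod l \<or> x = (y + 1) mod l" if "x < l" "y < l" for x y
    using h that by (auto simp: hole_def)
  have inj: "f x = f y \<longleftrightarrow> x = y" if "x < l" "y < l" for x y
    using h that by (auto simp: hole_def inj_on_def)
  have l: "l \<ge> 4" using h by (simp add: hole_def)
  \<comment> \<open>The arc without \<open>f m\<close>, held together by \<open>K\<close>. Within it
    \<open>f m\<close> sees only its two neighbours on the hole.\<close>
  define R where "R = (f ` {i..m - 1} \<union> K) \<union> f ` {m + 1..j}"
  have p: "adj (f x) (f (Suc x))" if "Suc x < l" for x using hole_Suc[OF h(1) that] .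
  have "conn (f ` {i..m - 1} \<union> K)"
  proof (rule conn_Un[OF conn_path K(1)])
    show "f ` {i..m - 1} \<inter> cnb K \<noteq> {}" using ij touch(1) by fastforce
  qed (use ij p in auto)
  moreover have "(f ` {i..m - 1} \<union> K) \<inter> cnb (f ` {m + 1..j}) \<noteq> {}"
  proof -
    obtain z where "z \<in> K" "z \<in> cnb {f j}" using touch(2) mem_cnb_iff by blast
    moreover have "cnb {f j} \<subseteq> cnb (f ` {m + 1..j})" using ij by (intro cnb_mono) auto
    ultimately show ?thesis by blast
  qed
  ultimately have R: "conn R" unfolding R_def
    using conn_Un[OF _ conn_path[of "m + 1" j f]] ij p by auto
  have nb: "f x \<in> cnb {f m} \<longleftrightarrow> x = m - 1 \<or> x = m \<or> x = m + 1" if "x < l" for x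
    using adj[of m x] inj[of x m] ij that by (auto simp: cnb_def mod_Suc split: if_splits)
  have "R \<inter> cnb {f m} = {f (m - 1), f (m + 1)}"
  proof (intro equalityI subsetI)
    fix x assume x: "x \<in> R \<inter> cnb {f m}"
    have "x \<notin> K" using x touch(3) mem_cnb_iff[of "f m" K] by blast
    then obtain y where "x = f y" "y \<in> {i..m-1} \<union> {m+1..j}" using x by (auto simp: R_def)
    moreover from this have "y < l" using ij by auto
    ultimately have "y = m - 1 \<or> y = m + 1" using nb[of y] x ij by auto
    with \<open>x = f y\<close> show "x \<in> {f (m - 1), f (m + 1)}" by auto
  qed (use nb[of "m - 1"] nb[of "m + 1"] ij in \<open>auto simp: R_def\<close>)
  moreover have "f m \<notin> R"
  proof
    assume "f m \<in> R"
    moreover have "f m \<notin> K" using touch(3) subset_cnb by blast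
    ultimately obtain y where "f m = f y" "y \<in> {i..m-1} \<union> {m+1..j}" by (auto simp: R_def)
    moreover from this have "y < l" using ij by auto
    ultimately show False using inj[of m y] ij by auto
  qed
  moreover have "f (m - 1) \<noteq> f (m + 1)" using inj[of "m - 1" "m + 1"] ij by auto
  moreover have "\<not> adj (f (m - 1)) (f (m + 1))"
    using adj[of "m - 1" "m + 1"] ij l by (auto simp: mod_Suc split: if_splits)
  moreover have "f (m - 1) \<in> R" "f (m + 1) \<in> R" using ij by (auto simp: R_def)
  ultimately obtain g k where g: "hole g k" "g ` {..<k} \<subseteq> insert (f m) R"
    using hole_through[OF R, of "f (m - 1)" "f (m + 1)" "f m"] by blast
  have sub: "insert (f m) R \<subseteq> f ` {i..j} \<union> K" using ij by (auto simp: R_def)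
  have "f ` {i..j} \<union> K \<subseteq> W" using ij h(2) K(2) by auto
  then have "l \<le> k" using f g sub unfolding shortest_hole_def by (meson order_trans)
  also have "k = card (g ` {..<k})" using hole_card[OF g(1)] by simp
  also have "\<dots> \<le> card (f ` {i..j} \<union> K)" using g sub K by (intro card_mono) auto
  also have "\<dots> \<le> card (f ` {i..j}) + card K" by (rule card_Un_le)
  also have "card (f ` {i..j}) \<le> card {i..j}" by (rule card_image_le) simp
  finally show ?thesis using ij by simp
qed

text \<open>The mirror image of \<open>attach_inside\<close>, for a free vertex on the other arc:
  rotate \<open>f j\<close> to index \<open>0\<close>.\<close>

lemma attach_outside:
  assumes f: "shortest_hole W f l" and K: "conn K" "K \<subseteq> W" "finite K"
    and ij: "i < j" "j < l" "m < l" "m < i \<or> j < m" and touch: "f i \<in> cnb K" "f j \<in> cnb K" "f m \<notin> cnb K"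
  shows "j - i \<le> 1 + card K"
proof -
  define g where "g x = f ((x + j) mod l)" for x
  define m' where "m' = (if m < i then m + l - j else m - j)"
  have "shortest_hole W g l" unfolding g_def by (rule shortest_hole_rotate[OF f])
  moreover have "g 0 = f j" "g (l - j + i) = f i" "g m' = f m"
    using ij by (auto simp: g_def m'_def)
  moreover have "0 < m'" "m' < l - j + i" "l - j + i < l" using ij by (auto simp: m'_def)
  ultimately have "l \<le> (l - j + i) - 0 + 1 + card K"
    using attach_inside[OF _ K, of g l 0 m' "l - j + i"] touch by simp
  then show ?thesis using ij by simp
qed

text \<open>Rotate a vertex not seen by \<open>v\<close> to index \<open>0\<close>. By
  \<open>attach_outside\<close> with \<open>K = {v}\<close>, the first and the last position seen
  differ by at most \<open>2\<close>.\<close>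

lemma attach_vertex:
  assumes f: "shortest_hole W f l" and v: "v \<in> W" and not_all: "\<not> f ` {..<l} \<subseteq> cnb {v}"
  shows "card (f ` {..<l} \<inter> cnb {v}) \<le> 3"
proof -
  from not_all obtain m where m: "m < l" "f m \<notin> cnb {v}" by auto
  define g where "g x = f ((x + m) mod l)" for x
  have g: "shortest_hole W g l" unfolding g_def by (rule shortest_hole_rotate[OF f])
  have l: "l > 0" using m by auto
  have img: "g ` {..<l} = f ` {..<l}" unfolding g_def by (rule image_rotate[OF l])
  have g0: "g 0 \<notin> cnb {v}" using m by (simp add: g_def)
  define J where "J = {x. x < l \<and> g x \<in> cnb {v}}"
  have finJ: "finite J" by (simp add: J_def)
  have "card J \<le> 3"
  proof (cases "J = {}")
    case False
    define i j where "i = Min J" and "j = Max J"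
    have i: "i \<in> J" "j \<in> J" "J \<subseteq> {i..j}" using finJ False by (auto simp: i_def j_def)
    have "i \<noteq> 0" using i(1) g0 unfolding J_def by (metis mem_Collect_eq)
    then have "j - i \<le> 2"
      using attach_outside[OF g conn_singleton[of v] _ _, of i j 0] i v g0
      by (cases "i < j") (auto simp: J_def)
    then have "card {i..j} \<le> 3" by simp
    then show ?thesis using card_mono[OF _ i(3)] by simp
  qed simp
  moreover have "f ` {..<l} \<inter> cnb {v} = g ` J" unfolding img[symmetric] by (auto simp: J_def)
  ultimately show ?thesis using card_image_le[OF finJ, of g] by simp
qed

text \<open>For contacts at distance \<open>d\<close>, the two attachment bounds give
  \<open>l \<le> d + 4\<close> and \<open>d \<le> 4\<close>; this is where \<open>8\<close> comes
  from.\<close>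

lemma attach_one_side:
  assumes f: "shortest_hole W f l" "8 < l" and K: "conn K" "K \<subseteq> W" "card K = 3"
    and y: "y1 < y2" "y2 < l" "f y1 \<notin> cnb K" "f y2 \<notin> cnb K"
    and x: "y1 < x" "x < y2" "f x \<in> cnb K" and z: "z < l" "z < y1 \<or> y2 < z" "f z \<in> cnb K"
  shows False
proof -
  have "finite K" using K(3) card.infinite by fastforce
  note a = attach_inside[OF f(1) K(1,2) this] attach_outside[OF f(1) K(1,2) this]
  show False
  proof (cases "z < y1")
    case True
    have "l \<le> x - z + 1 + 3" using a(1)[of z y1 x] True x y z K by simp
    moreover have "x - z \<le> 1 + 3" using a(2)[of z x y2] True x y z K by simp
    ultimately show False using f(2) by simp
  next
    case False
    have "l \<le> z - x + 1 + 3" using a(1)[of x y2 z] False x y z K by simp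
    moreover have "z - x \<le> 1 + 3" using a(2)[of x z y1] False x y z K by simp
    ultimately show False using f(2) by simp
  qed
qed

text \<open>Two nonadjacent vertices that see the whole hole would form a hole of length
  \<open>4\<close> with \<open>f 0\<close> and \<open>f 2\<close>. As a consequence, one closed
  neighbourhood contains all such vertices.\<close>

lemma universal_clique:
  assumes f: "shortest_hole W f l" "4 < l" and u: "u \<in> W" "f ` {..<l} \<subseteq> cnb {u}"
    and v: "v \<in> W" "f ` {..<l} \<subseteq> cnb {v}"
  shows "v \<in> cnb {u}"
proof (rule ccontr)
  assume nv: "v \<notin> cnb {u}"
  have h: "hole f l" "f ` {..<l} \<subseteq> W" using f by (auto simp: shortest_hole_def)
  have "f 0 \<noteq> f 2" using inj_onD[of f "{..<l}" 0 2] h(1) f(2) unfolding hole_def by auto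
  then have f02: "f 0 \<noteq> f 2" "\<not> adj (f 0) (f 2)" "\<not> adj (f 2) (f 0)"
    using h(1) f(2) by (auto simp: hole_def)
  have i: "f 0 \<in> f ` {..<l}" "f 2 \<in> f ` {..<l}" using f(2) by auto
  have u1: "f 0 = u \<or> adj u (f 0)" "f 2 = u \<or> adj u (f 2)" "f 0 = v \<or> adj v (f 0)" "f 2 = v \<or> adj v (f 2)"
    using u(2) v(2) i unfolding cnb_def by blast+
  then have u2: "adj u (f 0)" "adj u (f 2)" "adj v (f 0)" "adj v (f 2)"
    using f02 by metis+
  then have u3: "u \<noteq> f 0" "u \<noteq> f 2" "v \<noteq> f 0" "v \<noteq> f 2" using adj_irrefl by metis+
  have 1: "conn ({u} \<union> {f 2})" by (rule conn_Un[OF conn_singleton conn_singleton]) (use adj_sym[OF u2(2)] in \<open>auto simp: cnb_def\<close>)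
  have 2: "conn ({v} \<union> ({u} \<union> {f 2}))" by (rule conn_Un[OF conn_singleton 1]) (use adj_sym[OF u2(4)] in \<open>auto simp: cnb_def\<close>)
  have 3: "({v} \<union> ({u} \<union> {f 2})) \<inter> cnb {f 0} = {u, v}"
    using adj_sym[OF u2(1)] adj_sym[OF u2(3)] f02 by (auto simp: cnb_def)
  have "u \<noteq> v" "\<not> adj u v" using nv by (auto simp: cnb_def)
  with hole_through[OF 2 _ _ _ _ 3] u3 f02 obtain g k where
    g: "hole g k" "g ` {..<k} \<subseteq> insert (f 0) ({v} \<union> ({u} \<union> {f 2}))" by auto
  have "insert (f 0) ({v} \<union> ({u} \<union> {f 2})) \<subseteq> W" using u v h i by auto
  then have "l \<le> k" using f(1) g unfolding shortest_hole_def by (meson order_trans)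
  also have "k = card (g ` {..<k})" using hole_card[OF g(1)] by simp
  also have "\<dots> \<le> card (insert (f 0) ({v} \<union> ({u} \<union> {f 2})))" using g by (intro card_mono) auto
  also have "insert (f 0) ({v} \<union> ({u} \<union> {f 2})) = set [f 0, v, u, f 2]" by auto
  also have "card \<dots> \<le> 4" using card_length[of "[f 0, v, u, f 2]"] by simp
  finally show False using f(2) by simp
qed

end

text \<open>\<open>dense_cases\<close> needs \<open>dense_bound + t ^ 10\<close> vertices. After the
  deletion of neighbourhoods only the number of edges is under control, and it guarantees no more
  than the square root of the former number of vertices.\<close>

definition small_bound :: "nat \<Rightarrow> nat" where
  "small_bound t = (dense_bound + t ^ 10) ^ 2"

section \<open>Packings and the combination of two holes\<close>

context adjacency
begin

lemma hole_ge_4: "hole f l \<Longrightarrow> 4 \<le> l"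
  by (simp add: hole_def)

lemma hole_adj: "hole f l \<Longrightarrow> i < l \<Longrightarrow> j < l \<Longrightarrow> adj (f i) (f j) \<longleftrightarrow> j = (i + 1) mod l \<or> i = (j + 1) mod l"
  by (simp add: hole_def)

lemma hole_inj: "hole f l \<Longrightarrow> i < l \<Longrightarrow> j < l \<Longrightarrow> f i = f j \<longleftrightarrow> i = j"
  unfolding hole_def inj_on_def by blast

definition pack :: "nat \<Rightarrow> 'a set \<Rightarrow> bool" where
  "pack t V \<longleftrightarrow> (\<exists>T g l. hole g l \<and> g ` {..<l} \<subseteq> V \<and>
     (\<forall>i<t. T i \<subseteq> V \<and> cyc (T i) \<and> anticomplete (T i) (g ` {..<l})) \<and>
     (\<forall>i<t. \<forall>j<t. i \<noteq> j \<longrightarrow> anticomplete (T i) (T j)))"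

text \<open>Every hole must come close to almost all of the sets \<open>T i\<close>. If \<open>g\<close> avoids the neighbourhood of
  \<open>f 0\<close>, then the part of \<open>f\<close> around \<open>f 0\<close>, a suitable arc of \<open>g\<close> and two of the \<open>T i\<close> that link them
  contain a hole that comes close to at most \<open>3 * t\<close> of the \<open>4 * t\<close> sets.\<close>

lemma ring_contradiction:
  assumes f: "hole f l" "f ` {..<l} \<subseteq> V"
    and g: "shortest_hole (V - cnb {f 0}) g k" "8 < k"
    and T: "\<And>i. i < 4 * t \<Longrightarrow> conn (T i)" "\<And>i. i < 4 * t \<Longrightarrow> card (T i) = 3"
      "\<And>i. i < 4 * t \<Longrightarrow> T i \<subseteq> V - cnb {f 0}"
    and anti: "\<And>i j. i < 4 * t \<Longrightarrow> j < 4 * t \<Longrightarrow> i \<noteq> j \<Longrightarrow> anticomplete (T i) (T j)"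
    and uniq: "\<And>v i j. v \<in> f ` {..<l} \<union> g ` {..<k} \<Longrightarrow> i < 4 * t \<Longrightarrow> j < 4 * t \<Longrightarrow>
      v \<in> cnb (T i) \<Longrightarrow> v \<in> cnb (T j) \<Longrightarrow> i = j"
    and miss: "\<And>h m. hole h m \<Longrightarrow> h ` {..<m} \<subseteq> V \<Longrightarrow>
      card {i. i < 4 * t \<and> h ` {..<m} \<inter> cnb (T i) = {}} < t"
  shows False
proof -
  define F G where "F = f ` {..<l}" and "G = g ` {..<k}"
  \<comment> \<open>The indices of the sets that \<open>A\<close> touches. By \<open>miss\<close>,
    every hole touches more than \<open>3 * t\<close> of the \<open>4 * t\<close> sets.\<close>
  define tch where "tch A = {i. i < 4 * t \<and> A \<inter> cnb (T i) \<noteq> {}}" for A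
  have fin_tch: "finite (tch A)" for A by (simp add: tch_def)
  have tch_mono: "A \<subseteq> B \<Longrightarrow> tch A \<subseteq> tch B" for A B by (auto simp: tch_def)
  have tch_Un: "tch (A \<union> B) = tch A \<union> tch B" for A B by (auto simp: tch_def)
  have hg: "hole g k" "G \<subseteq> V - cnb {f 0}" using g by (auto simp: shortest_hole_def G_def)
  have untouched: "card {i. i < 4 * t \<and> A \<inter> cnb (T i) = {}} = 4 * t - card (tch A)" for A
  proof -
    have "{i. i < 4 * t \<and> A \<inter> cnb (T i) = {}} = {..<4 * t} - tch A" by (auto simp: tch_def)
    moreover have "tch A \<subseteq> {..<4 * t}" by (auto simp: tch_def)
    ultimately show ?thesis by (simp add: card_Diff_subset fin_tch)
  qed
  have hit: "3 * t < card (tch A)" if A: "hole_in A" "A \<subseteq> V" for A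
  proof -
    from A obtain h m where h: "hole h m" "h ` {..<m} \<subseteq> A" by (auto simp: hole_in_def)
    have "card {i. i < 4 * t \<and> h ` {..<m} \<inter> cnb (T i) = {}} < t" using miss[OF h(1)] h A by auto
    then have "3 * t < card (tch (h ` {..<m}))" unfolding untouched by linarith
    also have "\<dots> \<le> card (tch A)" using h by (intro card_mono fin_tch tch_mono)
    finally show ?thesis .
  qed
  define J where "J = tch G"
  have J4: "J \<subseteq> {..<4 * t}" by (auto simp: J_def tch_def)
  have "hole_in G" using hg unfolding hole_in_def G_def by blast
  then have "3 * t < card J" using hit[of G] hg by (auto simp: J_def)
  then have cJ: "card ({..<4 * t} - J) < t" using card_Diff_subset[OF finite_subset[OF J4] J4] card_mono[OF _ J4] by simp
  have l4: "l \<ge> 4" and k4: "k \<ge> 4" using hole_ge_4 f(1) hg(1) by blast+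
  have fadj: "adj (f x) (f y) \<longleftrightarrow> y = (x + 1) mod l \<or> x = (y + 1) mod l" if "x < l" "y < l" for x y
    using hole_adj[OF f(1) that] .
  have finj: "f x = f y \<longleftrightarrow> x = y" if "x < l" "y < l" for x y
    using hole_inj[OF f(1) that] .
  \<comment> \<open>Positions on \<open>f\<close> next to a set that \<open>g\<close> touches as
    well; such a set can link the two holes.\<close>
  define Pf where "Pf = {x. x < l \<and> (\<exists>i\<in>J. f x \<in> cnb (T i))}"
  have finPf: "finite Pf" by (simp add: Pf_def)
  have "hole_in F" using f unfolding hole_in_def F_def by blast
  then have "3 * t < card (tch F)" using hit[of F] f by (auto simp: F_def)
  moreover have "\<not> tch F \<subseteq> {..<4 * t} - J"
  proof
    assume "tch F \<subseteq> {..<4 * t} - J"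
    then have "card (tch F) \<le> card ({..<4 * t} - J)" by (intro card_mono) auto
    with calculation cJ show False by linarith
  qed
  ultimately obtain i where "i \<in> tch F" "i \<in> J" by (auto simp: tch_def)
  then have Pf: "Pf \<noteq> {}" by (auto simp: tch_def F_def Pf_def)
  have f0: "f 0 \<notin> cnb (T i)" if "i < 4 * t" for i
    using T(3)[OF that] mem_cnb_iff[of "f 0" "T i"] by blast
  \<comment> \<open>\<open>f 0\<close> touches no set at all, so these are the nearest linking
    positions on either side of it. The arcs in \<open>I\<close> lead there and touch no set with
    index in \<open>J\<close> before their ends.\<close>
  define x1 x2 where "x1 = Min Pf" and "x2 = Max Pf"
  have x: "x1 \<in> Pf" "x2 \<in> Pf" "Pf \<subseteq> {x1..x2}" using finPf Pf by (auto simp: x1_def x2_def)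
  have x0: "0 < x1" "x1 \<le> x2" "x2 < l"
    using x f0 J4 by (auto simp: Pf_def intro!: Nat.gr0I)
  from x obtain i1 i2 where i12: "i1 \<in> J" "f x1 \<in> cnb (T i1)" "i2 \<in> J" "f x2 \<in> cnb (T i2)"
    by (auto simp: Pf_def)
  have i4: "i1 < 4 * t" "i2 < 4 * t" using i12 J4 by auto
  define I where "I = f ` {1..x1} \<union> f ` {x2..l - 1}"
  have fS: "adj (f x) (f (Suc x))" if "Suc x < l" for x using hole_Suc[OF f(1) that] .
  have through: "hole_in (insert (f 0) (I \<union> K))"
    if K: "conn K" "K \<inter> cnb {f 0} = {}" "f x1 \<in> cnb K" "f x2 \<in> cnb K" for K
  proof -
    have c1: "conn (f ` {1..x1} \<union> K)"
    proof (rule conn_Un[OF conn_path K(1)])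
      have "f x1 \<in> f ` {1..x1} \<inter> cnb K" using K(3) x0 by auto
      then show "f ` {1..x1} \<inter> cnb K \<noteq> {}" by blast
    qed (use x0 fS in auto)
    have "conn (f ` {x2..l - 1} \<union> (f ` {1..x1} \<union> K))"
    proof (rule conn_Un[OF conn_path c1])
      have "f x2 \<in> f ` {x2..l - 1} \<inter> cnb (f ` {1..x1} \<union> K)" using K(4) x0 by (auto simp: cnb_Un)
      then show "f ` {x2..l - 1} \<inter> cnb (f ` {1..x1} \<union> K) \<noteq> {}" by blast
    qed (use x0 fS in auto)
    then have R: "conn (I \<union> K)" by (simp add: I_def Un_ac)
    have nb: "f x \<in> cnb {f 0} \<longleftrightarrow> x = 1 \<or> x = l - 1" if "x < l" "0 < x" for x
      using fadj[of 0 x] finj[of x 0] that l4 by (auto simp: cnb_def mod_Suc split: if_splits)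
    have If: "\<exists>x. v = f x \<and> 0 < x \<and> x < l" if "v \<in> I" for v
    proof -
      from that obtain x where "v = f x" "x \<in> {1..x1} \<union> {x2..l - 1}" by (auto simp: I_def)
      with x0 show ?thesis by (intro exI[of _ x]) auto
    qed
    have "(I \<union> K) \<inter> cnb {f 0} = {f 1, f (l - 1)}"
    proof (intro equalityI subsetI)
      fix v assume v: "v \<in> (I \<union> K) \<inter> cnb {f 0}"
      then have "v \<in> I" using K(2) by blast
      then obtain x where "v = f x" "0 < x" "x < l" using If by blast
      then show "v \<in> {f 1, f (l - 1)}" using nb[of x] v by blast
    next
      fix v assume "v \<in> {f 1, f (l - 1)}"
      moreover have "f 1 \<in> I" "f (l - 1) \<in> I" using x0 by (auto simp: I_def)
      moreover have "f 1 \<in> cnb {f 0}" "f (l - 1) \<in> cnb {f 0}" using nb l4 by auto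
      ultimately show "v \<in> (I \<union> K) \<inter> cnb {f 0}" by blast
    qed
    moreover have "f 0 \<notin> I \<union> K"
    proof -
      have "f 0 \<notin> I" using If finj x0 by (metis less_irrefl l4 less_le_trans zero_less_numeral)
      moreover have "f 0 \<notin> K" using K(2) subset_cnb by blast
      ultimately show ?thesis by blast
    qed
    moreover have "f 1 \<noteq> f (l - 1)" "\<not> adj (f 1) (f (l - 1))"
      using finj[of 1 "l - 1"] fadj[of 1 "l - 1"] l4 by (auto simp: mod_Suc split: if_splits)
    moreover have "f 1 \<in> I \<union> K" "f (l - 1) \<in> I \<union> K" using x0 by (auto simp: I_def)
    ultimately show ?thesis using hole_through[OF R, of "f 1" "f (l - 1)" "f 0"]
      unfolding hole_in_def by blast
  qed
  \<comment> \<open>Inner vertices of the arcs touch only sets with index outside \<open>J\<close>,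
    fewer than \<open>t\<close> in number. The ends touch only \<open>T i1\<close> and
    \<open>T i2\<close>, because no vertex touches two sets.\<close>
  have touch: "tch (insert (f 0) (I \<union> K)) \<subseteq> ({..<4 * t} - J) \<union> {i1, i2} \<union> tch K" for K
  proof
    fix i assume i: "i \<in> tch (insert (f 0) (I \<union> K))"
    then have i4t: "i < 4 * t" by (simp add: tch_def)
    from i obtain v where v: "v \<in> insert (f 0) (I \<union> K)" "v \<in> cnb (T i)" by (auto simp: tch_def)
    have "v \<noteq> f 0" using v f0[OF i4t] by auto
    show "i \<in> ({..<4 * t} - J) \<union> {i1, i2} \<union> tch K"
    proof (cases "v \<in> I \<and> i \<in> J")
      case True
      then obtain x where xx: "v = f x" "x \<in> {1..x1} \<union> {x2..l - 1}" by (auto simp: I_def)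
      then have "x \<in> Pf" using True v x0 by (auto simp: Pf_def)
      then have "x = x1 \<or> x = x2" using x(3) xx(2) by auto
      moreover have "f x \<in> F" using \<open>x \<in> Pf\<close> by (auto simp: F_def Pf_def)
      ultimately show ?thesis using uniq[of v i i1] uniq[of v i i2] i4 i4t i12 v xx by (auto simp: F_def)
    next
      case False
      then show ?thesis using v \<open>v \<noteq> f 0\<close> i4t by (auto simp: tch_def)
    qed
  qed
  have tchT: "tch (T i) \<subseteq> {i}" if "i < 4 * t" for i
    using anti[OF that] by (auto simp: tch_def anticomplete_def)
  have "I \<subseteq> f ` {..<l}" using x0 by (auto simp: I_def)
  then have IV: "I \<subseteq> V" "f 0 \<in> V" using f(2) x0 by auto
  have Tf: "T i \<inter> cnb {f 0} = {}" "T i \<subseteq> V" if "i < 4 * t" for i using T(3)[OF that] by auto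
  show False
  proof (cases "i1 = i2")
    case True
    have "hole_in (insert (f 0) (I \<union> T i1))" using T(1) Tf i4 i12 True by (intro through) auto
    then have "3 * t < card (tch (insert (f 0) (I \<union> T i1)))" using hit IV Tf i4 by auto
    also have "\<dots> \<le> card (insert i1 ({..<4 * t} - J))"
      using touch[of "T i1"] tchT[OF i4(1)] True by (intro card_mono) auto
    also have "\<dots> \<le> card ({..<4 * t} - J) + 1" by (simp add: card_insert_if)
    finally show False using cJ by linarith
  next
    case False
    have "\<exists>y<k. g y \<in> cnb (T i1)" "\<exists>y<k. g y \<in> cnb (T i2)" using i12 by (auto simp: J_def tch_def G_def)
    then obtain z1 z2 where z: "z1 < k" "g z1 \<in> cnb (T i1)" "z2 < k" "g z2 \<in> cnb (T i2)" by auto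
    have zG: "g z1 \<in> F \<union> G" "g z2 \<in> F \<union> G" using z by (auto simp: G_def)
    have "z1 \<noteq> z2" using uniq[of "g z1" i1 i2] z i4 False by (auto simp: G_def)
    \<comment> \<open>The contacts of \<open>g\<close> with the two linking sets cut
      \<open>g\<close> into two arcs, each of which can complete the connection.\<close>
    define a b where "a = min z1 z2" and "b = max z1 z2"
    have ab: "a < b" "b < k" using \<open>z1 \<noteq> z2\<close> z by (auto simp: a_def b_def)
    have gab: "g z1 \<in> {g a, g b}" "g z2 \<in> {g a, g b}" "{g a, g b} \<subseteq> {g z1, g z2}"
      by (auto simp: a_def b_def min_def max_def)
    define A1 A2 where "A1 = g ` {a..b}" and "A2 = g ` {b..k - 1} \<union> g ` {0..a}"
    have gS: "adj (g x) (g (Suc x))" if "Suc x < k" for x using hole_Suc[OF hg(1) that] .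
    have AG: "A1 \<subseteq> G" "A2 \<subseteq> G" using ab by (auto simp: A1_def A2_def G_def)
    have cA1: "conn A1" unfolding A1_def by (rule conn_path) (use ab gS in auto)
    have gw: "adj (g 0) (g (k - 1))" using hole_adj[OF hg(1), of 0 "k - 1"] k4 by (auto simp: mod_Suc)
    have cA2: "conn A2" unfolding A2_def
    proof (rule conn_Un[OF conn_path conn_path])
      have "g 0 \<in> g ` {0..a}" by auto
      then have "g (k - 1) \<in> g ` {b..k - 1} \<inter> cnb (g ` {0..a})" using gw ab unfolding cnb_def by auto
      then show "g ` {b..k - 1} \<inter> cnb (g ` {0..a}) \<noteq> {}" by blast
    qed (use ab gS in auto)
    have gA: "{g a, g b} \<subseteq> A1" "{g a, g b} \<subseteq> A2" using ab by (auto simp: A1_def A2_def)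
    \<comment> \<open>The new hole touches at most \<open>t - 1\<close> sets outside
      \<open>J\<close>, the two linking sets and \<open>2 * t - 1\<close> sets near the arc:
      \<open>3 * t\<close> altogether, which is too few for a hole.\<close>
    have final: False if A: "conn A" "A \<subseteq> G" "{g a, g b} \<subseteq> A"
      and c: "card (tch A - {i1, i2}) \<le> 2 * t - 1" for A
    proof -
      define K where "K = A \<union> T i1 \<union> T i2"
      have "g z1 \<in> A \<inter> cnb (T i1)" "g z2 \<in> (A \<union> T i1) \<inter> cnb (T i2)" using A(3) gab(1,2) z by blast+
      then have "conn K" unfolding K_def by (intro conn_Un T(1) i4 A(1)) blast+
      moreover have "K \<inter> cnb {f 0} = {}" using A hg Tf i4 by (auto simp: K_def)
      moreover have "f x1 \<in> cnb K" "f x2 \<in> cnb K" using i12 by (auto simp: K_def cnb_Un)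
      ultimately have "hole_in (insert (f 0) (I \<union> K))" by (rule through)
      moreover have "insert (f 0) (I \<union> K) \<subseteq> V" using A hg IV Tf i4 by (auto simp: K_def)
      ultimately have "3 * t < card (tch (insert (f 0) (I \<union> K)))" by (rule hit)
      also have "tch (insert (f 0) (I \<union> K)) \<subseteq> ({..<4 * t} - J) \<union> ({i1, i2} \<union> (tch A - {i1, i2}))"
        using touch[of K] tchT[OF i4(1)] tchT[OF i4(2)] by (auto simp: K_def tch_Un)
      then have "card (tch (insert (f 0) (I \<union> K))) \<le> card (({..<4 * t} - J) \<union> ({i1, i2} \<union> (tch A - {i1, i2})))"
        by (intro card_mono) (auto simp: fin_tch)
      also have "\<dots> \<le> card ({..<4 * t} - J) + (card {i1, i2} + card (tch A - {i1, i2}))"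
        using card_Un_le[of "{..<4 * t} - J" "{i1, i2} \<union> (tch A - {i1, i2})"]
          card_Un_le[of "{i1, i2}" "tch A - {i1, i2}"] by linarith
      also have "\<dots> \<le> 3 * t" using cJ c card_length[of "[i1, i2]"] by simp
      finally show False by simp
    qed
    \<comment> \<open>By \<open>attach_one_side\<close> no further set touches both arcs, so one of
      the arcs touches at most half of the remaining \<open>4 * t - 2\<close> sets.\<close>
    have disj: "(tch A1 - {i1, i2}) \<inter> (tch A2 - {i1, i2}) = {}"
    proof (rule equals0I)
      fix i assume i: "i \<in> (tch A1 - {i1, i2}) \<inter> (tch A2 - {i1, i2})"
      then have i4t: "i < 4 * t" by (auto simp: tch_def)
      have ends: "g a \<notin> cnb (T i)" "g b \<notin> cnb (T i)"
      proof -
        have "g z1 \<notin> cnb (T i)" using uniq[of "g z1" i i1] z(2) zG i i4 i4t unfolding F_def G_def by blast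
        moreover have "g z2 \<notin> cnb (T i)" using uniq[of "g z2" i i2] z(4) zG i i4 i4t unfolding F_def G_def by blast
        ultimately show "g a \<notin> cnb (T i)" "g b \<notin> cnb (T i)" using gab(3) by auto
      qed
      from i obtain x where x: "a \<le> x" "x \<le> b" "g x \<in> cnb (T i)" by (auto simp: tch_def A1_def)
      moreover have "x \<noteq> a" "x \<noteq> b" using x ends by auto
      ultimately have x': "a < x" "x < b" by auto
      from i obtain v where v: "v \<in> A2" "v \<in> cnb (T i)" by (auto simp: tch_def)
      then obtain y where y: "y \<in> {b..k-1} \<union> {0..a}" "g y \<in> cnb (T i)" unfolding A2_def by blast
      moreover have "y \<noteq> a" "y \<noteq> b" using y ends by auto
      ultimately have y': "y < k" "y < a \<or> b < y" using ab by auto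
      show False
        by (rule attach_one_side[OF g T(1)[OF i4t] T(3)[OF i4t] T(2)[OF i4t] ab ends x' x(3) y' y(2)])
    qed
    have "card (tch A1 - {i1, i2}) + card (tch A2 - {i1, i2}) =
        card ((tch A1 - {i1, i2}) \<union> (tch A2 - {i1, i2}))"
      using disj by (intro card_Un_disjoint[symmetric]) (auto simp: fin_tch)
    also have "\<dots> \<le> card ({..<4 * t} - {i1, i2})" by (rule card_mono) (auto simp: tch_def)
    also have "\<dots> = 4 * t - 2" using i4 False by (subst card_Diff_subset) auto
    finally have "card (tch A1 - {i1, i2}) \<le> 2 * t - 1 \<or> card (tch A2 - {i1, i2}) \<le> 2 * t - 1" by linarith
    then show False using final[OF cA1 AG(1) gA(1)] final[OF cA2 AG(2) gA(2)] by blast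
  qed
qed

section \<open>Triangles, volumes and the existence of a heavy vertex\<close>

lemma ec_remove:
  assumes "finite V" "s \<in> V" shows "ec V = ec (V - {s}) + 2 * deg V s"
proof -
  let ?D = "{y \<in> V. adj s y}"
  have e: "apairs V = apairs (V - {s}) \<union> (Pair s ` ?D \<union> (\<lambda>y. (y, s)) ` ?D)"
  proof (intro equalityI subsetI)
    fix p assume "p \<in> apairs V"
    then obtain a b where "p = (a, b)" "a \<in> V" "b \<in> V" "adj a b" "adj b a" using adj_sym by (auto simp: apairs_def)
    then show "p \<in> apairs (V - {s}) \<union> (Pair s ` ?D \<union> (\<lambda>y. (y, s)) ` ?D)"
      by (cases "a = s"; cases "b = s") (auto simp: apairs_def)
  next
    fix p assume "p \<in> apairs (V - {s}) \<union> (Pair s ` ?D \<union> (\<lambda>y. (y, s)) ` ?D)"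
    then consider "p \<in> apairs (V - {s})" | y where "y \<in> ?D" "p = (s, y)" | y where "y \<in> ?D" "p = (y, s)" by blast
    then show "p \<in> apairs V"
    proof cases
      case (3 y) then show ?thesis using assms(2) adj_sym[of s y] by (auto simp: apairs_def)
    qed (use assms(2) in \<open>auto simp: apairs_def\<close>)
  qed
  have "card (Pair s ` ?D \<union> (\<lambda>y. (y, s)) ` ?D) = card (Pair s ` ?D) + card ((\<lambda>y. (y, s)) ` ?D)"
    using assms(1) adj_irrefl by (intro card_Un_disjoint) auto
  also have "\<dots> = 2 * deg V s" by (simp add: deg_def card_image inj_on_def)
  finally have 1: "card (Pair s ` ?D \<union> (\<lambda>y. (y, s)) ` ?D) = 2 * deg V s" .
  have "card (apairs V) = card (apairs (V - {s})) + card (Pair s ` ?D \<union> (\<lambda>y. (y, s)) ` ?D)"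
    unfolding e using assms(1) by (intro card_Un_disjoint finite_apairs) (auto simp: apairs_def)
  then show ?thesis by (simp add: ec_def 1)
qed

definition triangle :: "'a set \<Rightarrow> bool" where
  "triangle T \<longleftrightarrow> card T = 3 \<and> (\<forall>x\<in>T. \<forall>y\<in>T. x = y \<or> adj x y)"

lemma triangle_conn: "triangle T \<Longrightarrow> conn T"
  unfolding conn_def
proof (intro conjI allI impI)
  fix S assume T: "triangle T" and S: "S \<subseteq> T" "S \<noteq> {}" "S \<noteq> T"
  then obtain x y where "x \<in> S" "y \<in> T - S" by blast
  moreover from this S(1) have "x \<in> T" "x \<noteq> y" by auto
  ultimately show "\<exists>x\<in>S. \<exists>y\<in>T - S. adj x y" using T unfolding triangle_def by blast
qed (auto simp: triangle_def)

lemma triangle_cyc: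
  assumes "triangle T" shows "cyc T"
proof -
  have T: "finite T" "card T = 3" using assms card.infinite by (fastforce simp: triangle_def)+
  have "apairs T = T \<times> T - (\<lambda>x. (x, x)) ` T" using assms adj_irrefl by (auto simp: apairs_def triangle_def)
  then have "ec T = card (T \<times> T) - card ((\<lambda>x. (x, x)) ` T)"
    unfolding ec_def using T by (simp add: card_Diff_subset image_subset_iff)
  also have "\<dots> = 6" using T by (simp add: card_cartesian_product card_image inj_on_def)
  finally show ?thesis using T by (auto simp: cyc_def)
qed

text \<open>In a minimal cyclic subset no vertex has degree below two. Without a hole it has a
  simplicial vertex, which forms a triangle with two of its neighbours.\<close>

lemma cyc_cases:
  assumes "cyc Q" shows "hole_in Q \<or> (\<exists>T\<subseteq>Q. triangle T)"
proof (rule disjCI)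
  assume no: "\<not> (\<exists>T\<subseteq>Q. triangle T)"
  show "hole_in Q"
  proof (rule ccontr)
    assume nh: "\<not> hole_in Q"
    define P where "P R \<longleftrightarrow> R \<subseteq> Q \<and> cyc R" for R
    have "P Q" using assms by (simp add: P_def)
    then obtain R where R: "P R" "\<And>S. P S \<Longrightarrow> card R \<le> card S" using ex_has_least_nat[of P Q card] by auto
    then have R': "finite R" "R \<noteq> {}" "R \<subseteq> Q" "2 * card R \<le> ec R" by (auto simp: P_def cyc_def)
    have "\<not> hole_in R" using nh hole_in_mono R' by blast
    with simplicial_exists R' obtain s where s: "simplicial R s" by blast
    then have sR: "s \<in> R" by (simp add: simplicial_def)
    have "2 \<le> deg R s"
    proof (rule ccontr)
      assume "\<not> ?thesis"
      then have "2 * card (R - {s}) \<le> ec (R - {s})" using ec_remove[OF R'(1) sR] R' sR by simp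
      moreover have "R - {s} \<noteq> {}"
      proof
        assume "R - {s} = {}"
        then have "R = {s}" using sR by auto
        moreover have "apairs {s} = {}" using adj_irrefl by (auto simp: apairs_def)
        ultimately show False using R'(4) by (simp add: ec_def)
      qed
      ultimately have "P (R - {s})" using R' by (auto simp: P_def cyc_def)
      from R(2)[OF this] show False using sR R' by (simp add: card_Diff_singleton card_gt_0_iff)
        (metis One_nat_def card_gt_0_iff diff_less empty_iff less_Suc_eq not_le zero_less_Suc)
    qed
    then obtain D where D: "D \<subseteq> {y \<in> R. adj s y}" "card D = 2" unfolding deg_def by (metis obtain_subset_with_card_n)
    then obtain x y where xy: "D = {x, y}" "x \<noteq> y" by (auto simp: card_2_iff)
    have a: "x \<in> R" "y \<in> R" "adj s x" "adj s y" using D xy by auto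
    then have "adj x y" using s xy unfolding simplicial_def cnb_def by blast
    moreover have "s \<noteq> x" "s \<noteq> y" using a adj_irrefl by auto
    ultimately have "triangle {s, x, y}"
      using a(3,4) xy(2) adj_sym[OF a(3)] adj_sym[OF a(4)] adj_sym[OF \<open>adj x y\<close>] by (auto simp: triangle_def)
    moreover have "{s, x, y} \<subseteq> Q" using R'(3) sR a(1,2) by blast
    ultimately show False using no by blast
  qed
qed

text \<open>The summand \<open>1\<close> turns degrees into closed degrees, in agreement with
  \<open>cvol\<close> on the side of the algorithm.\<close>

definition vol :: "'a set \<Rightarrow> 'a \<Rightarrow> nat" where
  "vol V v = (\<Sum>u\<in>V \<inter> cnb {v}. deg V u + 1)"

lemma vol_cover:
  assumes "finite V" "finite X"
  shows "(\<Sum>u\<in>V \<inter> cnb X. deg V u + 1) \<le> (\<Sum>x\<in>X. vol V x)"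
  using assms(2)
proof (induction X)
  case (insert x X)
  have "V \<inter> cnb (insert x X) = (V \<inter> cnb {x}) \<union> (V \<inter> cnb X)" using cnb_insert[of x X] by auto
  then have "(\<Sum>u\<in>V \<inter> cnb (insert x X). deg V u + 1) \<le>
      (\<Sum>u\<in>V \<inter> cnb {x}. deg V u + 1) + (\<Sum>u\<in>V \<inter> cnb X. deg V u + 1)"
    using assms(1) sum.union_inter[of "V \<inter> cnb {x}" "V \<inter> cnb X" "\<lambda>u. deg V u + 1"] by simp
  then show ?case using insert by (simp add: vol_def)
qed simp

lemma ec_cnb:
  assumes "finite V"
  shows "ec V \<le> ec (V - cnb X) + 2 * (\<Sum>u\<in>V \<inter> cnb X. deg V u)"
proof -
  let ?S = "SIGMA u:V \<inter> cnb X. {y\<in>V. adj u y}"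
  have fS: "finite ?S" "card ?S = (\<Sum>u\<in>V \<inter> cnb X. deg V u)" using assms by (auto simp: deg_def)
  have "apairs V \<subseteq> apairs (V - cnb X) \<union> (?S \<union> prod.swap ` ?S)"
  proof (rule subrelI)
    fix a b assume ab: "(a, b) \<in> apairs V"
    then have "adj a b" "adj b a" "a \<in> V" "b \<in> V" using adj_sym by (auto simp: apairs_def)
    then show "(a, b) \<in> apairs (V - cnb X) \<union> (?S \<union> prod.swap ` ?S)"
      by (cases "a \<in> cnb X"; cases "b \<in> cnb X") (auto simp: apairs_def image_iff)
  qed
  then have "card (apairs V) \<le> card (apairs (V - cnb X) \<union> (?S \<union> prod.swap ` ?S))"
    using assms fS by (intro card_mono finite_UnI finite_apairs) auto
  also have "\<dots> \<le> card (apairs (V - cnb X)) + (card ?S + card (prod.swap ` ?S))"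
    using card_Un_le[of "apairs (V - cnb X)" "?S \<union> prod.swap ` ?S"] card_Un_le[of ?S "prod.swap ` ?S"] by linarith
  also have "card (prod.swap ` ?S) = card ?S" by (rule card_image) (simp add: inj_on_def)
  finally show ?thesis using fS by (simp add: ec_def)
qed

lemma ec_deg: "finite V \<Longrightarrow> ec V = (\<Sum>v\<in>V. deg V v)"
  using ec_sum by (simp add: deg_def)

text \<open>If no closed neighbourhood has a fraction of \<open>1 / (44800 * t)\<close> of the total volume, then a short cycle remains
  after the deletion of the neighbourhoods of \<open>1120 * t\<close> vertices.\<close>

lemma cyc_remains:
  assumes V: "finite V" "small_bound t \<le> card V" and t: "t \<ge> 1" and np: "\<not> pack t V"
    and deg3: "\<And>v. v \<in> V \<Longrightarrow> 3 \<le> deg V v"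
    and light: "\<And>v. v \<in> V \<Longrightarrow> 44800 * t * vol V v < (\<Sum>u\<in>V. deg V u + 1)"
    and X: "X \<subseteq> V" "card X \<le> 1120 * t"
  shows "\<exists>Q\<subseteq>V - cnb X. cyc Q \<and> card Q \<le> 560"
proof -
  define V' where "V' = V - cnb X"
  have fin: "finite V'" "finite X" using V X finite_subset by (auto simp: V'_def)
  define n where "n = card V"
  have n3: "3 * n \<le> ec V" using sum_mono[of V "\<lambda>_. 3" "deg V"] deg3 ec_deg[OF V(1)] by (simp add: n_def)
  define S where "S = (\<Sum>u\<in>V \<inter> cnb X. deg V u + 1)"
  have mu: "(\<Sum>u\<in>V. deg V u + 1) = ec V + n" using ec_deg[OF V(1)] by (simp add: n_def sum_Suc)
  have "44800 * t * S \<le> 44800 * t * (\<Sum>x\<in>X. vol V x)"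
    using vol_cover[OF V(1) fin(2)] by (simp add: S_def)
  also have "\<dots> = (\<Sum>x\<in>X. 44800 * t * vol V x)" by (simp add: sum_distrib_left)
  also have "\<dots> \<le> (\<Sum>x\<in>X. ec V + n)" using light X mu by (intro sum_mono) (force intro: less_imp_le)
  also have "\<dots> = card X * (ec V + n)" by simp
  also have "\<dots> \<le> 1120 * t * (ec V + n)" using X(2) by (rule mult_le_mono1)
  \<comment> \<open>Here \<open>44800 = 1120 * 40\<close> is used: the deleted neighbourhoods carry
    at most one fortieth of the volume.\<close>
  finally have "(1120 * t) * (40 * S) \<le> (1120 * t) * (ec V + n)" by simp
  then have S: "40 * S \<le> ec V + n" using t by simp
  have "(\<Sum>u\<in>V \<inter> cnb X. deg V u) \<le> S" unfolding S_def by (rule sum_mono) simp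
  then have "ec V \<le> ec V' + 2 * S" using ec_cnb[OF V(1), of X] by (simp add: V'_def)
  \<comment> \<open>The loss \<open>2 * S\<close> is at most \<open>(ec V + n) / 20\<close>; with
    \<open>ec V \<ge> 3 * n\<close> at least \<open>2.85 * n - 0.05 * n\<close> ordered pairs
    remain.\<close>
  with S n3 have e: "28 * n \<le> 10 * ec V'" by linarith
  have cV: "card V' \<le> n" unfolding n_def V'_def using V by (intro card_mono) auto
  have dense: "2.8 * card V' \<le> ec V'" using e cV by simp
  have "(dense_bound + t ^ 10) ^ 2 \<le> n" using V(2) by (simp add: small_bound_def n_def)
  \<comment> \<open>The number of edges is all that is known about the size of \<open>V'\<close>,
    hence the square in \<open>small_bound\<close>.\<close>
  also have "\<dots> \<le> card V' ^ 2" using ec_le_square[OF fin(1)] e by (simp add: power2_eq_square)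
  finally have "dense_bound + t ^ 10 \<le> card V'" by (rule power2_le_imp_le) simp
  then have "(\<exists>Q\<subseteq>V'. cyc Q \<and> card Q \<le> 560) \<or>
    (\<exists>Q. (\<forall>i\<le>t. Q i \<subseteq> V' \<and> cyc (Q i)) \<and> (\<forall>i\<le>t. \<forall>j\<le>t. i \<noteq> j \<longrightarrow> anticomplete (Q i) (Q j)))"
    using dense by (intro dense_cases fin) auto
  then show ?thesis
  proof
    \<comment> \<open>The last of the \<open>t + 1\<close> sets either contains a triangle, which is
      short enough, or a hole, which forms a packing with the other \<open>t\<close> sets.\<close>
    assume "\<exists>Q. (\<forall>i\<le>t. Q i \<subseteq> V' \<and> cyc (Q i)) \<and> (\<forall>i\<le>t. \<forall>j\<le>t. i \<noteq> j \<longrightarrow> anticomplete (Q i) (Q j))"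
    then obtain Q where Q1: "\<forall>i\<le>t. Q i \<subseteq> V' \<and> cyc (Q i)"
      and Q2: "\<forall>i\<le>t. \<forall>j\<le>t. i \<noteq> j \<longrightarrow> anticomplete (Q i) (Q j)" by blast
    have Qt: "Q t \<subseteq> V'" "cyc (Q t)" using Q1 by auto
    show ?thesis
    proof (cases "\<exists>T\<subseteq>Q t. triangle T")
      case True
      then obtain T where "T \<subseteq> Q t" "triangle T" by blast
      then show ?thesis using Qt triangle_cyc[of T] unfolding V'_def[symmetric]
        by (intro exI[of _ T]) (auto simp: triangle_def)
    next
      case False
      then have "hole_in (Q t)" using cyc_cases[OF Qt(2)] by blast
      then obtain g l where g: "hole g l" "g ` {..<l} \<subseteq> Q t" by (auto simp: hole_in_def)
      have "pack t V" unfolding pack_def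
      proof (intro exI conjI allI impI)
        show "g ` {..<l} \<subseteq> V" using g Qt by (auto simp: V'_def)
        show "Q i \<subseteq> V" "cyc (Q i)" if "i < t" for i
          using Q1[rule_format, of i] that by (auto simp: V'_def)
        show "anticomplete (Q i) (g ` {..<l})" if "i < t" for i
          using anticomplete_mono[OF _ subset_refl g(2), of "Q i"] Q2 that by auto
        show "anticomplete (Q i) (Q j)" if "i < t" "j < t" "i \<noteq> j" for i j using Q2 that by auto
      qed (rule g(1))
      with np show ?thesis by simp
    qed
  qed (simp add: V'_def)
qed

text \<open>If all neighbourhoods are light, \<open>cyc_remains\<close> yields short cyclic sets one
  after the other, each anticomplete to the earlier ones. Together with a short hole they would be a
  packing, so all holes are long. Then the short sets contain triangles, and \<open>4 * t\<close> of
  these lead to \<open>ring_contradiction\<close>.\<close>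

lemma exists_heavy:
  assumes V: "finite V" "V \<noteq> {}" "small_bound t \<le> card V" and t: "t \<ge> 1" and np: "\<not> pack t V"
    and deg3: "\<And>v. v \<in> V \<Longrightarrow> 3 \<le> deg V v"
    and far_hole: "\<And>v. v \<in> V \<Longrightarrow> hole_in (V - cnb {v})"
  shows "\<exists>v\<in>V. (\<Sum>u\<in>V. deg V u + 1) \<le> 44800 * t * vol V v"
proof (rule ccontr)
  assume "\<not> ?thesis"
  then have "\<And>v. v \<in> V \<Longrightarrow> 44800 * t * vol V v < (\<Sum>u\<in>V. deg V u + 1)" by force
  note remains = cyc_remains[OF V(1,3) t np deg3 this]
  have long: "560 < l" if h: "hole h l" "h ` {..<l} \<subseteq> V" for h l
  proof (rule ccontr)
    assume l: "\<not> ?thesis"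
    define H where "H = h ` {..<l}"
    have cH: "card H \<le> 560" "finite H" using l hole_card[OF h(1)] by (auto simp: H_def)
    have "\<exists>Q. (\<forall>i<m. Q i \<subseteq> V \<and> cyc (Q i) \<and> card (Q i) \<le> 560 \<and> anticomplete (Q i) H) \<and>
       (\<forall>i<m. \<forall>j<m. i \<noteq> j \<longrightarrow> anticomplete (Q i) (Q j))" if "m \<le> t" for m
      using that
    proof (induction m)
      case (Suc m)
      then obtain Q where Q1: "\<forall>i<m. Q i \<subseteq> V \<and> cyc (Q i) \<and> card (Q i) \<le> 560 \<and> anticomplete (Q i) H"
        and Q2: "\<forall>i<m. \<forall>j<m. i \<noteq> j \<longrightarrow> anticomplete (Q i) (Q j)" by auto
      define X where "X = H \<union> (\<Union>i<m. Q i)"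
      have "card X \<le> card H + card (\<Union>i<m. Q i)" unfolding X_def by (rule card_Un_le)
      also have "card (\<Union>i<m. Q i) \<le> (\<Sum>i<m. card (Q i))" by (rule card_UN_le) simp
      also have "\<dots> \<le> (\<Sum>i<m. 560)" using Q1 by (intro sum_mono) auto
      finally have "card X \<le> 1120 * t" using cH Suc.prems by simp
      moreover have "X \<subseteq> V" using h(2) Q1 by (auto simp: X_def H_def)
      ultimately obtain R where R: "R \<subseteq> V - cnb X" "cyc R" "card R \<le> 560" using remains by blast
      have RX: "anticomplete R X" using R by (auto simp: anticomplete_def)
      have "anticomplete R H" using anticomplete_mono[OF RX] by (auto simp: X_def)
      moreover have "anticomplete R (Q i)" "anticomplete (Q i) R" if "i < m" for i
        using anticomplete_mono[OF RX, of R "Q i"] that anticomplete_sym[of R "Q i"] by (auto simp: X_def)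
      ultimately show ?case using Q1 Q2 R
        by (intro exI[of _ "Q(m := R)"]) (auto simp: less_Suc_eq)
    qed simp
    from this[of t] obtain Q where "\<forall>i<t. Q i \<subseteq> V \<and> cyc (Q i) \<and> card (Q i) \<le> 560 \<and> anticomplete (Q i) H"
       "\<forall>i<t. \<forall>j<t. i \<noteq> j \<longrightarrow> anticomplete (Q i) (Q j)" by auto
    then have "pack t V" unfolding pack_def H_def using h by blast
    with np show False by simp
  qed
  obtain v where "v \<in> V" using V by auto
  then have "hole_in V" using far_hole hole_in_mono by blast
  then obtain f l where f: "shortest_hole V f l" using ex_shortest_hole by blast
  then have f': "hole f l" "f ` {..<l} \<subseteq> V" by (auto simp: shortest_hole_def)
  have l: "560 < l" using long f' by blast
  define W where "W = V - cnb {f 0}"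
  have f0: "f 0 \<in> V" using f' l by auto
  from far_hole[OF f0] obtain g k where g: "shortest_hole W g k" using ex_shortest_hole unfolding W_def by blast
  then have g': "hole g k" "g ` {..<k} \<subseteq> W" by (auto simp: shortest_hole_def)
  have k: "560 < k" using long g' by (auto simp: W_def)
  \<comment> \<open>Removing the closed neighbourhood of \<open>u\<close> removes all vertices that
    see the whole of \<open>f\<close>, so that \<open>attach_vertex\<close> applies to the rest. If
    there are none, \<open>f 0\<close> serves as a default.\<close>
  have "\<exists>u\<in>V. \<forall>v\<in>V. f ` {..<l} \<subseteq> cnb {v} \<longrightarrow> v \<in> cnb {u}"
  proof (cases "\<exists>u\<in>V. f ` {..<l} \<subseteq> cnb {u}")
    case True
    have "4 < l" using l by simp
    with True show ?thesis using universal_clique[OF f] by blast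
  qed (use f0 in blast)
  then obtain u where u: "u \<in> V" "\<And>v. v \<in> V \<Longrightarrow> f ` {..<l} \<subseteq> cnb {v} \<Longrightarrow> v \<in> cnb {u}" by blast
  have "\<exists>u\<in>V. \<forall>v\<in>W. g ` {..<k} \<subseteq> cnb {v} \<longrightarrow> v \<in> cnb {u}"
  proof (cases "\<exists>u\<in>W. g ` {..<k} \<subseteq> cnb {u}")
    case True
    have "4 < k" using k by simp
    with True show ?thesis using universal_clique[OF g] unfolding W_def by blast
  qed (use f0 in blast)
  then obtain w where w: "w \<in> V" "\<And>v. v \<in> W \<Longrightarrow> g ` {..<k} \<subseteq> cnb {v} \<Longrightarrow> v \<in> cnb {w}" by blast
  define FG where "FG = f ` {..<l} \<union> g ` {..<k}"
  have FGV: "FG \<subseteq> V" using f' g' by (auto simp: FG_def W_def)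
  define ok where "ok S \<longleftrightarrow> S \<subseteq> V - cnb {f 0, u, w} \<and> triangle S" for S
  \<comment> \<open>Three vertices with at most three contacts each on either hole.\<close>
  have few: "card (FG \<inter> cnb S) \<le> 18" if S: "ok S" for S
  proof -
    have c3: "cnb {f 0} \<subseteq> cnb {f 0, u, w}" "cnb {u} \<subseteq> cnb {f 0, u, w}" "cnb {w} \<subseteq> cnb {f 0, u, w}"
      by (auto intro!: cnb_mono)
    have S': "card S = 3" "S \<subseteq> W" "S \<subseteq> V" using S c3 by (auto simp: ok_def triangle_def W_def)
    then have "finite S" using card.infinite by fastforce
    note S' = S'(1) this S'(2,3)
    have e: "FG \<inter> cnb S = (\<Union>s\<in>S. f ` {..<l} \<inter> cnb {s}) \<union> (\<Union>s\<in>S. g ` {..<k} \<inter> cnb {s})"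
      by (auto simp: FG_def cnb_def)
    have "card (f ` {..<l} \<inter> cnb {s}) \<le> 3" if "s \<in> S" for s
    proof (rule attach_vertex[OF f])
      show "\<not> f ` {..<l} \<subseteq> cnb {s}" using u(2)[of s] S that S' c3(2) unfolding ok_def by blast
    qed (use that S' in auto)
    then have 1: "card (\<Union>s\<in>S. f ` {..<l} \<inter> cnb {s}) \<le> 9"
      using card_UN_le[OF S'(2), of "\<lambda>s. f ` {..<l} \<inter> cnb {s}"] sum_mono[of S "\<lambda>s. card (f ` {..<l} \<inter> cnb {s})" "\<lambda>_. 3"] S'
      by simp
    have "card (g ` {..<k} \<inter> cnb {s}) \<le> 3" if "s \<in> S" for s
    proof (rule attach_vertex[OF g])
      show "\<not> g ` {..<k} \<subseteq> cnb {s}" using w(2)[of s] S that S' c3(3) unfolding ok_def by blast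
    qed (use that S' in auto)
    then have 2: "card (\<Union>s\<in>S. g ` {..<k} \<inter> cnb {s}) \<le> 9"
      using card_UN_le[OF S'(2), of "\<lambda>s. g ` {..<k} \<inter> cnb {s}"] sum_mono[of S "\<lambda>s. card (g ` {..<k} \<inter> cnb {s})" "\<lambda>_. 3"] S'
      by simp
    show ?thesis unfolding e using 1 2
      card_Un_le[of "\<Union>s\<in>S. f ` {..<l} \<inter> cnb {s}" "\<Union>s\<in>S. g ` {..<k} \<inter> cnb {s}"] by linarith
  qed
  \<comment> \<open>The contacts of earlier triangles on the two holes are avoided as well, so that
    no vertex of the holes sees two triangles. A triangle with its contacts has at most
    \<open>3 + 18 = 21\<close> vertices.\<close>
  have "\<exists>T. (\<forall>i<m. ok (T i)) \<and> (\<forall>i<m. \<forall>j<m. i \<noteq> j \<longrightarrow> anticomplete (T i) (T j \<union> (FG \<inter> cnb (T j))))"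
    if "m \<le> 4 * t" for m using that
  proof (induction m)
    case (Suc m)
    then obtain T where T1: "\<forall>i<m. ok (T i)"
      and T2: "\<forall>i<m. \<forall>j<m. i \<noteq> j \<longrightarrow> anticomplete (T i) (T j \<union> (FG \<inter> cnb (T j)))" by auto
    define X where "X = {f 0, u, w} \<union> (\<Union>i<m. T i \<union> (FG \<inter> cnb (T i)))"
    have "card X \<le> card {f 0, u, w} + card (\<Union>i<m. T i \<union> (FG \<inter> cnb (T i)))" unfolding X_def by (rule card_Un_le)
    also have "card {f 0, u, w} \<le> 3" using card_length[of "[f 0, u, w]"] by simp
    also have "card (\<Union>i<m. T i \<union> (FG \<inter> cnb (T i))) \<le> (\<Sum>i<m. card (T i \<union> (FG \<inter> cnb (T i))))" by (rule card_UN_le) simp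
    also have "\<dots> \<le> (\<Sum>i<m. 21)"
    proof (rule sum_mono)
      fix i assume "i \<in> {..<m}"
      then show "card (T i \<union> (FG \<inter> cnb (T i))) \<le> 21"
        using few[of "T i"] T1 card_Un_le[of "T i" "FG \<inter> cnb (T i)"] by (auto simp: ok_def triangle_def)
    qed
    finally have "card X \<le> 1120 * t" using Suc.prems t by simp
    moreover have "X \<subseteq> V" using f0 u w FGV T1 by (auto simp: X_def ok_def)
    ultimately obtain R where R: "R \<subseteq> V - cnb X" "cyc R" "card R \<le> 560" using remains by blast
    have finR: "finite R" using R(2) by (simp add: cyc_def)
    \<comment> \<open>All holes have more than \<open>560\<close> vertices, but \<open>R\<close>
      does not; so \<open>cyc_cases\<close> must provide a triangle.\<close>
    have "\<not> hole_in R"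
    proof
      assume "hole_in R"
      then obtain h j where h: "hole h j" "h ` {..<j} \<subseteq> R" by (auto simp: hole_in_def)
      then have "560 < j" using long R by blast
      moreover have "j \<le> card R" using card_mono[OF finR h(2)] hole_card[OF h(1)] by simp
      ultimately show False using R by simp
    qed
    then obtain S where S: "S \<subseteq> R" "triangle S" using cyc_cases[OF R(2)] by blast
    have SX: "anticomplete S X" using R S by (auto simp: anticomplete_def)
    have "cnb {f 0, u, w} \<subseteq> cnb X" by (rule cnb_mono) (auto simp: X_def)
    then have okS: "ok S" using R S by (auto simp: ok_def)
    have a1: "anticomplete S (T i \<union> (FG \<inter> cnb (T i)))" if "i < m" for i
      using that by (intro anticomplete_mono[OF SX]) (auto simp: X_def)
    have a2: "anticomplete (T i) (S \<union> (FG \<inter> cnb S))" if i: "i < m" for i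
    proof -
      have "x \<notin> cnb (T i)" if "x \<in> FG \<inter> cnb S" for x
      proof
        assume "x \<in> cnb (T i)"
        then have "x \<in> T i \<union> (FG \<inter> cnb (T i))" using that by auto
        then have "S \<inter> cnb {x} = {}" using a1[OF i] unfolding anticomplete_def cnb_def by blast
        then show False using that mem_cnb_iff[of x S] by blast
      qed
      then have "anticomplete (FG \<inter> cnb S) (T i)" by (auto simp: anticomplete_def)
      moreover have "anticomplete S (T i)" using anticomplete_mono[OF a1[OF i]] by blast
      ultimately show ?thesis using anticomplete_sym unfolding anticomplete_def cnb_Un by blast
    qed
    show ?case using T1 T2 okS a1 a2
      by (intro exI[of _ "T(m := S)"]) (auto simp: less_Suc_eq)
  qed simp
  from this[of "4 * t"] obtain T where T1: "\<And>i. i < 4 * t \<Longrightarrow> ok (T i)"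
    and T2: "\<And>i j. i < 4 * t \<Longrightarrow> j < 4 * t \<Longrightarrow> i \<noteq> j \<Longrightarrow> anticomplete (T i) (T j \<union> (FG \<inter> cnb (T j)))" by auto
  have T3: "anticomplete (T i) (T j)" if "i < 4 * t" "j < 4 * t" "i \<noteq> j" for i j
    using anticomplete_mono[OF T2[OF that]] by blast
  show False
  proof (rule ring_contradiction[OF f' g[unfolded W_def], of t T])
    show "8 < k" using k by simp
    show "conn (T i)" "card (T i) = 3" if "i < 4 * t" for i
      using T1[OF that] triangle_conn by (auto simp: ok_def triangle_def)
    show "T i \<subseteq> V - cnb {f 0}" if "i < 4 * t" for i
      using T1[OF that] by (auto simp: ok_def cnb_def)
    show "i = j" if v: "v \<in> f ` {..<l} \<union> g ` {..<k}" "v \<in> cnb (T i)" "v \<in> cnb (T j)"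
      and ij: "i < 4 * t" "j < 4 * t" for v i j
    proof (rule ccontr)
      assume "i \<noteq> j"
      have "v \<in> FG \<inter> cnb (T j)" using v by (auto simp: FG_def)
      then have "T i \<inter> cnb {v} = {}" using T2[OF ij \<open>i \<noteq> j\<close>] unfolding anticomplete_def cnb_def by blast
      then show False using v mem_cnb_iff[of v "T i"] by blast
    qed
    show "card {i. i < 4 * t \<and> h ` {..<m} \<inter> cnb (T i) = {}} < t" if h: "hole h m" "h ` {..<m} \<subseteq> V" for h m
    proof (rule ccontr)
      assume "\<not> ?thesis"
      \<comment> \<open>A hole that misses \<open>t\<close> triangles forms a packing with
        them.\<close>
      then obtain B where B: "B \<subseteq> {i. i < 4 * t \<and> h ` {..<m} \<inter> cnb (T i) = {}}" "card B = t" "finite B"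
        using obtain_subset_with_card_n by (metis (lifting) not_less)
      then obtain e where e: "bij_betw e {..<t} B" using ex_bij_betw_nat_finite[of B] by (auto simp: atLeast0LessThan)
      have eB: "e i < 4 * t" "h ` {..<m} \<inter> cnb (T (e i)) = {}" if "i < t" for i
        using bij_betwE[OF e] that B(1) by auto
      have "pack t V" unfolding pack_def
      proof (intro exI conjI allI impI)
        show "T (e i) \<subseteq> V" "cyc (T (e i))" if "i < t" for i
          using T1[OF eB(1)[OF that]] triangle_cyc by (auto simp: ok_def)
        show "anticomplete (T (e i)) (h ` {..<m})" if "i < t" for i
          using eB(2)[OF that] anticomplete_sym unfolding anticomplete_def by blast
        show "anticomplete (T (e i)) (T (e j))" if "i < t" "j < t" "i \<noteq> j" for i j
          using T3 eB that e unfolding bij_betw_def inj_on_def by blast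
      qed (use h in auto)
      with np show False by simp
    qed
  qed (use T3 in auto)
qed

end

section \<open>Induced minor models\<close>

definition touching :: "'a graph \<Rightarrow> 'a set \<Rightarrow> 'a set \<Rightarrow> bool" where
  "touching G A B \<longleftrightarrow> (\<exists>u\<in>A. \<exists>v\<in>B. {u, v} \<in> edges G)"

definition connected_in :: "'a graph \<Rightarrow> 'a set \<Rightarrow> bool" where
  "connected_in G A \<longleftrightarrow> A \<noteq> {} \<and> (\<forall>S\<subseteq>A. S \<noteq> {} \<longrightarrow> S \<noteq> A \<longrightarrow> touching G S (A - S))"

text \<open>The usual branch sets; the equivalence for contacts, instead of an implication, makes
  the minor induced.\<close>

definition minor_model :: "'b graph \<Rightarrow> 'a graph \<Rightarrow> ('b \<Rightarrow> 'a set) \<Rightarrow> bool" where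
  "minor_model H G B \<longleftrightarrow>
     (\<forall>x\<in>verts H. B x \<subseteq> verts G \<and> connected_in G (B x)) \<and>
     (\<forall>x\<in>verts H. \<forall>y\<in>verts H. x \<noteq> y \<longrightarrow> B x \<inter> B y = {} \<and> (touching G (B x) (B y) \<longleftrightarrow> {x, y} \<in> edges H))"

lemma induced_minor_step: "minor_step G G' \<Longrightarrow> induced_minor H G' \<Longrightarrow> induced_minor H G"
  unfolding induced_minor_def by (meson converse_rtranclp_into_rtranclp)

lemma simple_edge_verts: "simple_graph G \<Longrightarrow> {u, v} \<in> edges G \<Longrightarrow> u \<in> verts G \<and> v \<in> verts G \<and> u \<noteq> v"
  by (auto simp: simple_graph_def)

lemma contract_edge_edges:
  assumes G: "simple_graph G" and ab: "a \<noteq> v" "b \<noteq> v" "a \<noteq> b" "u \<noteq> v"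
  shows "{a, b} \<in> edges (contract_edge u v G) \<longleftrightarrow>
    {a, b} \<in> edges G \<or> (a = u \<and> {v, b} \<in> edges G) \<or> (b = u \<and> {a, v} \<in> edges G)"
    (is "?L \<longleftrightarrow> ?R")
proof -
  define r where "r x = (if x = v then u else x)" for x
  have E: "edges (contract_edge u v G) = (\<lambda>e. r ` e) ` (edges G - {{u, v}})"
    by (simp add: contract_edge_def r_def)
  show ?thesis
  proof
    assume ?L
    then obtain e where e: "e \<in> edges G" "e \<noteq> {u, v}" "{a, b} = r ` e" unfolding E by auto
    from G e have "card e = 2" by (auto simp: simple_graph_def)
    then obtain x y where xy: "e = {x, y}" "x \<noteq> y" by (auto simp: card_2_iff)
    have "{a, b} = {r x, r y}" using e(3) xy by simp
    then have "a = r x \<and> b = r y \<or> a = r y \<and> b = r x" by (metis doubleton_eq_iff)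
    moreover have ?R if "{x, y} \<in> edges G" "a = r x" "b = r y" for x y
      using that ab by (simp add: r_def split: if_splits)
    moreover have "{x, y} \<in> edges G" "{y, x} \<in> edges G" using e(1) xy(1) by (simp_all add: insert_commute)
    ultimately show ?R by blast
  next
    assume ?R
    then consider "{a, b} \<in> edges G" | "a = u" "{v, b} \<in> edges G" | "b = u" "{a, v} \<in> edges G" by blast
    then show ?L
    proof cases
      case 1
      then show ?thesis unfolding E using ab by (intro image_eqI[of _ _ "{a, b}"]) (auto simp: r_def doubleton_eq_iff)
    next
      case 2
      then show ?thesis unfolding E using ab by (intro image_eqI[of _ _ "{v, b}"]) (auto simp: r_def doubleton_eq_iff)
    next
      case 3
      then show ?thesis unfolding E using ab by (intro image_eqI[of _ _ "{a, v}"]) (auto simp: r_def doubleton_eq_iff)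
    qed
  qed
qed

lemma simple_delete_vertex: "simple_graph G \<Longrightarrow> simple_graph (delete_vertex v G)"
  by (auto simp: simple_graph_def delete_vertex_def)

text \<open>Only the edge \<open>{u, v}\<close> could collapse to a single vertex, and
  \<open>contract_edge\<close> takes it out beforehand.\<close>

lemma simple_contract_edge:
  assumes G: "simple_graph G" and uv: "{u, v} \<in> edges G"
  shows "simple_graph (contract_edge u v G)"
  unfolding simple_graph_def
proof (intro conjI ballI)
  show "finite (verts (contract_edge u v G))" using G by (simp add: simple_graph_def contract_edge_def)
  fix e assume "e \<in> edges (contract_edge u v G)"
  then obtain e' where e': "e' \<in> edges G" "e' \<noteq> {u, v}" "e = (\<lambda>x. if x = v then u else x) ` e'"
    by (auto simp: contract_edge_def)
  then have "card e' = 2" "e' \<subseteq> verts G" using G by (auto simp: simple_graph_def)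
  then obtain x y where xy: "e' = {x, y}" "x \<noteq> y" "x \<in> verts G" "y \<in> verts G" by (auto simp: card_2_iff)
  define r where "r z = (if z = v then u else z)" for z
  have e: "e = {r x, r y}" using e'(3) xy(1) by (simp add: r_def)
  have "u \<in> verts G" "u \<noteq> v" using simple_edge_verts[OF G uv] by auto
  then have "r x \<in> verts G - {v}" "r y \<in> verts G - {v}" using xy(3,4) by (simp_all add: r_def)
  then show "e \<subseteq> verts (contract_edge u v G)" by (simp add: e contract_edge_def)
  have "r x \<noteq> r y"
  proof
    assume "r x = r y"
    then have "x = v \<and> y = u \<or> y = v \<and> x = u" using xy(2) by (simp add: r_def split: if_splits)
    then have "e' = {u, v}" using xy(1) by (auto simp: insert_commute)
    with e'(2) show False ..
  qed
  then show "card e = 2" by (simp add: e)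
qed

text \<open>Induction on the number of vertices: delete a vertex outside all branch sets, or
  contract an edge inside a branch set with several vertices. If neither is possible, the branch
  sets are singletons that cover \<open>G\<close>, and \<open>G\<close> is isomorphic to
  \<open>H\<close>.\<close>

lemma minor_model_induced_minor:
  assumes "simple_graph G" "simple_graph H" "minor_model H G B"
  shows "induced_minor H G"
  using assms
proof (induction "card (verts G)" arbitrary: G B rule: less_induct)
  case less
  note G = less.prems(1) and H = less.prems(2)
  have finG: "finite (verts G)" using G by (simp add: simple_graph_def)
  have B: "B x \<subseteq> verts G" "connected_in G (B x)" if "x \<in> verts H" for x
    using less.prems(3) that by (auto simp: minor_model_def)
  have Bd: "B x \<inter> B y = {}" "touching G (B x) (B y) \<longleftrightarrow> {x, y} \<in> edges H"
    if "x \<in> verts H" "y \<in> verts H" "x \<noteq> y" for x y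
    using less.prems(3) that by (auto simp: minor_model_def)
  consider (out) v where "v \<in> verts G" "\<And>x. x \<in> verts H \<Longrightarrow> v \<notin> B x"
    | (big) x u where "x \<in> verts H" "u \<in> B x" "B x \<noteq> {u}"
    | (iso) "\<And>v. v \<in> verts G \<Longrightarrow> \<exists>x\<in>verts H. v \<in> B x" "\<And>x u. x \<in> verts H \<Longrightarrow> u \<in> B x \<Longrightarrow> B x = {u}"
    by blast
  then show ?case
  proof cases
    case out
    let ?G = "delete_vertex v G"
    have t: "touching ?G A C \<longleftrightarrow> touching G A C" if "v \<notin> A" "v \<notin> C" for A C
      using that by (auto simp: touching_def delete_vertex_def)
    have "connected_in ?G (B x)" if "x \<in> verts H" for x
      unfolding connected_in_def
    proof (intro conjI allI impI)
      show "B x \<noteq> {}" using B[OF that] by (simp add: connected_in_def)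
      fix S assume S: "S \<subseteq> B x" "S \<noteq> {}" "S \<noteq> B x"
      then have "touching G S (B x - S)" using B[OF that] by (simp add: connected_in_def)
      then show "touching ?G S (B x - S)" using t[of S "B x - S"] S out(2)[OF that] by auto
    qed
    moreover have "B x \<subseteq> verts ?G" if "x \<in> verts H" for x
      using B(1)[OF that] out(2)[OF that] by (auto simp: delete_vertex_def)
    ultimately have "minor_model H ?G B" unfolding minor_model_def using Bd t out(2) by simp
    moreover have "card (verts ?G) < card (verts G)"
      unfolding delete_vertex_def graph.select_convs by (rule card_Diff1_less[OF finG out(1)])
    ultimately have "induced_minor H ?G" using less.hyps simple_delete_vertex[OF G] H by blast
    then show ?thesis using induced_minor_step minor_step.delete[OF out(1)] by blast
  next
    case big
    then have "{u} \<subseteq> B x" "{u} \<noteq> B x" by auto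
    then have "touching G {u} (B x - {u})" using B(2)[OF big(1)] by (auto simp: connected_in_def)
    then obtain v where v: "v \<in> B x" "v \<noteq> u" "{u, v} \<in> edges G" by (auto simp: touching_def)
    let ?G = "contract_edge u v G"
    have uv: "u \<in> verts G" "v \<in> verts G" using simple_edge_verts[OF G v(3)] by auto
    \<comment> \<open>The contraction as a map on vertices. The sets \<open>C y\<close> are the
      images of the old branch sets, and by \<open>rC\<close> their preimages are the old branch
      sets again.\<close>
    define r where "r y = (if y = v then u else y)" for y
    have key: "{r a, r b} \<in> edges ?G" if "{a, b} \<in> edges G" "r a \<noteq> r b" for a b
      using that v(2) by (subst contract_edge_edges[OF G]) (auto simp: r_def insert_commute split: if_splits)
    have key': "\<exists>a' b'. {a', b'} \<in> edges G \<and> r a' = a \<and> r b' = b"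
      if "{a, b} \<in> edges ?G" "a \<noteq> v" "b \<noteq> v" "a \<noteq> b" for a b
    proof -
      from contract_edge_edges[OF G that(2-4) v(2)[symmetric]] that(1)
      consider "{a, b} \<in> edges G" | "a = u" "{v, b} \<in> edges G" | "b = u" "{a, v} \<in> edges G" by blast
      then show ?thesis
      proof cases
        case 1 then show ?thesis using that by (intro exI[of _ a] exI[of _ b]) (auto simp: r_def)
      next
        case 2 then show ?thesis using that by (intro exI[of _ v] exI[of _ b]) (auto simp: r_def)
      next
        case 3 then show ?thesis using that by (intro exI[of _ a] exI[of _ v]) (auto simp: r_def)
      qed
    qed
    define C where "C y = B y - {v}" for y
    have rC: "r a \<in> C y \<longleftrightarrow> a \<in> B y" if "y \<in> verts H" for a y
    proof (cases "y = x")
      case True then show ?thesis using big v by (auto simp: r_def C_def)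
    next
      case False
      then have "u \<notin> B y" "v \<notin> B y" using Bd(1)[OF that big(1)] big v by auto
      then show ?thesis by (auto simp: r_def C_def)
    qed
    have conn: "connected_in ?G (C y)" if y: "y \<in> verts H" for y
      unfolding connected_in_def
    proof (intro conjI allI impI)
      from B(2)[OF y] obtain a where "a \<in> B y" by (auto simp: connected_in_def)
      then show "C y \<noteq> {}" using rC[OF y, of a] by auto
      fix S assume S: "S \<subseteq> C y" "S \<noteq> {}" "S \<noteq> C y"
      \<comment> \<open>A cut of the contracted branch set is pulled back to a cut of the old one;
        an edge across the latter survives the contraction.\<close>
      define S' where "S' = {a \<in> B y. r a \<in> S}"
      have rr: "r a = a" if "a \<in> C y" for a using that by (auto simp: C_def r_def)
      have CB: "C y \<subseteq> B y" by (auto simp: C_def)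
      from S obtain s where s: "s \<in> S" by auto
      then have "s \<in> S'" using S(1) CB rr[of s] by (auto simp: S'_def)
      moreover from S obtain c where c: "c \<in> C y" "c \<notin> S" by auto
      then have "c \<in> B y" "c \<notin> S'" using CB rr[of c] by (auto simp: S'_def)
      ultimately have "S' \<subseteq> B y" "S' \<noteq> {}" "S' \<noteq> B y" by (auto simp: S'_def)
      then have "touching G S' (B y - S')" using B(2)[OF y] unfolding connected_in_def by simp
      then obtain p q where pq: "p \<in> S'" "q \<in> B y - S'" "{p, q} \<in> edges G" by (auto simp: touching_def)
      then have "r p \<in> S" "r q \<in> C y - S" using rC[OF y] by (auto simp: S'_def)
      moreover from this have "r p \<noteq> r q" by (metis DiffD2)
      then have "{r p, r q} \<in> edges ?G" by (rule key[OF pq(3)])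
      ultimately show "touching ?G S (C y - S)" unfolding touching_def by blast
    qed
    have touch: "touching ?G (C y) (C z) \<longleftrightarrow> touching G (B y) (B z)"
      if yz: "y \<in> verts H" "z \<in> verts H" "y \<noteq> z" for y z
    proof
      have d: "C y \<inter> C z = {}" using Bd(1)[OF yz] by (auto simp: C_def)
      show "touching G (B y) (B z)" if "touching ?G (C y) (C z)"
      proof -
        from that obtain a b where ab: "a \<in> C y" "b \<in> C z" "{a, b} \<in> edges ?G" by (auto simp: touching_def)
        moreover have "a \<noteq> v" "b \<noteq> v" "a \<noteq> b" using ab d by (auto simp: C_def)
        ultimately obtain a' b' where "{a', b'} \<in> edges G" "r a' = a" "r b' = b" using key'[of a b] by blast
        then show ?thesis using rC[OF yz(1)] rC[OF yz(2)] ab unfolding touching_def by blast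
      qed
      show "touching ?G (C y) (C z)" if "touching G (B y) (B z)"
      proof -
        from that obtain a b where ab: "a \<in> B y" "b \<in> B z" "{a, b} \<in> edges G" by (auto simp: touching_def)
        then have "r a \<in> C y" "r b \<in> C z" using rC yz by auto
        moreover from this have "r a \<noteq> r b" using d by (metis IntI emptyE)
        ultimately show ?thesis using key[OF ab(3)] unfolding touching_def by blast
      qed
    qed
    have "C y \<subseteq> verts ?G" if "y \<in> verts H" for y using B(1)[OF that] by (auto simp: C_def contract_edge_def)
    moreover have "C y \<inter> C z = {}" if "y \<in> verts H" "z \<in> verts H" "y \<noteq> z" for y z
      using Bd(1)[OF that] by (auto simp: C_def)
    ultimately have "minor_model H ?G C" unfolding minor_model_def using Bd(2) conn touch by simp
    moreover have "card (verts ?G) < card (verts G)"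
      unfolding contract_edge_def graph.select_convs by (rule card_Diff1_less[OF finG uv(2)])
    ultimately have "induced_minor H ?G" using less.hyps simple_contract_edge[OF G v(3)] H by blast
    then show ?thesis using induced_minor_step minor_step.contract[OF v(3)] by blast
  next
    case iso
    define g where "g x = (SOME u. u \<in> B x)" for x
    have g: "B x = {g x}" if x: "x \<in> verts H" for x
    proof -
      have "B x \<noteq> {}" using B(2)[OF x] by (simp add: connected_in_def)
      then have "g x \<in> B x" unfolding g_def by (rule some_in_eq[THEN iffD2])
      then show ?thesis by (rule iso(2)[OF x])
    qed
    have inj: "inj_on g (verts H)"
    proof (rule inj_onI, rule ccontr)
      fix x y assume xy: "x \<in> verts H" "y \<in> verts H" "g x = g y" "x \<noteq> y"
      then show False using Bd(1)[OF xy(1,2,4)] g by auto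
    qed
    have img: "g ` verts H = verts G" using iso(1) g B(1) by fastforce
    have bij: "bij_betw g (verts H) (verts G)" using inj img by (simp add: bij_betw_def)
    define f where "f = inv_into (verts H) g"
    have fg: "f (g x) = x" if "x \<in> verts H" for x using inj that by (simp add: f_def)
    have edge: "{g x, g y} \<in> edges G \<longleftrightarrow> {x, y} \<in> edges H" if "x \<in> verts H" "y \<in> verts H" "x \<noteq> y" for x y
      using Bd(2)[OF that] g that by (simp add: touching_def)
    have "(\<lambda>e. f ` e) ` edges G = edges H"
    proof (intro equalityI subsetI)
      fix e assume "e \<in> (\<lambda>e. f ` e) ` edges G"
      then obtain e' where e': "e' \<in> edges G" "e = f ` e'" by auto
      then obtain a b where ab: "e' = {a, b}" "a \<noteq> b" "a \<in> verts G" "b \<in> verts G"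
        using G by (auto simp: simple_graph_def card_2_iff)
      then obtain x y where "a = g x" "b = g y" "x \<in> verts H" "y \<in> verts H" using img by blast
      then show "e \<in> edges H" using edge[of x y] e' ab fg by auto
    next
      fix e assume e: "e \<in> edges H"
      then have "card e = 2" "e \<subseteq> verts H" using H by (auto simp: simple_graph_def)
      then obtain x y where xy: "e = {x, y}" "x \<noteq> y" "x \<in> verts H" "y \<in> verts H" by (auto simp: card_2_iff)
      then have "{g x, g y} \<in> edges G" using edge e by auto
      moreover have "e = f ` {g x, g y}" using xy fg by simp
      ultimately show "e \<in> (\<lambda>e. f ` e) ` edges G" by (rule image_eqI[rotated])
    qed
    then have "isomorphic G H" unfolding isomorphic_def f_def using bij_betw_inv_into[OF bij] by blast
    then show ?thesis unfolding induced_minor_def by blast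
  qed
qed

section \<open>From packings to the excluded induced minor\<close>

definition graph_of :: "('a \<Rightarrow> 'a \<Rightarrow> bool) \<Rightarrow> 'a set \<Rightarrow> 'a graph" where
  "graph_of r V = \<lparr>verts = V, edges = {{x, y} | x y. x \<in> V \<and> y \<in> V \<and> r x y}\<rparr>"

lemma mod_3_edges: "a < 3 \<Longrightarrow> b < 3 \<Longrightarrow> a \<noteq> b \<Longrightarrow> {a, b} \<in> edges (cycle_graph 3)"
proof -
  assume "a < 3" "b < 3" "a \<noteq> b"
  then have "a \<in> {0, 1, 2}" "b \<in> {0, 1, 2}" "a \<noteq> b" by auto
  then have "b = (a + 1) mod 3 \<or> a = (b + 1) mod 3" by auto
  then show ?thesis
    using \<open>a < 3\<close> \<open>b < 3\<close> by (auto simp: cycle_graph_def insert_commute)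
qed

lemma cycle_edges_iff:
  "a < l \<Longrightarrow> b < l \<Longrightarrow> {a, b} \<in> edges (cycle_graph l) \<longleftrightarrow> b = (a + 1) mod l \<or> a = (b + 1) mod l"
  by (auto simp: cycle_graph_def doubleton_eq_iff insert_commute)

lemma simple_cycle_graph: "2 \<le> l \<Longrightarrow> simple_graph (cycle_graph l)"
  by (auto simp: simple_graph_def cycle_graph_def card_insert_if mod_Suc)

lemma simple_tC3_C4: "simple_graph (tC3_C4 t)"
proof -
  have 1: "simple_graph (copies t H)" if "simple_graph H" for H :: "nat graph"
    using that by (auto simp: simple_graph_def copies_def card_image inj_on_def)
  have 2: "simple_graph (disjoint_union G H)" if "simple_graph G" "simple_graph H"
    for G :: "(nat \<times> nat) graph" and H :: "nat graph"
    using that by (auto simp: simple_graph_def disjoint_union_def card_image inj_on_def)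
  show ?thesis unfolding tC3_C4_def by (intro 1 2 simple_cycle_graph) auto
qed

lemma disjoint_union_edges:
  "{Inl x, Inl y} \<in> edges (disjoint_union G H) \<longleftrightarrow> {x, y} \<in> edges G"
  "{Inr z, Inr w} \<in> edges (disjoint_union G H) \<longleftrightarrow> {z, w} \<in> edges H"
  "{Inl x, Inr w} \<notin> edges (disjoint_union G H)"
proof -
  have E: "edges (disjoint_union G H) = image Inl ` edges G \<union> image Inr ` edges H"
    by (simp add: disjoint_union_def)
  have i: "inj (image (Inl :: 'a \<Rightarrow> 'a + 'b))" "inj (image (Inr :: 'b \<Rightarrow> 'a + 'b))" by (auto intro: inj_on_image)
  have "{Inl x, Inl y} \<notin> image Inr ` edges H" by (auto simp: set_eq_iff)
  then show "{Inl x, Inl y} \<in> edges (disjoint_union G H) \<longleftrightarrow> {x, y} \<in> edges G"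
    unfolding E using inj_image_mem_iff[OF i(1), of "{x, y}" "edges G"] by simp
  have "{Inr z, Inr w} \<notin> image Inl ` edges G" by (auto simp: set_eq_iff)
  then show "{Inr z, Inr w} \<in> edges (disjoint_union G H) \<longleftrightarrow> {z, w} \<in> edges H"
    unfolding E using inj_image_mem_iff[OF i(2), of "{z, w}" "edges H"] by simp
  show "{Inl x, Inr w} \<notin> edges (disjoint_union G H)"
  proof
    assume "{Inl x, Inr w} \<in> edges (disjoint_union G H)"
    then consider e where "{Inl x, Inr w} = Inl ` e" | e where "{Inl x, Inr w} = Inr ` e"
      unfolding E by blast
    then show False
    proof cases
      case (1 e)
      then have "Inr w \<in> Inl ` e" by blast
      then show False by blast
    next
      case (2 e)
      then have "Inl x \<in> Inr ` e" by blast
      then show False by blast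
    qed
  qed
qed

lemma copies_edges: "{(i, a), (j, b)} \<in> edges (copies t G) \<longleftrightarrow> i = j \<and> i < t \<and> {a, b} \<in> edges G"
proof
  assume "{(i, a), (j, b)} \<in> edges (copies t G)"
  then obtain k e where e: "{(i, a), (j, b)} = Pair k ` e" "k < t" "e \<in> edges G" by (auto simp: copies_def)
  have "(i, a) \<in> Pair k ` e" "(j, b) \<in> Pair k ` e" unfolding e(1)[symmetric] by auto
  then have "i = k" "j = k" by auto
  moreover have "snd ` {(i, a), (j, b)} = snd ` Pair k ` e" by (simp only: e(1))
  then have "{a, b} = e" by (simp add: image_image)
  ultimately show "i = j \<and> i < t \<and> {a, b} \<in> edges G" using e by simp
next
  assume a: "i = j \<and> i < t \<and> {a, b} \<in> edges G"
  then have "Pair i ` {a, b} \<in> edges (copies t G)" unfolding copies_def graph.select_convs by blast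
  then show "{(i, a), (j, b)} \<in> edges (copies t G)" using a by simp
qed

lemma tC3_C4_edges:
  "{Inl (i, a), Inl (j, b)} \<in> edges (tC3_C4 t) \<longleftrightarrow> i = j \<and> i < t \<and> {a, b} \<in> edges (cycle_graph 3)"
  "{Inr c, Inr d} \<in> edges (tC3_C4 t) \<longleftrightarrow> {c, d} \<in> edges (cycle_graph 4)"
  "{Inl x, Inr y} \<notin> edges (tC3_C4 t)" "{Inr y, Inl x} \<notin> edges (tC3_C4 t)"
  by (simp_all add: tC3_C4_def disjoint_union_edges copies_edges insert_commute[of "Inr y"])

context adjacency
begin

lemma simple_graph_of: "finite V \<Longrightarrow> simple_graph (graph_of adj V)"
  unfolding simple_graph_def graph_of_def using adj_neq by fastforce

lemma graph_of_edge: "{x, y} \<in> edges (graph_of adj V) \<longleftrightarrow> x \<in> V \<and> y \<in> V \<and> adj x y"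
proof
  assume "{x, y} \<in> edges (graph_of adj V)"
  then obtain a b where "{x, y} = {a, b}" "a \<in> V" "b \<in> V" "adj a b" by (auto simp: graph_of_def)
  then show "x \<in> V \<and> y \<in> V \<and> adj x y" using adj_sym[of a b] unfolding doubleton_eq_iff by blast
qed (auto simp: graph_of_def)

lemma touching_graph_of: "A \<subseteq> V \<Longrightarrow> B \<subseteq> V \<Longrightarrow> touching (graph_of adj V) A B \<longleftrightarrow> (\<exists>x\<in>A. \<exists>y\<in>B. adj x y)"
  unfolding touching_def graph_of_edge by blast

lemma connected_graph_of: "A \<subseteq> V \<Longrightarrow> conn A \<Longrightarrow> connected_in (graph_of adj V) A"
  unfolding connected_in_def conn_def
proof (elim conjE, intro conjI allI impI)
  fix S assume A: "A \<subseteq> V" "\<forall>S\<subseteq>A. S \<noteq> {} \<longrightarrow> S \<noteq> A \<longrightarrow> (\<exists>x\<in>S. \<exists>y\<in>A - S. adj x y)"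
    and S: "S \<subseteq> A" "S \<noteq> {}" "S \<noteq> A"
  then show "touching (graph_of adj V) S (A - S)" using touching_graph_of[of S V "A - S"] by blast
qed

text \<open>A triangle is its own model; in a hole, everything from index \<open>2\<close> on
  becomes the third branch set.\<close>

lemma model_C3:
  assumes "cyc T"
  shows "\<exists>A :: nat \<Rightarrow> 'a set. (\<forall>i<3. A i \<subseteq> T \<and> conn (A i)) \<and>
    (\<forall>i<3. \<forall>j<3. i \<noteq> j \<longrightarrow> A i \<inter> A j = {} \<and> (\<exists>x\<in>A i. \<exists>y\<in>A j. adj x y))"
  using cyc_cases[OF assms]
proof
  assume "hole_in T"
  then obtain f l where f: "hole f l" "f ` {..<l} \<subseteq> T" by (auto simp: hole_in_def)
  note l = hole_ge_4[OF f(1)]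
  define A where "A i = (if i < 2 then {f i} else f ` {2..l - 1})" for i :: nat
  have S: "adj (f i) (f (Suc i))" if "Suc i < l" for i using hole_Suc[OF f(1) that] .
  have A2: "f 2 \<in> A 2" "f (l - 1) \<in> A 2" using l by (auto simp: A_def)
  have a: "adj (f 0) (f 1)" "adj (f 1) (f 2)" "adj (f 0) (f (l - 1))"
    using S[of 0] S[of 1] hole_adj[OF f(1), of 0 "l - 1"] l by (auto simp: mod_Suc eval_nat_numeral)
  have c: "conn (f ` {2..l - 1})" by (rule conn_path) (use S l in auto)
  have "f ` {2..l - 1} \<subseteq> f ` {..<l}" using l by (intro image_mono) auto
  then have sub: "A i \<subseteq> T" for i using f(2) l by (auto simp: A_def)
  have d: "A 0 \<inter> A 1 = {}" "A 0 \<inter> A 2 = {}" "A 1 \<inter> A 2 = {}"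
    using hole_inj[OF f(1)] l by (auto simp: A_def)
  have t: "\<exists>x\<in>A 0. \<exists>y\<in>A 1. adj x y" "\<exists>x\<in>A 0. \<exists>y\<in>A 2. adj x y" "\<exists>x\<in>A 1. \<exists>y\<in>A 2. adj x y"
    using a A2 by (auto simp: A_def)
  then have t': "\<exists>x\<in>A 1. \<exists>y\<in>A 0. adj x y" "\<exists>x\<in>A 2. \<exists>y\<in>A 0. adj x y" "\<exists>x\<in>A 2. \<exists>y\<in>A 1. adj x y"
    using adj_sym by blast+
  show ?thesis
  proof (intro exI[of _ A] conjI allI impI)
    fix i j :: nat assume ij: "i < 3" "j < 3" "i \<noteq> j"
    then have "i = 0 \<and> j = 1 \<or> i = 0 \<and> j = 2 \<or> i = 1 \<and> j = 2 \<or> i = 1 \<and> j = 0 \<or> i = 2 \<and> j = 0 \<or> i = 2 \<and> j = 1"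
      by linarith
    then show "A i \<inter> A j = {}" "\<exists>x\<in>A i. \<exists>y\<in>A j. adj x y" using d t t' by blast+
  qed (use sub c in \<open>auto simp: A_def conn_singleton\<close>)
next
  assume "\<exists>S\<subseteq>T. triangle S"
  then obtain S where S: "S \<subseteq> T" "triangle S" by auto
  then have "card S = 3" by (simp add: triangle_def)
  moreover from this have "finite S" using card.infinite by fastforce
  ultimately obtain h where h: "bij_betw h {0..<3::nat} S" using ex_bij_betw_nat_finite by metis
  have hS: "h i \<in> S" if "i < 3" for i using bij_betwE[OF h] that by auto
  have hi: "h i \<noteq> h j" if "i < 3" "j < 3" "i \<noteq> j" for i j
    using h that by (auto simp: bij_betw_def inj_on_def)
  have ha: "adj (h i) (h j)" if "i < 3" "j < 3" "i \<noteq> j" for i j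
    using S(2) hS[OF that(1)] hS[OF that(2)] hi[OF that] unfolding triangle_def by blast
  show ?thesis
    by (rule exI[of _ "\<lambda>i. {h i}"]) (use S(1) hS hi ha in \<open>auto simp: conn_singleton\<close>)
qed

text \<open>The indices from \<open>3\<close> on form the fourth branch set. It has contact with
  \<open>f 2\<close> and, by the closing edge, with \<open>f 0\<close>, but not with
  \<open>f 1\<close>.\<close>

lemma model_C4:
  assumes "hole f l"
  shows "\<exists>A :: nat \<Rightarrow> 'a set. (\<forall>i<4. A i \<subseteq> f ` {..<l} \<and> conn (A i)) \<and>
    (\<forall>i<4. \<forall>j<4. i \<noteq> j \<longrightarrow> A i \<inter> A j = {} \<and>
      ((\<exists>x\<in>A i. \<exists>y\<in>A j. adj x y) \<longleftrightarrow> j = (i + 1) mod 4 \<or> i = (j + 1) mod 4))"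
proof -
  note l = hole_ge_4[OF assms]
  define A where "A i = (if i < 3 then {f i} else f ` {3..l - 1})" for i :: nat
  have S: "adj (f i) (f (Suc i))" if "Suc i < l" for i using hole_Suc[OF assms that] .
  have c: "conn (f ` {3..l - 1})" by (rule conn_path) (use S l in auto)
  have "f ` {3..l - 1} \<subseteq> f ` {..<l}" using l by (intro image_mono) auto
  then have sub: "A i \<subseteq> f ` {..<l}" for i using l by (auto simp: A_def)
  have d: "A i \<inter> A j = {}" if "i < j" "j < 4" for i j
    using hole_inj[OF assms] l that by (auto simp: A_def)
  have a: "adj (f i) (f j) \<longleftrightarrow> j = Suc i \<or> (i = 0 \<and> j = l - 1)" if "i < j" "j < l" for i j
    using hole_adj[OF assms, of i j] that by (auto simp: mod_Suc)
  have t: "(\<exists>x\<in>A i. \<exists>y\<in>A j. adj x y) \<longleftrightarrow> j = (i + 1) mod 4 \<or> i = (j + 1) mod 4" if ij: "i < j" "j < 4" for i j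
  proof (cases "j = 3")
    case False
    then show ?thesis using ij a[of i j] l by (auto simp: A_def mod_Suc)
  next
    case True
    have "(\<exists>x\<in>A i. \<exists>y\<in>A j. adj x y) \<longleftrightarrow> (\<exists>k\<in>{3..l - 1}. adj (f i) (f k))"
      using ij True by (auto simp: A_def)
    also have "\<dots> \<longleftrightarrow> (\<exists>k\<in>{3..l - 1}. k = Suc i \<or> (i = 0 \<and> k = l - 1))"
      using a[of i] ij True l by (intro bex_cong) auto
    also have "\<dots> \<longleftrightarrow> i = 2 \<or> i = 0" using ij True l by auto
    also have "\<dots> \<longleftrightarrow> j = (i + 1) mod 4 \<or> i = (j + 1) mod 4"
      using ij True by (auto simp: mod_Suc)
    finally show ?thesis .
  qed
  have sym: "(\<exists>x\<in>A i. \<exists>y\<in>A j. adj x y) \<longleftrightarrow> (\<exists>x\<in>A j. \<exists>y\<in>A i. adj x y)" for i j using adj_sym by blast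
  show ?thesis
  proof (intro exI[of _ A] conjI allI impI)
    fix i j :: nat assume ij: "i < 4" "j < 4" "i \<noteq> j"
    show "A i \<inter> A j = {}" using d[of i j] d[of j i] ij by (cases "i < j") auto
    show "(\<exists>x\<in>A i. \<exists>y\<in>A j. adj x y) \<longleftrightarrow> j = (i + 1) mod 4 \<or> i = (j + 1) mod 4"
    proof (cases "i < j")
      case True then show ?thesis using t ij by blast
    next
      case False then show ?thesis using t[of j i] sym[of i j] ij by auto
    qed
  qed (use sub c in \<open>auto simp: A_def conn_singleton\<close>)
qed

text \<open>The models of the single components are put side by side; anticompleteness excludes
  contacts between different components.\<close>

lemma pack_induced_minor:
  assumes fin: "finite V" and p: "pack t V"
  shows "induced_minor (tC3_C4 t) (graph_of adj V)"
proof -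
  from p obtain T g l where g: "hole g l" "g ` {..<l} \<subseteq> V" and
    T: "\<forall>i<t. T i \<subseteq> V \<and> cyc (T i) \<and> anticomplete (T i) (g ` {..<l})"
    and TT: "\<forall>i<t. \<forall>j<t. i \<noteq> j \<longrightarrow> anticomplete (T i) (T j)"
    unfolding pack_def by blast
  have "\<forall>i\<in>{..<t}. \<exists>A :: nat \<Rightarrow> 'a set. (\<forall>a<3. A a \<subseteq> T i \<and> conn (A a)) \<and>
    (\<forall>a<3. \<forall>b<3. a \<noteq> b \<longrightarrow> A a \<inter> A b = {} \<and> (\<exists>x\<in>A a. \<exists>y\<in>A b. adj x y))"
    using model_C3 T by blast
  from bchoice[OF this] obtain A :: "nat \<Rightarrow> nat \<Rightarrow> 'a set" where
    A0: "\<forall>i\<in>{..<t}. (\<forall>a<3. A i a \<subseteq> T i \<and> conn (A i a)) \<and>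
      (\<forall>a<3. \<forall>b<3. a \<noteq> b \<longrightarrow> A i a \<inter> A i b = {} \<and> (\<exists>x\<in>A i a. \<exists>y\<in>A i b. adj x y))" ..
  then have A: "\<And>i a. i < t \<Longrightarrow> a < 3 \<Longrightarrow> A i a \<subseteq> T i \<and> conn (A i a)"
      "\<And>i a b. i < t \<Longrightarrow> a < 3 \<Longrightarrow> b < 3 \<Longrightarrow> a \<noteq> b \<Longrightarrow>
        A i a \<inter> A i b = {} \<and> (\<exists>x\<in>A i a. \<exists>y\<in>A i b. adj x y)"
    by simp_all
  from model_C4[OF g(1)] obtain C :: "nat \<Rightarrow> 'a set" where
    "(\<forall>a<4. C a \<subseteq> g ` {..<l} \<and> conn (C a)) \<and> (\<forall>a<4. \<forall>b<4. a \<noteq> b \<longrightarrow> C a \<inter> C b = {} \<and>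
      ((\<exists>x\<in>C a. \<exists>y\<in>C b. adj x y) \<longleftrightarrow> b = (a + 1) mod 4 \<or> a = (b + 1) mod 4))" ..
  then have C: "\<And>a. a < 4 \<Longrightarrow> C a \<subseteq> g ` {..<l} \<and> conn (C a)"
      "\<And>a b. a < 4 \<Longrightarrow> b < 4 \<Longrightarrow> a \<noteq> b \<Longrightarrow>
        C a \<inter> C b = {} \<and> ((\<exists>x\<in>C a. \<exists>y\<in>C b. adj x y) \<longleftrightarrow> b = (a + 1) mod 4 \<or> a = (b + 1) mod 4)"
    by simp_all
  define B where "B x = (case x of Inl (i, a) \<Rightarrow> A i a | Inr a \<Rightarrow> C a)" for x :: "nat \<times> nat + nat"
  have V: "verts (tC3_C4 t) = {..<t} \<times> {..<3} <+> {..<4}"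
    by (simp add: tC3_C4_def disjoint_union_def copies_def cycle_graph_def)
  have anti: "S \<inter> S' = {}" "\<not> (\<exists>x\<in>S. \<exists>y\<in>S'. adj x y)" "\<not> (\<exists>x\<in>S'. \<exists>y\<in>S. adj x y)"
    if "anticomplete X Y" "S \<subseteq> X" "S' \<subseteq> Y" for S S' X Y
    using that adj_sym unfolding anticomplete_def cnb_def by blast+
  have BV: "B x \<subseteq> V \<and> conn (B x)" if "x \<in> verts (tC3_C4 t)" for x
  proof (cases x)
    case (Inl p)
    have p: "fst p < t" "snd p < 3" using that unfolding Inl V by (auto simp: mem_Times_iff)
    have "B x = A (fst p) (snd p)" unfolding Inl B_def by (simp add: split_beta)
    moreover have "T (fst p) \<subseteq> V" using T p by blast
    ultimately show ?thesis using A(1)[OF p] by auto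
  next
    case (Inr a)
    then show ?thesis using that C(1)[of a] g(2) V by (auto simp: B_def)
  qed
  have BB: "B x \<inter> B y = {} \<and> ((\<exists>u\<in>B x. \<exists>v\<in>B y. adj u v) \<longleftrightarrow> {x, y} \<in> edges (tC3_C4 t))"
    if xy: "x \<in> verts (tC3_C4 t)" "y \<in> verts (tC3_C4 t)" "x \<noteq> y" for x y
  proof (cases x; cases y)
    fix p q assume e: "x = Inl p" "y = Inl q"
    obtain i a where p: "p = (i, a)" by (cases p)
    obtain j b where q: "q = (j, b)" by (cases q)
    have lt: "i < t" "a < 3" "j < t" "b < 3" using xy e p q V by auto
    show ?thesis
    proof (cases "i = j")
      case True
      then have "a \<noteq> b" using xy e p q by auto
      then show ?thesis using True A(2)[of i a b] lt e p q tC3_C4_edges(1)[of i a j b t] mod_3_edges[of a b]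
        by (simp add: B_def)
    next
      case False
      then have "anticomplete (T i) (T j)" using TT lt by blast
      then show ?thesis using anti[of "T i" "T j" "A i a" "A j b"] A(1) lt False tC3_C4_edges(1)[of i a j b t]
        unfolding e p q B_def by simp
    qed
  next
    fix p b assume e: "x = Inl p" "y = Inr b"
    obtain i a where p: "p = (i, a)" by (cases p)
    have lt: "i < t" "a < 3" "b < 4" using xy e p V by auto
    then have "anticomplete (T i) (g ` {..<l})" using T by blast
    then show ?thesis using anti[of "T i" "g ` {..<l}" "A i a" "C b"] A(1) C(1) lt tC3_C4_edges(3)[of p b t]
      unfolding e p B_def by simp
  next
    fix p b assume e: "x = Inr b" "y = Inl p"
    obtain i a where p: "p = (i, a)" by (cases p)
    have lt: "i < t" "a < 3" "b < 4" using xy e p V by auto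
    then have "anticomplete (T i) (g ` {..<l})" using T by blast
    then show ?thesis using anti[of "T i" "g ` {..<l}" "A i a" "C b"] A(1) C(1) lt tC3_C4_edges(4)[of b p t]
      unfolding e p B_def by (simp add: Int_commute)
  next
    fix a b assume e: "x = Inr a" "y = Inr b"
    have "a < 4" "b < 4" "a \<noteq> b" using xy e V by auto
    then show ?thesis using C(2)[of a b] tC3_C4_edges(2)[of a b t] cycle_edges_iff[of a 4 b]
      unfolding e B_def by simp
  qed
  have "minor_model (tC3_C4 t) (graph_of adj V) B"
    unfolding minor_model_def
  proof (intro conjI ballI impI)
    fix x assume x: "x \<in> verts (tC3_C4 t)"
    show "B x \<subseteq> verts (graph_of adj V)" using BV[OF x] by (simp add: graph_of_def)
    show "connected_in (graph_of adj V) (B x)" using BV[OF x] connected_graph_of by blast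
    fix y assume y: "y \<in> verts (tC3_C4 t)" "x \<noteq> y"
    show "B x \<inter> B y = {}" using BB[OF x y] by blast
    show "touching (graph_of adj V) (B x) (B y) \<longleftrightarrow> {x, y} \<in> edges (tC3_C4 t)"
      using BB[OF x y] touching_graph_of BV[OF x] BV[OF y(1)] by metis
  qed
  then show ?thesis by (rule minor_model_induced_minor[OF simple_graph_of[OF fin] simple_tC3_C4])
qed

end

section \<open>The branching algorithm\<close>

subsection \<open>Independent sets\<close>

text \<open>A graph is given by its closed adjacency relation \<open>M\<close>, which is reflexive and symmetric.\<close>

definition sym_refl :: "(nat \<Rightarrow> nat \<Rightarrow> bool) \<Rightarrow> bool" where
  "sym_refl M \<longleftrightarrow> (\<forall>u v. M u v \<longrightarrow> M v u) \<and> (\<forall>u. M u u)"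

definition open_adj :: "(nat \<Rightarrow> nat \<Rightarrow> bool) \<Rightarrow> nat \<Rightarrow> nat \<Rightarrow> bool" where
  "open_adj M u v \<longleftrightarrow> u \<noteq> v \<and> M u v"

lemma adjacency_open_adj: "sym_refl M \<Longrightarrow> adjacency (open_adj M)"
  unfolding adjacency_def open_adj_def sym_refl_def by auto

definition indep :: "(nat \<Rightarrow> nat \<Rightarrow> bool) \<Rightarrow> nat set \<Rightarrow> bool" where
  "indep M S \<longleftrightarrow> (\<forall>u\<in>S. \<forall>v\<in>S. u \<noteq> v \<longrightarrow> \<not> M u v)"

definition alpha :: "(nat \<Rightarrow> nat \<Rightarrow> bool) \<Rightarrow> nat set \<Rightarrow> nat" where
  "alpha M A = Max (card ` {S. S \<subseteq> A \<and> indep M S})"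

lemma alpha_facts:
  assumes "finite A"
  shows alpha_ge: "\<And>S. S \<subseteq> A \<Longrightarrow> indep M S \<Longrightarrow> card S \<le> alpha M A"
    and alpha_ex: "\<exists>S\<subseteq>A. indep M S \<and> card S = alpha M A"
proof -
  let ?F = "card ` {S. S \<subseteq> A \<and> indep M S}"
  have fin: "finite ?F" using assms by simp
  show "\<And>S. S \<subseteq> A \<Longrightarrow> indep M S \<Longrightarrow> card S \<le> alpha M A"
    unfolding alpha_def using fin by (intro Max_ge) auto
  have "?F \<noteq> {}" by (auto simp: indep_def)
  from Max_in[OF fin this] show "\<exists>S\<subseteq>A. indep M S \<and> card S = alpha M A" unfolding alpha_def by auto
qed

lemma alpha_empty [simp]: "alpha M {} = 0"
  using alpha_ex[of "{}" M] by auto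

lemma indep_subset: "indep M S \<Longrightarrow> T \<subseteq> S \<Longrightarrow> indep M T"
  unfolding indep_def by blast

lemma indep_insert: "sym_refl M \<Longrightarrow> indep M T \<Longrightarrow> (\<And>u. u \<in> T \<Longrightarrow> \<not> M v u) \<Longrightarrow> indep M (insert v T)"
  unfolding indep_def sym_refl_def by blast

lemma alpha_branch:
  assumes "finite A" "v \<in> A" "sym_refl M"
  shows "alpha M A = max (1 + alpha M (A - {u. M v u})) (alpha M (A - {v}))"
proof (rule antisym)
  obtain S where S: "S \<subseteq> A" "indep M S" "card S = alpha M A" using alpha_ex[OF assms(1)] by blast
  have finS: "finite S" using S assms(1) finite_subset by blast
  show "alpha M A \<le> max (1 + alpha M (A - {u. M v u})) (alpha M (A - {v}))"
  proof (cases "v \<in> S")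
    case True
    have "S - {v} \<subseteq> A - {u. M v u}" using S True by (auto simp: indep_def)
    then have "card (S - {v}) \<le> alpha M (A - {u. M v u})"
      using alpha_ge[of "A - {u. M v u}" "S - {v}" M] assms(1) indep_subset[OF S(2)] by auto
    then show ?thesis using True S(3) finS by (simp add: card_Diff_singleton)
  next
    case False
    then have "card S \<le> alpha M (A - {v})" using S assms(1) by (intro alpha_ge) auto
    then show ?thesis using S(3) by simp
  qed
  obtain T where T: "T \<subseteq> A - {u. M v u}" "indep M T" "card T = alpha M (A - {u. M v u})"
    using alpha_ex[of "A - {u. M v u}"] assms(1) by blast
  have "M v v" "\<And>u. M u v \<longleftrightarrow> M v u" using assms(3) by (auto simp: sym_refl_def)
  then have "indep M (insert v T)" "v \<notin> T" using T(1,2) unfolding indep_def by blast+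
  moreover have "finite T" using T assms(1) finite_subset by blast
  ultimately have "1 + alpha M (A - {u. M v u}) \<le> alpha M A"
    using alpha_ge[OF assms(1), of "insert v T" M] T assms(2) by auto
  moreover obtain U where "U \<subseteq> A - {v}" "indep M U" "card U = alpha M (A - {v})"
    using alpha_ex[of "A - {v}"] assms(1) by blast
  then have "alpha M (A - {v}) \<le> alpha M A" using alpha_ge[OF assms(1), of U M] by auto
  ultimately show "max (1 + alpha M (A - {u. M v u})) (alpha M (A - {v})) \<le> alpha M A" by simp
qed

definition simp_v :: "(nat \<Rightarrow> nat \<Rightarrow> bool) \<Rightarrow> nat set \<Rightarrow> nat \<Rightarrow> bool" where
  "simp_v M A v \<longleftrightarrow> v \<in> A \<and> (\<forall>u\<in>A. \<forall>w\<in>A. M v u \<longrightarrow> M v w \<longrightarrow> M u w)"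

text \<open>The closed neighbourhood of \<open>v\<close> is a clique. An independent set meets it at
  most once, and \<open>v\<close> is as good as any other choice there.\<close>

lemma alpha_simplicial:
  assumes "finite A" "simp_v M A v" "sym_refl M"
  shows "alpha M A = 1 + alpha M (A - {u. M v u})"
proof -
  have v: "v \<in> A" using assms(2) by (simp add: simp_v_def)
  obtain S where S: "S \<subseteq> A - {v}" "indep M S" "card S = alpha M (A - {v})"
    using alpha_ex[of "A - {v}"] assms(1) by blast
  have finS: "finite S" using S(1) assms(1) finite_subset by blast
  have "card (S \<inter> {u. M v u}) \<le> 1"
  proof (rule ccontr)
    assume "\<not> ?thesis"
    then have "2 \<le> card (S \<inter> {u. M v u})" by simp
    then obtain D where D: "D \<subseteq> S \<inter> {u. M v u}" "card D = 2" by (metis obtain_subset_with_card_n)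
    then obtain x y where "D = {x, y}" "x \<noteq> y" by (auto simp: card_2_iff)
    then have "x \<in> S" "y \<in> S" "M v x" "M v y" "x \<noteq> y" using D by auto
    moreover from this have "M x y" using assms(2) S(1) unfolding simp_v_def by blast
    ultimately show False using S(2) by (auto simp: indep_def)
  qed
  moreover have "card (S - {u. M v u}) \<le> alpha M (A - {u. M v u})"
    using S assms(1) indep_subset[OF S(2)] by (intro alpha_ge) auto
  moreover have "card S = card (S \<inter> {u. M v u}) + card (S - {u. M v u})"
    using finS card_Int_Diff by blast
  ultimately have "alpha M (A - {v}) \<le> 1 + alpha M (A - {u. M v u})" using S(3) by simp
  then show ?thesis using alpha_branch[OF assms(1) v assms(3)] by simp
qed

text \<open>Contraction of the path \<open>a, v, b\<close> to the vertex \<open>a\<close>, once \<open>v\<close> and \<open>b\<close> are deleted.\<close>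

definition merge :: "(nat \<Rightarrow> nat \<Rightarrow> bool) \<Rightarrow> nat \<Rightarrow> nat \<Rightarrow> nat \<Rightarrow> nat \<Rightarrow> bool" where
  "merge M a b u w \<longleftrightarrow> (if u = a then M a w \<or> M b w else if w = a then M u a \<or> M u b else M u w)"

lemma sym_refl_merge: "sym_refl M \<Longrightarrow> sym_refl (merge M a b)"
  unfolding sym_refl_def merge_def by auto

text \<open>The folding rule for degree two. An optimal set contains both \<open>a\<close> and
  \<open>b\<close>, which corresponds to the merged vertex, or at most one of \<open>v\<close>,
  \<open>a\<close>, \<open>b\<close>, which may then be taken to be \<open>v\<close>.\<close>

lemma alpha_fold:
  assumes fin: "finite A" and M: "sym_refl M" and v: "{u \<in> A. M v u} = {v, a, b}"
    and d: "v \<noteq> a" "v \<noteq> b" "a \<noteq> b" "\<not> M a b"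
  shows "alpha M A = 1 + alpha (merge M a b) (A - {v, b})"
proof (rule antisym)
  have sym: "M x y \<longleftrightarrow> M y x" for x y using M by (auto simp: sym_refl_def)
  have A: "v \<in> A" "a \<in> A" "b \<in> A" "M v a" "M v b" using v by auto
  obtain S where S: "S \<subseteq> A" "indep M S" "card S = alpha M A" using alpha_ex[OF fin] by blast
  have finS: "finite S" using S fin finite_subset by blast
  show "alpha M A \<le> 1 + alpha (merge M a b) (A - {v, b})"
  proof (cases "a \<in> S \<and> b \<in> S")
    case True
    then have "v \<notin> S" using S(2) A d unfolding indep_def by blast
    moreover have "indep (merge M a b) (S - {b})" using S(2) True sym unfolding indep_def merge_def by auto
    ultimately have "card (S - {b}) \<le> alpha (merge M a b) (A - {v, b})" using fin S by (intro alpha_ge) auto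
    then show ?thesis using True finS S by (simp add: card_Diff_singleton)
  next
    case False
    have "card (S \<inter> {v, a, b}) \<le> 1"
    proof -
      have "S \<inter> {v, a, b} \<subseteq> {v} \<or> S \<inter> {v, a, b} \<subseteq> {a} \<or> S \<inter> {v, a, b} \<subseteq> {b}"
        using False S(2) A d unfolding indep_def by blast
      then show ?thesis using card_mono[of "{v}"] card_mono[of "{a}"] card_mono[of "{b}"] by fastforce
    qed
    moreover have "indep (merge M a b) (S - {v, a, b})" using S(2) by (auto simp: indep_def merge_def)
    then have "card (S - {v, a, b}) \<le> alpha (merge M a b) (A - {v, b})" using fin S by (intro alpha_ge) auto
    moreover have "card S = card (S \<inter> {v, a, b}) + card (S - {v, a, b})" using finS card_Int_Diff by blast
    ultimately show ?thesis using S by simp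
  qed
  obtain T where T: "T \<subseteq> A - {v, b}" "indep (merge M a b) T" "card T = alpha (merge M a b) (A - {v, b})"
    using alpha_ex[of "A - {v, b}"] fin by blast
  have finT: "finite T" using T fin finite_subset by blast
  show "1 + alpha (merge M a b) (A - {v, b}) \<le> alpha M A"
  proof (cases "a \<in> T")
    case True
    have nb: "\<not> M b u" if "u \<in> T" for u
    proof (cases "u = a")
      case True then show ?thesis using d(4) sym[of a b] by simp
    next
      case False
      then have "\<not> merge M a b a u" using T(2) \<open>a \<in> T\<close> that by (auto simp: indep_def)
      then show ?thesis by (simp add: merge_def)
    qed
    have "indep M T" using T(2) by (auto simp: indep_def merge_def split: if_splits)
    from indep_insert[OF M this nb] have "indep M (insert b T)" .
    then have "card (insert b T) \<le> alpha M A" using T A fin by (intro alpha_ge) auto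
    moreover have "b \<notin> T" using T by auto
    ultimately show ?thesis using T finT by simp
  next
    case False
    have nv: "\<not> M v u" if "u \<in> T" for u
    proof
      assume "M v u"
      then have "u \<in> {u \<in> A. M v u}" using that T(1) by auto
      then show False unfolding v using that T(1) False by auto
    qed
    have "merge M a b x y = M x y" if "x \<in> T" "y \<in> T" for x y using False that by (auto simp: merge_def)
    then have "indep M T" using T(2) unfolding indep_def by simp
    from indep_insert[OF M this nv] have "indep M (insert v T)" .
    then have "card (insert v T) \<le> alpha M A" using T A fin by (intro alpha_ge) auto
    moreover have "v \<notin> T" using T by auto
    ultimately show ?thesis using T finT by simp
  qed
qed

subsection \<open>The search tree\<close>

text \<open>Indices are shifted by one so that \<open>0\<close> can stand for ``not found''.\<close>

fun last_sat :: "(nat \<Rightarrow> bool) \<Rightarrow> nat \<Rightarrow> nat" where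
  "last_sat P 0 = 0"
| "last_sat P (Suc k) = (if P k then Suc k else last_sat P k)"

fun argmax :: "(nat \<Rightarrow> nat) \<Rightarrow> nat \<Rightarrow> nat" where
  "argmax f 0 = 0"
| "argmax f (Suc k) = (if (if argmax f k = 0 then 0 else f (argmax f k - 1)) < f k then Suc k else argmax f k)"

lemma last_sat_0: "last_sat P n = 0 \<longleftrightarrow> (\<forall>v<n. \<not> P v)"
  by (induction n) (auto simp: less_Suc_eq)

lemma last_sat_pos: "last_sat P n \<noteq> 0 \<Longrightarrow> P (last_sat P n - 1) \<and> last_sat P n - 1 < n"
  by (induction n) (auto split: if_splits)

lemma argmax_le: "v < n \<Longrightarrow> f v \<le> (if argmax f n = 0 then 0 else f (argmax f n - 1))"
  by (induction n) (auto simp: less_Suc_eq split: if_splits)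

lemma argmax_pos: "argmax f n \<noteq> 0 \<Longrightarrow> 0 < f (argmax f n - 1) \<and> argmax f n - 1 < n"
  by (induction n) (auto split: if_splits)

text \<open>The simplicial vertex is meant to enter the independent set, so its whole closed
  neighbourhood goes. The choice by \<open>last_sat\<close> is the one made in
  \<open>outcome_of\<close>.\<close>

definition elim_step :: "nat \<Rightarrow> (nat \<Rightarrow> nat \<Rightarrow> bool) \<Rightarrow> nat set \<Rightarrow> nat set" where
  "elim_step n M B = (let p = last_sat (simp_v M B) n in if p = 0 then B else B - {u. M (p - 1) u})"

text \<open>A computable stand-in for the absence of holes outside the closed neighbourhood of
  \<open>v\<close>: hole-free sets pass the test (\<open>elim_succeeds\<close>), and whatever passes
  is searched without branching (\<open>leaves_easy\<close>).\<close>

definition easy :: "nat \<Rightarrow> (nat \<Rightarrow> nat \<Rightarrow> bool) \<Rightarrow> nat set \<Rightarrow> nat \<Rightarrow> bool" where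
  "easy n M A v \<longleftrightarrow> v \<in> A \<and> (elim_step n M ^^ n) (A - {u. M v u}) = {}"

text \<open>By reflexivity of \<open>M\<close> a vertex of \<open>A\<close> counts itself, so degree
  two appears as \<open>cdeg = 3\<close>.\<close>

definition cdeg :: "(nat \<Rightarrow> nat \<Rightarrow> bool) \<Rightarrow> nat set \<Rightarrow> nat \<Rightarrow> nat" where
  "cdeg M A v = card {u \<in> A. M v u}"

definition cvol :: "(nat \<Rightarrow> nat \<Rightarrow> bool) \<Rightarrow> nat set \<Rightarrow> nat \<Rightarrow> nat" where
  "cvol M A v = (if v \<in> A then \<Sum>u | u \<in> A \<and> M v u. cdeg M A u else 0)"

datatype outcome = Done | Reduce "nat \<Rightarrow> nat \<Rightarrow> bool" "nat set" | Branch nat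

text \<open>\<open>b\<close> is removed before \<open>a\<close> is looked up, which makes them
  distinct; \<open>fold_prog\<close> proceeds in the same order.\<close>

definition fold_at :: "nat \<Rightarrow> (nat \<Rightarrow> nat \<Rightarrow> bool) \<Rightarrow> nat set \<Rightarrow> nat \<Rightarrow> outcome" where
  "fold_at n M A v =
     (let b = last_sat (\<lambda>u. u \<in> A - {v} \<and> M v u) n - 1;
          a = last_sat (\<lambda>u. u \<in> A - {v} - {b} \<and> M v u) n - 1
      in Reduce (merge M a b) (A - {v} - {b}))"

definition branch_vertex :: "nat \<Rightarrow> (nat \<Rightarrow> nat \<Rightarrow> bool) \<Rightarrow> nat set \<Rightarrow> nat" where
  "branch_vertex n M A =
     (let e = last_sat (easy n M A) n in if e \<noteq> 0 then e else argmax (cvol M A) n)"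

definition outcome_of :: "nat \<Rightarrow> (nat \<Rightarrow> nat \<Rightarrow> bool) \<Rightarrow> nat set \<Rightarrow> outcome" where
  "outcome_of n M A =
     (let p = last_sat (simp_v M A) n; q = last_sat (\<lambda>v. v \<in> A \<and> cdeg M A v = 3) n; h = branch_vertex n M A in
      if p \<noteq> 0 then Reduce M (A - {u. M (p - 1) u})
      else if q \<noteq> 0 then fold_at n M A (q - 1)
      else if h \<noteq> 0 then Branch (h - 1) else Done)"

datatype tree = Leaf nat | Node tree tree

text \<open>\<open>k\<close> is fuel; each step removes a vertex, so \<open>card A\<close> is
  enough. \<open>c\<close> accumulates the units that reductions and taken vertices contribute to
  the independence number.\<close>

fun search :: "nat \<Rightarrow> nat \<Rightarrow> (nat \<Rightarrow> nat \<Rightarrow> bool) \<Rightarrow> nat set \<Rightarrow> nat \<Rightarrow> tree" where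
  "search n 0 M A c = Leaf c"
| "search n (Suc k) M A c = (case outcome_of n M A of
      Done \<Rightarrow> Leaf c
    | Reduce M' A' \<Rightarrow> search n k M' A' (c + 1)
    | Branch v \<Rightarrow> Node (search n k M (A - {u. M v u}) (c + 1)) (search n k M (A - {v}) c))"

fun leaf_values :: "tree \<Rightarrow> nat list" where
  "leaf_values (Leaf v) = [v]"
| "leaf_values (Node l r) = leaf_values l @ leaf_values r"

lemma cvol_pos: "sym_refl M \<Longrightarrow> finite A \<Longrightarrow> v \<in> A \<Longrightarrow> 0 < cvol M A v"
proof -
  assume M: "sym_refl M" and A: "finite A" "v \<in> A"
  have "v \<in> {u \<in> A. M v u}" using M A by (simp add: sym_refl_def)
  then have "0 < cdeg M A v" unfolding cdeg_def using A by (subst card_gt_0_iff) auto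
  also have "cdeg M A v \<le> cvol M A v" unfolding cvol_def using A \<open>v \<in> {u \<in> A. M v u}\<close>
    by (auto intro: member_le_sum)
  finally show ?thesis .
qed

lemma outcome_empty: "outcome_of n M {} = Done"
proof -
  have "argmax (\<lambda>v. 0) n = 0" by (induction n) auto
  moreover have "cvol M {} = (\<lambda>v. 0)" by (auto simp: cvol_def)
  moreover have "last_sat (\<lambda>v. False) n = 0" by (simp add: last_sat_0)
  ultimately show ?thesis
    by (simp add: outcome_of_def branch_vertex_def simp_v_def easy_def Let_def last_sat_0)
qed



text \<open>In the folding case \<open>a\<close> and \<open>b\<close> are nonadjacent, since
  otherwise \<open>v\<close> would be simplicial and the earlier test would have succeeded.\<close>

lemma outcome_cases:
  assumes A: "A \<subseteq> {..<n}" and M: "sym_refl M"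
  obtains (empty) "A = {}" "outcome_of n M A = Done"
  | (simplicial) v where "simp_v M A v" "outcome_of n M A = Reduce M (A - {u. M v u})"
      "last_sat (simp_v M A) n = Suc v"
  | (fold) v a b where "v \<in> A" "{u \<in> A. M v u} = {v, a, b}" "v \<noteq> a" "v \<noteq> b" "a \<noteq> b" "\<not> M a b"
      "outcome_of n M A = Reduce (merge M a b) (A - {v, b})"
  | (easy) v where "v \<in> A" "easy n M A v" "outcome_of n M A = Branch v"
  | (heavy) v where "v \<in> A" "outcome_of n M A = Branch v" "\<And>u. u \<in> A \<Longrightarrow> \<not> simp_v M A u"
      "\<And>u. u \<in> A \<Longrightarrow> cdeg M A u \<noteq> 3" "\<And>u. u \<in> A \<Longrightarrow> \<not> easy n M A u"
      "\<And>u. u \<in> A \<Longrightarrow> cvol M A u \<le> cvol M A v"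
proof -
  have finA: "finite A" using A finite_subset by blast
  have refl: "M u u" and sym: "M u w \<longleftrightarrow> M w u" for u w using M by (auto simp: sym_refl_def)
  define p q where "p = last_sat (simp_v M A) n" and "q = last_sat (\<lambda>v. v \<in> A \<and> cdeg M A v = 3) n"
  note out = outcome_of_def[of n M A, unfolded Let_def, folded p_def q_def]
  show thesis
  proof (cases "p \<noteq> 0")
    case True
    then have "simp_v M A (p - 1)" using last_sat_pos[of "simp_v M A" n] by (simp add: p_def)
    then show thesis using True out by (intro simplicial[of "p - 1"]) (simp_all add: p_def)
  next
    case False
    then have p0: "p = 0" by simp
    have ns: "\<not> simp_v M A u" if "u \<in> A" for u
      using p0 that A by (auto simp: p_def last_sat_0)
    show thesis
    proof (cases "q \<noteq> 0")
      case True
      define v where "v = q - 1"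
      have v: "v \<in> A" "cdeg M A v = 3" using last_sat_pos[of "\<lambda>v. v \<in> A \<and> cdeg M A v = 3" n] True
        by (auto simp: q_def v_def)
      define N where "N = {u \<in> A. M v u}"
      have N: "card N = 3" "finite N" "v \<in> N" "N \<subseteq> A" using v finA refl by (auto simp: N_def cdeg_def)
      define pb where "pb = last_sat (\<lambda>u. u \<in> A - {v} \<and> M v u) n"
      define b where "b = pb - 1"
      have "card (N - {v}) = 2" using N by (simp add: card_Diff_singleton)
      then have "N - {v} \<noteq> {}" by (metis card.empty zero_neq_numeral)
      then have "pb \<noteq> 0" using A unfolding pb_def by (subst last_sat_0) (auto simp: N_def)
      then have b: "b \<in> N - {v}" using last_sat_pos[of "\<lambda>u. u \<in> A - {v} \<and> M v u" n]
        by (auto simp: pb_def b_def N_def)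
      define pa where "pa = last_sat (\<lambda>u. u \<in> A - {v} - {b} \<and> M v u) n"
      define a where "a = pa - 1"
      have "card (N - {v} - {b}) = 1" using N b \<open>card (N - {v}) = 2\<close> by (subst card_Diff_singleton) auto
      then have "N - {v} - {b} \<noteq> {}" by (metis card.empty zero_neq_one)
      then have "pa \<noteq> 0" using A unfolding pa_def by (subst last_sat_0) (auto simp: N_def)
      then have a: "a \<in> N - {v} - {b}" using last_sat_pos[of "\<lambda>u. u \<in> A - {v} - {b} \<and> M v u" n]
        by (auto simp: pa_def a_def N_def)
      have d: "v \<noteq> a" "v \<noteq> b" "a \<noteq> b" using a b by auto
      have "{v, a, b} \<subseteq> N" using a b N by auto
      moreover have "card {v, a, b} = 3" using d by auto
      ultimately have Neq: "N = {v, a, b}" using N card_subset_eq[of N "{v, a, b}"] by auto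
      have "\<not> M a b"
      proof
        assume ab: "M a b"
        have "simp_v M A v" unfolding simp_v_def
        proof (intro conjI ballI impI)
          fix x y assume "x \<in> A" "y \<in> A" "M v x" "M v y"
          then have "x \<in> N" "y \<in> N" by (auto simp: N_def)
          moreover have "M v a" "M v b" using a b by (auto simp: N_def)
          ultimately show "M x y" unfolding Neq using ab refl sym[of a b] sym[of v a] sym[of v b] by auto
        qed (rule v)
        with ns v show False by blast
      qed
      moreover have "outcome_of n M A = Reduce (merge M a b) (A - {v, b})"
      proof -
        have "outcome_of n M A = fold_at n M A v" using out p0 True by (simp add: v_def)
        also have "\<dots> = Reduce (merge M a b) (A - {v} - {b})"
          by (simp only: fold_at_def Let_def pb_def[symmetric] b_def[symmetric] pa_def[symmetric] a_def[symmetric])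
        also have "A - {v} - {b} = A - {v, b}" by auto
        finally show ?thesis .
      qed
      ultimately show thesis using fold[OF v(1) _ d] Neq by (simp add: N_def)
    next
      case False
      then have q0: "q = 0" by simp
      have n3: "cdeg M A u \<noteq> 3" if "u \<in> A" for u using q0 that A by (auto simp: q_def last_sat_0)
      define e where "e = last_sat (easy n M A) n"
      show thesis
      proof (cases "e \<noteq> 0")
        case True
        then have "easy n M A (e - 1)" using last_sat_pos[of "easy n M A" n] by (simp add: e_def)
        moreover from this have "e - 1 \<in> A" by (simp add: easy_def)
        moreover have "branch_vertex n M A = e" using True by (simp add: branch_vertex_def e_def)
        ultimately show thesis using True out p0 q0 by (intro easy[of "e - 1"]) auto
      next
        case False
        then have ne: "\<not> easy n M A u" if "u \<in> A" for u using that A by (auto simp: e_def last_sat_0)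
        define h where "h = argmax (cvol M A) n"
        have bh: "branch_vertex n M A = h" using False by (simp add: branch_vertex_def e_def h_def)
        show thesis
        proof (cases "h = 0")
          case True
          have "A = {}"
          proof (rule ccontr)
            assume "A \<noteq> {}"
            then obtain u where "u \<in> A" by auto
            then have "0 < cvol M A u" "u < n" using cvol_pos[OF M finA] A by auto
            then show False using argmax_le[of u n "cvol M A"] True by (simp add: h_def)
          qed
          then show thesis using outcome_empty by (intro empty) auto
        next
          case False
          then have "0 < cvol M A (h - 1)" using argmax_pos[of "cvol M A" n] by (simp add: h_def)
          then have hA: "h - 1 \<in> A" by (simp add: cvol_def split: if_splits)
          have "cvol M A u \<le> cvol M A (h - 1)" if "u \<in> A" for u
            using argmax_le[of u n "cvol M A"] that A False by (auto simp: h_def)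
          then show thesis using hA ns n3 ne out p0 q0 bh False by (intro heavy[of "h - 1"]) auto
        qed
      qed
    qed
  qed
qed

lemma Max_append: "xs \<noteq> [] \<Longrightarrow> ys \<noteq> [] \<Longrightarrow> Max (set (xs @ ys)) = max (Max (set xs)) (Max (set ys))"
  by (simp add: Max_Un)

lemma leaf_values_ne: "leaf_values s \<noteq> []"
  by (induction s) auto

text \<open>Correctness of the search: reductions lower the independence number by exactly one,
  branches follow \<open>alpha_branch\<close>, and \<open>card A \<le> k\<close> keeps the fuel from
  running out early.\<close>

lemma Max_search:
  "A \<subseteq> {..<n} \<Longrightarrow> sym_refl M \<Longrightarrow> card A \<le> k \<Longrightarrow> Max (set (leaf_values (search n k M A c))) = c + alpha M A"
proof (induction k arbitrary: M A c)
  case 0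
  have "finite A" using 0 finite_subset by blast
  with 0 show ?case by simp
next
  case (Suc k)
  have fin: "finite A" using Suc.prems finite_subset by blast
  have less: "card B \<le> k" if "B \<subseteq> A" "v \<in> A" "v \<notin> B" for B v
  proof -
    have "card B < card A" using that fin by (intro psubset_card_mono) auto
    then show ?thesis using Suc.prems by simp
  qed
  have refl: "M v v" for v using Suc.prems by (simp add: sym_refl_def)
  have br: ?case if v: "v \<in> A" "outcome_of n M A = Branch v" for v
  proof -
    have "Max (set (leaf_values (search n k M (A - {u. M v u}) (c + 1)))) = c + 1 + alpha M (A - {u. M v u})"
      by (rule Suc.IH) (use Suc.prems v refl less[OF _ v(1)] in auto)
    moreover have "Max (set (leaf_values (search n k M (A - {v}) c))) = c + alpha M (A - {v})"
      by (rule Suc.IH) (use Suc.prems v less[OF _ v(1)] in auto)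
    ultimately show ?case using alpha_branch[OF fin v(1) Suc.prems(2)] v(2)
      by (simp add: Max_append[OF leaf_values_ne leaf_values_ne, simplified] max_add_distrib_right)
  qed
  from Suc.prems(1,2) show ?case
  proof (cases rule: outcome_cases)
    case empty then show ?thesis by simp
  next
    case (simplicial v)
    then have v: "v \<in> A" by (simp add: simp_v_def)
    have "Max (set (leaf_values (search n k M (A - {u. M v u}) (c + 1)))) = c + 1 + alpha M (A - {u. M v u})"
      by (rule Suc.IH) (use Suc.prems v refl less[OF _ v] in auto)
    then show ?thesis using simplicial alpha_simplicial[OF fin simplicial(1) Suc.prems(2)] by simp
  next
    case (fold v a b)
    have "Max (set (leaf_values (search n k (merge M a b) (A - {v, b}) (c + 1)))) = c + 1 + alpha (merge M a b) (A - {v, b})"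
      using Suc.prems sym_refl_merge less[OF _ fold(1), of "A - {v, b}"] by (intro Suc.IH) auto
    then show ?thesis using fold(7) alpha_fold[OF fin Suc.prems(2) fold(2-6)] by simp
  next
    case (easy v) then show ?thesis using br by blast
  next
    case (heavy v) then show ?thesis using br by blast
  qed
qed

subsection \<open>The number of leaves\<close>

text \<open>The search looks for simplicial vertices first and finds the very vertex that
  \<open>elim_step\<close> uses, so it follows the successful elimination.\<close>

lemma leaves_easy:
  "A \<subseteq> {..<n} \<Longrightarrow> sym_refl M \<Longrightarrow> (elim_step n M ^^ j) A = {} \<Longrightarrow> length (leaf_values (search n k M A c)) = 1"
proof (induction k arbitrary: A c j)
  case (Suc k)
  show ?case
  proof (cases "A = {}")
    case True then show ?thesis by (simp add: outcome_empty)
  next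
    case False
    define p where "p = last_sat (simp_v M A) n"
    have "p \<noteq> 0"
    proof
      assume "p = 0"
      then have "elim_step n M A = A" by (simp add: elim_step_def p_def)
      then have "(elim_step n M ^^ j) A = A" by (induction j) auto
      then show False using Suc.prems(3) False by simp
    qed
    then have e: "elim_step n M A = A - {u. M (p - 1) u}"
      and o: "outcome_of n M A = Reduce M (A - {u. M (p - 1) u})"
      by (simp_all add: elim_step_def outcome_of_def p_def Let_def)
    obtain i where "j = Suc i" using Suc.prems(3) False by (cases j) auto
    then have "(elim_step n M ^^ i) (A - {u. M (p - 1) u}) = {}"
      using Suc.prems(3) e by (simp add: funpow_swap1)
    then show ?thesis using Suc.IH[of "A - {u. M (p - 1) u}" i "c + 1"] Suc.prems o by auto
  qed
qed simp

text \<open>Every child has fewer vertices. This crude bound takes over once at most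
  \<open>small_bound\<close> vertices are left.\<close>

lemma leaves_le_power:
  "A \<subseteq> {..<n} \<Longrightarrow> sym_refl M \<Longrightarrow> length (leaf_values (search n k M A c)) \<le> 2 ^ card A"
proof (induction k arbitrary: M A c)
  case (Suc k)
  have fin: "finite A" using Suc.prems finite_subset by blast
  have refl: "M v v" for v using Suc.prems by (simp add: sym_refl_def)
  have less: "2 * (2::nat) ^ card B \<le> 2 ^ card A" if "B \<subseteq> A" "v \<in> A" "v \<notin> B" for B v
  proof -
    have "card B < card A" using that fin by (intro psubset_card_mono) auto
    then have "(2::nat) ^ Suc (card B) \<le> 2 ^ card A" by (intro power_increasing) auto
    then show ?thesis by simp
  qed
  have red: "length (leaf_values (search n k M' B c')) \<le> 2 ^ card A div 2"
    if "B \<subseteq> A" "v \<in> A" "v \<notin> B" "sym_refl M'" for B v M' c'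
  proof -
    have "length (leaf_values (search n k M' B c')) \<le> 2 ^ card B"
      using Suc.IH[of B M' c'] that Suc.prems by auto
    then show ?thesis using less[OF that(1-3)] by linarith
  qed
  have br: ?case if v: "v \<in> A" "outcome_of n M A = Branch v" for v
  proof -
    have "length (leaf_values (search n k M (A - {u. M v u}) (c + 1))) \<le> 2 ^ card A div 2"
      by (rule red[OF _ v(1) _ Suc.prems(2)]) (use refl in auto)
    moreover have "length (leaf_values (search n k M (A - {v}) c)) \<le> 2 ^ card A div 2"
      by (rule red[OF _ v(1) _ Suc.prems(2)]) auto
    ultimately show ?case using v(2) by simp
  qed
  have half: "(2::nat) ^ card A div 2 \<le> 2 ^ card A" by simp
  from Suc.prems(1,2) show ?case
  proof (cases rule: outcome_cases)
    case empty then show ?thesis by simp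
  next
    case (simplicial v)
    then have v: "v \<in> A" by (simp add: simp_v_def)
    have "length (leaf_values (search n k M (A - {u. M v u}) (c + 1))) \<le> 2 ^ card A div 2"
      by (rule red[OF _ v _ Suc.prems(2)]) (use refl in auto)
    then show ?thesis using simplicial half by simp
  next
    case (fold v a b)
    have "length (leaf_values (search n k (merge M a b) (A - {v, b}) (c + 1))) \<le> 2 ^ card A div 2"
      by (rule red[OF _ fold(1)]) (use Suc.prems sym_refl_merge in auto)
    then show ?thesis using fold(7) half by simp
  next
    case (easy v) then show ?thesis using br by blast
  next
    case (heavy v) then show ?thesis using br by blast
  qed
qed simp

section \<open>Reductions and the excluded minor\<close>

definition minor_free :: "nat \<Rightarrow> (nat \<Rightarrow> nat \<Rightarrow> bool) \<Rightarrow> nat set \<Rightarrow> bool" where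
  "minor_free t M A \<longleftrightarrow> \<not> induced_minor (tC3_C4 t) (graph_of (open_adj M) A)"

lemma minor_free_remove:
  assumes "minor_free t M A" "v \<in> A" shows "minor_free t M (A - {v})"
proof -
  have e: "delete_vertex v (graph_of (open_adj M) A) = graph_of (open_adj M) (A - {v})"
    by (auto simp: delete_vertex_def graph_of_def)
  have "minor_step (graph_of (open_adj M) A) (graph_of (open_adj M) (A - {v}))"
    using minor_step.delete[of v "graph_of (open_adj M) A"] assms(2) unfolding e by (simp add: graph_of_def)
  then show ?thesis using assms(1) induced_minor_step unfolding minor_free_def by blast
qed

lemma minor_free_subset:
  assumes "finite A" "minor_free t M A" "B \<subseteq> A" shows "minor_free t M B"
proof -
  have "finite D \<Longrightarrow> D \<subseteq> A \<Longrightarrow> minor_free t M (A - D)" for D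
  proof (induction D rule: finite_induct)
    case (insert d D)
    then have "minor_free t M (A - D - {d})" by (intro minor_free_remove) auto
    moreover have "A - D - {d} = A - insert d D" by auto
    ultimately show ?case by simp
  qed (use assms in simp)
  from this[of "A - B"] assms show ?thesis by (simp add: double_diff)
qed

lemma simple_graph_eqI:
  assumes G: "simple_graph G" and H: "simple_graph H" and V: "verts G = verts H"
    and e: "\<And>x y. x \<in> verts G \<Longrightarrow> y \<in> verts G \<Longrightarrow> x \<noteq> y \<Longrightarrow> {x, y} \<in> edges G \<longleftrightarrow> {x, y} \<in> edges H"
  shows "G = H"
proof -
  have "e \<in> edges G \<longleftrightarrow> e \<in> edges H" for e
  proof (cases "card e = 2 \<and> e \<subseteq> verts G")
    case True
    then obtain x y where "e = {x, y}" "x \<noteq> y" "x \<in> verts G" "y \<in> verts G" by (auto simp: card_2_iff)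
    then show ?thesis using e by blast
  next
    case False then show ?thesis using G H V unfolding simple_graph_def by blast
  qed
  then have "edges G = edges H" by blast
  then show ?thesis using V by simp
qed

text \<open>Folding contracts first \<open>{a, v}\<close> and then \<open>{a, b}\<close>, an edge
  created by the first contraction.\<close>

lemma minor_free_fold:
  assumes fin: "finite A" and M: "sym_refl M" and free: "minor_free t M A"
    and v: "v \<in> A" "{u \<in> A. M v u} = {v, a, b}" and d: "v \<noteq> a" "v \<noteq> b" "a \<noteq> b" "\<not> M a b"
  shows "minor_free t (merge M a b) (A - {v, b})"
proof -
  interpret adjacency "open_adj M" by (rule adjacency_open_adj[OF M])
  interpret m: adjacency "open_adj (merge M a b)" by (rule adjacency_open_adj[OF sym_refl_merge[OF M]])
  have sym: "M x y \<longleftrightarrow> M y x" for x y using M by (auto simp: sym_refl_def)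
  have A: "a \<in> A" "b \<in> A" "M v a" "M v b" using v by auto
  have nv: "M v u \<longleftrightarrow> u = v \<or> u = a \<or> u = b" if "u \<in> A" for u using v(2) that by blast
  define G0 where "G0 = graph_of (open_adj M) A"
  define G1 where "G1 = contract_edge a v G0"
  define G2 where "G2 = contract_edge a b G1"
  have s0: "simple_graph G0" unfolding G0_def by (rule simple_graph_of[OF fin])
  have E0: "{x, y} \<in> edges G0 \<longleftrightarrow> x \<in> A \<and> y \<in> A \<and> open_adj M x y" for x y
    unfolding G0_def by (rule graph_of_edge)
  have av: "{a, v} \<in> edges G0" using A v d sym[of v a] by (simp add: E0 open_adj_def)
  have s1: "simple_graph G1" unfolding G1_def by (rule simple_contract_edge[OF s0 av])
  have V1: "verts G1 = A - {v}" by (simp add: G1_def G0_def contract_edge_def graph_of_def)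
  have E1: "{x, y} \<in> edges G1 \<longleftrightarrow> M x y \<or> x = a \<and> y = b \<or> x = b \<and> y = a"
    if "x \<in> A - {v}" "y \<in> A - {v}" "x \<noteq> y" for x y
    unfolding G1_def using that d v(1) nv sym[of x v]
    by (subst contract_edge_edges[OF s0]) (auto simp: E0 open_adj_def)
  have ab: "{a, b} \<in> edges G1" using A d by (subst E1) auto
  have s2: "simple_graph G2" unfolding G2_def by (rule simple_contract_edge[OF s1 ab])
  have V2: "verts G2 = A - {v, b}" by (auto simp: G2_def contract_edge_def V1)
  have inV: "x \<in> verts G1 \<and> y \<in> verts G1" if "{x, y} \<in> edges G1" for x y using simple_edge_verts[OF s1 that] by simp
  have G2eq: "G2 = graph_of (open_adj (merge M a b)) (A - {v, b})"
  proof (rule simple_graph_eqI[OF s2])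
    show "simple_graph (graph_of (open_adj (merge M a b)) (A - {v, b}))" using fin by (intro m.simple_graph_of) simp
    show "verts G2 = verts (graph_of (open_adj (merge M a b)) (A - {v, b}))" by (simp add: V2 graph_of_def)
    fix x y assume xy: "x \<in> verts G2" "y \<in> verts G2" "x \<noteq> y"
    then have xA: "x \<in> A - {v}" "y \<in> A - {v}" "x \<noteq> b" "y \<noteq> b" by (auto simp: V2)
    have bA: "b \<in> A - {v}" using A d by auto
    have "{x, y} \<in> edges G2 \<longleftrightarrow> {x, y} \<in> edges G1 \<or> (x = a \<and> {b, y} \<in> edges G1) \<or> (y = a \<and> {x, b} \<in> edges G1)"
      unfolding G2_def by (rule contract_edge_edges[OF s1 xA(3,4) xy(3) d(3)])
    also have "\<dots> \<longleftrightarrow> M x y \<or> (x = a \<and> M b y) \<or> (y = a \<and> M x b)"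
      using E1[OF xA(1,2) xy(3)] E1[OF bA xA(2) xA(4)[symmetric]] E1[OF xA(1) bA xA(3)] xA(3,4) xy(3) d(3) by auto
    also have "\<dots> \<longleftrightarrow> {x, y} \<in> edges (graph_of (open_adj (merge M a b)) (A - {v, b}))"
      unfolding m.graph_of_edge using xy by (auto simp: V2 open_adj_def merge_def)
    finally show "{x, y} \<in> edges G2 \<longleftrightarrow> {x, y} \<in> edges (graph_of (open_adj (merge M a b)) (A - {v, b}))" .
  qed
  have "minor_step G0 G1" unfolding G1_def by (rule minor_step.contract[OF av])
  moreover have "minor_step G1 G2" unfolding G2_def by (rule minor_step.contract[OF ab])
  ultimately have "\<not> induced_minor (tC3_C4 t) G2"
    using free induced_minor_step[of G1 G2] induced_minor_step[of G0 G1] unfolding minor_free_def G0_def by blast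
  then show ?thesis unfolding minor_free_def G2eq .
qed

text \<open>The number of vertices plus twice the number of edges. It measures progress: it falls by
  at least \<open>cvol\<close> when a vertex is taken and never rises, not even under
  folding.\<close>

definition total :: "(nat \<Rightarrow> nat \<Rightarrow> bool) \<Rightarrow> nat set \<Rightarrow> nat" where
  "total M A = (\<Sum>u\<in>A. cdeg M A u)"

lemma cdeg_mono: "finite A \<Longrightarrow> B \<subseteq> A \<Longrightarrow> cdeg M B u \<le> cdeg M A u"
  unfolding cdeg_def by (intro card_mono) auto

lemma total_subset: "finite A \<Longrightarrow> B \<subseteq> A \<Longrightarrow> total M B \<le> total M A"
  unfolding total_def by (rule order_trans[OF sum_mono[OF cdeg_mono] sum_mono2]) auto

lemma total_take:
  assumes "finite A" "v \<in> A" shows "total M (A - {u. M v u}) + cvol M A v \<le> total M A"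
proof -
  let ?N = "{u. u \<in> A \<and> M v u}"
  have "total M (A - {u. M v u}) \<le> (\<Sum>u\<in>A - {u. M v u}. cdeg M A u)"
    unfolding total_def using assms by (intro sum_mono cdeg_mono) auto
  moreover have "total M A = (\<Sum>u\<in>A - ?N. cdeg M A u) + (\<Sum>u\<in>?N. cdeg M A u)"
    unfolding total_def using assms(1) by (intro sum.subset_diff) auto
  moreover have "A - ?N = A - {u. M v u}" by auto
  ultimately show ?thesis using assms by (simp add: cvol_def)
qed

text \<open>The merged vertex has at most the closed degrees of \<open>a\<close> and
  \<open>b\<close> together, and no other closed degree grows.\<close>

lemma total_fold:
  assumes fin: "finite A" and A: "a \<in> A" "b \<in> A" "v \<in> A" and d: "v \<noteq> a" "v \<noteq> b" "a \<noteq> b"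
  shows "total (merge M a b) (A - {v, b}) \<le> total M A"
proof -
  let ?B = "A - {v, b}"
  have 1: "cdeg (merge M a b) ?B u \<le> cdeg M A u" if "u \<noteq> a" for u
  proof -
    \<comment> \<open>If \<open>u\<close> sees \<open>b\<close> but not \<open>a\<close>, then it
      gains \<open>a\<close> and loses \<open>b\<close>; so \<open>a\<close> is charged to
      \<open>b\<close>.\<close>
    define \<iota> where "\<iota> w = (if w = a \<and> \<not> M u a then b else w)" for w
    have "inj_on \<iota> ?B" by (rule inj_onI) (auto simp: \<iota>_def split: if_splits)
    then have "inj_on \<iota> {w \<in> ?B. merge M a b u w}" by (rule inj_on_subset) auto
    moreover have "\<iota> ` {w \<in> ?B. merge M a b u w} \<subseteq> {w \<in> A. M u w}"
      using A that by (auto simp: \<iota>_def merge_def split: if_splits)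
    ultimately show ?thesis unfolding cdeg_def using fin by (intro card_inj_on_le[of \<iota>]) auto
  qed
  have 2: "cdeg (merge M a b) ?B a \<le> cdeg M A a + cdeg M A b"
  proof -
    have "{w \<in> ?B. merge M a b a w} \<subseteq> {w \<in> A. M a w} \<union> {w \<in> A. M b w}" by (auto simp: merge_def)
    then have "cdeg (merge M a b) ?B a \<le> card ({w \<in> A. M a w} \<union> {w \<in> A. M b w})"
      unfolding cdeg_def using fin by (intro card_mono) auto
    also have "\<dots> \<le> cdeg M A a + cdeg M A b" unfolding cdeg_def by (rule card_Un_le)
    finally show ?thesis .
  qed
  have B: "?B = insert a (A - {v, a, b})" using A d by auto
  have "total (merge M a b) ?B = cdeg (merge M a b) ?B a + (\<Sum>u\<in>A - {v, a, b}. cdeg (merge M a b) ?B u)"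
    unfolding total_def using fin by (subst (2) B) simp
  also have "\<dots> \<le> (cdeg M A a + cdeg M A b) + (\<Sum>u\<in>A - {v, a, b}. cdeg M A u)"
    using 2 by (intro add_mono sum_mono 1) auto
  also have "\<dots> = (\<Sum>u\<in>insert a (insert b (A - {v, a, b})). cdeg M A u)" using fin d by simp
  also have "\<dots> \<le> total M A" unfolding total_def using fin A by (intro sum_mono2) auto
  finally show ?thesis .
qed

text \<open>Absence of holes is hereditary, so Dirac's theorem supplies a simplicial vertex in every
  round.\<close>

lemma elim_succeeds:
  assumes "sym_refl M"
  shows "B \<subseteq> {..<n} \<Longrightarrow> \<not> adjacency.hole_in (open_adj M) B \<Longrightarrow> card B \<le> j \<Longrightarrow> (elim_step n M ^^ j) B = {}"
proof (induction j arbitrary: B)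
  case 0 then show ?case using finite_subset[OF 0(1)] by simp
next
  case (Suc j)
  interpret adjacency "open_adj M" by (rule adjacency_open_adj[OF assms])
  have fin: "finite B" using Suc.prems finite_subset by blast
  have c: "cnb {v} = {u. M v u}" for v using assms by (auto simp: cnb_def open_adj_def sym_refl_def)
  define p where "p = last_sat (simp_v M B) n"
  show ?case
  proof (cases "B = {}")
    case True
    have "elim_step n M {} = {}" by (simp add: elim_step_def Let_def)
    then have "(elim_step n M ^^ i) {} = {}" for i by (induction i) auto
    then show ?thesis using True by blast
  next
    case False
    from simplicial_exists[OF fin False Suc.prems(2)] obtain s where s: "simplicial B s" by blast
    have "simp_v M B s" unfolding simp_v_def
    proof (intro conjI ballI impI)
      show "s \<in> B" using s by (simp add: simplicial_def)
      fix x y assume "x \<in> B" "y \<in> B" "M s x" "M s y"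
      then have "x = y \<or> open_adj M x y" using s unfolding simplicial_def c by blast
      then show "M x y" using assms by (auto simp: open_adj_def sym_refl_def)
    qed
    moreover have "s < n" using s Suc.prems(1) by (auto simp: simplicial_def)
    ultimately have "p \<noteq> 0" by (auto simp: p_def last_sat_0)
    then have e: "elim_step n M B = B - {u. M (p - 1) u}" by (simp add: elim_step_def p_def)
    have "p - 1 \<in> B" using last_sat_pos[of "simp_v M B" n] \<open>p \<noteq> 0\<close> by (auto simp: p_def simp_v_def)
    moreover have "M (p - 1) (p - 1)" using assms by (simp add: sym_refl_def)
    ultimately have "card (B - {u. M (p - 1) u}) < card B" using fin by (intro psubset_card_mono) auto
    moreover have "\<not> hole_in (B - {u. M (p - 1) u})" using hole_in_mono Suc.prems(2) by blast
    ultimately have "(elim_step n M ^^ j) (B - {u. M (p - 1) u}) = {}" using Suc.prems by (intro Suc.IH) auto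
    then show ?thesis using e by (simp add: funpow_swap1)
  qed
qed

text \<open>Vertices of degree at most one are simplicial, so failure of both reductions forces
  degree at least three; failure of the easy test forces a hole outside each closed neighbourhood.
  With these facts \<open>exists_heavy\<close> applies.\<close>

lemma heavy_branch:
  assumes A: "A \<subseteq> {..<n}" and M: "sym_refl M" and free: "minor_free t M A" and t: "1 \<le> t"
    and big: "small_bound t \<le> card A" and v: "v \<in> A"
    and simp: "\<And>u. u \<in> A \<Longrightarrow> \<not> simp_v M A u" and deg2: "\<And>u. u \<in> A \<Longrightarrow> cdeg M A u \<noteq> 3"
    and hard: "\<And>u. u \<in> A \<Longrightarrow> \<not> easy n M A u" and max: "\<And>u. u \<in> A \<Longrightarrow> cvol M A u \<le> cvol M A v"
  shows "total M A \<le> 44800 * t * cvol M A v"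
proof -
  interpret adjacency "open_adj M" by (rule adjacency_open_adj[OF M])
  have fin: "finite A" using A finite_subset by blast
  have refl: "M u u" and sym: "M u w \<longleftrightarrow> M w u" for u w using M by (auto simp: sym_refl_def)
  have c: "cnb {v} = {u. M v u}" for v using refl by (auto simp: cnb_def open_adj_def)
  have dg: "deg A u + 1 = cdeg M A u" if "u \<in> A" for u
  proof -
    have "{w \<in> A. M u w} = insert u {w \<in> A. open_adj M u w}" using that refl by (auto simp: open_adj_def)
    then show ?thesis unfolding deg_def cdeg_def using fin by (simp add: open_adj_def)
  qed
  have vl: "vol A u = cvol M A u" if "u \<in> A" for u
    unfolding vol_def cvol_def c using that dg by (auto intro!: sum.cong)
  have tot: "(\<Sum>u\<in>A. deg A u + 1) = total M A" unfolding total_def using dg by (auto intro!: sum.cong)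
  have "\<exists>w\<in>A. (\<Sum>u\<in>A. deg A u + 1) \<le> 44800 * t * vol A w"
  proof (rule exists_heavy[OF fin _ big t])
    show "A \<noteq> {}" using v by auto
    show "\<not> pack t A" using pack_induced_minor[OF fin] free by (auto simp: minor_free_def)
    show "3 \<le> deg A u" if u: "u \<in> A" for u
    proof (rule ccontr)
      assume "\<not> ?thesis"
      then have le: "deg A u \<le> 1" using dg[OF u] deg2[OF u] by linarith
      have "x = y" if "x \<in> A" "y \<in> A" "open_adj M u x" "open_adj M u y" for x y
      proof -
        have "card {x, y} \<le> deg A u" unfolding deg_def using that fin by (intro card_mono) auto
        with le show ?thesis by (cases "x = y") auto
      qed
      then have "simp_v M A u" using u refl sym unfolding simp_v_def open_adj_def by metis
      with simp u show False by blast
    qed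
    show "hole_in (A - cnb {u})" if u: "u \<in> A" for u
    proof (rule ccontr)
      assume "\<not> ?thesis"
      moreover have "card (A - {w. M u w}) \<le> n" using card_mono[of "{..<n}" "A - {w. M u w}"] A by auto
      ultimately have "(elim_step n M ^^ n) (A - {w. M u w}) = {}"
        using A unfolding c by (intro elim_succeeds[OF M]) auto
      then show False using hard[OF u] u by (simp add: easy_def)
    qed
  qed
  then obtain w where w: "w \<in> A" "total M A \<le> 44800 * t * cvol M A w" unfolding tot using vl by auto
  have "44800 * t * cvol M A w \<le> 44800 * t * cvol M A v" using max[OF w(1)] by (rule mult_le_mono2)
  with w show ?thesis by linarith
qed

text \<open>Taking a vertex of large volume shrinks the total volume by a constant factor, so that this
  happens only logarithmically often on every branch of the tree.\<close>

lemma leaves_bound: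
  fixes K :: real
  assumes t: "1 \<le> t" and K: "K = 44800 * real t"
  shows "A \<subseteq> {..<n} \<Longrightarrow> sym_refl M \<Longrightarrow> minor_free t M A \<Longrightarrow>
    total M A \<le> small_bound t * (K / (K - 1)) ^ q \<Longrightarrow>
    length (leaf_values (search n k M A c)) \<le> 2 ^ small_bound t * (card A + 1) * (n + 1) ^ q"
proof (induction k arbitrary: M A c q)
  case (Suc k)
  let ?s = "small_bound t"
  let ?L = "\<lambda>M A c. length (leaf_values (search n k M A c))"
  have K1: "K > 1" using t K by simp
  have fin: "finite A" using Suc.prems finite_subset by blast
  have refl: "M v v" for v using Suc.prems by (simp add: sym_refl_def)
  have one: "1 \<le> (2::nat) ^ ?s * (n + 1) ^ q" for q by (simp add: Suc_le_eq)
  have less: "card B + 1 \<le> card A" if "B \<subseteq> A" "v \<in> A" "v \<notin> B" for B v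
    using psubset_card_mono[OF fin, of B] that by fastforce
  have IH: "?L M' B c' \<le> 2 ^ ?s * card A * (n + 1) ^ q"
    if B: "B \<subseteq> A" "v \<in> A" "v \<notin> B" and M': "sym_refl M'" "minor_free t M' B" "total M' B \<le> total M A" for M' B v c'
  proof -
    have "real (total M' B) \<le> ?s * (K / (K - 1)) ^ q" using M'(3) Suc.prems(4) by linarith
    then have "?L M' B c' \<le> 2 ^ ?s * (card B + 1) * (n + 1) ^ q"
      using Suc.IH[of B M' q c'] B M' Suc.prems(1) by auto
    also have "\<dots> \<le> 2 ^ ?s * card A * (n + 1) ^ q" using less[OF B] by (intro mult_le_mono) auto
    finally show ?thesis .
  qed
  have more: "2 ^ ?s * card A * (n + 1) ^ q \<le> 2 ^ ?s * (card A + 1) * (n + 1) ^ q" by (intro mult_le_mono) auto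
  \<comment> \<open>Discarding a vertex leaves \<open>q\<close> unchanged and is paid for by the
    factor \<open>card A + 1\<close>.\<close>
  have drop: "?L M (A - {v}) c \<le> 2 ^ ?s * card A * (n + 1) ^ q" if v: "v \<in> A" for v
    by (rule IH[of _ v]) (use v Suc.prems minor_free_remove total_subset[OF fin] in auto)
  \<comment> \<open>The difference between the factors \<open>card A + 1\<close> and
    \<open>card A\<close> is what remains for the branch that takes \<open>v\<close>.\<close>
  have two: ?case if "outcome_of n M A = Branch v" "v \<in> A" "?L M (A - {u. M v u}) (c + 1) \<le> 2 ^ ?s * (n + 1) ^ q" for v
  proof -
    have "length (leaf_values (search n (Suc k) M A c)) \<le> 2 ^ ?s * (n + 1) ^ q + 2 ^ ?s * card A * (n + 1) ^ q"
      using that drop[OF that(2)] by simp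
    also have "\<dots> = 2 ^ ?s * (card A + 1) * (n + 1) ^ q" by (simp add: algebra_simps)
    finally show ?thesis .
  qed
  from Suc.prems(1,2) show ?case
  proof (cases rule: outcome_cases)
    case empty then show ?thesis using one[of q] by simp
  next
    case (simplicial v)
    then have v: "v \<in> A" by (simp add: simp_v_def)
    have "?L M (A - {u. M v u}) (c + 1) \<le> 2 ^ ?s * card A * (n + 1) ^ q"
      by (rule IH[OF _ v]) (use refl Suc.prems minor_free_subset[OF fin] total_subset[OF fin] in auto)
    moreover have "length (leaf_values (search n (Suc k) M A c)) = ?L M (A - {u. M v u}) (c + 1)"
      using simplicial by simp
    ultimately show ?thesis using more by linarith
  next
    case (fold v a b)
    have "a \<in> A" "b \<in> A" using fold(2) by auto
    then have "?L (merge M a b) (A - {v, b}) (c + 1) \<le> 2 ^ ?s * card A * (n + 1) ^ q"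
      using minor_free_fold[OF fin Suc.prems(2,3) fold(1-6)] total_fold[OF fin _ _ fold(1,3-5)]
        sym_refl_merge[OF Suc.prems(2)] by (intro IH[OF _ fold(1)]) auto
    moreover have "length (leaf_values (search n (Suc k) M A c)) = ?L (merge M a b) (A - {v, b}) (c + 1)"
      using fold(7) by simp
    ultimately show ?thesis using more by linarith
  next
    case (easy v)
    have "?L M (A - {u. M v u}) (c + 1) = 1"
      by (rule leaves_easy) (use easy Suc.prems in \<open>auto simp: easy_def\<close>)
    then show ?thesis using two[OF easy(3,1)] one[of q] by simp
  next
    case (heavy v)
    show ?thesis
    proof (cases "card A < ?s")
      case True
      have "length (leaf_values (search n (Suc k) M A c)) \<le> 2 ^ card A" by (rule leaves_le_power[OF Suc.prems(1,2)])
      also have "\<dots> \<le> 2 ^ ?s" using True by (intro power_increasing) auto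
      also have "\<dots> \<le> 2 ^ ?s * ((card A + 1) * (n + 1) ^ q)" by (simp add: Suc_le_eq)
      finally show ?thesis by (simp only: mult.assoc)
    next
      case False
      have "total M A \<le> 44800 * t * cvol M A v"
        using False heavy by (intro heavy_branch[OF Suc.prems(1-3) t]) auto
      then have hv: "real (total M A) \<le> K * cvol M A v" unfolding K by (metis of_nat_le_iff of_nat_mult of_nat_numeral)
      have tk: "total M (A - {u. M v u}) + cvol M A v \<le> total M A" by (rule total_take[OF fin heavy(1)])
      have "K * total M (A - {u. M v u}) \<le> K * (total M A - cvol M A v)" using tk K1 by simp
      also have "\<dots> \<le> (K - 1) * total M A" using hv tk by (simp add: algebra_simps of_nat_diff)
      finally have tk': "real (total M (A - {u. M v u})) \<le> (K - 1) / K * total M A" using K1 by (simp add: field_simps)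
      \<comment> \<open>For \<open>q = 0\<close> the volume, and with it the number of vertices, is
        at most \<open>small_bound t\<close>. For larger \<open>q\<close>, taking \<open>v\<close>
        lowers \<open>q\<close> by one, and the released factor \<open>n + 1\<close> absorbs the
        factor for the number of vertices.\<close>
      show ?thesis
      proof (cases q)
        case 0
        have small: "card (A - {u. M v u}) + 1 \<le> card A" by (rule less[OF _ heavy(1)]) (use refl in auto)
        have "1 \<le> cdeg M A u" if "u \<in> A" for u
        proof -
          have "u \<in> {w \<in> A. M u w}" using that refl by simp
          then have "0 < card {w \<in> A. M u w}" using fin by (subst card_gt_0_iff) auto
          then show ?thesis by (simp add: cdeg_def)
        qed
        then have "(\<Sum>u\<in>A. 1) \<le> total M A" unfolding total_def by (intro sum_mono) auto
        then have "card A \<le> ?s" using Suc.prems(4) 0 by simp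
        then have "card (A - {u. M v u}) \<le> ?s" using small by simp
        have "?L M (A - {u. M v u}) (c + 1) \<le> 2 ^ card (A - {u. M v u})"
          by (rule leaves_le_power) (use Suc.prems in auto)
        also have "\<dots> \<le> 2 ^ ?s" using \<open>card (A - {u. M v u}) \<le> ?s\<close> by (intro power_increasing) auto
        finally show ?thesis using two[OF heavy(2,1)] 0 by simp
      next
        case (Suc q')
        have "real (total M (A - {u. M v u})) \<le> (K - 1) / K * (?s * (K / (K - 1)) ^ q)"
          using tk' Suc.prems(4) K1 by (meson order_trans mult_left_mono divide_nonneg_pos diff_ge_0_iff_ge less_imp_le zero_less_one less_trans)
        also have "\<dots> = ?s * (K / (K - 1)) ^ q'" using K1 Suc by (simp add: field_simps)
        finally have "?L M (A - {u. M v u}) (c + 1) \<le> 2 ^ ?s * (card (A - {u. M v u}) + 1) * (n + 1) ^ q'"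
          using Suc.prems minor_free_subset[OF fin Suc.prems(3)] by (intro Suc.IH) auto
        also have "\<dots> \<le> 2 ^ ?s * (n + 1) * (n + 1) ^ q'"
          using card_mono[of "{..<n}" "A - {u. M v u}"] Suc.prems(1) by (intro mult_le_mono) auto
        also have "\<dots> = 2 ^ ?s * (n + 1) ^ q" using Suc by (simp add: algebra_simps)
        finally show ?thesis using two[OF heavy(2,1)] by simp
      qed
    qed
  qed
qed (simp add: Suc_le_eq)

subsection \<open>Depth-first search by choice strings\<close>

text \<open>A list of booleans describes a path from the root, where \<open>True\<close> leads to the right subtree.
  The leaves that are still to be visited are those not to the left of the path.\<close>

fun valid :: "tree \<Rightarrow> bool list \<Rightarrow> bool" where
  "valid (Leaf v) p \<longleftrightarrow> p = []"
| "valid (Node l r) [] \<longleftrightarrow> True"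
| "valid (Node l r) (b # p) \<longleftrightarrow> valid (if b then r else l) p"

fun todo :: "tree \<Rightarrow> bool list \<Rightarrow> nat list" where
  "todo (Leaf v) p = [v]"
| "todo (Node l r) [] = leaf_values l @ leaf_values r"
| "todo (Node l r) (b # p) = (if b then todo r p else todo l p @ leaf_values r)"

fun full_path :: "tree \<Rightarrow> bool list \<Rightarrow> bool list" where
  "full_path (Leaf v) p = []"
| "full_path (Node l r) [] = False # full_path l []"
| "full_path (Node l r) (b # p) = b # full_path (if b then r else l) p"

fun value_at :: "tree \<Rightarrow> bool list \<Rightarrow> nat" where
  "value_at (Leaf v) p = v"
| "value_at (Node l r) [] = value_at l []"
| "value_at (Node l r) (b # p) = value_at (if b then r else l) p"

text \<open>Backtracking: the last \<open>False\<close> becomes \<open>True\<close>, and what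
  follows it is cut off.\<close>

fun next_path :: "bool list \<Rightarrow> bool list option" where
  "next_path [] = None"
| "next_path (b # q) = (case next_path q of Some p \<Rightarrow> Some (b # p) | None \<Rightarrow> if b then None else Some [True])"

lemma todo_Nil: "todo s [] = leaf_values s"
  by (cases s) auto

lemma valid_Nil: "valid s []"
  by (cases s) auto

text \<open>One visit consumes the leftmost remaining leaf, and the next path stands for exactly the
  others. So a single path suffices in place of a stored tree.\<close>

lemma todo_step:
  "valid s p \<Longrightarrow> todo s p = value_at s p # (case next_path (full_path s p) of None \<Rightarrow> [] | Some p' \<Rightarrow> todo s p') \<and>
    (\<forall>p'. next_path (full_path s p) = Some p' \<longrightarrow> valid s p')"
proof (induction s arbitrary: p)
  case (Node l r)
  show ?case
  proof (cases p)
    case Nil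
    show ?thesis using Node.IH(1)[OF valid_Nil] Nil
      by (auto simp: todo_Nil valid_Nil split: option.splits)
  next
    case (Cons b q)
    then show ?thesis using Node.IH Node.prems
      by (cases b) (force simp: todo_Nil valid_Nil split: option.splits)+
  qed
qed simp

section \<open>The program\<close>

subsection \<open>Loop programs\<close>

text \<open>In \<open>LFor x c\<close> the register \<open>x\<close> runs through all numbers below the content of register \<open>0\<close>.\<close>

datatype lprog =
    LSkip
  | LAssign nat expr
  | LStore nat expr expr
  | LSeq lprog lprog (infixr "\<then>" 60)
  | LCond expr lprog lprog
  | LFor nat lprog

primrec compile :: "lprog \<Rightarrow> prog" where
  "compile LSkip = Skip"
| "compile (LAssign x e) = Assign x e"
| "compile (LStore a i e) = Store a i e"
| "compile (LSeq c d) = Seq (compile c) (compile d)"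
| "compile (LCond b c d) = Cond b (compile c) (compile d)"
| "compile (LFor x c) = Seq (Assign x (Const 0))
     (While (Sub (Reg 0) (Reg x)) (Seq (compile c) (Assign x (Add (Reg x) (Const 1)))))"

text \<open>Loop programs always halt, so their effect is a function and their cost can be bounded
  in terms of register \<open>0\<close> alone. \<open>exec_compile\<close> transfers both facts to
  the machine.\<close>

primrec sem :: "lprog \<Rightarrow> machine_state \<Rightarrow> machine_state" where
  "sem LSkip s = s"
| "sem (LAssign x e) s = set_reg x (expr_val e s) s"
| "sem (LStore a i e) s = set_elem a (expr_val i s) (expr_val e s) s"
| "sem (LSeq c d) s = sem d (sem c s)"
| "sem (LCond b c d) s = (if expr_val b s \<noteq> 0 then sem c s else sem d s)"
| "sem (LFor x c) s = set_reg x (regs s 0) (foldl (\<lambda>s i. sem c (set_reg x i s)) s [0..<regs s 0])"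

primrec written_regs :: "lprog \<Rightarrow> nat set" where
  "written_regs LSkip = {}"
| "written_regs (LAssign x e) = {x}"
| "written_regs (LStore a i e) = {}"
| "written_regs (LSeq c d) = written_regs c \<union> written_regs d"
| "written_regs (LCond b c d) = written_regs c \<union> written_regs d"
| "written_regs (LFor x c) = insert x (written_regs c)"

primrec written_arrs :: "lprog \<Rightarrow> nat set" where
  "written_arrs LSkip = {}"
| "written_arrs (LAssign x e) = {}"
| "written_arrs (LStore a i e) = {a}"
| "written_arrs (LSeq c d) = written_arrs c \<union> written_arrs d"
| "written_arrs (LCond b c d) = written_arrs c \<union> written_arrs d"
| "written_arrs (LFor x c) = written_arrs c"

text \<open>Ensures that the compiled while loop makes the rounds that \<open>sem\<close>
  prescribes: the body changes neither the bound nor the counter.\<close>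

primrec wf_loops :: "lprog \<Rightarrow> bool" where
  "wf_loops LSkip = True"
| "wf_loops (LAssign x e) = True"
| "wf_loops (LStore a i e) = True"
| "wf_loops (LSeq c d) = (wf_loops c \<and> wf_loops d)"
| "wf_loops (LCond b c d) = (wf_loops c \<and> wf_loops d)"
| "wf_loops (LFor x c) = (x \<noteq> 0 \<and> x \<notin> written_regs c \<and> 0 \<notin> written_regs c \<and> wf_loops c)"

text \<open>For a loop, \<open>6\<close> is the initialisation (\<open>2\<close>) and the failing
  test (\<open>4\<close>); each round adds a test and an increment of \<open>4\<close> each. A
  conditional is charged for both branches to be independent of the state.\<close>

primrec cost :: "lprog \<Rightarrow> nat \<Rightarrow> nat" where
  "cost LSkip n = 1"
| "cost (LAssign x e) n = 1 + expr_time e"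
| "cost (LStore a i e) n = 1 + expr_time i + expr_time e"
| "cost (LSeq c d) n = cost c n + cost d n"
| "cost (LCond b c d) n = 1 + expr_time b + cost c n + cost d n"
| "cost (LFor x c) n = 6 + n * (8 + cost c n)"

lemma set_simps [simp]:
  "regs (set_reg x k s) y = (if y = x then k else regs s y)"
  "arrs (set_reg x k s) = arrs s"
  "regs (set_elem a i k s) = regs s"
  "arrs (set_elem a i k s) b = (if b = a then (arrs s a)(i := k) else arrs s b)"
  by (auto simp: set_reg_def set_elem_def)

lemma set_reg_set_reg [simp]: "set_reg x k (set_reg x j s) = set_reg x k s"
  by (simp add: set_reg_def)

lemma foldl_inv:
  assumes "P s" "\<And>i s. i \<in> set xs \<Longrightarrow> P s \<Longrightarrow> P (f s i)" shows "P (foldl f s xs)"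
  using assms by (induction xs arbitrary: s) auto

lemma sem_frame:
  "x \<notin> written_regs c \<Longrightarrow> regs (sem c s) x = regs s x"
  "a \<notin> written_arrs c \<Longrightarrow> arrs (sem c s) a = arrs s a"
proof (induction c arbitrary: s)
  case (LFor y c)
  { case 1
    then show ?case
      using LFor.IH(1) foldl_inv[of "\<lambda>t. regs t x = regs s x" s "[0..<regs s 0]" "\<lambda>s i. sem c (set_reg y i s)"] by auto
  next
    case 2
    then show ?case
      using LFor.IH(2) foldl_inv[of "\<lambda>t. arrs t a = arrs s a" s "[0..<regs s 0]" "\<lambda>s i. sem c (set_reg y i s)"] by auto }
qed auto

lemma exec_compile:
  "wf_loops c \<Longrightarrow> 0 \<notin> written_regs c \<Longrightarrow> \<exists>k\<le>cost c (regs s 0). exec (compile c) s k (sem c s)"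
proof (induction c arbitrary: s)
  case LSkip then show ?case using exec.Skip by auto
next
  case (LAssign x e) then show ?case using exec.Assign by auto
next
  case (LStore a i e) then show ?case using exec.Store by auto
next
  case (LSeq c d)
  from LSeq.IH(1)[of s] LSeq.prems obtain k where k: "k \<le> cost c (regs s 0)" "exec (compile c) s k (sem c s)" by auto
  moreover have "regs (sem c s) 0 = regs s 0" using LSeq.prems by (intro sem_frame) auto
  with LSeq.IH(2)[of "sem c s"] LSeq.prems obtain l where
    l: "l \<le> cost d (regs s 0)" "exec (compile d) (sem c s) l (sem d (sem c s))" by auto
  ultimately show ?case using exec.Seq[OF k(2) l(2)] by (intro exI[of _ "k + l"]) auto
next
  case (LCond b c d)
  show ?case
  proof (cases "expr_val b s = 0")
    case True
    from LCond.IH(2)[of s] LCond.prems obtain k where "k \<le> cost d (regs s 0)" "exec (compile d) s k (sem d s)" by auto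
    then show ?thesis using exec.CondFalse[OF True] True by (intro exI[of _ "1 + expr_time b + k"]) auto
  next
    case False
    from LCond.IH(1)[of s] LCond.prems obtain k where "k \<le> cost c (regs s 0)" "exec (compile c) s k (sem c s)" by auto
    then show ?thesis using exec.CondTrue[OF False] False by (intro exI[of _ "1 + expr_time b + k"]) auto
  qed
next
  case (LFor x c)
  define n where "n = regs s 0"
  define F where "F i = foldl (\<lambda>s i. sem c (set_reg x i s)) s [0..<i]" for i
  have x: "x \<noteq> 0" "x \<notin> written_regs c" "0 \<notin> written_regs c" "wf_loops c" using LFor.prems by auto
  have FS: "F (Suc i) = sem c (set_reg x i (F i))" for i by (simp add: F_def)
  have F0: "regs (F i) 0 = n" for i
  proof (induction i)
    case 0 show ?case by (simp add: F_def n_def)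
  next
    case (Suc i) then show ?case using sem_frame(1)[OF x(3)] x(1) by (simp add: FS)
  qed
  let ?b = "Sub (Reg 0) (Reg x)" and ?body = "Seq (compile c) (Assign x (Add (Reg x) (Const 1)))"
  \<comment> \<open>Downward induction from the exit of the loop, matching the while rule, which
    puts a first round before the rest.\<close>
  have "\<exists>k\<le>4 + (n - i) * (8 + cost c n). exec (While ?b ?body) (set_reg x i (F i)) k (set_reg x n (F n))"
    if "i \<le> n" for i using that
  proof (induction i rule: inc_induct)
    case base
    have "exec (While ?b ?body) (set_reg x n (F n)) (1 + expr_time ?b) (set_reg x n (F n))"
      using F0 x by (intro exec.WhileFalse) auto
    moreover have "1 + expr_time ?b = 4" by simp
    ultimately have "exec (While ?b ?body) (set_reg x n (F n)) 4 (set_reg x n (F n))" by (simp only:)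
    then show ?case by (intro exI[of _ 4] conjI) simp_all
  next
    case (step i)
    from LFor.IH[OF x(4,3), of "set_reg x i (F i)"] obtain k where
      k: "k \<le> cost c n" "exec (compile c) (set_reg x i (F i)) k (F (Suc i))"
      using F0 x by (auto simp: FS)
    have "regs (F (Suc i)) x = i" using sem_frame(1)[OF x(2)] by (simp add: FS)
    then have "exec (Assign x (Add (Reg x) (Const 1))) (F (Suc i)) 4 (set_reg x (Suc i) (F (Suc i)))"
      using exec.Assign[of x "Add (Reg x) (Const 1)" "F (Suc i)"] by (simp add: eval_nat_numeral)
    from exec.Seq[OF k(2) this] have b: "exec ?body (set_reg x i (F i)) (k + 4) (set_reg x (Suc i) (F (Suc i)))" .
    from step.IH obtain l where l: "l \<le> 4 + (n - Suc i) * (8 + cost c n)"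
      "exec (While ?b ?body) (set_reg x (Suc i) (F (Suc i))) l (set_reg x n (F n))" by auto
    have "expr_val ?b (set_reg x i (F i)) \<noteq> 0" using F0 x step by auto
    from exec.WhileTrue[OF this b l(2)]
    have "exec (While ?b ?body) (set_reg x i (F i)) (8 + k + l) (set_reg x n (F n))" by (simp add: eval_nat_numeral)
    moreover have "n - i = Suc (n - Suc i)" using step by simp
    then have "8 + k + l \<le> 4 + (n - i) * (8 + cost c n)" using k l by simp
    ultimately show ?case by blast
  qed
  from this[of 0] obtain k where k: "k \<le> 4 + n * (8 + cost c n)"
    "exec (While ?b ?body) (set_reg x 0 s) k (set_reg x n (F n))" by (auto simp: F_def)
  have "exec (Assign x (Const 0)) s 2 (set_reg x 0 s)" using exec.Assign[of x "Const 0" s] by (simp add: eval_nat_numeral)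
  from exec.Seq[OF this k(2)] show ?case using k(1) by (intro exI[of _ "2 + k"]) (auto simp: n_def F_def)
qed

text \<open>Each loop raises the degree by one; for compositions it is enough to add the
  degrees.\<close>

lemma cost_polynomial: "\<exists>K d. \<forall>n. cost c n \<le> K * (n + 1) ^ d"
proof (induction c)
  case (LSeq c d)
  then obtain K1 d1 K2 d2 where *: "\<forall>n. cost c n \<le> K1 * (n + 1) ^ d1" "\<forall>n. cost d n \<le> K2 * (n + 1) ^ d2" by blast
  have "cost (LSeq c d) n \<le> (K1 + K2) * (n + 1) ^ (d1 + d2)" for n
  proof -
    have p: "(n + 1) ^ d1 \<le> (n + 1) ^ (d1 + d2)" "(n + 1) ^ d2 \<le> (n + 1) ^ (d1 + d2)"
      by (auto intro: power_increasing)
    have "cost c n \<le> K1 * (n + 1) ^ (d1 + d2)" "cost d n \<le> K2 * (n + 1) ^ (d1 + d2)"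
      using * p by (meson mult_le_mono2 order_trans)+
    then show ?thesis unfolding cost.simps add_mult_distrib by linarith
  qed
  then show ?case by blast
next
  case (LCond b c d)
  then obtain K1 d1 K2 d2 where *: "\<forall>n. cost c n \<le> K1 * (n + 1) ^ d1" "\<forall>n. cost d n \<le> K2 * (n + 1) ^ d2" by blast
  have "cost (LCond b c d) n \<le> (1 + expr_time b + K1 + K2) * (n + 1) ^ (d1 + d2)" for n
  proof -
    have p: "(n + 1) ^ d1 \<le> (n + 1) ^ (d1 + d2)" "(n + 1) ^ d2 \<le> (n + 1) ^ (d1 + d2)" "1 \<le> (n + 1) ^ (d1 + d2)"
      by (auto intro: power_increasing simp: Suc_le_eq)
    have "cost c n \<le> K1 * (n + 1) ^ (d1 + d2)" "cost d n \<le> K2 * (n + 1) ^ (d1 + d2)"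
      using * p by (meson mult_le_mono2 order_trans)+
    moreover have "1 + expr_time b \<le> (1 + expr_time b) * (n + 1) ^ (d1 + d2)" using mult_le_mono2[OF p(3), of "1 + expr_time b"] by simp
    ultimately show ?thesis unfolding cost.simps add_mult_distrib by linarith
  qed
  then show ?case by blast
next
  case (LFor x c)
  then obtain K d where *: "\<forall>n. cost c n \<le> K * (n + 1) ^ d" by blast
  have "cost (LFor x c) n \<le> (14 + K) * (n + 1) ^ Suc d" for n
  proof -
    have p: "1 \<le> (n + 1) ^ d" by (simp add: Suc_le_eq)
    have "8 + cost c n \<le> (8 + K) * (n + 1) ^ d" using *[rule_format, of n] p unfolding add_mult_distrib by linarith
    then have "n * (8 + cost c n) \<le> (n + 1) * ((8 + K) * (n + 1) ^ d)" by (intro mult_le_mono) auto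
    moreover have "1 \<le> (n + 1) ^ Suc d" by (simp add: Suc_le_eq)
    ultimately show ?thesis by (simp add: algebra_simps)
  qed
  then show ?case by blast
next
  case LSkip show ?case by (rule exI[of _ 1], rule exI[of _ 0]) simp
next
  case (LAssign x e) show ?case by (rule exI[of _ "1 + expr_time e"], rule exI[of _ 0]) simp
next
  case (LStore a i e) show ?case by (rule exI[of _ "1 + expr_time i + expr_time e"], rule exI[of _ 0]) simp
qed

text \<open>The invariant must not depend on the loop register.\<close>

lemma sem_For:
  assumes wf: "wf_loops (LFor x c)" and n: "regs s0 0 = n" and I0: "I 0 s0"
    and ins: "\<And>i k s. I i s \<Longrightarrow> I i (set_reg x k s)"
    and step: "\<And>i s. i < n \<Longrightarrow> I i s \<Longrightarrow> regs s x = i \<Longrightarrow> (\<And>y. y \<noteq> x \<Longrightarrow> y \<notin> written_regs c \<Longrightarrow> regs s y = regs s0 y) \<Longrightarrow>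
      (\<And>a. a \<notin> written_arrs c \<Longrightarrow> arrs s a = arrs s0 a) \<Longrightarrow> I (Suc i) (sem c s)"
  shows "I n (sem (LFor x c) s0)"
proof -
  define F where "F i = foldl (\<lambda>s i. sem c (set_reg x i s)) s0 [0..<i]" for i
  have FS: "F (Suc i) = sem c (set_reg x i (F i))" for i by (simp add: F_def)
  have "i \<le> n \<Longrightarrow> I i (F i) \<and> (\<forall>y. y \<noteq> x \<longrightarrow> y \<notin> written_regs c \<longrightarrow> regs (F i) y = regs s0 y) \<and>
      (\<forall>a. a \<notin> written_arrs c \<longrightarrow> arrs (F i) a = arrs s0 a)" for i
  proof (induction i)
    case 0 then show ?case using I0 by (simp add: F_def)
  next
    case (Suc i)
    then have IH: "I i (F i)" "\<And>y. y \<noteq> x \<Longrightarrow> y \<notin> written_regs c \<Longrightarrow> regs (F i) y = regs s0 y"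
      "\<And>a. a \<notin> written_arrs c \<Longrightarrow> arrs (F i) a = arrs s0 a" by auto
    have "I (Suc i) (sem c (set_reg x i (F i)))"
      using Suc.prems IH by (intro step ins) auto
    then show ?case using IH sem_frame by (simp add: FS)
  qed
  from this[of n] have "I n (F n)" by simp
  then show ?thesis using ins n by (simp add: F_def)
qed

declare sem.simps(6) [simp del]

subsection \<open>Searching the graph\<close>

text \<open>Array \<open>0\<close> holds the input and array \<open>1\<close> the vertices that have not been discarded. Array \<open>2\<close> holds the
  multiples of \<open>n\<close>, array \<open>3\<close> the closed adjacency matrix of the current graph, array \<open>4\<close> its vertices,
  array \<open>5\<close> a second vertex set, and array \<open>6\<close> a path in the search tree.\<close>

definition mat :: "nat \<Rightarrow> nat \<Rightarrow> expr" where
  "mat x y = Elem 3 (Add (Elem 2 (Reg x)) (Reg y))"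

definition mem :: "nat \<Rightarrow> nat \<Rightarrow> expr" where
  "mem a x = Elem a (Reg x)"

definition "when" :: "expr \<Rightarrow> lprog \<Rightarrow> lprog" where
  "when b c = LCond b c LSkip"

definition represents :: "nat \<Rightarrow> (nat \<Rightarrow> nat \<Rightarrow> bool) \<Rightarrow> machine_state \<Rightarrow> bool" where
  "represents n M s \<longleftrightarrow> regs s 0 = n \<and> (\<forall>u<n. arrs s 2 u = u * n) \<and>
     (\<forall>u<n. \<forall>v<n. arrs s 3 (u * n + v) \<noteq> 0 \<longleftrightarrow> M u v)"

definition vset :: "nat \<Rightarrow> nat \<Rightarrow> machine_state \<Rightarrow> nat set" where
  "vset n a s = {u. u < n \<and> arrs s a u \<noteq> 0}"

lemma represents_frame:
  "represents n M s \<Longrightarrow> regs s' 0 = regs s 0 \<Longrightarrow> arrs s' 2 = arrs s 2 \<Longrightarrow> arrs s' 3 = arrs s 3 \<Longrightarrow> represents n M s'"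
  unfolding represents_def by simp

lemma mat_val: "represents n M s \<Longrightarrow> regs s x < n \<Longrightarrow> regs s y < n \<Longrightarrow> expr_val (mat x y) s \<noteq> 0 \<longleftrightarrow> M (regs s x) (regs s y)"
  unfolding represents_def mat_def by simp

lemma mem_val: "regs s x < n \<Longrightarrow> expr_val (mem a x) s \<noteq> 0 \<longleftrightarrow> regs s x \<in> vset n a s"
  unfolding vset_def mem_def by simp

lemma sem_when: "sem (when b c) s = (if expr_val b s \<noteq> 0 then sem c s else s)"
  by (simp add: when_def)

lemma when_simps [simp]:
  "written_regs (when b c) = written_regs c" "written_arrs (when b c) = written_arrs c" "wf_loops (when b c) = wf_loops c"
  by (simp_all add: when_def)

lemma vset_frame: "arrs s' a = arrs s a \<Longrightarrow> vset n a s' = vset n a s"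
  by (simp add: vset_def)

lemma represents_set_reg: "x \<noteq> 0 \<Longrightarrow> represents n M (set_reg x k s) = represents n M s"
  by (simp add: represents_def)

lemma vset_set_reg [simp]: "vset n a (set_reg x k s) = vset n a s"
  by (simp add: vset_def)

lemma vset_lt: "u \<in> vset n a s \<Longrightarrow> u < n"
  by (simp add: vset_def)

text \<open>Register \<open>10\<close> holds the candidate, \<open>11\<close> and \<open>12\<close>
  run through its neighbours, \<open>13\<close> is the flag that no violation has been seen, and
  \<open>14\<close> later receives the shifted result.\<close>

definition check_simp_row :: "nat \<Rightarrow> lprog" where
  "check_simp_row a = LFor 12 (when (mem a 12) (when (mat 10 12) (LCond (mat 11 12) LSkip (LAssign 13 (Const 0)))))"

lemma check_simp_row_frame [simp]:
  "written_regs (check_simp_row a) = {12, 13}" "written_arrs (check_simp_row a) = {}" "wf_loops (check_simp_row a)"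
  by (auto simp: check_simp_row_def)

lemma check_simp_row:
  assumes "represents n M s" "regs s 10 < n" "regs s 11 < n"
  shows "regs (sem (check_simp_row a) s) 13 \<noteq> 0 \<longleftrightarrow>
    regs s 13 \<noteq> 0 \<and> (\<forall>w\<in>vset n a s. M (regs s 10) w \<longrightarrow> M (regs s 11) w)"
proof -
  define I where "I i t \<longleftrightarrow> (regs t 13 \<noteq> 0 \<longleftrightarrow>
    regs s 13 \<noteq> 0 \<and> (\<forall>w\<in>vset n a s. w < i \<longrightarrow> M (regs s 10) w \<longrightarrow> M (regs s 11) w))" for i and t :: machine_state
  have "I n (sem (check_simp_row a) s)"
    unfolding check_simp_row_def
  proof (rule sem_For)
    fix i t assume i: "i < n" "I i t" "regs t 12 = i"
      and fr: "\<And>y. y \<noteq> 12 \<Longrightarrow> y \<notin> written_regs (when (mem a 12) (when (mat 10 12) (LCond (mat 11 12) LSkip (LAssign 13 (Const 0))))) \<Longrightarrow> regs t y = regs s y"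
        "\<And>b. b \<notin> written_arrs (when (mem a 12) (when (mat 10 12) (LCond (mat 11 12) LSkip (LAssign 13 (Const 0))))) \<Longrightarrow> arrs t b = arrs s b"
    have r: "regs t 10 = regs s 10" "regs t 11 = regs s 11" using fr(1)[of 10] fr(1)[of 11] by auto
    have R: "represents n M t" by (rule represents_frame[OF assms(1)]) (use fr in auto)
    have m: "expr_val (mem a 12) t \<noteq> 0 \<longleftrightarrow> i \<in> vset n a s"
      using mem_val[of t 12 n a] vset_frame[of t a s n] fr(2) i by auto
    have e: "expr_val (mat 10 12) t \<noteq> 0 \<longleftrightarrow> M (regs s 10) i" "expr_val (mat 11 12) t \<noteq> 0 \<longleftrightarrow> M (regs s 11) i"
      using mat_val[OF R, of 10 12] mat_val[OF R, of 11 12] r i assms by auto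
    show "I (Suc i) (sem (when (mem a 12) (when (mat 10 12) (LCond (mat 11 12) LSkip (LAssign 13 (Const 0))))) t)"
      using i(2) m e by (auto simp: I_def sem_when less_Suc_eq)
  qed (use assms in \<open>auto simp: I_def represents_def\<close>)
  then show ?thesis by (auto simp: I_def vset_lt)
qed

definition find_simplicial :: "nat \<Rightarrow> lprog" where
  "find_simplicial a = LAssign 14 (Const 0) \<then> LFor 10 (when (mem a 10) (LAssign 13 (Const 1) \<then>
     LFor 11 (when (mem a 11) (when (mat 10 11) (check_simp_row a))) \<then>
     when (Reg 13) (LAssign 14 (Add (Reg 10) (Const 1)))))"

lemma find_simplicial_frame [simp]:
  "written_regs (find_simplicial a) = {10, 11, 12, 13, 14}" "written_arrs (find_simplicial a) = {}" "wf_loops (find_simplicial a)"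
  by (auto simp: find_simplicial_def)

lemma check_simp_rows:
  assumes "represents n M s" "regs s 10 < n"
  shows "regs (sem (LFor 11 (when (mem a 11) (when (mat 10 11) (check_simp_row a)))) s) 13 \<noteq> 0 \<longleftrightarrow>
    regs s 13 \<noteq> 0 \<and> (\<forall>u\<in>vset n a s. M (regs s 10) u \<longrightarrow> (\<forall>w\<in>vset n a s. M (regs s 10) w \<longrightarrow> M u w))"
proof -
  define I where "I i t \<longleftrightarrow> (regs t 13 \<noteq> 0 \<longleftrightarrow> regs s 13 \<noteq> 0 \<and>
    (\<forall>u\<in>vset n a s. u < i \<longrightarrow> M (regs s 10) u \<longrightarrow> (\<forall>w\<in>vset n a s. M (regs s 10) w \<longrightarrow> M u w)))" for i and t :: machine_state
  let ?b = "when (mem a 11) (when (mat 10 11) (check_simp_row a))"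
  have "I n (sem (LFor 11 ?b) s)"
  proof (rule sem_For)
    fix i t assume i: "i < n" "I i t" "regs t 11 = i"
      and fr: "\<And>y. y \<noteq> 11 \<Longrightarrow> y \<notin> written_regs ?b \<Longrightarrow> regs t y = regs s y"
        "\<And>b. b \<notin> written_arrs ?b \<Longrightarrow> arrs t b = arrs s b"
    have r: "regs t 10 = regs s 10" using fr(1)[of 10] by auto
    have R: "represents n M t" by (rule represents_frame[OF assms(1)]) (use fr in auto)
    have v: "vset n a t = vset n a s" using vset_frame[of t a s n] fr(2) by auto
    have m: "expr_val (mem a 11) t \<noteq> 0 \<longleftrightarrow> i \<in> vset n a s" using mem_val[of t 11 n a] v i by auto
    have e: "expr_val (mat 10 11) t \<noteq> 0 \<longleftrightarrow> M (regs s 10) i" using mat_val[OF R, of 10 11] r i assms by auto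
    have c: "regs (sem (check_simp_row a) t) 13 \<noteq> 0 \<longleftrightarrow> regs t 13 \<noteq> 0 \<and> (\<forall>w\<in>vset n a s. M (regs s 10) w \<longrightarrow> M i w)"
      using check_simp_row[OF R] r i v assms by auto
    show "I (Suc i) (sem ?b t)"
      using i(2) m e c by (auto simp: I_def sem_when less_Suc_eq)
  qed (use assms in \<open>auto simp: I_def represents_def\<close>)
  then show ?thesis by (auto simp: I_def vset_lt)
qed

lemma find_simplicial:
  assumes "represents n M s"
  shows "regs (sem (find_simplicial a) s) 14 = last_sat (simp_v M (vset n a s)) n"
proof -
  define I where "I i t \<longleftrightarrow> regs t 14 = last_sat (simp_v M (vset n a s)) i" for i and t :: machine_state
  let ?d = "LFor 11 (when (mem a 11) (when (mat 10 11) (check_simp_row a)))"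
  let ?b = "when (mem a 10) (LAssign 13 (Const 1) \<then> ?d \<then> when (Reg 13) (LAssign 14 (Add (Reg 10) (Const 1))))"
  let ?s = "set_reg 14 0 s"
  have "I n (sem (LFor 10 ?b) ?s)"
  proof (rule sem_For)
    fix i t assume i: "i < n" "I i t" "regs t 10 = i"
      and fr: "\<And>y. y \<noteq> 10 \<Longrightarrow> y \<notin> written_regs ?b \<Longrightarrow> regs t y = regs ?s y"
        "\<And>b. b \<notin> written_arrs ?b \<Longrightarrow> arrs t b = arrs ?s b"
    let ?t = "set_reg 13 1 t"
    have R: "represents n M ?t" by (rule represents_frame[OF assms]) (use fr in auto)
    have v: "vset n a t = vset n a s" using vset_frame[of t a s n] fr(2) by auto
    have m: "expr_val (mem a 10) t \<noteq> 0 \<longleftrightarrow> i \<in> vset n a s" using mem_val[of t 10 n a] v i by auto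
    have c: "regs (sem ?d ?t) 13 \<noteq> 0 \<longleftrightarrow> (\<forall>u\<in>vset n a s. M i u \<longrightarrow> (\<forall>w\<in>vset n a s. M i w \<longrightarrow> M u w))"
      using check_simp_rows[OF R, of a] i v by auto
    have k: "regs (sem ?d ?t) 14 = regs t 14" "regs (sem ?d ?t) 10 = i"
      using sem_frame(1)[of 14 ?d ?t] sem_frame(1)[of 10 ?d ?t] i by auto
    have sv: "simp_v M (vset n a s) i \<longleftrightarrow> i \<in> vset n a s \<and> regs (sem ?d ?t) 13 \<noteq> 0"
      unfolding c simp_v_def by blast
    show "I (Suc i) (sem ?b t)"
      using i(2) m k sv by (simp add: I_def sem_when)
  qed (use assms in \<open>auto simp: I_def represents_def\<close>)
  then show ?thesis by (simp add: I_def find_simplicial_def)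
qed

definition remove_nb :: "nat \<Rightarrow> nat \<Rightarrow> lprog" where
  "remove_nb a v = LFor 11 (when (mat v 11) (LStore a (Reg 11) (Const 0)))"

lemma remove_nb_frame [simp]:
  "written_regs (remove_nb a v) = {11}" "written_arrs (remove_nb a v) = {a}" "wf_loops (remove_nb a v)"
  by (auto simp: remove_nb_def)

lemma remove_nb:
  assumes "represents n M s" "regs s v < n" "v \<noteq> 11" "a \<noteq> 2" "a \<noteq> 3"
  shows "vset n a (sem (remove_nb a v) s) = vset n a s - {u. M (regs s v) u}"
proof -
  define I where "I i t \<longleftrightarrow> vset n a t = vset n a s - {u. u < i \<and> M (regs s v) u}" for i and t :: machine_state
  let ?b = "when (mat v 11) (LStore a (Reg 11) (Const 0))"
  have "I n (sem (LFor 11 ?b) s)"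
  proof (rule sem_For)
    fix i t assume i: "i < n" "I i t" "regs t 11 = i"
      and fr: "\<And>y. y \<noteq> 11 \<Longrightarrow> y \<notin> written_regs ?b \<Longrightarrow> regs t y = regs s y"
        "\<And>b. b \<notin> written_arrs ?b \<Longrightarrow> arrs t b = arrs s b"
    have R: "represents n M t" by (rule represents_frame[OF assms(1)]) (use fr assms in auto)
    have e: "expr_val (mat v 11) t \<noteq> 0 \<longleftrightarrow> M (regs s v) i" using mat_val[OF R, of v 11] fr(1)[of v] i assms by auto
    have "vset n a (set_elem a i 0 t) = vset n a t - {i}" by (auto simp: vset_def)
    then show "I (Suc i) (sem ?b t)" using i e by (auto simp: I_def sem_when less_Suc_eq)
  qed (use assms in \<open>auto simp: I_def represents_def\<close>)
  then show ?thesis by (auto simp: I_def remove_nb_def vset_lt intro: vset_lt)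
qed

definition elim_once :: lprog where
  "elim_once = find_simplicial 5 \<then> when (Reg 14) (LAssign 15 (Sub (Reg 14) (Const 1)) \<then> remove_nb 5 15)"

lemma elim_once_frame [simp]:
  "written_regs elim_once = {10, 11, 12, 13, 14, 15}" "written_arrs elim_once = {5}" "wf_loops elim_once"
  by (auto simp: elim_once_def)

lemma elim_once:
  assumes "represents n M s"
  shows "vset n 5 (sem elim_once s) = elim_step n M (vset n 5 s)"
proof -
  define t where "t = sem (find_simplicial 5) s"
  define p where "p = last_sat (simp_v M (vset n 5 s)) n"
  have R: "represents n M t" using assms sem_frame by (intro represents_frame[OF assms]) (auto simp: t_def)
  have p: "regs t 14 = p" using find_simplicial[OF assms] by (simp add: t_def p_def)
  have v: "vset n 5 t = vset n 5 s" using sem_frame(2) by (intro vset_frame) (auto simp: t_def)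
  have "p - 1 < n" if "p \<noteq> 0" using last_sat_pos that by (simp add: p_def)
  then have "vset n 5 (sem (remove_nb 5 15) (set_reg 15 (p - 1) t)) = vset n 5 s - {u. M (p - 1) u}" if "p \<noteq> 0"
    using that R v by (subst remove_nb[of n M]) (auto simp: represents_set_reg)
  then show ?thesis using p v by (simp add: elim_once_def sem_when t_def[symmetric] elim_step_def p_def[symmetric])
qed

text \<open>The elimination works on array \<open>5\<close> so that array \<open>4\<close> stays
  intact; register \<open>18\<close> merely counts \<open>n\<close> rounds.\<close>

definition easy_test :: lprog where
  "easy_test = LFor 11 (LCond (mat 16 11) (LStore 5 (Reg 11) (Const 0)) (LStore 5 (Reg 11) (mem 4 11))) \<then>
     LFor 18 elim_once \<then> LAssign 19 (Const 1) \<then> LFor 11 (when (mem 5 11) (LAssign 19 (Const 0)))"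

lemma easy_test_frame [simp]:
  "written_regs easy_test = {10, 11, 12, 13, 14, 15, 18, 19}" "written_arrs easy_test = {5}" "wf_loops easy_test"
  by (auto simp: easy_test_def)

lemma easy_test:
  assumes "represents n M s" "regs s 16 < n"
  shows "regs (sem easy_test s) 19 \<noteq> 0 \<longleftrightarrow> (elim_step n M ^^ n) (vset n 4 s - {u. M (regs s 16) u}) = {}"
proof -
  let ?b1 = "LCond (mat 16 11) (LStore 5 (Reg 11) (Const 0)) (LStore 5 (Reg 11) (mem 4 11))"
  let ?b3 = "when (mem 5 11) (LAssign 19 (Const 0))"
  define W where "W = vset n 4 s - {u. M (regs s 16) u}"
  define s1 where "s1 = sem (LFor 11 ?b1) s"
  define I1 where "I1 i t \<longleftrightarrow> (\<forall>u<i. arrs t 5 u \<noteq> 0 \<longleftrightarrow> u \<in> W)" for i and t :: machine_state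
  have n0: "regs s 0 = n" using assms by (simp add: represents_def)
  have "I1 n s1" unfolding s1_def
  proof (rule sem_For)
    fix i t assume i: "i < n" "I1 i t" "regs t 11 = i"
      and fr: "\<And>y. y \<noteq> 11 \<Longrightarrow> y \<notin> written_regs ?b1 \<Longrightarrow> regs t y = regs s y"
        "\<And>b. b \<notin> written_arrs ?b1 \<Longrightarrow> arrs t b = arrs s b"
    have R: "represents n M t" by (rule represents_frame[OF assms(1)]) (use fr in auto)
    have e: "expr_val (mat 16 11) t \<noteq> 0 \<longleftrightarrow> M (regs s 16) i" using mat_val[OF R, of 16 11] fr(1)[of 16] i assms by auto
    have m: "expr_val (mem 4 11) t \<noteq> 0 \<longleftrightarrow> i \<in> vset n 4 s"
      using mem_val[of t 11 n 4] vset_frame[of t 4 s n] fr(2)[of 4] i by auto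
    show "I1 (Suc i) (sem ?b1 t)" using i e m by (auto simp: I1_def W_def less_Suc_eq)
  qed (auto simp: I1_def n0)
  then have v1: "vset n 5 s1 = W" by (auto simp: I1_def vset_def W_def)
  have R1: "represents n M s1" by (rule represents_frame[OF assms(1)]) (use sem_frame in \<open>auto simp: s1_def\<close>)
  define s2 where "s2 = sem (LFor 18 elim_once) s1"
  define I2 where "I2 i t \<longleftrightarrow> vset n 5 t = (elim_step n M ^^ i) W" for i and t :: machine_state
  have "I2 n s2" unfolding s2_def
  proof (rule sem_For)
    fix i t assume i: "i < n" "I2 i t" "regs t 18 = i"
      and fr: "\<And>y. y \<noteq> 18 \<Longrightarrow> y \<notin> written_regs elim_once \<Longrightarrow> regs t y = regs s1 y"
        "\<And>b. b \<notin> written_arrs elim_once \<Longrightarrow> arrs t b = arrs s1 b"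
    have R: "represents n M t" by (rule represents_frame[OF R1]) (use fr in auto)
    show "I2 (Suc i) (sem elim_once t)" using elim_once[OF R] i by (simp add: I2_def)
  qed (use R1 in \<open>auto simp: I2_def v1 represents_def\<close>)
  then have v2: "vset n 5 s2 = (elim_step n M ^^ n) W" by (simp add: I2_def)
  define s3 where "s3 = set_reg 19 1 s2"
  define I3 where "I3 i t \<longleftrightarrow> (regs t 19 \<noteq> 0 \<longleftrightarrow> (\<forall>u\<in>vset n 5 s2. \<not> u < i))" for i and t :: machine_state
  have "regs s2 0 = regs s1 0" unfolding s2_def by (rule sem_frame) simp
  then have "regs s2 0 = n" using R1 by (simp add: represents_def)
  then have n3: "regs s3 0 = n" by (simp add: s3_def)
  have "I3 n (sem (LFor 11 ?b3) s3)"
  proof (rule sem_For)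
    fix i t assume i: "i < n" "I3 i t" "regs t 11 = i"
      and fr: "\<And>b. b \<notin> written_arrs ?b3 \<Longrightarrow> arrs t b = arrs s3 b"
    have "expr_val (mem 5 11) t \<noteq> 0 \<longleftrightarrow> i \<in> vset n 5 s2"
      using mem_val[of t 11 n 5] vset_frame[of t 5 s2 n] fr[of 5] i by (auto simp: s3_def)
    then show "I3 (Suc i) (sem ?b3 t)" using i by (auto simp: I3_def sem_when less_Suc_eq)
  qed (use \<open>regs s2 0 = n\<close> in \<open>auto simp: I3_def s3_def\<close>)
  moreover have "sem easy_test s = sem (LFor 11 ?b3) s3"
    by (simp add: easy_test_def s1_def s2_def s3_def)
  moreover have "(\<forall>u\<in>vset n 5 s2. \<not> u < n) \<longleftrightarrow> vset n 5 s2 = {}" by (auto simp: vset_def)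
  ultimately show ?thesis using v2 by (simp add: I3_def W_def)
qed

definition find_easy :: lprog where
  "find_easy = LAssign 20 (Const 0) \<then>
     LFor 16 (when (mem 4 16) (easy_test \<then> when (Reg 19) (LAssign 20 (Add (Reg 16) (Const 1)))))"

lemma find_easy_frame [simp]:
  "written_regs find_easy = {10, 11, 12, 13, 14, 15, 16, 18, 19, 20}" "written_arrs find_easy = {5}" "wf_loops find_easy"
  by (auto simp: find_easy_def)

lemma find_easy:
  assumes "represents n M s"
  shows "regs (sem find_easy s) 20 = last_sat (easy n M (vset n 4 s)) n"
proof -
  define I where "I i t \<longleftrightarrow> regs t 20 = last_sat (easy n M (vset n 4 s)) i" for i and t :: machine_state
  let ?b = "when (mem 4 16) (easy_test \<then> when (Reg 19) (LAssign 20 (Add (Reg 16) (Const 1))))"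
  let ?s = "set_reg 20 0 s"
  have "I n (sem (LFor 16 ?b) ?s)"
  proof (rule sem_For)
    fix i t assume i: "i < n" "I i t" "regs t 16 = i"
      and fr: "\<And>y. y \<noteq> 16 \<Longrightarrow> y \<notin> written_regs ?b \<Longrightarrow> regs t y = regs ?s y"
        "\<And>b. b \<notin> written_arrs ?b \<Longrightarrow> arrs t b = arrs ?s b"
    have R: "represents n M t" by (rule represents_frame[OF assms]) (use fr in auto)
    have v: "vset n 4 t = vset n 4 s" using vset_frame[of t 4 s n] fr(2) by auto
    have m: "expr_val (mem 4 16) t \<noteq> 0 \<longleftrightarrow> i \<in> vset n 4 s" using mem_val[of t 16 n 4] v i by auto
    have k: "regs (sem easy_test t) 20 = regs t 20" "regs (sem easy_test t) 16 = i"
      using sem_frame(1)[of 20 easy_test t] sem_frame(1)[of 16 easy_test t] i by auto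
    have sv: "easy n M (vset n 4 s) i \<longleftrightarrow> i \<in> vset n 4 s \<and> regs (sem easy_test t) 19 \<noteq> 0"
      using easy_test[OF R] i v by (auto simp: easy_def)
    show "I (Suc i) (sem ?b t)" using i(2) m k sv by (simp add: I_def sem_when)
  qed (use assms in \<open>auto simp: I_def represents_def\<close>)
  then show ?thesis by (simp add: I_def find_easy_def)
qed



definition count_nb :: "nat \<Rightarrow> lprog" where
  "count_nb v = LFor 12 (when (mem 4 12) (when (mat v 12) (LAssign 25 (Add (Reg 25) (Const 1)))))"

lemma count_nb_frame [simp]:
  "written_regs (count_nb v) = {12, 25}" "written_arrs (count_nb v) = {}" "v \<noteq> 12 \<Longrightarrow> wf_loops (count_nb v)"
  by (auto simp: count_nb_def)

lemma count_nb:
  assumes "represents n M s" "regs s v < n" "v \<noteq> 12" "v \<noteq> 25"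
  shows "regs (sem (count_nb v) s) 25 = regs s 25 + cdeg M (vset n 4 s) (regs s v)"
proof -
  define I where "I i t \<longleftrightarrow> regs t 25 = regs s 25 + card {u \<in> vset n 4 s. u < i \<and> M (regs s v) u}" for i and t :: machine_state
  let ?b = "when (mem 4 12) (when (mat v 12) (LAssign 25 (Add (Reg 25) (Const 1))))"
  have "I n (sem (LFor 12 ?b) s)"
  proof (rule sem_For)
    fix i t assume i: "i < n" "I i t" "regs t 12 = i"
      and fr: "\<And>y. y \<noteq> 12 \<Longrightarrow> y \<notin> written_regs ?b \<Longrightarrow> regs t y = regs s y"
        "\<And>b. b \<notin> written_arrs ?b \<Longrightarrow> arrs t b = arrs s b"
    have R: "represents n M t" by (rule represents_frame[OF assms(1)]) (use fr in auto)
    have m: "expr_val (mem 4 12) t \<noteq> 0 \<longleftrightarrow> i \<in> vset n 4 s"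
      using mem_val[of t 12 n 4] vset_frame[of t 4 s n] fr(2) i by auto
    have e: "expr_val (mat v 12) t \<noteq> 0 \<longleftrightarrow> M (regs s v) i" using mat_val[OF R, of v 12] fr(1)[of v] i assms by auto
    have "{u \<in> vset n 4 s. u < Suc i \<and> M (regs s v) u} = (if i \<in> vset n 4 s \<and> M (regs s v) i
        then insert i {u \<in> vset n 4 s. u < i \<and> M (regs s v) u} else {u \<in> vset n 4 s. u < i \<and> M (regs s v) u})"
      by (auto simp: less_Suc_eq)
    then show "I (Suc i) (sem ?b t)" using i m e by (simp add: I_def sem_when)
  qed (use assms in \<open>auto simp: I_def represents_def\<close>)
  moreover have "{u \<in> vset n 4 s. u < n \<and> M (regs s v) u} = {u \<in> vset n 4 s. M (regs s v) u}" by (auto simp: vset_lt)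
  ultimately show ?thesis by (simp add: I_def count_nb_def cdeg_def)
qed

text \<open>The sum of the two truncated differences is the distance of register \<open>25\<close>
  from \<open>3\<close>, so it vanishes only at equality.\<close>

definition find_deg2 :: lprog where
  "find_deg2 = LAssign 22 (Const 0) \<then> LFor 16 (when (mem 4 16) (LAssign 25 (Const 0) \<then> count_nb 16 \<then>
     LCond (Add (Sub (Reg 25) (Const 3)) (Sub (Const 3) (Reg 25))) LSkip (LAssign 22 (Add (Reg 16) (Const 1)))))"

lemma find_deg2_frame [simp]:
  "written_regs find_deg2 = {12, 16, 22, 25}" "written_arrs find_deg2 = {}" "wf_loops find_deg2"
  by (auto simp: find_deg2_def)

lemma find_deg2:
  assumes "represents n M s"
  shows "regs (sem find_deg2 s) 22 = last_sat (\<lambda>v. v \<in> vset n 4 s \<and> cdeg M (vset n 4 s) v = 3) n"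
proof -
  define I where "I i t \<longleftrightarrow> regs t 22 = last_sat (\<lambda>v. v \<in> vset n 4 s \<and> cdeg M (vset n 4 s) v = 3) i" for i and t :: machine_state
  let ?b = "when (mem 4 16) (LAssign 25 (Const 0) \<then> count_nb 16 \<then>
     LCond (Add (Sub (Reg 25) (Const 3)) (Sub (Const 3) (Reg 25))) LSkip (LAssign 22 (Add (Reg 16) (Const 1))))"
  let ?s = "set_reg 22 0 s"
  have "I n (sem (LFor 16 ?b) ?s)"
  proof (rule sem_For)
    fix i t assume i: "i < n" "I i t" "regs t 16 = i"
      and fr: "\<And>y. y \<noteq> 16 \<Longrightarrow> y \<notin> written_regs ?b \<Longrightarrow> regs t y = regs ?s y"
        "\<And>b. b \<notin> written_arrs ?b \<Longrightarrow> arrs t b = arrs ?s b"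
    let ?t = "set_reg 25 0 t"
    have R: "represents n M ?t" by (rule represents_frame[OF assms]) (use fr in auto)
    have v: "vset n 4 t = vset n 4 s" using vset_frame[of t 4 s n] fr(2) by auto
    have m: "expr_val (mem 4 16) t \<noteq> 0 \<longleftrightarrow> i \<in> vset n 4 s" using mem_val[of t 16 n 4] v i by auto
    have k: "regs (sem (count_nb 16) ?t) 22 = regs t 22" "regs (sem (count_nb 16) ?t) 16 = i"
      using sem_frame(1)[of 22 "count_nb 16" ?t] sem_frame(1)[of 16 "count_nb 16" ?t] i by auto
    have c: "regs (sem (count_nb 16) ?t) 25 = cdeg M (vset n 4 s) i" using count_nb[OF R, of 16] i v by auto
    show "I (Suc i) (sem ?b t)" using i(2) m k c by (auto simp: I_def sem_when)
  qed (use assms in \<open>auto simp: I_def represents_def\<close>)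
  then show ?thesis by (simp add: I_def find_deg2_def)
qed

definition compute_vol :: lprog where
  "compute_vol = LAssign 25 (Const 0) \<then> LFor 11 (when (mem 4 11) (when (mat 16 11) (count_nb 11)))"

lemma compute_vol_frame [simp]:
  "written_regs compute_vol = {11, 12, 25}" "written_arrs compute_vol = {}" "wf_loops compute_vol"
  by (auto simp: compute_vol_def)

lemma compute_vol:
  assumes "represents n M s" "regs s 16 \<in> vset n 4 s"
  shows "regs (sem compute_vol s) 25 = cvol M (vset n 4 s) (regs s 16)"
proof -
  let ?A = "vset n 4 s"
  define I where "I i t \<longleftrightarrow> regs t 25 = (\<Sum>u | u \<in> ?A \<and> u < i \<and> M (regs s 16) u. cdeg M ?A u)" for i and t :: machine_state
  let ?b = "when (mem 4 11) (when (mat 16 11) (count_nb 11))"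
  let ?s = "set_reg 25 0 s"
  have "I n (sem (LFor 11 ?b) ?s)"
  proof (rule sem_For)
    fix i t assume i: "i < n" "I i t" "regs t 11 = i"
      and fr: "\<And>y. y \<noteq> 11 \<Longrightarrow> y \<notin> written_regs ?b \<Longrightarrow> regs t y = regs ?s y"
        "\<And>b. b \<notin> written_arrs ?b \<Longrightarrow> arrs t b = arrs ?s b"
    have R: "represents n M t" by (rule represents_frame[OF assms(1)]) (use fr in auto)
    have v: "vset n 4 t = ?A" using vset_frame[of t 4 s n] fr(2) by auto
    have m: "expr_val (mem 4 11) t \<noteq> 0 \<longleftrightarrow> i \<in> ?A" using mem_val[of t 11 n 4] v i by auto
    have e: "expr_val (mat 16 11) t \<noteq> 0 \<longleftrightarrow> M (regs s 16) i"
      using mat_val[OF R, of 16 11] fr(1)[of 16] i assms by (auto simp: vset_lt)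
    have c: "regs (sem (count_nb 11) t) 25 = regs t 25 + cdeg M ?A i" using count_nb[OF R, of 11] i v by auto
    have "{u. u \<in> ?A \<and> u < Suc i \<and> M (regs s 16) u} = (if i \<in> ?A \<and> M (regs s 16) i
        then insert i {u. u \<in> ?A \<and> u < i \<and> M (regs s 16) u} else {u. u \<in> ?A \<and> u < i \<and> M (regs s 16) u})"
      by (auto simp: less_Suc_eq)
    then show "I (Suc i) (sem ?b t)" using i m e c by (simp add: I_def sem_when)
  qed (use assms in \<open>auto simp: I_def represents_def\<close>)
  moreover have "{u. u \<in> ?A \<and> u < n \<and> M (regs s 16) u} = {u. u \<in> ?A \<and> M (regs s 16) u}" by (auto simp: vset_lt)
  ultimately show ?thesis using assms(2) by (simp add: I_def compute_vol_def cvol_def)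
qed

text \<open>The truncated difference is nonzero only for a strict improvement, as in
  \<open>argmax\<close>.\<close>

definition find_heavy :: lprog where
  "find_heavy = LAssign 23 (Const 0) \<then> LAssign 24 (Const 0) \<then> LFor 16 (when (mem 4 16) (compute_vol \<then>
     when (Sub (Reg 25) (Reg 24)) (LAssign 24 (Reg 25) \<then> LAssign 23 (Add (Reg 16) (Const 1)))))"

lemma find_heavy_frame [simp]:
  "written_regs find_heavy = {11, 12, 16, 23, 24, 25}" "written_arrs find_heavy = {}" "wf_loops find_heavy"
  by (auto simp: find_heavy_def)

lemma find_heavy:
  assumes "represents n M s"
  shows "regs (sem find_heavy s) 23 = argmax (cvol M (vset n 4 s)) n"
proof -
  let ?f = "cvol M (vset n 4 s)"
  define I where "I i t \<longleftrightarrow> regs t 23 = argmax ?f i \<and> regs t 24 = (if argmax ?f i = 0 then 0 else ?f (argmax ?f i - 1))" for i and t :: machine_state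
  let ?b = "when (mem 4 16) (compute_vol \<then>
     when (Sub (Reg 25) (Reg 24)) (LAssign 24 (Reg 25) \<then> LAssign 23 (Add (Reg 16) (Const 1))))"
  let ?s = "set_reg 24 0 (set_reg 23 0 s)"
  have "I n (sem (LFor 16 ?b) ?s)"
  proof (rule sem_For)
    fix i t assume i: "i < n" "I i t" "regs t 16 = i"
      and fr: "\<And>y. y \<noteq> 16 \<Longrightarrow> y \<notin> written_regs ?b \<Longrightarrow> regs t y = regs ?s y"
        "\<And>b. b \<notin> written_arrs ?b \<Longrightarrow> arrs t b = arrs ?s b"
    have R: "represents n M t" by (rule represents_frame[OF assms]) (use fr in auto)
    have v: "vset n 4 t = vset n 4 s" using vset_frame[of t 4 s n] fr(2) by auto
    have m: "expr_val (mem 4 16) t \<noteq> 0 \<longleftrightarrow> i \<in> vset n 4 s" using mem_val[of t 16 n 4] v i by auto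
    have k: "regs (sem compute_vol t) 23 = regs t 23" "regs (sem compute_vol t) 24 = regs t 24" "regs (sem compute_vol t) 16 = i"
      using sem_frame(1)[of 23 compute_vol t] sem_frame(1)[of 24 compute_vol t] sem_frame(1)[of 16 compute_vol t] i by auto
    show "I (Suc i) (sem ?b t)"
    proof (cases "i \<in> vset n 4 s")
      case True
      then have "regs (sem compute_vol t) 25 = ?f i" using compute_vol[OF R] i v by auto
      then show ?thesis using i(2) m k True by (simp add: I_def sem_when split: if_splits)
    next
      case False
      then have "?f i = 0" by (simp add: cvol_def)
      then show ?thesis using i(2) m False by (simp add: I_def sem_when)
    qed
  qed (use assms in \<open>auto simp: I_def represents_def\<close>)
  then show ?thesis by (simp add: I_def find_heavy_def)
qed

subsection \<open>One step of the search\<close>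

definition find_nb :: lprog where
  "find_nb = LAssign 26 (Const 0) \<then> LFor 11 (when (mem 4 11) (when (mat 16 11) (LAssign 26 (Add (Reg 11) (Const 1)))))"

lemma find_nb_frame [simp]:
  "written_regs find_nb = {11, 26}" "written_arrs find_nb = {}" "wf_loops find_nb"
  by (auto simp: find_nb_def)

lemma find_nb:
  assumes "represents n M s" "regs s 16 < n"
  shows "regs (sem find_nb s) 26 = last_sat (\<lambda>u. u \<in> vset n 4 s \<and> M (regs s 16) u) n"
proof -
  define I where "I i t \<longleftrightarrow> regs t 26 = last_sat (\<lambda>u. u \<in> vset n 4 s \<and> M (regs s 16) u) i" for i and t :: machine_state
  let ?b = "when (mem 4 11) (when (mat 16 11) (LAssign 26 (Add (Reg 11) (Const 1))))"
  let ?s = "set_reg 26 0 s"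
  have "I n (sem (LFor 11 ?b) ?s)"
  proof (rule sem_For)
    fix i t assume i: "i < n" "I i t" "regs t 11 = i"
      and fr: "\<And>y. y \<noteq> 11 \<Longrightarrow> y \<notin> written_regs ?b \<Longrightarrow> regs t y = regs ?s y"
        "\<And>b. b \<notin> written_arrs ?b \<Longrightarrow> arrs t b = arrs ?s b"
    have R: "represents n M t" by (rule represents_frame[OF assms(1)]) (use fr in auto)
    have m: "expr_val (mem 4 11) t \<noteq> 0 \<longleftrightarrow> i \<in> vset n 4 s"
      using mem_val[of t 11 n 4] vset_frame[of t 4 s n] fr(2) i by auto
    have e: "expr_val (mat 16 11) t \<noteq> 0 \<longleftrightarrow> M (regs s 16) i" using mat_val[OF R, of 16 11] fr(1)[of 16] i assms by auto
    show "I (Suc i) (sem ?b t)" using i m e by (simp add: I_def sem_when)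
  qed (use assms in \<open>auto simp: I_def represents_def\<close>)
  then show ?thesis by (simp add: I_def find_nb_def)
qed

definition merge_prog :: lprog where
  "merge_prog = LFor 11 (when (mat 27 11) (LStore 3 (Add (Elem 2 (Reg 29)) (Reg 11)) (Const 1)) \<then>
     when (mat 11 27) (LStore 3 (Add (Elem 2 (Reg 11)) (Reg 29)) (Const 1)))"

lemma merge_prog_frame [simp]:
  "written_regs merge_prog = {11}" "written_arrs merge_prog = {3}" "wf_loops merge_prog"
  by (auto simp: merge_prog_def)

lemma index_inj: "v < n \<Longrightarrow> y < n \<Longrightarrow> u * n + v = x * n + y \<longleftrightarrow> u = x \<and> v = (y::nat)"
proof
  assume vy: "v < n" "y < n" and e: "u * n + v = x * n + y"
  have "(u * n + v) div n = u" "(x * n + y) div n = x" "(u * n + v) mod n = v" "(x * n + y) mod n = y"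
    using vy by (simp_all add: div_mult_self3)
  then show "u = x \<and> v = y" using e by metis
qed auto

lemma represents_store:
  assumes "represents n N t" "x < n" "y < n"
  shows "represents n (\<lambda>u v. N u v \<or> u = x \<and> v = y) (set_elem 3 (x * n + y) (Suc 0) t)"
  using assms index_inj[of _ n y _ x] unfolding represents_def by auto

lemma merge_prog:
  assumes s: "represents n M s" and M: "sym_refl M" and ab: "regs s 29 < n" "regs s 27 < n"
  shows "represents n (merge M (regs s 29) (regs s 27)) (sem merge_prog s)"
proof -
  define a b where "a = regs s 29" and "b = regs s 27"
  have refl: "M u u" for u using M by (simp add: sym_refl_def)
  define N where "N i u v \<longleftrightarrow> M u v \<or> (u = a \<and> v < i \<and> M b v) \<or> (v = a \<and> u < i \<and> M u b)" for i u v
  define I where "I i t \<longleftrightarrow> represents n (N i) t" for i t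
  let ?b1 = "when (mat 27 11) (LStore 3 (Add (Elem 2 (Reg 29)) (Reg 11)) (Const 1))"
  let ?b2 = "when (mat 11 27) (LStore 3 (Add (Elem 2 (Reg 11)) (Reg 29)) (Const 1))"
  have "I n (sem (LFor 11 (?b1 \<then> ?b2)) s)"
  proof (rule sem_For)
    fix i t assume i: "i < n" "I i t" "regs t 11 = i"
      and fr: "\<And>y. y \<noteq> 11 \<Longrightarrow> y \<notin> written_regs (?b1 \<then> ?b2) \<Longrightarrow> regs t y = regs s y"
    have r: "regs t 29 = a" "regs t 27 = b" using fr by (auto simp: a_def b_def)
    have R: "represents n (N i) t" using i by (simp add: I_def)
    have row: "arrs t 2 u = u * n" if "u < n" for u using R that by (simp add: represents_def)
    have an: "a < n" "b < n" using ab by (auto simp: a_def b_def)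
    have e: "expr_val (mat 27 11) t \<noteq> 0 \<longleftrightarrow> N i b i" using mat_val[OF R, of 27 11] r i an by auto
    define t1 where "t1 = sem ?b1 t"
    define N1 where "N1 u v \<longleftrightarrow> N i u v \<or> (u = a \<and> v = i) \<and> N i b i" for u v
    have R1: "represents n N1 t1"
    proof (cases "N i b i")
      case True
      then have "t1 = set_elem 3 (a * n + i) (Suc 0) t" using e r i an row by (simp add: t1_def sem_when)
      moreover have "N1 = (\<lambda>u v. N i u v \<or> u = a \<and> v = i)" using True by (auto simp: N1_def fun_eq_iff)
      ultimately show ?thesis using represents_store[OF R an(1) i(1)] by simp
    next
      case False
      then have "t1 = t" using e by (simp add: t1_def sem_when)
      moreover have "N1 = N i" using False by (auto simp: N1_def fun_eq_iff)
      ultimately show ?thesis using R by simp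
    qed
    have r1: "regs t1 29 = a" "regs t1 27 = b" "regs t1 11 = i"
      using r i sem_frame(1)[of _ ?b1 t] by (auto simp: t1_def)
    have row1: "arrs t1 2 u = u * n" if "u < n" for u using R1 that by (simp add: represents_def)
    have e1: "expr_val (mat 11 27) t1 \<noteq> 0 \<longleftrightarrow> N1 i b" using mat_val[OF R1, of 11 27] r1 i an by auto
    define N2 where "N2 u v \<longleftrightarrow> N1 u v \<or> (u = i \<and> v = a) \<and> N1 i b" for u v
    have R2: "represents n N2 (sem ?b2 t1)"
    proof (cases "N1 i b")
      case True
      then have "sem ?b2 t1 = set_elem 3 (i * n + a) (Suc 0) t1" using e1 r1 i an row1 by (simp add: sem_when)
      moreover have "N2 = (\<lambda>u v. N1 u v \<or> u = i \<and> v = a)" using True by (auto simp: N2_def fun_eq_iff)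
      ultimately show ?thesis using represents_store[OF R1 i(1) an(1)] by simp
    next
      case False
      then have "sem ?b2 t1 = t1" using e1 by (simp add: sem_when)
      moreover have "N2 = N1" using False by (auto simp: N2_def fun_eq_iff)
      ultimately show ?thesis using R1 by simp
    qed
    \<comment> \<open>Updating in place is harmless: for \<open>a\<close> distinct from
      \<open>b\<close>, an entry changed earlier can be read again only for \<open>i = a\<close>,
      and then the write goes to the diagonal entry of \<open>a\<close>, which is true by
      reflexivity.\<close>
    have "N2 u v \<longleftrightarrow> N (Suc i) u v" for u v
      using refl unfolding N2_def N1_def N_def less_Suc_eq by blast
    then have "N2 = N (Suc i)" by (simp add: fun_eq_iff)
    then show "I (Suc i) (sem (?b1 \<then> ?b2) t)" using R2 by (simp add: I_def t1_def)
  next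
    have "N 0 = M" by (auto simp: N_def fun_eq_iff)
    then show "I 0 s" using s by (simp add: I_def)
  qed (use s in \<open>auto simp: I_def represents_def\<close>)
  then have "represents n (N n) (sem merge_prog s)" by (simp add: I_def merge_prog_def)
  moreover have "N n u v \<longleftrightarrow> merge M a b u v" if "u < n" "v < n" for u v
    using refl that unfolding N_def merge_def by auto
  ultimately show ?thesis unfolding a_def[symmetric] b_def[symmetric] by (simp add: represents_def)
qed

definition fold_prog :: lprog where
  "fold_prog = LStore 4 (Reg 16) (Const 0) \<then> find_nb \<then> LAssign 27 (Sub (Reg 26) (Const 1)) \<then>
     LStore 4 (Reg 27) (Const 0) \<then> find_nb \<then> LAssign 29 (Sub (Reg 26) (Const 1)) \<then> merge_prog"

lemma fold_prog_frame [simp]: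
  "written_regs fold_prog = {11, 26, 27, 29}" "written_arrs fold_prog = {3, 4}" "wf_loops fold_prog"
  by (auto simp: fold_prog_def)

lemma vset_clear: "vset n a (set_elem a i 0 s) = vset n a s - {i}"
  by (auto simp: vset_def)

lemma represents_elem: "a \<noteq> 2 \<Longrightarrow> a \<noteq> 3 \<Longrightarrow> represents n M (set_elem a i k s) = represents n M s"
  by (simp add: represents_def)

lemma fold_prog:
  assumes s: "represents n M s" and M: "sym_refl M" and v: "regs s 16 < n"
    and fold: "fold_at n M (vset n 4 s) (regs s 16) = Reduce M' A'"
  shows "represents n M' (sem fold_prog s)" "vset n 4 (sem fold_prog s) = A'"
proof -
  define w A where "w = regs s 16" and "A = vset n 4 s"
  define b a where "b = last_sat (\<lambda>u. u \<in> A - {w} \<and> M w u) n - 1"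
    and "a = last_sat (\<lambda>u. u \<in> A - {w} - {b} \<and> M w u) n - 1"
  have MA: "M' = merge M a b" "A' = A - {w} - {b}"
    using fold by (auto simp: fold_at_def Let_def a_def b_def w_def A_def)
  \<comment> \<open>This holds even if nothing is found, because truncated subtraction then gives
    \<open>0 < n\<close>.\<close>
  have lt: "last_sat P n - 1 < n" for P using last_sat_pos[of P n] v by (cases "last_sat P n = 0") auto
  define s1 where "s1 = set_elem 4 w 0 s"
  have R1: "represents n M s1" using s by (simp add: s1_def represents_elem)
  have f1: "regs (sem find_nb s1) 26 = last_sat (\<lambda>u. u \<in> A - {w} \<and> M w u) n"
    using find_nb[OF R1] v by (simp add: s1_def vset_clear A_def w_def)
  define s2 where "s2 = set_reg 27 b (sem find_nb s1)"
  have s2: "regs s2 16 = w" "vset n 4 s2 = A - {w}" "represents n M s2" "regs s2 27 = b"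
    using sem_frame[of _ find_nb s1] represents_frame[OF R1, of s2] vset_frame[of s2 4 s1 n]
    by (auto simp: s2_def s1_def w_def A_def vset_clear)
  define s3 where "s3 = set_elem 4 b 0 s2"
  have s3: "regs s3 16 = w" "vset n 4 s3 = A - {w} - {b}" "represents n M s3" "regs s3 27 = b"
    using s2 by (auto simp: s3_def represents_elem vset_clear)
  have f3: "regs (sem find_nb s3) 26 = last_sat (\<lambda>u. u \<in> A - {w} - {b} \<and> M w u) n"
    using find_nb[OF s3(3)] v s3 by (simp add: w_def)
  define s4 where "s4 = set_reg 29 a (sem find_nb s3)"
  have s4: "vset n 4 s4 = A - {w} - {b}" "represents n M s4" "regs s4 27 = b" "regs s4 29 = a"
    using sem_frame[of _ find_nb s3] represents_frame[OF s3(3), of s4] vset_frame[of s4 4 s3 n] s3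
    by (auto simp: s4_def)
  have e: "sem fold_prog s = sem merge_prog s4"
    using f1 f3 s2(4) by (simp add: fold_prog_def s1_def s2_def s3_def s4_def w_def a_def b_def)
  have "represents n (merge M (regs s4 29) (regs s4 27)) (sem merge_prog s4)"
    using lt by (intro merge_prog[OF s4(2) M]) (auto simp: s4 a_def b_def)
  then show "represents n M' (sem fold_prog s)" using s4 e MA by simp
  show "vset n 4 (sem fold_prog s) = A'"
    using vset_frame[of "sem merge_prog s4" 4 s4 n] sem_frame(2)[of 4 merge_prog s4] s4 e MA by simp
qed

definition incr :: "nat \<Rightarrow> lprog" where
  "incr x = LAssign x (Add (Reg x) (Const 1))"

text \<open>Register \<open>31\<close> is the current depth in the path, \<open>32\<close> its
  length, and array \<open>6\<close> its bits. Beyond the end a zero is appended, which means taking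
  the vertex; a nonzero bit means discarding it. Register \<open>30\<close> counts.\<close>

definition branch_prog :: lprog where
  "branch_prog = LAssign 15 (Sub (Reg 23) (Const 1)) \<then>
     LCond (Sub (Reg 32) (Reg 31)) LSkip (LStore 6 (Reg 31) (Const 0) \<then> LAssign 32 (Add (Reg 31) (Const 1))) \<then>
     LCond (Elem 6 (Reg 31)) (LStore 4 (Reg 15) (Const 0)) (remove_nb 4 15 \<then> incr 30) \<then> incr 31"

definition step_prog :: lprog where
  "step_prog = find_simplicial 4 \<then>
     LCond (Reg 14) (LAssign 15 (Sub (Reg 14) (Const 1)) \<then> remove_nb 4 15 \<then> incr 30) (find_deg2 \<then>
     LCond (Reg 22) (LAssign 16 (Sub (Reg 22) (Const 1)) \<then> fold_prog \<then> incr 30) (find_easy \<then>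
     LCond (Reg 20) (LAssign 23 (Reg 20)) find_heavy \<then>
     when (Reg 23) branch_prog))"

lemma incr_simps [simp]:
  "sem (incr x) s = set_reg x (Suc (regs s x)) s" "written_regs (incr x) = {x}" "written_arrs (incr x) = {}" "wf_loops (incr x)"
  by (simp_all add: incr_def)

lemma branch_prog_frame [simp]:
  "written_regs branch_prog = {11, 15, 30, 31, 32}" "written_arrs branch_prog = {4, 6}" "wf_loops branch_prog"
  by (auto simp: branch_prog_def)

lemma step_prog_frame [simp]:
  "written_regs step_prog = {10, 11, 12, 13, 14, 15, 16, 18, 19, 20, 22, 23, 24, 25, 26, 27, 29, 30, 31, 32}"
  "written_arrs step_prog = {3, 4, 5, 6}" "wf_loops step_prog"
  by (auto simp: step_prog_def)

definition branched :: "nat \<Rightarrow> (nat \<Rightarrow> nat \<Rightarrow> bool) \<Rightarrow> nat \<Rightarrow> machine_state \<Rightarrow> machine_state \<Rightarrow> bool" where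
  "branched n M v s s' \<longleftrightarrow> regs s' 31 = Suc (regs s 31) \<and>
     (if regs s 31 < regs s 32 then regs s' 32 = regs s 32 \<and> arrs s' 6 = arrs s 6
      else regs s' 32 = Suc (regs s 31) \<and> arrs s' 6 = (arrs s 6)(regs s 31 := 0)) \<and>
     (if arrs s' 6 (regs s 31) \<noteq> 0 then vset n 4 s' = vset n 4 s - {v} \<and> regs s' 30 = regs s 30
      else vset n 4 s' = vset n 4 s - {u. M v u} \<and> regs s' 30 = Suc (regs s 30))"

lemma branch_prog:
  assumes s: "represents n M s" and v: "regs s 23 = Suc v" "v < n"
  shows "represents n M (sem branch_prog s)" "branched n M v s (sem branch_prog s)"
proof -
  show "represents n M (sem branch_prog s)"
    by (rule represents_frame[OF s]) (simp_all add: sem_frame)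
  define s1 where "s1 = (if regs s 31 < regs s 32 then set_reg 15 v s
      else set_reg 32 (Suc (regs s 31)) (set_elem 6 (regs s 31) 0 (set_reg 15 v s)))"
  have R1: "represents n M s1" using s by (simp add: s1_def represents_elem represents_set_reg)
  have r1: "regs s1 15 = v" "regs s1 31 = regs s 31" "regs s1 30 = regs s 30" "vset n 4 s1 = vset n 4 s"
    by (auto simp: s1_def vset_def)
  have rm: "vset n 4 (sem (remove_nb 4 15) s1) = vset n 4 s - {u. M v u}"
    using remove_nb[OF R1, of 15 4] r1 v by simp
  have cl: "vset n 4 (set_elem 4 v 0 s1) = vset n 4 s - {v}" using vset_clear[of n 4 v s1] r1 by simp
  define s2 where "s2 = (if arrs s1 6 (regs s 31) \<noteq> 0 then set_elem 4 v 0 s1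
      else set_reg 30 (Suc (regs s 30)) (sem (remove_nb 4 15) s1))"
  have e: "sem branch_prog s = set_reg 31 (Suc (regs s 31)) s2"
    using v r1 by (auto simp: branch_prog_def s2_def s1_def sem_frame)
  have fr: "arrs s2 6 = arrs s1 6" "regs s2 32 = regs s1 32" by (auto simp: s2_def sem_frame)
  have c1: "vset n 4 s2 = (if arrs s1 6 (regs s 31) \<noteq> 0 then vset n 4 s - {v} else vset n 4 s - {u. M v u})"
    "regs s2 30 = (if arrs s1 6 (regs s 31) \<noteq> 0 then regs s 30 else Suc (regs s 30))"
    using rm cl r1 by (auto simp: s2_def)
  show "branched n M v s (sem branch_prog s)"
    unfolding branched_def e using fr c1 by (auto simp: s1_def)
qed

text \<open>Simulates one unfolding of \<open>search\<close>. Under \<open>Done\<close> nothing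
  relevant changes, so a loop with a fixed number of rounds can be used.\<close>

lemma step_prog:
  assumes s: "represents n M s" and M: "sym_refl M"
  shows "case outcome_of n M (vset n 4 s) of
      Done \<Rightarrow> represents n M (sem step_prog s) \<and> vset n 4 (sem step_prog s) = vset n 4 s \<and>
        regs (sem step_prog s) 30 = regs s 30 \<and> regs (sem step_prog s) 31 = regs s 31 \<and>
        regs (sem step_prog s) 32 = regs s 32 \<and> arrs (sem step_prog s) 6 = arrs s 6
    | Reduce M' A' \<Rightarrow> represents n M' (sem step_prog s) \<and> vset n 4 (sem step_prog s) = A' \<and>
        regs (sem step_prog s) 30 = Suc (regs s 30) \<and> regs (sem step_prog s) 31 = regs s 31 \<and>
        regs (sem step_prog s) 32 = regs s 32 \<and> arrs (sem step_prog s) 6 = arrs s 6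
    | Branch v \<Rightarrow> represents n M (sem step_prog s) \<and> branched n M v s (sem step_prog s)"
proof -
  define A where "A = vset n 4 s"
  have A: "A \<subseteq> {..<n}" by (auto simp: A_def vset_lt)
  define p q h where "p = last_sat (simp_v M A) n" and "q = last_sat (\<lambda>v. v \<in> A \<and> cdeg M A v = 3) n"
    and "h = branch_vertex n M A"
  define s1 where "s1 = sem (find_simplicial 4) s"
  have p: "regs s1 14 = p" using find_simplicial[OF s] by (simp add: s1_def p_def A_def)
  have fr1: "represents n M s1" "vset n 4 s1 = A" "regs s1 30 = regs s 30" "regs s1 31 = regs s 31"
      "regs s1 32 = regs s 32" "arrs s1 6 = arrs s 6"
    using represents_frame[OF s, of s1] vset_frame[of s1 4 s n] by (simp_all add: s1_def sem_frame A_def)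
  note out = outcome_of_def[of n M A, unfolded Let_def, folded p_def q_def h_def]
  show ?thesis
  proof (cases "p \<noteq> 0")
    case True
    have "p - 1 < n" using last_sat_pos[of "simp_v M A" n] True by (simp add: p_def)
    define s2 where "s2 = set_reg 15 (p - 1) s1"
    have R2: "represents n M s2" using fr1 by (simp add: s2_def represents_set_reg)
    have "vset n 4 (sem (remove_nb 4 15) s2) = A - {u. M (p - 1) u}"
      using remove_nb[OF R2, of 15 4] \<open>p - 1 < n\<close> fr1 by (simp add: s2_def)
    moreover have "represents n M (sem (remove_nb 4 15) s2)"
      using represents_frame[OF R2] by (simp add: sem_frame)
    moreover have "sem step_prog s = set_reg 30 (Suc (regs s 30)) (sem (remove_nb 4 15) s2)"
      using True p fr1 by (simp add: step_prog_def s1_def[symmetric] s2_def sem_frame)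
    ultimately show ?thesis using True out fr1
      by (simp add: A_def[symmetric] represents_set_reg sem_frame s2_def)
  next
    case False
    then have p0: "p = 0" by simp
    define s2 where "s2 = sem find_deg2 s1"
    have q: "regs s2 22 = q" using find_deg2[OF fr1(1)] fr1 by (simp add: s2_def q_def)
    have fr2: "represents n M s2" "vset n 4 s2 = A" "regs s2 30 = regs s 30" "regs s2 31 = regs s 31"
        "regs s2 32 = regs s 32" "arrs s2 6 = arrs s 6"
      using represents_frame[OF fr1(1), of s2] vset_frame[of s2 4 s1 n] fr1 by (simp_all add: s2_def sem_frame)
    show ?thesis
    proof (cases "q \<noteq> 0")
      case True
      have qn: "q - 1 < n" using last_sat_pos[of "\<lambda>v. v \<in> A \<and> cdeg M A v = 3" n] True by (simp add: q_def)
      define s3 where "s3 = set_reg 16 (q - 1) s2"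
      have R3: "represents n M s3" using fr2 by (simp add: s3_def represents_set_reg)
      obtain M' A' where F: "fold_at n M A (q - 1) = Reduce M' A'" by (simp add: fold_at_def Let_def)
      have "represents n M' (sem fold_prog s3)" "vset n 4 (sem fold_prog s3) = A'"
        using fold_prog[OF R3 M, of M' A'] qn F fr2 by (simp_all add: s3_def)
      moreover have "sem step_prog s = set_reg 30 (Suc (regs s 30)) (sem fold_prog s3)"
        using True p0 p q fr2 by (simp add: step_prog_def s1_def[symmetric] s2_def[symmetric] s3_def sem_frame)
      ultimately show ?thesis using True p0 out F fr2
        by (simp add: A_def[symmetric] represents_set_reg sem_frame s3_def)
    next
      case False
      then have q0: "q = 0" by simp
      define s3 where "s3 = sem find_easy s2"
      have e: "regs s3 20 = last_sat (easy n M A) n" using find_easy[OF fr2(1)] fr2 by (simp add: s3_def)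
      have fr3: "represents n M s3" "vset n 4 s3 = A" "regs s3 30 = regs s 30" "regs s3 31 = regs s 31"
          "regs s3 32 = regs s 32" "arrs s3 6 = arrs s 6"
        using represents_frame[OF fr2(1), of s3] vset_frame[of s3 4 s2 n] fr2 by (simp_all add: s3_def sem_frame)
      define s4 where "s4 = (if 0 < regs s3 20 then sem (LAssign 23 (Reg 20)) s3 else sem find_heavy s3)"
      have h: "regs s4 23 = h"
        using find_heavy[OF fr3(1)] fr3 e by (auto simp: s4_def h_def branch_vertex_def Let_def)
      have fr4: "represents n M s4" "vset n 4 s4 = A" "regs s4 30 = regs s 30" "regs s4 31 = regs s 31"
          "regs s4 32 = regs s 32" "arrs s4 6 = arrs s 6"
        using represents_frame[OF fr3(1), of s4] vset_frame[of s4 4 s3 n] fr3 by (simp_all add: s4_def sem_frame)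
      have st: "sem step_prog s = (if h \<noteq> 0 then sem branch_prog s4 else s4)"
        using p0 q0 p q h by (simp add: step_prog_def s1_def[symmetric] s2_def[symmetric] s3_def[symmetric] s4_def[symmetric] sem_when
          split del: if_split)
      show ?thesis
      proof (cases "h = 0")
        case True
        then show ?thesis using p0 q0 out st fr4 by (simp add: A_def[symmetric])
      next
        case False
        then have o: "outcome_of n M A = Branch (h - 1)" using p0 q0 out by simp
        have "h - 1 \<in> A"
          by (rule outcome_cases[OF A M]) (use o in \<open>auto\<close>)
        then have hn: "h - 1 < n" using A by auto
        have "represents n M (sem branch_prog s4)" "branched n M (h - 1) s4 (sem branch_prog s4)"
          using branch_prog[OF fr4(1), of "h - 1"] h False hn by auto
        moreover have "branched n M (h - 1) s4 t \<longleftrightarrow> branched n M (h - 1) s t" for t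
          using fr4 by (simp add: branched_def A_def)
        ultimately show ?thesis using o st False by (simp add: A_def[symmetric])
      qed
    qed
  qed
qed

subsection \<open>Following one branch\<close>

definition inputs :: "nat \<Rightarrow> (nat \<Rightarrow> nat \<Rightarrow> bool) \<Rightarrow> machine_state \<Rightarrow> bool" where
  "inputs n E s \<longleftrightarrow> regs s 0 = n \<and> (\<forall>u<n. arrs s 2 u = u * n) \<and> (\<forall>u<n. \<forall>v<n. arrs s 0 (u * n + v) \<noteq> 0 \<longleftrightarrow> E u v)"

text \<open>The input matrix of a simple graph has an empty diagonal, while the search works with
  closed neighbourhoods.\<close>

definition closure :: "(nat \<Rightarrow> nat \<Rightarrow> bool) \<Rightarrow> nat \<Rightarrow> nat \<Rightarrow> bool" where
  "closure E u v \<longleftrightarrow> u = v \<or> E u v"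

text \<open>Folding overwrites the matrix, so each descent restores it from the input and sets the
  diagonal. The path in register \<open>32\<close> and array \<open>6\<close> is left alone.\<close>

definition init_prog :: lprog where
  "init_prog = LFor 11 (
       LFor 12 (LStore 3 (Add (Elem 2 (Reg 11)) (Reg 12)) (Elem 0 (Add (Elem 2 (Reg 11)) (Reg 12)))) \<then>
       LStore 3 (Add (Elem 2 (Reg 11)) (Reg 11)) (Const 1) \<then> LStore 4 (Reg 11) (mem 1 11)) \<then>
     LAssign 30 (Const 0) \<then> LAssign 31 (Const 0)"

lemma init_prog_frame [simp]:
  "written_regs init_prog = {11, 12, 30, 31}" "written_arrs init_prog = {3, 4}" "wf_loops init_prog"
  by (auto simp: init_prog_def)

lemma init_prog:
  assumes s: "inputs n E s"
  shows "represents n (closure E) (sem init_prog s)" "vset n 4 (sem init_prog s) = vset n 1 s"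
    "regs (sem init_prog s) 30 = 0" "regs (sem init_prog s) 31 = 0"
proof -
  define ok where "ok i t \<longleftrightarrow> (\<forall>u<i. \<forall>v<n. arrs t 3 (u * n + v) \<noteq> 0 \<longleftrightarrow> closure E u v)" for i :: nat and t :: machine_state
  define I where "I i t \<longleftrightarrow> ok i t \<and> (\<forall>u<i. arrs t 4 u = arrs s 1 u)" for i :: nat and t :: machine_state
  let ?b = "LStore 3 (Add (Elem 2 (Reg 11)) (Reg 12)) (Elem 0 (Add (Elem 2 (Reg 11)) (Reg 12)))"
  let ?c = "LFor 12 ?b \<then> LStore 3 (Add (Elem 2 (Reg 11)) (Reg 11)) (Const 1) \<then> LStore 4 (Reg 11) (mem 1 11)"
  have row: "arrs s 2 u = u * n" if "u < n" for u using s that by (simp add: inputs_def)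
  have inp: "arrs s 0 (u * n + v) \<noteq> 0 \<longleftrightarrow> E u v" if "u < n" "v < n" for u v using s that by (simp add: inputs_def)
  have n0: "regs s 0 = n" using s by (simp add: inputs_def)
  have I: "I n (sem (LFor 11 ?c) s)"
  proof (rule sem_For)
    fix i t assume i: "i < n" "I i t" "regs t 11 = i"
      and fr: "\<And>y. y \<noteq> 11 \<Longrightarrow> y \<notin> written_regs ?c \<Longrightarrow> regs t y = regs s y"
        "\<And>b. b \<notin> written_arrs ?c \<Longrightarrow> arrs t b = arrs s b"
    define J where "J j t' \<longleftrightarrow> ok i t' \<and> (\<forall>v<j. arrs t' 3 (i * n + v) \<noteq> 0 \<longleftrightarrow> E i v)" for j :: nat and t' :: machine_state
    have t0: "regs t 0 = n" using fr(1)[of 0] n0 by simp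
    have J: "J n (sem (LFor 12 ?b) t)"
    proof (rule sem_For)
      fix j t' assume j: "j < n" "J j t'" "regs t' 12 = j"
        and fr': "\<And>y. y \<noteq> 12 \<Longrightarrow> y \<notin> written_regs ?b \<Longrightarrow> regs t' y = regs t y"
          "\<And>b. b \<notin> written_arrs ?b \<Longrightarrow> arrs t' b = arrs t b"
      have "regs t' 11 = i" using fr'(1)[of 11] i by simp
      moreover have a: "arrs t' 2 i = i * n" "arrs t' 0 = arrs s 0" using fr'(2) fr(2) row i(1) by auto
      ultimately have st: "sem ?b t' = set_elem 3 (i * n + j) (arrs s 0 (i * n + j)) t'" using j(3) by simp
      have "ok i (sem ?b t')"
        using j(2) i(1) j(1) unfolding ok_def J_def st by (auto simp: index_inj)
      moreover have "arrs (sem ?b t') 3 (i * n + v) \<noteq> 0 \<longleftrightarrow> E i v" if "v < Suc j" for v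
        using that j i(1) inp[OF i(1) j(1)] unfolding st by (auto simp: J_def less_Suc_eq)
      ultimately show "J (Suc j) (sem ?b t')" by (simp add: J_def)
    qed (use t0 i in \<open>auto simp: J_def I_def ok_def\<close>)
    define t1 where "t1 = sem (LFor 12 ?b) t"
    have t1: "regs t1 11 = i" "arrs t1 2 = arrs s 2" "arrs t1 1 = arrs s 1" "arrs t1 4 = arrs t 4"
      using i(3) fr(2) by (simp_all add: t1_def sem_frame)
    have st: "sem ?c t = set_elem 4 i (arrs s 1 i) (set_elem 3 (i * n + i) (Suc 0) t1)"
      using t1 row[OF i(1)] by (simp add: t1_def[symmetric] mem_def)
    have "ok (Suc i) (sem ?c t)"
      using J i(1) unfolding st ok_def J_def t1_def[symmetric] by (auto simp: less_Suc_eq index_inj closure_def)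
    moreover have "arrs (sem ?c t) 4 u = arrs s 1 u" if "u < Suc i" for u
      using that i(2) unfolding st by (auto simp: t1 I_def less_Suc_eq)
    ultimately show "I (Suc i) (sem ?c t)" by (simp add: I_def)
  qed (use n0 in \<open>auto simp: I_def ok_def\<close>)
  define s1 where "s1 = sem (LFor 11 ?c) s"
  have e: "sem init_prog s = set_reg 31 0 (set_reg 30 0 s1)" by (simp add: init_prog_def s1_def)
  have f: "regs s1 0 = n" "arrs s1 2 = arrs s 2" by (simp_all add: s1_def sem_frame n0)
  show "represents n (closure E) (sem init_prog s)"
    using I row f unfolding e represents_def I_def ok_def s1_def[symmetric] by auto
  show "vset n 4 (sem init_prog s) = vset n 1 s"
    using I unfolding e vset_def I_def s1_def[symmetric] by auto
  show "regs (sem init_prog s) 30 = 0" "regs (sem init_prog s) 31 = 0" by (simp_all add: e)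
qed

definition run_prog :: lprog where
  "run_prog = init_prog \<then> LFor 40 step_prog"

lemma run_prog_frame [simp]:
  "written_regs run_prog = {10, 11, 12, 13, 14, 15, 16, 18, 19, 20, 22, 23, 24, 25, 26, 27, 29, 30, 31, 32, 40}"
  "written_arrs run_prog = {3, 4, 5, 6}" "wf_loops run_prog"
  by (auto simp: run_prog_def)

definition choices :: "machine_state \<Rightarrow> bool list" where
  "choices s = map (\<lambda>j. arrs s 6 j \<noteq> 0) [0..<regs s 32]"

lemma choices_frame: "regs s' 32 = regs s 32 \<Longrightarrow> arrs s' 6 = arrs s 6 \<Longrightarrow> choices s' = choices s"
  by (simp add: choices_def)

lemma search_done: "outcome_of n M A = Done \<Longrightarrow> search n k M A c = Leaf c"
  by (cases k) auto

lemma length_full_path: "length (full_path (search n k M A c) p) \<le> k"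
proof (induction k arbitrary: M A c p)
  case (Suc k)
  show ?case
  proof (cases "outcome_of n M A")
    case (Reduce M' A') then show ?thesis using Suc.IH[of M' A' "Suc c" p] by simp
  next
    case (Branch v) then show ?thesis using Suc.IH by (cases p) auto
  qed simp
qed simp

lemma outcome_invariants:
  assumes A: "A \<subseteq> {..<n}" and M: "sym_refl M"
  shows "outcome_of n M A = Reduce M' A' \<Longrightarrow> sym_refl M'"
  by (rule outcome_cases[OF A M]) (use M sym_refl_merge in auto)

lemma run_prog:
  assumes s: "inputs n E s" and E: "sym_refl (closure E)"
    and \<tau>: "\<tau> = search n n (closure E) (vset n 1 s) 0" and valid: "valid \<tau> (choices s)"
  shows "regs (sem run_prog s) 30 = value_at \<tau> (choices s)"
    "choices (sem run_prog s) = full_path \<tau> (choices s)"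
proof -
  define p where "p = choices s"
  \<comment> \<open>After \<open>i\<close> rounds the state sits at the root of a subtree with fuel
    \<open>n - i\<close>. The rest \<open>r\<close> of the path leads from there to the same leaf,
    and the part already followed is the beginning of the full path.\<close>
  define I where "I i t \<longleftrightarrow> (\<exists>M r. represents n M t \<and> sym_refl M \<and> regs t 31 \<le> regs t 32 \<and>
      r = drop (regs t 31) (choices t) \<and> valid (search n (n - i) M (vset n 4 t) (regs t 30)) r \<and>
      value_at (search n (n - i) M (vset n 4 t) (regs t 30)) r = value_at \<tau> p \<and>
      full_path \<tau> p = take (regs t 31) (choices t) @ full_path (search n (n - i) M (vset n 4 t) (regs t 30)) r)"
    for i and t :: machine_state
  let ?s = "sem init_prog s"
  have ch0: "choices ?s = choices s" by (rule choices_frame) (simp_all add: sem_frame)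
  have "I n (sem (LFor 40 step_prog) ?s)"
  proof (rule sem_For)
    show "regs ?s 0 = n" using init_prog(1)[OF s] by (simp add: represents_def)
    show "I 0 ?s"
      unfolding I_def using init_prog[OF s] E valid ch0 \<tau> by (intro exI[of _ "closure E"]) (simp add: p_def)
    show "I i (set_reg 40 k t)" if "I i t" for i k t
      using that choices_frame[of "set_reg 40 k t" t] by (simp add: I_def represents_set_reg)
    fix i t assume i: "i < n" "I i t"
    define t' where "t' = sem step_prog t"
    from i(2) obtain M where R: "represents n M t" "sym_refl M" "regs t 31 \<le> regs t 32"
      and V: "valid (search n (n - i) M (vset n 4 t) (regs t 30)) (drop (regs t 31) (choices t))"
        "value_at (search n (n - i) M (vset n 4 t) (regs t 30)) (drop (regs t 31) (choices t)) = value_at \<tau> p"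
        "full_path \<tau> p = take (regs t 31) (choices t) @
           full_path (search n (n - i) M (vset n 4 t) (regs t 30)) (drop (regs t 31) (choices t))"
      unfolding I_def by blast
    define A where "A = vset n 4 t"
    have A: "A \<subseteq> {..<n}" by (auto simp: A_def vset_lt)
    have ni: "n - i = Suc (n - Suc i)" using i by simp
    note st = step_prog[OF R(1,2), folded t'_def A_def]
    have "I (Suc i) t'"
    proof (cases "outcome_of n M A")
      case Done
      have "choices t' = choices t" using st Done by (intro choices_frame) simp_all
      moreover have "search n k M A c = Leaf c" for k c using search_done[OF Done] .
      ultimately show ?thesis
        unfolding I_def using st Done R V by (intro exI[of _ M]) (simp add: A_def[symmetric])
    next
      case (Reduce M' A')
      have "choices t' = choices t" using st Reduce by (intro choices_frame) simp_all
      moreover have "sym_refl M'" using outcome_invariants[OF A R(2) Reduce] .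
      ultimately show ?thesis
        unfolding I_def using st Reduce R V ni by (intro exI[of _ M']) (simp add: A_def[symmetric])
    next
      case (Branch v)
      define l r where "l = search n (n - Suc i) M (A - {u. M v u}) (Suc (regs t 30))"
        and "r = search n (n - Suc i) M (A - {v}) (regs t 30)"
      have node: "search n (n - i) M A (regs t 30) = Node l r" using Branch ni by (simp add: l_def r_def)
      have b: "represents n M t'" "branched n M v t t'" using st Branch by auto
      note bd = b(2)[unfolded branched_def, folded A_def]
      have V': "valid (Node l r) (drop (regs t 31) (choices t))"
        "value_at (Node l r) (drop (regs t 31) (choices t)) = value_at \<tau> p"
        "full_path \<tau> p = take (regs t 31) (choices t) @ full_path (Node l r) (drop (regs t 31) (choices t))"
        using V unfolding A_def[symmetric] node by auto
      have len: "length (choices t) = regs t 32" by (simp add: choices_def)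
      show ?thesis
      proof (cases "regs t 31 < regs t 32")
        case True
        then have ch: "choices t' = choices t" using bd by (intro choices_frame) auto
        define c where "c = (arrs t 6 (regs t 31) \<noteq> 0)"
        have "choices t ! regs t 31 = c" using True by (simp add: choices_def c_def)
        then have d: "drop (regs t 31) (choices t) = c # drop (Suc (regs t 31)) (choices t)"
          using True len Cons_nth_drop_Suc[of "regs t 31" "choices t"] by simp
        have tk: "take (Suc (regs t 31)) (choices t) = take (regs t 31) (choices t) @ [c]"
          using True len \<open>choices t ! regs t 31 = c\<close> take_Suc_conv_app_nth[of "regs t 31" "choices t"] by simp
        have "search n (n - Suc i) M (vset n 4 t') (regs t' 30) = (if c then r else l)"
          using bd True by (auto simp: c_def l_def r_def)
        then show ?thesis unfolding I_def using b(1) R(2) bd True V' d tk ch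
          by (intro exI[of _ M]) auto
      next
        case False
        then have eq: "regs t 31 = regs t 32" using R(3) by simp
        then have d: "drop (regs t 31) (choices t) = []" "take (regs t 31) (choices t) = choices t" using len by auto
        \<comment> \<open>Past the end of the given path the descent turns left and records
          this.\<close>
        have ch: "choices t' = choices t @ [False]"
          using bd False eq by (auto simp: choices_def)
        have "search n (n - Suc i) M (vset n 4 t') (regs t' 30) = l"
          using bd False by (auto simp: l_def)
        then show ?thesis unfolding I_def using b(1) R(2) bd False V' d ch eq len valid_Nil
          by (intro exI[of _ M]) auto
      qed
    qed
    then show "I (Suc i) (sem step_prog t)" by (simp add: t'_def)
  qed simp
  then have "I n (sem run_prog s)" by (simp add: run_prog_def)
  then show "regs (sem run_prog s) 30 = value_at \<tau> (choices s)"
    "choices (sem run_prog s) = full_path \<tau> (choices s)"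
    by (auto simp: I_def p_def choices_def)
qed

subsection \<open>Backtracking\<close>

text \<open>The loop strips trailing ones. If something is left, its last bit is zero and is set to
  one; otherwise register \<open>34\<close> signals the end.\<close>

definition back_prog :: lprog where
  "back_prog = LFor 40 (when (Reg 32) (when (Elem 6 (Sub (Reg 32) (Const 1))) (LAssign 32 (Sub (Reg 32) (Const 1))))) \<then>
     LCond (Reg 32) (LStore 6 (Sub (Reg 32) (Const 1)) (Const 1)) (LAssign 34 (Const 0))"

lemma back_prog_frame [simp]:
  "written_regs back_prog = {32, 34, 40}" "written_arrs back_prog = {6}" "wf_loops back_prog"
  by (auto simp: back_prog_def)

lemma next_path_snoc: "next_path (q @ [b]) = (if b then next_path q else Some (q @ [True]))"
  by (induction q) (auto split: option.splits)

lemma back_prog: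
  assumes n: "regs s 0 = n" and len: "regs s 32 \<le> n"
  shows "case next_path (choices s) of None \<Rightarrow> regs (sem back_prog s) 34 = 0
    | Some p \<Rightarrow> choices (sem back_prog s) = p \<and> regs (sem back_prog s) 34 = regs s 34"
proof -
  let ?b = "when (Reg 32) (when (Elem 6 (Sub (Reg 32) (Const 1))) (LAssign 32 (Sub (Reg 32) (Const 1))))"
  \<comment> \<open>A round that is not yet finished shortens the path, whose length is at most
    \<open>n\<close>; so \<open>n\<close> rounds suffice.\<close>
  define I where "I i t \<longleftrightarrow> next_path (choices t) = next_path (choices s) \<and>
      (regs t 32 = 0 \<or> arrs t 6 (regs t 32 - 1) = 0 \<or> regs t 32 + i \<le> n)" for i and t :: machine_state
  define t where "t = sem (LFor 40 ?b) s"
  have snoc: "choices u = map (\<lambda>j. arrs u 6 j \<noteq> 0) [0..<regs u 32 - 1] @ [arrs u 6 (regs u 32 - 1) \<noteq> 0]"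
    if "regs u 32 \<noteq> 0" for u
    using that by (cases "regs u 32") (auto simp: choices_def)
  have It: "I n t" unfolding t_def
  proof (rule sem_For)
    show "I i (set_reg 40 k u)" if "I i u" for i k u
      using that choices_frame[of "set_reg 40 k u" u] by (simp add: I_def)
    fix i u assume i: "i < n" "I i u"
    show "I (Suc i) (sem ?b u)"
    proof (cases "regs u 32 \<noteq> 0 \<and> arrs u 6 (regs u 32 - 1) \<noteq> 0")
      case True
      have e: "sem ?b u = set_reg 32 (regs u 32 - 1) u" using True by (simp add: sem_when)
      have "next_path (choices u) = next_path (choices (set_reg 32 (regs u 32 - 1) u))"
        using snoc[of u] True next_path_snoc by (simp add: choices_def)
      then show ?thesis using i True unfolding I_def e by auto
    next
      case False
      then have "sem ?b u = u" by (auto simp: sem_when)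
      then show ?thesis using i False by (auto simp: I_def)
    qed
  qed (use n len in \<open>auto simp: I_def\<close>)
  have fr: "regs t 34 = regs s 34" by (simp add: t_def sem_frame)
  have bp: "sem back_prog s = sem (LCond (Reg 32) (LStore 6 (Sub (Reg 32) (Const 1)) (Const 1)) (LAssign 34 (Const 0))) t"
    by (simp only: back_prog_def t_def sem.simps(4))
  show ?thesis
  proof (cases "regs t 32 = 0")
    case True
    then have "choices t = []" by (simp add: choices_def)
    then have "next_path (choices s) = None" using It by (simp add: I_def)
    then show ?thesis using True by (simp add: bp)
  next
    case False
    then have z: "arrs t 6 (regs t 32 - 1) = 0" using It by (auto simp: I_def)
    have "next_path (choices s) = Some (map (\<lambda>j. arrs t 6 j \<noteq> 0) [0..<regs t 32 - 1] @ [True])"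
      using It snoc[OF False] z by (simp add: I_def next_path_snoc)
    moreover have e: "sem back_prog s = set_elem 6 (regs t 32 - 1) (Suc 0) t"
      using False by (simp add: bp)
    moreover have "choices (sem back_prog s) = map (\<lambda>j. arrs t 6 j \<noteq> 0) [0..<regs t 32 - 1] @ [True]"
      using snoc[of "sem back_prog s"] False by (simp add: e)
    ultimately show ?thesis using fr by simp
  qed
qed

subsection \<open>The algorithm\<close>

definition body_prog :: lprog where
  "body_prog = run_prog \<then> when (Sub (Reg 30) (Reg 33)) (LAssign 33 (Reg 30)) \<then> back_prog"

lemma body_prog_frame:
  "0 \<notin> written_regs body_prog" "35 \<notin> written_regs body_prog" "36 \<notin> written_regs body_prog"
  "0 \<notin> written_arrs body_prog" "1 \<notin> written_arrs body_prog" "2 \<notin> written_arrs body_prog" "wf_loops body_prog"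
  by (simp_all add: body_prog_def)

definition start_prog :: lprog where
  "start_prog = LAssign 33 (Const 0) \<then> LAssign 32 (Const 0) \<then> LAssign 34 (Const 1)"

text \<open>The number of rounds is the number of leaves, which no nesting of \<open>LFor\<close>
  loops provides, hence a genuine while loop.\<close>

definition alpha_prog :: prog where
  "alpha_prog = Seq (compile start_prog) (While (Reg 34) (compile body_prog))"

text \<open>What the outer loop relies on: registers \<open>35\<close> and \<open>36\<close> are its
  target value and its counter, array \<open>1\<close> its vertex set.\<close>

definition same_input :: "machine_state \<Rightarrow> machine_state \<Rightarrow> bool" where
  "same_input s s' \<longleftrightarrow> (\<forall>x\<in>{0, 35, 36}. regs s' x = regs s x) \<and> (\<forall>a\<in>{0, 1, 2}. arrs s' a = arrs s a)"

lemma same_input_trans: "same_input s s' \<Longrightarrow> same_input s' s'' \<Longrightarrow> same_input s s''"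
  by (simp add: same_input_def)

lemma same_input_inputs: "same_input s s' \<Longrightarrow> inputs n E s \<Longrightarrow> inputs n E s'"
  by (simp add: same_input_def inputs_def)

lemma same_input_vset: "same_input s s' \<Longrightarrow> vset n 1 s' = vset n 1 s"
  by (simp add: same_input_def vset_def)

lemma body_prog:
  assumes s: "inputs n E s" and E: "sym_refl (closure E)"
    and \<tau>: "\<tau> = search n n (closure E) (vset n 1 s) 0" and valid: "valid \<tau> (choices s)"
  shows "same_input s (sem body_prog s)" "regs (sem body_prog s) 33 = max (regs s 33) (value_at \<tau> (choices s))"
    "case next_path (full_path \<tau> (choices s)) of None \<Rightarrow> regs (sem body_prog s) 34 = 0
      | Some p \<Rightarrow> choices (sem body_prog s) = p \<and> regs (sem body_prog s) 34 = regs s 34"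
proof -
  show "same_input s (sem body_prog s)"
    by (simp add: same_input_def sem_frame body_prog_frame del: One_nat_def)
  define s1 where "s1 = sem run_prog s"
  have r1: "regs s1 30 = value_at \<tau> (choices s)" "choices s1 = full_path \<tau> (choices s)"
    "regs s1 33 = regs s 33" "regs s1 34 = regs s 34" "regs s1 0 = n"
    using run_prog[OF assms] s by (simp_all add: s1_def sem_frame inputs_def)
  define s2 where "s2 = set_reg 33 (max (regs s 33) (value_at \<tau> (choices s))) s1"
  have "set_reg 33 (regs s 33) s1 = s1" using r1(3) by (simp add: set_reg_def fun_upd_idem)
  then have w: "sem (when (Sub (Reg 30) (Reg 33)) (LAssign 33 (Reg 30))) s1 = s2"
    using r1 by (simp add: s2_def sem_when max_def)
  have e: "sem body_prog s = sem back_prog s2"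
    unfolding body_prog_def sem.simps(4) w[symmetric] s1_def ..
  show "regs (sem body_prog s) 33 = max (regs s 33) (value_at \<tau> (choices s))"
    unfolding e by (simp add: sem_frame s2_def)
  have ch: "choices s2 = full_path \<tau> (choices s)"
    using choices_frame[of s2 s1] r1 by (simp add: s2_def)
  have "length (choices s2) \<le> n" unfolding ch \<tau> by (rule length_full_path)
  then have len: "regs s2 32 \<le> n" by (simp add: choices_def)
  have "regs s2 0 = n" "regs s2 34 = regs s 34" using r1 by (simp_all add: s2_def)
  then show "case next_path (full_path \<tau> (choices s)) of None \<Rightarrow> regs (sem body_prog s) 34 = 0
      | Some p \<Rightarrow> choices (sem body_prog s) = p \<and> regs (sem body_prog s) 34 = regs s 34"
    using back_prog[OF _ len] unfolding e ch by (auto split: option.splits)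
qed

text \<open>Induction on the number of leaves still to be visited; register \<open>33\<close> keeps
  the best value so far.\<close>

lemma alpha_loop:
  assumes E: "sym_refl (closure E)" and s: "inputs n E s" and A: "vset n 1 s = A"
    and \<tau>: "\<tau> = search n n (closure E) A 0" and valid: "valid \<tau> (choices s)" and go: "regs s 34 \<noteq> 0"
  shows "\<exists>k s'. exec (While (Reg 34) (compile body_prog)) s k s' \<and>
    k \<le> 2 + length (todo \<tau> (choices s)) * (2 + cost body_prog n) \<and> same_input s s' \<and>
    regs s' 33 = max (regs s 33) (Max (set (todo \<tau> (choices s))))"
  using s A valid go
proof (induction "length (todo \<tau> (choices s))" arbitrary: s rule: less_induct)
  case less
  define s1 where "s1 = sem body_prog s"
  have n0: "regs s 0 = n" using less.prems by (simp add: inputs_def)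
  have \<tau>': "\<tau> = search n n (closure E) (vset n 1 s) 0" using \<tau> less.prems by simp
  note body = body_prog[OF less.prems(1) E \<tau>' less.prems(3), folded s1_def]
  obtain k1 where k1: "k1 \<le> cost body_prog n" "exec (compile body_prog) s k1 s1"
    using exec_compile[of body_prog s] body_prog_frame n0 by (auto simp: s1_def)
  note ts = todo_step[OF less.prems(3)]
  show ?case
  proof (cases "next_path (full_path \<tau> (choices s))")
    case None
    then have t: "todo \<tau> (choices s) = [value_at \<tau> (choices s)]" using ts by simp
    have "regs s1 34 = 0" using body(3) None by simp
    then have "exec (While (Reg 34) (compile body_prog)) s1 (1 + expr_time (Reg 34)) s1"
      by (intro exec.WhileFalse) simp
    from exec.WhileTrue[OF _ k1(2) this] less.prems(4)
    have "exec (While (Reg 34) (compile body_prog)) s (4 + k1) s1" by (simp add: eval_nat_numeral)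
    then show ?thesis using k1(1) body t by (intro exI[of _ "4 + k1"] exI[of _ s1]) simp
  next
    case (Some p)
    have c1: "choices s1 = p" "regs s1 34 = regs s 34" using body(3) Some by auto
    have t: "todo \<tau> (choices s) = value_at \<tau> (choices s) # todo \<tau> (choices s1)" "valid \<tau> (choices s1)"
      using ts Some c1 by auto
    have "inputs n E s1" "vset n 1 s1 = A" "regs s1 34 \<noteq> 0"
      using same_input_inputs[OF body(1)] same_input_vset[OF body(1)] less.prems c1 by auto
    then obtain k2 s2 where k2: "exec (While (Reg 34) (compile body_prog)) s1 k2 s2"
      "k2 \<le> 2 + length (todo \<tau> (choices s1)) * (2 + cost body_prog n)" "same_input s1 s2"
      "regs s2 33 = max (regs s1 33) (Max (set (todo \<tau> (choices s1))))"
      using less.hyps[of s1] t by auto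
    have ne: "todo \<tau> (choices s1) \<noteq> []" using todo_step[OF t(2)] by (metis list.distinct(1))
    from exec.WhileTrue[OF _ k1(2) k2(1)] less.prems(4)
    have "exec (While (Reg 34) (compile body_prog)) s (2 + k1 + k2) s2" by (simp add: eval_nat_numeral)
    moreover have "same_input s s2" using same_input_trans[OF body(1) k2(3)] .
    moreover have "regs s2 33 = max (regs s 33) (Max (set (todo \<tau> (choices s))))"
      using k2(4) body(2) t(1) ne by (simp add: max.assoc)
    ultimately show ?thesis using k1(1) k2(2) t(1) by (intro exI[of _ "2 + k1 + k2"] exI[of _ s2]) simp
  qed
qed

definition alpha_time :: "nat \<Rightarrow> nat \<Rightarrow> nat" where
  "alpha_time n L = 8 + L * (2 + cost body_prog n)"

lemma alpha_prog:
  assumes E: "sym_refl (closure E)" and s: "inputs n E s"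
    and L: "length (leaf_values (search n n (closure E) (vset n 1 s) 0)) \<le> L"
  shows "\<exists>k s'. exec alpha_prog s k s' \<and> k \<le> alpha_time n L \<and> same_input s s' \<and>
    regs s' 33 = alpha (closure E) (vset n 1 s)"
proof -
  define A \<tau> where "A = vset n 1 s" and "\<tau> = search n n (closure E) A 0"
  define s1 where "s1 = sem start_prog s"
  have "exec (compile start_prog) s (1 + expr_time (Const 0) + (1 + expr_time (Const 0) + (1 + expr_time (Const 1)))) s1"
    unfolding start_prog_def s1_def compile.simps sem.simps
    by (rule exec.Seq[OF exec.Assign exec.Seq[OF exec.Assign exec.Assign]])
  then have e1: "exec (compile start_prog) s 6 s1" by (simp add: eval_nat_numeral)
  have r1: "regs s1 33 = 0" "choices s1 = []" "regs s1 34 \<noteq> 0"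
    by (simp_all add: s1_def start_prog_def choices_def)
  have same: "same_input s s1" by (simp add: s1_def start_prog_def same_input_def)
  have "inputs n E s1" "vset n 1 s1 = A" using same_input_inputs[OF same s] same_input_vset[OF same] by (auto simp: A_def)
  from alpha_loop[OF E this \<tau>_def _ r1(3)] obtain k s2 where k:
    "exec (While (Reg 34) (compile body_prog)) s1 k s2"
    "k \<le> 2 + length (leaf_values \<tau>) * (2 + cost body_prog n)" "same_input s1 s2"
    "regs s2 33 = Max (set (leaf_values \<tau>))"
    by (auto simp: r1 valid_Nil todo_Nil)
  have "A \<subseteq> {..<n}" by (auto simp: A_def vset_lt)
  then have "Max (set (leaf_values \<tau>)) = alpha (closure E) A"
    using Max_search[OF _ E, of A n n 0] card_mono[of "{..<n}" A] by (simp add: \<tau>_def)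
  moreover have "length (leaf_values \<tau>) * (2 + cost body_prog n) \<le> L * (2 + cost body_prog n)"
    using L by (intro mult_le_mono1) (simp add: \<tau>_def A_def)
  then have "6 + k \<le> alpha_time n L" using k(2) by (simp add: alpha_time_def)
  ultimately show ?thesis using exec.Seq[OF e1 k(1)] k(3,4) same_input_trans[OF same k(3)]
    unfolding alpha_prog_def A_def[symmetric] by (intro exI[of _ "6 + k"] exI[of _ s2]) simp
qed

text \<open>Register \<open>41\<close> produces the multiples of \<open>n\<close> by repeated
  addition.\<close>

definition setup_prog :: lprog where
  "setup_prog = LAssign 41 (Const 0) \<then> LFor 11 (LStore 2 (Reg 11) (Reg 41) \<then>
     LAssign 41 (Add (Reg 41) (Reg 0)) \<then> LStore 1 (Reg 11) (Const 1))"

lemma setup_prog_frame [simp]: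
  "written_regs setup_prog = {11, 41}" "written_arrs setup_prog = {1, 2}" "wf_loops setup_prog"
  by (auto simp: setup_prog_def)

lemma setup_prog:
  assumes n: "regs s 0 = n" and "\<forall>u<n. \<forall>v<n. arrs s 0 (u * n + v) \<noteq> 0 \<longleftrightarrow> E u v"
  shows "inputs n E (sem setup_prog s)" "vset n 1 (sem setup_prog s) = {..<n}"
proof -
  let ?b = "LStore 2 (Reg 11) (Reg 41) \<then> LAssign 41 (Add (Reg 41) (Reg 0)) \<then> LStore 1 (Reg 11) (Const 1)"
  define I where "I i t \<longleftrightarrow> regs t 41 = i * n \<and> (\<forall>u<i. arrs t 2 u = u * n \<and> arrs t 1 u = 1)" for i and t :: machine_state
  have I: "I n (sem (LFor 11 ?b) (set_reg 41 0 s))"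
  proof (rule sem_For)
    fix i t assume i: "i < n" "I i t" "regs t 11 = i"
      and fr: "\<And>y. y \<noteq> 11 \<Longrightarrow> y \<notin> written_regs ?b \<Longrightarrow> regs t y = regs (set_reg 41 0 s) y"
    have "regs t 0 = n" using fr[of 0] n by simp
    then show "I (Suc i) (sem ?b t)" using i by (auto simp: I_def less_Suc_eq)
  qed (use n in \<open>auto simp: I_def\<close>)
  have e: "sem setup_prog s = sem (LFor 11 ?b) (set_reg 41 0 s)" by (simp add: setup_prog_def)
  have "regs (sem setup_prog s) 0 = n" "arrs (sem setup_prog s) 0 = arrs s 0"
    using n by (simp_all add: sem_frame)
  then show "inputs n E (sem setup_prog s)"
    using I assms(2) unfolding e inputs_def I_def by auto
  show "vset n 1 (sem setup_prog s) = {..<n}" using I unfolding e I_def vset_def by auto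
qed

definition pick_prog :: prog where
  "pick_prog = Seq (Store 1 (Reg 36) (Const 0)) (Seq alpha_prog
     (Seq (Cond (Sub (Reg 35) (Reg 33)) (Store 1 (Reg 36) (Const 1)) Skip) (Assign 36 (Add (Reg 36) (Const 1)))))"

definition mis_prog :: prog where
  "mis_prog = Seq (compile setup_prog) (Seq alpha_prog (Seq (Assign 35 (Reg 33)) (Seq (Assign 36 (Const 0))
     (While (Sub (Reg 0) (Reg 36)) pick_prog))))"

text \<open>Every surviving vertex already tested is indispensable for the value \<open>a\<close>.
  Later deletions preserve this because \<open>alpha\<close> is monotone.\<close>

definition pruned :: "nat \<Rightarrow> (nat \<Rightarrow> nat \<Rightarrow> bool) \<Rightarrow> nat \<Rightarrow> nat \<Rightarrow> machine_state \<Rightarrow> bool" where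
  "pruned n E a i s \<longleftrightarrow> inputs n E s \<and> regs s 35 = a \<and> regs s 36 = i \<and> alpha (closure E) (vset n 1 s) = a \<and>
     (\<forall>v\<in>vset n 1 s. v < i \<longrightarrow> alpha (closure E) (vset n 1 s - {v}) < a)"

lemma alpha_subset: "finite B \<Longrightarrow> A \<subseteq> B \<Longrightarrow> alpha M A \<le> alpha M B"
  using alpha_ex[of A M] alpha_ge[of B _ M] finite_subset[of A B] by (metis order_trans)

lemma pick_prog:
  assumes E: "sym_refl (closure E)" and s: "pruned n E a i s" and i: "i < n"
    and L: "\<And>A. A \<subseteq> {..<n} \<Longrightarrow> length (leaf_values (search n n (closure E) A 0)) \<le> L"
  shows "\<exists>k s'. exec pick_prog s k s' \<and> k \<le> 14 + alpha_time n L \<and> pruned n E a (Suc i) s'"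
proof -
  define A where "A = vset n 1 s"
  have fin: "finite A" by (simp add: A_def vset_def)
  have s': "inputs n E s" "regs s 35 = a" "regs s 36 = i" "alpha (closure E) A = a"
    and strict: "\<And>v. v \<in> A \<Longrightarrow> v < i \<Longrightarrow> alpha (closure E) (A - {v}) < a"
    using s by (auto simp: pruned_def A_def)
  define s1 where "s1 = set_elem 1 i 0 s"
  have e1: "exec (Store 1 (Reg 36) (Const 0)) s 3 s1"
    using exec.Store[of 1 "Reg 36" "Const 0" s] s'(3) by (simp add: s1_def eval_nat_numeral)
  have s1: "inputs n E s1" "vset n 1 s1 = A - {i}" "regs s1 35 = a" "regs s1 36 = i"
    using s' by (auto simp: s1_def A_def inputs_def vset_clear)
  have "vset n 1 s1 \<subseteq> {..<n}" by (auto simp: vset_lt)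
  from alpha_prog[OF E s1(1) L[OF this]] obtain k2 s2 where
    e2: "exec alpha_prog s1 k2 s2" "k2 \<le> alpha_time n L" and same: "same_input s1 s2"
    and r2: "regs s2 33 = alpha (closure E) (A - {i})" using s1(2) by auto
  have s2: "inputs n E s2" "vset n 1 s2 = A - {i}" "regs s2 35 = a" "regs s2 36 = i" "arrs s2 1 = (arrs s 1)(i := 0)"
    using same_input_inputs[OF same] same_input_vset[OF same] same s1 by (auto simp: same_input_def s1_def)
  let ?t = "Sub (Reg 35) (Reg 33)"
  define s3 where "s3 = (if alpha (closure E) (A - {i}) < a then set_elem 1 i 1 s2 else s2)"
  have "\<exists>k3\<le>7. exec (Cond ?t (Store 1 (Reg 36) (Const 1)) Skip) s2 k3 s3"
  proof (cases "alpha (closure E) (A - {i}) < a")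
    case True
    have "exec (Store 1 (Reg 36) (Const 1)) s2 3 s3"
      using exec.Store[of 1 "Reg 36" "Const 1" s2] s2 True by (simp add: s3_def eval_nat_numeral)
    from exec.CondTrue[OF _ this, of ?t Skip] show ?thesis using True r2 s2 by (intro exI[of _ 7]) simp
  next
    case False
    have "exec Skip s2 1 s3" using False exec.Skip by (simp add: s3_def)
    from exec.CondFalse[OF _ this, of ?t] show ?thesis using False r2 s2 by (intro exI[of _ 5]) (simp add: eval_nat_numeral)
  qed
  then obtain k3 where e3: "k3 \<le> 7" "exec (Cond ?t (Store 1 (Reg 36) (Const 1)) Skip) s2 k3 s3" by blast
  define s4 where "s4 = set_reg 36 (Suc i) s3"
  have "regs s3 36 = i" using s2 by (simp add: s3_def)
  then have e4: "exec (Assign 36 (Add (Reg 36) (Const 1))) s3 4 s4"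
    using exec.Assign[of 36 "Add (Reg 36) (Const 1)" s3] by (simp add: s4_def eval_nat_numeral)
  have "exec pick_prog s (3 + (k2 + (k3 + 4))) s4"
    unfolding pick_prog_def by (intro exec.Seq[OF e1] exec.Seq[OF e2(1)] exec.Seq[OF e3(2) e4])
  moreover have "pruned n E a (Suc i) s4"
  proof (cases "alpha (closure E) (A - {i}) < a")
    case True
    then have "i \<in> A" using s'(4) by (cases "i \<in> A") auto
    then have v: "vset n 1 s4 = A" using s2 True i by (auto simp: s4_def s3_def A_def vset_def)
    have "inputs n E s4" "regs s4 35 = a" "regs s4 36 = Suc i"
      using s2 by (auto simp: s4_def s3_def inputs_def)
    then show ?thesis unfolding pruned_def v using s'(4) strict True by (auto simp: less_Suc_eq)
  next
    case False
    have v: "vset n 1 s4 = A - {i}" using s2(2) False by (simp add: s4_def s3_def)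
    have "alpha (closure E) (A - {i}) = a"
      using False s'(4) alpha_subset[OF fin, of "A - {i}" "closure E"] by auto
    moreover have "alpha (closure E) (A - {i} - {v}) < a" if "v \<in> A - {i}" "v < Suc i" for v
    proof -
      have "alpha (closure E) (A - {i} - {v}) \<le> alpha (closure E) (A - {v})"
        using fin by (intro alpha_subset) auto
      also have "\<dots> < a" using strict[of v] that by auto
      finally show ?thesis .
    qed
    moreover have "inputs n E s4" "regs s4 35 = a" "regs s4 36 = Suc i"
      using s2 False by (auto simp: s4_def s3_def inputs_def)
    ultimately show ?thesis unfolding pruned_def v by auto
  qed
  ultimately show ?thesis using e2 e3 by (intro exI[of _ "3 + (k2 + (k3 + 4))"] exI[of _ s4]) simp
qed

lemma pick_loop:
  assumes E: "sym_refl (closure E)" and s: "pruned n E a i s" and i: "i \<le> n"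
    and L: "\<And>A. A \<subseteq> {..<n} \<Longrightarrow> length (leaf_values (search n n (closure E) A 0)) \<le> L"
  shows "\<exists>k s'. exec (While (Sub (Reg 0) (Reg 36)) pick_prog) s k s' \<and>
    k \<le> 4 + (n - i) * (18 + alpha_time n L) \<and> pruned n E a n s'"
  using i s
proof (induction i arbitrary: s rule: inc_induct)
  case base
  then have "expr_val (Sub (Reg 0) (Reg 36)) s = 0" by (simp add: pruned_def inputs_def)
  from exec.WhileFalse[OF this] show ?case using base
    by (intro exI[of _ 4] exI[of _ s]) (simp add: eval_nat_numeral)
next
  case (step i)
  obtain k1 s1 where k1: "exec pick_prog s k1 s1" "k1 \<le> 14 + alpha_time n L" "pruned n E a (Suc i) s1"
    using pick_prog[OF E step.prems step.hyps(2) L] by blast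
  from step.IH[OF k1(3)] obtain k2 s2 where k2: "exec (While (Sub (Reg 0) (Reg 36)) pick_prog) s1 k2 s2"
    "k2 \<le> 4 + (n - Suc i) * (18 + alpha_time n L)" "pruned n E a n s2" by blast
  have "expr_val (Sub (Reg 0) (Reg 36)) s \<noteq> 0" using step by (simp add: pruned_def inputs_def)
  from exec.WhileTrue[OF this k1(1) k2(1)]
  have "exec (While (Sub (Reg 0) (Reg 36)) pick_prog) s (4 + k1 + k2) s2" by (simp add: eval_nat_numeral)
  moreover have "n - i = Suc (n - Suc i)" using step by simp
  then have "4 + k1 + k2 \<le> 4 + (n - i) * (18 + alpha_time n L)" using k1(2) k2(2) by simp
  ultimately show ?case using k2(3) by blast
qed

lemma mis_prog:
  assumes E: "sym_refl (closure E)" and n: "regs s 0 = n"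
    and inp: "\<forall>u<n. \<forall>v<n. arrs s 0 (u * n + v) \<noteq> 0 \<longleftrightarrow> E u v"
    and L: "\<And>A. A \<subseteq> {..<n} \<Longrightarrow> length (leaf_values (search n n (closure E) A 0)) \<le> L"
  shows "\<exists>k s'. exec mis_prog s k s' \<and> k \<le> cost setup_prog n + 8 + 18 * n + (n + 1) * alpha_time n L \<and>
    indep (closure E) (vset n 1 s') \<and> card (vset n 1 s') = alpha (closure E) {..<n}"
proof -
  define a where "a = alpha (closure E) {..<n}"
  define s1 where "s1 = sem setup_prog s"
  obtain k1 where e1: "k1 \<le> cost setup_prog n" "exec (compile setup_prog) s k1 s1"
    using exec_compile[of setup_prog s] n by (auto simp: s1_def)
  note s1 = setup_prog[OF n inp, folded s1_def]
  from alpha_prog[OF E s1(1), of L] obtain k2 s2 where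
    e2: "exec alpha_prog s1 k2 s2" "k2 \<le> alpha_time n L" and same: "same_input s1 s2"
    and r2: "regs s2 33 = a" using L[of "{..<n}"] s1(2) by (auto simp: a_def)
  define s3 s4 where "s3 = set_reg 35 a s2" and "s4 = set_reg 36 0 s3"
  have e3: "exec (Assign 35 (Reg 33)) s2 2 s3"
    using exec.Assign[of 35 "Reg 33" s2] r2 by (simp add: s3_def eval_nat_numeral)
  have e4: "exec (Assign 36 (Const 0)) s3 2 s4"
    using exec.Assign[of 36 "Const 0" s3] by (simp add: s4_def eval_nat_numeral)
  have v: "vset n 1 s4 = {..<n}" using same_input_vset[OF same] s1(2) by (simp add: s4_def s3_def)
  have "inputs n E s4" using same_input_inputs[OF same s1(1)] by (simp add: s4_def s3_def inputs_def)
  then have "pruned n E a 0 s4" unfolding pruned_def v by (simp add: s4_def s3_def a_def)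
  from pick_loop[OF E this _ L] obtain k5 s5 where
    e5: "exec (While (Sub (Reg 0) (Reg 36)) pick_prog) s4 k5 s5"
    and k5: "k5 \<le> 4 + n * (18 + alpha_time n L)" and p: "pruned n E a n s5" by auto
  define V where "V = vset n 1 s5"
  have fin: "finite V" by (simp add: V_def vset_def)
  obtain S where S: "S \<subseteq> V" "indep (closure E) S" "card S = a"
    using alpha_ex[OF fin, of "closure E"] p by (auto simp: pruned_def V_def)
  \<comment> \<open>All vertices left are indispensable, so a maximum independent subset cannot miss
    any of them.\<close>
  have "S = V"
  proof (rule ccontr)
    assume "S \<noteq> V"
    then obtain v where v: "v \<in> V" "S \<subseteq> V - {v}" using S(1) by blast
    have "a \<le> alpha (closure E) (V - {v})" using alpha_ge[of "V - {v}", OF _ v(2) S(2)] fin S(3) by simp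
    moreover have "alpha (closure E) (V - {v}) < a" using p v(1) by (auto simp: pruned_def V_def vset_lt)
    ultimately show False by simp
  qed
  moreover have "exec mis_prog s (k1 + (k2 + (2 + (2 + k5)))) s5"
    unfolding mis_prog_def by (intro exec.Seq[OF e1(2)] exec.Seq[OF e2(1)] exec.Seq[OF e3] exec.Seq[OF e4 e5])
  moreover have "k1 + (k2 + (2 + (2 + k5))) \<le> cost setup_prog n + 8 + 18 * n + (n + 1) * alpha_time n L"
    using e1(1) e2(2) k5 by (simp add: algebra_simps)
  ultimately show ?thesis using S unfolding V_def a_def by blast
qed

text \<open>Linear in the number of leaves and polynomial otherwise. \<open>K\<close> and
  \<open>d\<close> come from fixed programs and are thus independent of \<open>t\<close>.\<close>

lemma mis_prog_time:
  "\<exists>K d. \<forall>n L. 1 \<le> L \<longrightarrow> cost setup_prog n + 8 + 18 * n + (n + 1) * alpha_time n L \<le> K * (n + 1) ^ d * L"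
proof -
  obtain K1 d1 K2 d2 where K: "\<And>n. cost setup_prog n \<le> K1 * (n + 1) ^ d1" "\<And>n. cost body_prog n \<le> K2 * (n + 1) ^ d2"
    using cost_polynomial by metis
  have "cost setup_prog n + 8 + 18 * n + (n + 1) * alpha_time n L \<le> (K1 + 28 + K2) * (n + 1) ^ (d1 + d2 + 1) * L"
    if L: "1 \<le> L" for n L
  proof -
    define N where "N = (n + 1) ^ (d1 + d2 + 1)"
    have N: "(n + 1) ^ d1 \<le> N" "(n + 1) * (n + 1) ^ d2 \<le> N" "n + 1 \<le> N"
      unfolding N_def power_Suc[symmetric] by (rule power_increasing self_le_power; simp)+
    have NL: "N \<le> N * L" using L by simp
    have a: "cost setup_prog n \<le> K1 * (N * L)"
      using K(1)[of n] mult_le_mono2[OF order_trans[OF N(1) NL], of K1] by linarith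
    have b: "8 + 18 * n \<le> 18 * (N * L)" using N(3) NL by linarith
    have "alpha_time n L \<le> L * (10 + cost body_prog n)"
      using L by (simp add: alpha_time_def algebra_simps)
    also have "\<dots> \<le> L * ((10 + K2) * (n + 1) ^ d2)"
    proof (rule mult_le_mono2)
      have "1 \<le> (n + 1) ^ d2" by simp
      then show "10 + cost body_prog n \<le> (10 + K2) * (n + 1) ^ d2"
        using K(2)[of n] unfolding add_mult_distrib by linarith
    qed
    finally have "(n + 1) * alpha_time n L \<le> (n + 1) * (L * ((10 + K2) * (n + 1) ^ d2))" by (rule mult_le_mono2)
    also have "\<dots> = L * (10 + K2) * ((n + 1) * (n + 1) ^ d2)" by (simp only: ac_simps)
    also have "\<dots> \<le> L * (10 + K2) * N" using N(2) by (rule mult_le_mono2)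
    also have "\<dots> = 10 * (N * L) + K2 * (N * L)" by (simp add: algebra_simps)
    finally have c: "(n + 1) * alpha_time n L \<le> 10 * (N * L) + K2 * (N * L)" .
    have "(K1 + 28 + K2) * N * L = K1 * (N * L) + 28 * (N * L) + K2 * (N * L)" by (simp add: algebra_simps)
    then show ?thesis using a b c unfolding N_def by linarith
  qed
  then show ?thesis by blast
qed

subsection \<open>Running time\<close>

lemma total_le: "A \<subseteq> {..<n} \<Longrightarrow> total M A \<le> n ^ 2"
proof -
  assume A: "A \<subseteq> {..<n}"
  then have c: "card A \<le> n" "finite A" using card_mono[of "{..<n}" A] finite_subset by auto
  have "cdeg M A u \<le> n" for u
    unfolding cdeg_def using card_mono[OF c(2), of "{u' \<in> A. M u u'}"] c(1) by fastforce
  then have "total M A \<le> (\<Sum>u\<in>A. n)" unfolding total_def by (intro sum_mono)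
  also have "\<dots> \<le> n ^ 2" using c(1) by (simp add: power2_eq_square)
  finally show ?thesis .
qed

text \<open>With \<open>K = 44800 * t\<close>, taking a heavy vertex multiplies the volume by at
  most \<open>1 - 1 / K\<close>. Starting from at most \<open>n ^ 2\<close>, about
  \<open>2 * K * ln n\<close> such steps exhaust it.\<close>

definition depth_bound :: "nat \<Rightarrow> nat \<Rightarrow> nat" where
  "depth_bound t n = nat \<lceil>2 * (44800 * real t) * ln (real n)\<rceil>"

text \<open>From \<open>1 - x \<le> exp (- x)\<close> at \<open>x = 1 / K\<close> the base is at
  least \<open>exp (1 / K)\<close>, and the exponent is at least
  \<open>2 * K * ln n\<close>.\<close>

lemma depth_bound:
  assumes t: "1 \<le> t" and K: "K = 44800 * real t"
  shows "real (n ^ 2) \<le> real (small_bound t) * (K / (K - 1)) ^ depth_bound t n"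
proof (cases "n = 0")
  case False
  define q where "q = depth_bound t n"
  have K1: "1 < K" using t K by simp
  have "exp (- (1 / K)) \<ge> 1 + - (1 / K)" by (rule exp_ge_add_one_self)
  then have "(K - 1) / K \<le> exp (- (1 / K))" using K1 by (simp add: field_simps)
  then have "inverse (exp (- (1 / K))) \<le> inverse ((K - 1) / K)" using K1 by (intro le_imp_inverse_le) auto
  then have "exp (1 / K) \<le> K / (K - 1)" by (simp add: exp_minus)
  then have "exp (1 / K) ^ q \<le> (K / (K - 1)) ^ q" by (intro power_mono) auto
  moreover have "exp (1 / K) ^ q = exp (real q / K)" by (simp flip: exp_of_nat_mult)
  moreover have "2 * K * ln (real n) \<le> real q"
    unfolding q_def depth_bound_def K[symmetric] by (rule real_nat_ceiling_ge)
  then have "2 * ln (real n) \<le> real q / K" using K1 by (simp add: field_simps)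
  then have "exp (2 * ln (real n)) \<le> exp (real q / K)" by simp
  moreover have "exp (2 * ln (real n)) = real (n ^ 2)" using False by (simp add: exp_double)
  ultimately have "real (n ^ 2) \<le> (K / (K - 1)) ^ q" by linarith
  moreover have "0 < small_bound t" using t by (simp add: small_bound_def)
  then have "1 \<le> real (small_bound t)" by simp
  moreover have "0 \<le> (K / (K - 1)) ^ q" using K1 by simp
  ultimately show ?thesis unfolding q_def[symmetric]
    using mult_right_mono[of 1 "real (small_bound t)" "(K / (K - 1)) ^ q"] by linarith
qed (use assms in simp)

definition leaf_bound :: "nat \<Rightarrow> nat \<Rightarrow> nat" where
  "leaf_bound t n = 2 ^ small_bound t * (n + 1) * (n + 1) ^ depth_bound t n"

lemma leaf_bound:
  assumes t: "1 \<le> t" and M: "sym_refl M" and free: "minor_free t M {..<n}" and A: "A \<subseteq> {..<n}"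
  shows "length (leaf_values (search n n M A 0)) \<le> leaf_bound t n"
proof -
  define K where "K = 44800 * real t"
  have "real (total M A) \<le> real (n ^ 2)" using total_le[OF A] by (simp only: of_nat_le_iff)
  then have "real (total M A) \<le> small_bound t * (K / (K - 1)) ^ depth_bound t n"
    using depth_bound[OF t K_def, of n] by linarith
  then have "length (leaf_values (search n n M A 0)) \<le> 2 ^ small_bound t * (card A + 1) * (n + 1) ^ depth_bound t n"
    by (intro leaves_bound[OF t K_def A M minor_free_subset[OF _ free A]]) auto
  also have "\<dots> \<le> leaf_bound t n"
    unfolding leaf_bound_def using card_mono[OF _ A] by (intro mult_le_mono) auto
  finally show ?thesis .
qed

text \<open>A constant factor must be hidden in the exponent of \<open>t\<close>. For
  \<open>t \<ge> 2\<close> this works since \<open>D \<le> 2 ^ D \<le> t ^ D\<close>; for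
  \<open>t = 1\<close> powers of \<open>t\<close> do not grow, and the logarithmic term absorbs
  \<open>D\<close> instead.\<close>

lemma exponent_bound:
  assumes t: "1 \<le> t" and l: "1 \<le> (l :: real)"
  shows "real D * real t ^ 20 \<le> real D * real t ^ 2 * l + real t ^ (20 + D)"
proof (cases "t = 1")
  case True
  then show ?thesis using l mult_left_mono[of 1 l "real D"] by simp
next
  case False
  then have "2 \<le> real t" using t by simp
  have "real D \<le> 2 ^ D" using of_nat_less_two_power[of D, where 'a = real] by simp
  also have "\<dots> \<le> real t ^ D" using \<open>2 \<le> real t\<close> by (intro power_mono) auto
  finally have "real D * real t ^ 20 \<le> real t ^ D * real t ^ 20" by (intro mult_right_mono) auto
  also have "\<dots> = real t ^ (20 + D)" by (simp add: power_add)
  finally show ?thesis using l by (simp add: add.commute add_increasing)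
qed

lemma small_bound_le: "1 \<le> t \<Longrightarrow> small_bound t \<le> (dense_bound + 1) ^ 2 * t ^ 20"
proof -
  assume "1 \<le> t"
  then have "dense_bound \<le> dense_bound * t ^ 10" by simp
  then have "dense_bound + t ^ 10 \<le> (dense_bound + 1) * t ^ 10" by simp
  then have "small_bound t \<le> ((dense_bound + 1) * t ^ 10) ^ 2"
    unfolding small_bound_def by (rule power_mono) simp
  also have "\<dots> = (dense_bound + 1) ^ 2 * t ^ 20" unfolding power_mult_distrib by (simp flip: power_mult)
  finally show ?thesis .
qed

lemma running_time:
  "\<exists>(C::real) (c::nat). \<forall>t n. 1 \<le> t \<longrightarrow> 2 \<le> n \<longrightarrow>
     real (K * (n + 1) ^ d * leaf_bound t n) \<le> real n powr (C * real t ^ 2 * log 2 (real n) + real t ^ c)"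
proof -
  \<comment> \<open>The \<open>4\<close> consists of \<open>2\<close> for the factor
    \<open>n + 1\<close> in \<open>leaf_bound\<close> and \<open>2\<close> for the rounding in
    \<open>depth_bound\<close>; the square comes from \<open>small_bound_le\<close>.\<close>
  define D where "D = K + 2 * d + 4 + (dense_bound + 1) ^ 2"
  have "real (K * (n + 1) ^ d * leaf_bound t n) \<le>
      real n powr ((179200 + real D) * real t ^ 2 * log 2 (real n) + real t ^ (20 + D))"
    if t: "1 \<le> t" and n: "2 \<le> n" for t n
  proof -
    define q s l where "q = depth_bound t n" and "s = small_bound t" and "l = log 2 (real n)"
    have "n + 1 \<le> 2 * n" using n by simp
    also have "\<dots> \<le> n ^ 2" using n by (simp add: power2_eq_square)
    finally have n1: "n + 1 \<le> n ^ 2" .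
    have pw: "(n + 1) ^ j \<le> n ^ (2 * j)" for j
      using power_mono[OF n1, of j] by (simp add: power_mult)
    have two: "j \<le> n ^ j" "2 ^ j \<le> n ^ j" for j
    proof -
      show "2 ^ j \<le> n ^ j" using n by (intro power_mono) auto
      then show "j \<le> n ^ j" using less_exp[of j] by linarith
    qed
    \<comment> \<open>As \<open>n \<ge> 2\<close>, every factor becomes a power of \<open>n\<close>.
      In particular \<open>2 ^ s\<close> moves \<open>small_bound t\<close>, a polynomial in
      \<open>t\<close>, into the exponent.\<close>
    have "K * (n + 1) ^ d * leaf_bound t n \<le> n ^ K * n ^ (2 * d) * (n ^ s * n ^ 2 * n ^ (2 * q))"
      unfolding leaf_bound_def q_def[symmetric] s_def[symmetric]
      using two n1 pw by (intro mult_le_mono) auto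
    also have "\<dots> = n ^ (K + 2 * d + 2 + s + 2 * q)" by (simp add: power_add power2_eq_square)
    finally have "real (K * (n + 1) ^ d * leaf_bound t n) \<le> real (n ^ (K + 2 * d + 2 + s + 2 * q))"
      by (simp only: of_nat_le_iff)
    also have "\<dots> = real n powr real (K + 2 * d + 2 + s + 2 * q)"
      unfolding of_nat_power by (subst powr_realpow) (use n in auto)
    also have "\<dots> \<le> real n powr ((179200 + real D) * real t ^ 2 * l + real t ^ (20 + D))"
    proof (rule powr_mono)
      have ln: "0 \<le> ln (real n)" using n by simp
      have q: "real q \<le> 2 * (44800 * real t) * ln (real n) + 1"
        unfolding q_def depth_bound_def using ln of_int_ceiling_le_add_one[of "2 * (44800 * real t) * ln (real n)"] by simp
      have "1 \<le> l" using n by (simp add: l_def)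
      have "ln (real n) = l * ln 2" using n by (simp add: l_def log_def)
      also have "\<dots> \<le> l * 1" using \<open>1 \<le> l\<close> ln_2_less_1 by (intro mult_left_mono) auto
      finally have "ln (real n) \<le> l" by simp
      then have "(44800 * real t) * ln (real n) \<le> (44800 * real t) * l" by (intro mult_left_mono) auto
      \<comment> \<open>\<open>179200 = 4 * 44800\<close>. This contribution is linear in
        \<open>t\<close>; it is enlarged to \<open>t ^ 2\<close> only to fit the stated
        form.\<close>
      then have "real (2 * q) \<le> 179200 * (real t * l) + 2" using q by simp
      moreover have "real t * l \<le> real t ^ 2 * l"
        using t \<open>1 \<le> l\<close> by (intro mult_right_mono) (auto simp: power2_eq_square)
      moreover have "1 \<le> t ^ 20" using t by simp
      then have "K + 2 * d + 4 \<le> (K + 2 * d + 4) * t ^ 20" by (metis mult_le_mono2 mult.right_neutral)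
      then have "K + 2 * d + 4 + s \<le> D * t ^ 20"
        using small_bound_le[OF t] unfolding D_def s_def add_mult_distrib by linarith
      then have "real (K + 2 * d + 4 + s) \<le> real D * real t ^ 20" by (simp only: of_nat_le_iff flip: of_nat_power of_nat_mult)
      ultimately have "real (K + 2 * d + 2 + s + 2 * q) \<le> 179200 * (real t ^ 2 * l) + real D * real t ^ 2 * l + real t ^ (20 + D)"
        using exponent_bound[OF t \<open>1 \<le> l\<close>, of D] by simp
      also have "\<dots> = (179200 + real D) * real t ^ 2 * l + real t ^ (20 + D)" by (simp add: algebra_simps)
      finally show "real (K + 2 * d + 2 + s + 2 * q) \<le> (179200 + real D) * real t ^ 2 * l + real t ^ (20 + D)" .
    qed (use n in simp)
    finally show ?thesis by (simp only: l_def)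
  qed
  then show ?thesis by blast
qed

lemma simple_graph_eq_graph_of:
  assumes G: "simple_graph G" "verts G = V" and E: "\<And>u v. E u v \<longleftrightarrow> {u, v} \<in> edges (G :: nat graph)"
  shows "graph_of (open_adj (closure E)) V = G"
proof -
  have sg: "e \<subseteq> V \<and> card e = 2" if "e \<in> edges G" for e using G that by (auto simp: simple_graph_def)
  have "edges G = {{x, y} | x y. x \<in> V \<and> y \<in> V \<and> open_adj (closure E) x y}"
  proof (intro set_eqI iffI)
    fix e assume e: "e \<in> edges G"
    obtain x y where xy: "e = {x, y}" "x \<noteq> y" using sg[OF e] by (auto simp: card_2_iff)
    have "E x y" using e xy(1) by (simp add: E)
    then show "e \<in> {{x, y} | x y. x \<in> V \<and> y \<in> V \<and> open_adj (closure E) x y}"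
      using xy sg[OF e] unfolding open_adj_def closure_def by auto
  qed (auto simp: open_adj_def closure_def E)
  then show ?thesis using G(2) by (simp add: graph_of_def)
qed

lemma independent_set_iff_indep:
  assumes G: "simple_graph G" and E: "\<And>u v. E u v \<longleftrightarrow> {u, v} \<in> edges (G :: nat graph)"
  shows "independent_set G S \<longleftrightarrow> S \<subseteq> verts G \<and> indep (closure E) S"
proof -
  have "u \<noteq> v" if "{u, v} \<in> edges G" for u v using G that by (auto simp: simple_graph_def)
  then show ?thesis unfolding independent_set_def indep_def closure_def E by blast
qed

text \<open>The witness \<open>mis_prog\<close> is the same for all \<open>t\<close>; the parameter
  enters only through the bound on the number of leaves.\<close>

theorem theorem1p2:
  "\<exists>(C::real) (c::nat). \<forall>t::nat. t \<ge> 1 \<longrightarrow>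
     (\<exists>p::prog. \<forall>(n::nat) (G::nat graph).
        simple_graph G \<and> verts G = {..<n} \<and> \<not> induced_minor (tC3_C4 t) G \<longrightarrow>
        (\<exists>k s. exec p (input_state G) k s \<and>
               maximum_independent_set G (output_set G s) \<and>
               (n \<ge> 2 \<longrightarrow>
                  real k \<le> real n powr (C * real t ^ 2 * log 2 (real n) + real t ^ c))))"
proof -
  obtain K d where Kd: "\<And>n L. 1 \<le> L \<Longrightarrow>
      cost setup_prog n + 8 + 18 * n + (n + 1) * alpha_time n L \<le> K * (n + 1) ^ d * L"
    using mis_prog_time by metis
  obtain C c where Cc: "\<And>t n. 1 \<le> t \<Longrightarrow> 2 \<le> n \<Longrightarrow>
      real (K * (n + 1) ^ d * leaf_bound t n) \<le> real n powr (C * real t ^ 2 * log 2 (real n) + real t ^ c)"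
    using running_time by metis
  have "\<exists>k s. exec mis_prog (input_state G) k s \<and> maximum_independent_set G (output_set G s) \<and>
      (n \<ge> 2 \<longrightarrow> real k \<le> real n powr (C * real t ^ 2 * log 2 (real n) + real t ^ c))"
    if t: "t \<ge> 1" and G: "simple_graph G" "verts G = {..<n}" and free: "\<not> induced_minor (tC3_C4 t) G" for t n G
  proof -
    define E where "E u v \<longleftrightarrow> {u, v} \<in> edges G" for u v
    define M where "M = closure E"
    have sym: "sym_refl M" by (auto simp: sym_refl_def M_def closure_def E_def insert_commute)
    have "minor_free t M {..<n}"
      using free simple_graph_eq_graph_of[OF G E_def] by (simp add: minor_free_def M_def)
    note leaves = leaf_bound[OF t sym this]
    have "regs (input_state G) 0 = n" by (simp add: input_state_def G(2) Let_def)
    moreover have "arrs (input_state G) 0 (u * n + v) \<noteq> 0 \<longleftrightarrow> E u v" if "u < n" "v < n" for u v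
    proof -
      have "u * n + v < Suc u * n" using that by simp
      also have "\<dots> \<le> n * n" using that by (intro mult_le_mono) auto
      finally have "u * n + v < n * n" .
      then show ?thesis using that by (simp add: input_state_def G(2) Let_def E_def)
    qed
    ultimately obtain k s where k: "exec mis_prog (input_state G) k s"
      "k \<le> cost setup_prog n + 8 + 18 * n + (n + 1) * alpha_time n (leaf_bound t n)"
      and ind: "indep M (vset n 1 s)" and card: "card (vset n 1 s) = alpha M {..<n}"
      using mis_prog[of E "input_state G" n "leaf_bound t n"] sym leaves unfolding M_def by blast
    have out: "output_set G s = vset n 1 s" by (auto simp: output_set_def vset_def G(2))
    have iff: "independent_set G S \<longleftrightarrow> S \<subseteq> {..<n} \<and> indep M S" for S
      using independent_set_iff_indep[OF G(1) E_def] G(2) by (simp add: M_def)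
    have "maximum_independent_set G (output_set G s)"
      unfolding maximum_independent_set_def out iff using ind card alpha_ge[of "{..<n}" _ M] vset_lt by auto
    moreover have "leaf_bound t n \<noteq> 0" by (simp add: leaf_bound_def)
    then have "1 \<le> leaf_bound t n" by simp
    then have "k \<le> K * (n + 1) ^ d * leaf_bound t n" using Kd[of "leaf_bound t n" n] k(2) by linarith
    then have "real k \<le> real (K * (n + 1) ^ d * leaf_bound t n)" by (simp only: of_nat_le_iff)
    then have "real k \<le> real n powr (C * real t ^ 2 * log 2 (real n) + real t ^ c)" if "n \<ge> 2"
      using Cc[OF t that] by linarith
    ultimately show ?thesis using k(1) by blast
  qed
  then show ?thesis by blast
qed

end
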